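(* Let $\mathsf T=\mathrm{Spec}\ \mathbb C[a,b,c,t_1,t_2,\frac1\Delta]$ with $t_3=4a^3-t_2a-b^2$ and $\Delta=27t_3^2-t_2^3$, be the moduli space of enhanced elliptic curves with two marked points, with its universal family and frame $(\alpha_1,\alpha_2,\alpha_3)$ of relative de Rham cohomology. There are unique global vector fields $\mathsf R_\tau$ and $\mathsf R_z$ on $\mathsf T$ such that $$\nabla_{\mathsf R_\tau}\begin{pmatrix}\alpha_1\\ \alpha_2\\ \alpha_3\end{pmatrix}=\begin{pmatrix}0&0&0\\0&0&-1\\0&0&0\end{pmatrix}\begin{pmatrix}\alpha_1\\ \alpha_2\\ \alpha_3\end{pmatrix}\qquad\text{and}\qquad \nabla_{\mathsf R_z}\begin{pmatrix}\alpha_1\\ \alpha_2\\ \alpha_3\end{pmatrix}=\begin{pmatrix}0&0&0\\-1&0&0\\0&0&0\end{pmatrix}\begin{pmatrix}\alpha_1\\ \alpha_2\\ \alpha_3\end{pmatrix},$$ where $\nabla$ is the Gauss-Manin connection. More precisely, $$\mathsf R_\tau=\left(-2a^2+2at_1+bc+\tfrac{t_2}{3}\right)\frac{\partial}{\partial a}+\left(6a^2c-\tfrac{ct_2}{2}-3ab+3bt_1\right)\frac{\partial}{\partial b}+\left(ac+ct_1-\tfrac b2\right)\frac{\partial}{\partial c}+\left(t_1^2-\tfrac{t_2}{12}\right)\frac{\partial}{\partial t_1}+(4t_1t_2-6t_3)\frac{\partial}{\partial t_2},$$ $$\mathsf R_z=b\frac{\partial}{\partial a}+\left(6a^2-\tfrac{t_2}{2}\right)\frac{\partial}{\partial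 b}+(a+t_1)\frac{\partial}{\partial c}.$$
   Context: The universal family over $\mathsf T$ has fibre the elliptic curve $X=\{y^2=4x^3-t_2x-t_3\}$ with the two marked points $Y=\{O,P\}$, $O=(0:1:0)$ (point at infinity) and $P=(a:b:1)$. For a smooth variety $X$ and a smooth subvariety $Y$, $H^m_{\mathrm{dR}}(X,Y)$ is the $m$-th hypercohomology of $\Omega^m_{(X,Y)}=\Omega^m_X\oplus\Omega^{m-1}_Y$ with $d(\omega,\alpha)=(d\omega,\omega|_Y-d\alpha)$. For an elliptic curve $X$, $Y=\{O,P\}$, and an affine open $U\supseteq Y$, $H^1_{\mathrm{dR}}(X,Y)$ (of dimension $3$) is identified with the regular $1$-forms on $U$ having no residues at points of $X-U$, modulo $\{df: f\in\Gamma(U,\mathcal O_U),\ f|_Y=0\}$. The frame is $$\alpha_1=\mathrm d\left(\tfrac{x-a}{x}\right),\quad \alpha_2=\tfrac{\mathrm dx}{y},\quad \alpha_3=\left(c-\tfrac{b}{2a}\right)\mathrm d\left(\tfrac{x-a}{x}\right)+t_1\tfrac{\mathrm dx}{y}+\tfrac{x\,\mathrm dx}{y}-\mathrm d\left(\tfrac{y}{2x}\right)$$ with $U=(X-\{x=0\})\cup\{O\}$ where $a\ne0$; where $a\neq 1$ the same classes are represented by $\mathrm d\left(\frac{x-a}{x-1}\right)$, $\frac{\mathrm dx}{y}$, $\left(c-\frac{b}{2(a-1)}\right)\mathrm d\left(\frac{x-a}{x-1}\right)+t_1\frac{\mathrm dx}{y}+\frac{x\,\mathrm dx}{y}-\mathrm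 d\left(\frac{y}{2(x-1)}\right)$ with $U=(X-\{x=1\})\cup\{O\}$. The Gauss-Manin connection $\nabla$ on the bundle $H^1_{\mathrm{dR}}(X,Y)$ over $\mathsf T$ is the connection determined by $d\left(\int_\delta\omega\right)=\int_\delta\nabla\omega$ for every locally constant family of relative cycles $\delta\in H_1(X,Y;\mathbb Z)$, where $\int_\delta\sum_i df_i\otimes\eta_i:=\sum_i df_i\cdot\int_\delta\eta_i$. For a vector field $\mathsf R$, $\nabla_{\mathsf R}$ is $\nabla$ contracted with $\mathsf R$. *)

theory Defs
  imports
    "HOL-Complex_Analysis.Complex_Analysis"
    "HOL-Homology.Homology"
    "HOL-Algebra.Module"
begin

text \<open>\<open>$\<close> is used for vector components only.\<close>

no_notation fps_nth (infixl \<open>$\<close> 75)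

section \<open>The parameter space\<close>

text \<open>Coordinates on \<open>\<complex>\<^sup>5\<close>: \<open>(a, b, c, t\<^sub>1, t\<^sub>2) = (t $ 1, t $ 2, t $ 3, t $ 4, t $ 5)\<close>.
  \<open>TT\<close> is the set of closed points of \<open>Spec \<complex>[a,b,c,t\<^sub>1,t\<^sub>2,1/\<Delta>]\<close> and \<open>regT\<close> is its
  coordinate ring, realised as functions on \<open>TT\<close> (extended by \<open>undefined\<close> outside \<open>TT\<close>).\<close>

type_synonym param = "complex ^ 5"

definition t3 :: "param \<Rightarrow> complex" where
  "t3 t = 4 * (t $ 1)^3 - t $ 5 * t $ 1 - (t $ 2)^2"

definition Disc :: "param \<Rightarrow> complex" where
  "Disc t = 27 * (t3 t)^2 - (t $ 5)^3"

definition TT :: "param set" where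
  "TT = {t. Disc t \<noteq> 0}"

inductive_set regT :: "(param \<Rightarrow> complex) set" where
  const: "(\<lambda>t\<in>TT. z) \<in> regT"
| coord: "(\<lambda>t\<in>TT. t $ k) \<in> regT"
| inv_Disc: "(\<lambda>t\<in>TT. 1 / Disc t) \<in> regT"
| add: "f \<in> regT \<Longrightarrow> g \<in> regT \<Longrightarrow> (\<lambda>t\<in>TT. f t + g t) \<in> regT"
| mult: "f \<in> regT \<Longrightarrow> g \<in> regT \<Longrightarrow> (\<lambda>t\<in>TT. f t * g t) \<in> regT"

definition partialT :: "5 \<Rightarrow> (param \<Rightarrow> complex) \<Rightarrow> param \<Rightarrow> complex" where
  "partialT k f = (\<lambda>t\<in>TT. deriv (\<lambda>z. f (\<chi> j. if j = k then z else t $ j)) (t $ k))"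

text \<open>Global algebraic vector fields; \<open>R t $ k\<close> is the coefficient of the \<open>k\<close>-th coordinate
  derivation.\<close>

definition vector_fields :: "(param \<Rightarrow> complex ^ 5) set" where
  "vector_fields = {R \<in> extensional TT. \<forall>k. (\<lambda>t\<in>TT. R t $ k) \<in> regT}"


section \<open>The fibres of the universal family\<close>

text \<open>\<open>Some (x, y)\<close> is the point \<open>(x : y : 1)\<close> and \<open>None\<close> is the point at infinity
  \<open>O = (0 : 1 : 0)\<close>.\<close>

type_synonym point = "(complex \<times> complex) option"

definition affine_curve :: "param \<Rightarrow> (complex \<times> complex) set" where
  "affine_curve t = {(x, y). y^2 = 4 * x^3 - t $ 5 * x - t3 t}"

definition XX :: "param \<Rightarrow> point set" where
  "XX t = insert None (Some ` affine_curve t)"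

definition YY :: "param \<Rightarrow> point set" where
  "YY t = {None, Some (t $ 1, t $ 2)}"

text \<open>The analytic topology: \<open>XX t\<close> is compact Hausdorff, so it is the one-point compactification
  of its affine part.\<close>

definition curve_top :: "param \<Rightarrow> point topology" where
  "curve_top t = Alexandroff_compactification (top_of_set (affine_curve t))"


section \<open>Regular functions and regular 1-forms on affine opens\<close>

text \<open>The affine open subsets of a projective curve are the complements of the nonempty finite
  sets.\<close>

definition affine_open :: "param \<Rightarrow> point set \<Rightarrow> bool" where
  "affine_open t U \<longleftrightarrow> U \<subseteq> XX t \<and> finite (XX t - U) \<and> XX t - U \<noteq> {}"

definition poly2 :: "complex poly poly \<Rightarrow> complex \<Rightarrow> complex \<Rightarrow> complex" where
  "poly2 P x y = poly (poly P [:x:]) y"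

text \<open>Regular functions are those which are locally quotients of polynomials, in the affine
  coordinates \<open>(x, y)\<close> near a finite point and in the affine coordinates \<open>(x / y, 1 / y)\<close> of the
  chart \<open>{(u : 1 : v)}\<close> near \<open>O\<close>, which is \<open>(u, v) = (0, 0)\<close>.\<close>

definition regular_at :: "point set \<Rightarrow> (point \<Rightarrow> complex) \<Rightarrow> point \<Rightarrow> bool" where
  "regular_at U f p = (case p of
     Some (x0, y0) \<Rightarrow> \<exists>P Q. poly2 Q x0 y0 \<noteq> 0 \<and>
       (\<forall>x y. Some (x, y) \<in> U \<and> poly2 Q x y \<noteq> 0 \<longrightarrow> f (Some (x, y)) = poly2 P x y / poly2 Q x y)
   | None \<Rightarrow> \<exists>P Q. poly2 Q 0 0 \<noteq> 0 \<and> f None = poly2 P 0 0 / poly2 Q 0 0 \<and>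
       (\<forall>x y. Some (x, y) \<in> U \<and> y \<noteq> 0 \<and> poly2 Q (x / y) (1 / y) \<noteq> 0 \<longrightarrow>
          f (Some (x, y)) = poly2 P (x / y) (1 / y) / poly2 Q (x / y) (1 / y)))"

definition regular_on :: "point set \<Rightarrow> (point \<Rightarrow> complex) \<Rightarrow> bool" where
  "regular_on U f \<longleftrightarrow> (\<forall>p\<in>U. regular_at U f p)"

text \<open>The invariant differential \<open>dx/y\<close> is regular and nowhere zero on the projective curve.
  Hence the regular 1-forms on \<open>U\<close> are the \<open>g dx/y\<close> with \<open>g\<close> regular on \<open>U\<close>, and a 1-form is
  represented by its coefficient \<open>g\<close>.

  The following says \<open>df = h dx/y\<close> on \<open>U\<close>. It is tested on holomorphic curve germs in the affine
  part of \<open>U\<close>; for \<open>f\<close>, \<open>h\<close> regular on \<open>U\<close> the identity at \<open>O\<close> follows by continuity.\<close>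

definition is_differential :: "point set \<Rightarrow> (point \<Rightarrow> complex) \<Rightarrow> (point \<Rightarrow> complex) \<Rightarrow> bool" where
  "is_differential U f h \<longleftrightarrow>
     (\<forall>S x y. open S \<and> x holomorphic_on S \<and> y holomorphic_on S \<and> (\<forall>w\<in>S. Some (x w, y w) \<in> U) \<longrightarrow>
        (\<forall>w\<in>S. deriv (\<lambda>w. f (Some (x w, y w))) w * y w = h (Some (x w, y w)) * deriv x w))"

text \<open>Vanishing of the residue of \<open>g dx/y\<close> at a finite point \<open>q\<close>, computed in an arbitrary local
  holomorphic coordinate \<open>w\<close> centred at \<open>q\<close>.\<close>

definition no_residue_at :: "param \<Rightarrow> (point \<Rightarrow> complex) \<Rightarrow> complex \<times> complex \<Rightarrow> bool" where
  "no_residue_at t g q \<longleftrightarrow>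
     (\<forall>r x y. r > 0 \<and> x holomorphic_on ball 0 r \<and> y holomorphic_on ball 0 r \<and>
        (\<forall>w\<in>ball 0 r. (x w, y w) \<in> affine_curve t) \<and> (x 0, y 0) = q \<and>
        (deriv x 0, deriv y 0) \<noteq> (0, 0) \<longrightarrow>
        residue (\<lambda>w. g (Some (x w, y w)) * deriv x w / y w) 0 = 0)"


section \<open>Relative de Rham cohomology\<close>

text \<open>Elements of \<open>forms t\<close> are pairs \<open>(U, g)\<close> with \<open>U \<supseteq> Y\<close> affine open and \<open>g dx/y\<close> regular on \<open>U\<close>
  without residues at the points of \<open>X - U\<close> (these are finite points because \<open>O \<in> Y\<close>).
  For a fixed \<open>U\<close>, \<open>H\<^sup>1\<^sub>d\<^sub>R(X,Y)\<close> is the quotient by the \<open>df\<close> with \<open>f\<close> regular on \<open>U\<close> and \<open>f|\<^sub>Y = 0\<close>;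
  for different \<open>U\<close> these quotients are identified by restriction to smaller affine opens.
  Thus \<open>H\<^sup>1\<^sub>d\<^sub>R(X,Y)\<close> is the colimit over \<open>U\<close>, whose elements do not depend on the choice of \<open>U\<close>.\<close>

type_synonym form = "point set \<times> (point \<Rightarrow> complex)"
type_synonym dR_class = "form set"

definition forms :: "param \<Rightarrow> form set" where
  "forms t = {(U, g). affine_open t U \<and> YY t \<subseteq> U \<and> regular_on U g \<and>
                (\<forall>q. Some q \<in> XX t - U \<longrightarrow> no_residue_at t g q)}"

definition dR_rel :: "param \<Rightarrow> (form \<times> form) set" where
  "dR_rel t = {((U, g), (U', g')). (U, g) \<in> forms t \<and> (U', g') \<in> forms t \<and>
     (\<exists>W f. affine_open t W \<and> YY t \<subseteq> W \<and> W \<subseteq> U \<inter> U' \<and> regular_on W f \<and>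
        (\<forall>p\<in>YY t. f p = 0) \<and> is_differential W f (\<lambda>p. g p - g' p))}"

text \<open>\<open>H1dR t\<close> is \<open>H\<^sup>1\<^sub>d\<^sub>R(X,Y)\<close> as a complex vector space. Only the additive structure and the scalar
  multiplication of the record are used.\<close>

definition H1dR :: "param \<Rightarrow> (complex, dR_class) module" where
  "H1dR t = \<lparr>carrier = forms t // dR_rel t,
     mult = undefined, one = undefined,
     zero = (\<Union>U \<in> {U. (U, \<lambda>p. 0) \<in> forms t}. dR_rel t `` {(U, \<lambda>p. 0)}),
     add = (\<lambda>C C'. \<Union>(U, g) \<in> C. \<Union>(U', g') \<in> C'. dR_rel t `` {(U \<inter> U', \<lambda>p. g p + g' p)}),
     smult = (\<lambda>z C. \<Union>(U, g) \<in> C. dR_rel t `` {(U, \<lambda>p. z * g p)})\<rparr>"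


section \<open>The frame\<close>

text \<open>Coefficient (with respect to \<open>dx/y\<close>) of \<open>dF = F\<^sub>x dx + F\<^sub>y dy\<close> for \<open>F\<close> given in the affine
  coordinates: \<open>dx = y (dx/y)\<close>, and \<open>dy = (6x\<^sup>2 - t\<^sub>2/2) (dx/y)\<close> by differentiating the
  equation of the curve.\<close>

definition d_coeff :: "param \<Rightarrow> (complex \<Rightarrow> complex \<Rightarrow> complex) \<Rightarrow> complex \<times> complex \<Rightarrow> complex" where
  "d_coeff t F = (\<lambda>(x, y). deriv (\<lambda>\<xi>. F \<xi> y) x * y + deriv (\<lambda>\<eta>. F x \<eta>) y * (6 * x^2 - t $ 5 / 2))"

text \<open>The continuous extension to \<open>O\<close> of a function on the affine part of the curve.\<close>

definition extend_to_O :: "param \<Rightarrow> (complex \<times> complex \<Rightarrow> complex) \<Rightarrow> point \<Rightarrow> complex" where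
  "extend_to_O t h p = (case p of
      Some q \<Rightarrow> h q
    | None \<Rightarrow> Lim (inf at_infinity (principal (affine_curve t))) h)"

text \<open>The two sets of representatives are \<open>e = 0\<close>, where \<open>a \<noteq> 0\<close>, and \<open>e = 1\<close>, where \<open>a \<noteq> 1\<close>.\<close>

definition U_frame :: "complex \<Rightarrow> param \<Rightarrow> point set" where
  "U_frame e t = {None} \<union> {p \<in> XX t. \<exists>x y. p = Some (x, y) \<and> x \<noteq> e}"

definition frame_coeff :: "complex \<Rightarrow> 3 \<Rightarrow> param \<Rightarrow> complex \<times> complex \<Rightarrow> complex" where
  "frame_coeff e i t =
     (let a = t $ 1; b = t $ 2; c = t $ 3; t1 = t $ 4;
          d1 = d_coeff t (\<lambda>x y. (x - a) / (x - e));
          d2 = d_coeff t (\<lambda>x y. y / (2 * (x - e)))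
      in if i = 1 then d1
         else if i = 2 then (\<lambda>(x, y). 1)
         else (\<lambda>(x, y). (c - b / (2 * (a - e))) * d1 (x, y) + t1 + x - d2 (x, y)))"

definition frame :: "3 \<Rightarrow> param \<Rightarrow> dR_class" where
  "frame i = (\<lambda>t\<in>TT. let e = (if t $ 1 \<noteq> 0 then 0 else 1) in
                dR_rel t `` {(U_frame e t, extend_to_O t (frame_coeff e i t))})"

text \<open>Global algebraic sections of the bundle \<open>H\<^sup>1\<^sub>d\<^sub>R(X,Y)\<close> over \<open>TT\<close>: the free \<open>regT\<close>-module on the
  frame, realised as functions on \<open>TT\<close> with values in the fibres.\<close>

definition sections :: "(param \<Rightarrow> dR_class) set" where
  "sections = {s. \<exists>f. (\<forall>i. f i \<in> regT) \<and>
     s = (\<lambda>t\<in>TT. \<Oplus>\<^bsub>H1dR t\<^esub> i\<in>UNIV. f i t \<odot>\<^bsub>H1dR t\<^esub> frame i t)}"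


section \<open>Relative cycles and periods\<close>

text \<open>Paths in the curve are given by lifts to homogeneous coordinates
  \<open>(X, Y, Z) = (p $ 1, p $ 2, p $ 3)\<close>.\<close>

definition pt :: "complex ^ 3 \<Rightarrow> point" where
  "pt p = (if p $ 3 = 0 then None else Some (p $ 1 / p $ 3, p $ 2 / p $ 3))"

definition on_cone :: "param \<Rightarrow> complex ^ 3 \<Rightarrow> bool" where
  "on_cone t p \<longleftrightarrow> p \<noteq> 0 \<and>
     (p $ 2)^2 * p $ 3 = 4 * (p $ 1)^3 - t $ 5 * p $ 1 * (p $ 3)^2 - t3 t * (p $ 3)^3"

text \<open>The value of \<open>dx/y\<close> on the tangent vector \<open>v\<close> at \<open>p\<close>. With
  \<open>F = Y\<^sup>2Z - 4X\<^sup>3 + t\<^sub>2XZ\<^sup>2 + t\<^sub>3Z\<^sup>3\<close>, both \<open>p \<times> v\<close> and \<open>\<nabla>F(p)\<close> are orthogonal to \<open>p\<close> and \<open>v\<close>,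
  and \<open>2 (p \<times> v) = (dx/y)(v) \<nabla>F(p)\<close>; the second component is
  \<open>2 (Z dX - X dZ) = (dx/y) 2YZ\<close>, that is \<open>dx/y = d(X/Z) / (Y/Z)\<close>. As \<open>\<nabla>F(p) \<noteq> 0\<close>, this also covers
  \<open>y = 0\<close> and \<open>O\<close>.\<close>

definition inv_diff :: "param \<Rightarrow> complex ^ 3 \<Rightarrow> complex ^ 3 \<Rightarrow> complex" where
  "inv_diff t p v = (THE l.
     2 * (p $ 2 * v $ 3 - p $ 3 * v $ 2) = l * (t $ 5 * (p $ 3)^2 - 12 * (p $ 1)^2) \<and>
     2 * (p $ 3 * v $ 1 - p $ 1 * v $ 3) = l * (2 * p $ 2 * p $ 3) \<and>
     2 * (p $ 1 * v $ 2 - p $ 2 * v $ 1) =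
        l * ((p $ 2)^2 + 2 * t $ 5 * p $ 1 * p $ 3 + 3 * t3 t * (p $ 3)^2))"

definition path_integral :: "param \<Rightarrow> (point \<Rightarrow> complex) \<Rightarrow> (real \<Rightarrow> complex ^ 3) \<Rightarrow> complex" where
  "path_integral t g \<gamma> = integral {0..1}
     (\<lambda>s. g (pt (\<gamma> s)) * inv_diff t (\<gamma> s) (vector_derivative \<gamma> (at s within {0..1})))"

text \<open>A list \<open>[(n\<^sub>1, \<gamma>\<^sub>1), \<dots>]\<close> stands for the 1-chain \<open>n\<^sub>1 \<gamma>\<^sub>1 + \<dots>\<close>.\<close>

type_synonym path_chain = "(int \<times> (real \<Rightarrow> complex ^ 3)) list"

definition chain_integral :: "param \<Rightarrow> (point \<Rightarrow> complex) \<Rightarrow> path_chain \<Rightarrow> complex" where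
  "chain_integral t g c = (\<Sum>(n, \<gamma>)\<leftarrow>c. of_int n * path_integral t g \<gamma>)"

definition singular_chain_of :: "path_chain \<Rightarrow> point chain" where
  "singular_chain_of c =
     (\<Sum>(n, \<gamma>)\<leftarrow>c. frag_cmul n (frag_of (restrict (\<lambda>z. pt (\<gamma> (z 1))) (standard_simplex 1))))"

text \<open>The pairing of a class in \<open>H\<^sup>1\<^sub>d\<^sub>R(X,Y)\<close> with a relative cycle: integrate a representative which is
  regular along the cycle.\<close>

definition period :: "param \<Rightarrow> path_chain \<Rightarrow> dR_class \<Rightarrow> complex" where
  "period t c C = (THE z. \<exists>(U, g) \<in> C.
     (\<forall>(n, \<gamma>) \<in> set c. \<forall>s\<in>{0..1}. pt (\<gamma> s) \<in> U) \<and> z = chain_integral t g c)"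

definition C1_on :: "(param \<times> real) set \<Rightarrow> (param \<times> real \<Rightarrow> complex ^ 3) \<Rightarrow> bool" where
  "C1_on S f \<longleftrightarrow> (\<exists>f'. continuous_on S f' \<and>
     (\<forall>z\<in>S. (f has_derivative blinfun_apply (f' z)) (at z within S)))"

definition at_param ::
    "(int \<times> (param \<Rightarrow> real \<Rightarrow> complex ^ 3)) list \<Rightarrow> param \<Rightarrow> path_chain" where
  "at_param c t = map (\<lambda>(n, \<Gamma>). (n, \<Gamma> t)) c"

text \<open>Families over \<open>V\<close> of relative cycles of \<open>(X, Y)\<close>. The cycles move continuously with the
  parameter, so their classes in \<open>H\<^sub>1(X,Y;\<int>)\<close> form a locally constant family; conversely every locally
  constant family of classes is locally of this form. For periods to be defined and differentiable,
  the paths and their velocities are taken to be \<open>C\<^sup>1\<close> jointly in the parameter and the time.\<close>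

definition cycle_family ::
    "param set \<Rightarrow> (int \<times> (param \<Rightarrow> real \<Rightarrow> complex ^ 3)) list \<Rightarrow> bool" where
  "cycle_family V c \<longleftrightarrow> open V \<and> V \<subseteq> TT \<and>
     (\<forall>(n, \<Gamma>) \<in> set c.
        (\<forall>t\<in>V. \<forall>s\<in>{0..1}. on_cone t (\<Gamma> t s)) \<and>
        C1_on (V \<times> {0..1}) (\<lambda>(t, s). \<Gamma> t s) \<and>
        C1_on (V \<times> {0..1}) (\<lambda>(t, s). vector_derivative (\<Gamma> t) (at s within {0..1}))) \<and>
     (\<forall>t\<in>V. singular_relcycle 1 (curve_top t) (YY t) (singular_chain_of (at_param c t)))"


section \<open>The Gauss-Manin connection\<close>

text \<open>A connection \<open>D\<close> maps a section \<open>s\<close> to \<open>\<Sum>\<^sub>k dt\<^sub>k \<otimes> D s k\<close>, where \<open>t\<^sub>k\<close> are the five coordinates.\<close>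

type_synonym connection = "(param \<Rightarrow> dR_class) \<Rightarrow> 5 \<Rightarrow> param \<Rightarrow> dR_class"

definition is_connection :: "connection \<Rightarrow> bool" where
  "is_connection D \<longleftrightarrow>
     D \<in> extensional sections \<and>
     (\<forall>s\<in>sections. \<forall>k. D s k \<in> sections) \<and>
     (\<forall>s\<in>sections. \<forall>s'\<in>sections. \<forall>k. \<forall>t\<in>TT.
        D (\<lambda>t\<in>TT. s t \<oplus>\<^bsub>H1dR t\<^esub> s' t) k t = D s k t \<oplus>\<^bsub>H1dR t\<^esub> D s' k t) \<and>
     (\<forall>f\<in>regT. \<forall>s\<in>sections. \<forall>k. \<forall>t\<in>TT.
        D (\<lambda>t\<in>TT. f t \<odot>\<^bsub>H1dR t\<^esub> s t) k t =
          partialT k f t \<odot>\<^bsub>H1dR t\<^esub> s t \<oplus>\<^bsub>H1dR t\<^esub> f t \<odot>\<^bsub>H1dR t\<^esub> D s k t)"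

definition is_gauss_manin :: "connection \<Rightarrow> bool" where
  "is_gauss_manin D \<longleftrightarrow> is_connection D \<and>
     (\<forall>s\<in>sections. \<forall>V c. cycle_family V c \<longrightarrow>
        (\<forall>t\<in>V. ((\<lambda>t'. period t' (at_param c t') (s t')) has_derivative
                 (\<lambda>v. \<Sum>k\<in>UNIV. v $ k * period t (at_param c t) (D s k t))) (at t)))"

definition gauss_manin :: connection where
  "gauss_manin = (THE D. is_gauss_manin D)"

definition nabla :: "(param \<Rightarrow> complex ^ 5) \<Rightarrow> (param \<Rightarrow> dR_class) \<Rightarrow> param \<Rightarrow> dR_class" where
  "nabla R s = (\<lambda>t\<in>TT. \<Oplus>\<^bsub>H1dR t\<^esub> k\<in>UNIV. R t $ k \<odot>\<^bsub>H1dR t\<^esub> gauss_manin s k t)"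

definition mat_sections ::
    "complex ^ 3 ^ 3 \<Rightarrow> (3 \<Rightarrow> param \<Rightarrow> dR_class) \<Rightarrow> 3 \<Rightarrow> param \<Rightarrow> dR_class" where
  "mat_sections M \<alpha> i = (\<lambda>t\<in>TT. \<Oplus>\<^bsub>H1dR t\<^esub> j\<in>UNIV. M $ i $ j \<odot>\<^bsub>H1dR t\<^esub> \<alpha> j t)"

definition M_tau :: "complex ^ 3 ^ 3" where
  "M_tau = vector [vector [0, 0, 0], vector [0, 0, -1], vector [0, 0, 0]]"

definition M_z :: "complex ^ 3 ^ 3" where
  "M_z = vector [vector [0, 0, 0], vector [-1, 0, 0], vector [0, 0, 0]]"

definition R_tau :: "param \<Rightarrow> complex ^ 5" where
  "R_tau = (\<lambda>t\<in>TT. let a = t $ 1; b = t $ 2; c = t $ 3; t1 = t $ 4; t2 = t $ 5 in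
     vector [-2 * a^2 + 2 * a * t1 + b * c + t2 / 3,
             6 * a^2 * c - c * t2 / 2 - 3 * a * b + 3 * b * t1,
             a * c + c * t1 - b / 2,
             t1^2 - t2 / 12,
             4 * t1 * t2 - 6 * t3 t])"

definition R_z :: "param \<Rightarrow> complex ^ 5" where
  "R_z = (\<lambda>t\<in>TT. let a = t $ 1; b = t $ 2; t1 = t $ 4; t2 = t $ 5 in
     vector [b, 6 * a^2 - t2 / 2, a + t1, 0, 0])"

end

theory Submission
 imports Defs
begin

text \<open>Relative classes are written in the frame, whose representatives may be given any pole \<open>x = e\<close>
 avoiding \<open>Y\<close> and the cycle at hand. To differentiate the period of a moving cycle in the direction \<open>v\<close>,
 lift \<open>v\<close> to a vector field on the total space which is rational on the fibres (Fricke--Frobenius) and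
 decompose the velocity of the cycle into its lifted and its vertical part. The derivatives of the
 integrands of \<open>dx/y\<close> and of the form of the second kind are then combinations of the integrands
 themselves and of total derivatives along the path, whose boundary terms depend only on the motion
 of \<open>P\<close>. This is the matrix \<open>conn t v\<close> of \<open>\<nabla>\<^sub>v\<close>.

 A section is determined by its periods: at one parameter, two explicit loops and a path from \<open>O\<close>
 to \<open>P\<close> have independent periods, by continuity this holds nearby, and regular functions on \<open>TT\<close>
 which agree on an open set are equal. Hence \<open>\<nabla>\<close> is unique, and, \<open>v \<mapsto> conn t v\<close> being injective, a vector
 field is determined by its connection matrix; for \<open>R_tau\<close> and \<open>R_z\<close> this matrix is computed.\<close>

text \<open>The first period is constant, so the analysis concerns dx/y and h dx/y, where h = x -
  D(y/(2(x-e))) and D is the derivation dual to dx/y. The polynomial lift of v has a simple pole at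
  O. Adding al y/(2(x-e)) D removes it and fixes O, at the price of a pole at x = e; in the
  derivative of dx/y this replaces x by h. Thus the function y/(2(x-e)) in the frame is also the
  correction of the lift. Three obstacles shape the proof. Paths may cross branch points and O,
  where x is no coordinate: derivatives are computed chart by chart, and smooth dependence on
  parameters rests on formulas with conjugate gradients valid in all charts. The ends of single
  paths need not lie in Y, only the boundary of the whole chain does: end contributions are compared
  with P and O through local coordinates at the moving ends. Finally, independent periods are needed
  only near one parameter; there y^2 = 4x^3 - 4x has an automorphism acting on dx/y and x dx/y by
  different factors, so independence reduces to two integrals being non-zero.\<close>

notation has_vector_derivative (infix "hvd" 50)
abbreviation "at01 s \<equiv> at s within {0..1::real}"
notation tendsto (infixr "--->" 55)

lemmas hvd_add = has_vector_derivative_add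
lemmas hvd_const = has_vector_derivative_const
lemmas hvd_def = has_vector_derivative_def
lemmas hvd_diff = has_vector_derivative_diff
lemmas hvd_divide = has_vector_derivative_divide
lemmas hvd_eq_rhs = has_vector_derivative_eq_rhs
lemmas hvd_mult = has_vector_derivative_mult
lemmas hvd_mult_right = has_vector_derivative_mult_right
lemmas pow_eqs = power2_eq_square power3_eq_cube

section \<open>The five coordinate directions\<close>

lemma exhaust_5:
 fixes x :: 5
 shows "x = 1 \<or> x = 2 \<or> x = 3 \<or> x = 4 \<or> x = 5"
proof (induct x)
 case (of_int z)
 then have "z = 0 \<or> z = 1 \<or> z = 2 \<or> z = 3 \<or> z = 4" by fastforce
 then show ?case by auto
qed

lemma UNIV_5: "UNIV = {1, 2, 3, 4, 5 :: 5}" using exhaust_5 by auto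

lemma sum_5: "sum f (UNIV :: 5 set) = f 1 + f 2 + f 3 + f 4 + f 5" unfolding UNIV_5 by (simp add: ac_simps)

lemma forall_5: "(\<forall>i::5. P i) \<longleftrightarrow> P 1 & P 2 & P 3 & P 4 & P 5" by (metis exhaust_5)

lemma vector_5 [simp]:
 "(vector [x1, x2, x3, x4, x5] :: 'a::zero ^ 5) $ 1 = x1"
 "(vector [x1, x2, x3, x4, x5] :: 'a::zero ^ 5) $ 2 = x2"
 "(vector [x1, x2, x3, x4, x5] :: 'a::zero ^ 5) $ 3 = x3"
 "(vector [x1, x2, x3, x4, x5] :: 'a::zero ^ 5) $ 4 = x4"
 "(vector [x1, x2, x3, x4, x5] :: 'a::zero ^ 5) $ 5 = x5" unfolding vector_def by auto

section \<open>Regular functions on the parameter space\<close>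

lemma continuous_on_Disc: "continuous_on S Disc" unfolding Disc_def t3_def by (intro continuous_intros)

lemma open_TT: "open TT"
proof -
 have "TT = Disc -` (- {0})" by (auto simp: TT_def)
 then show ?thesis by (metis open_vimage[OF _ continuous_on_Disc] open_Compl closed_singleton)
qed

text \<open>Elements of \<open>regT\<close> are \<open>undefined\<close> off \<open>TT\<close>.
  Asking only for the values on \<open>TT\<close> lets the closure rules apply to plain formulas in
  the coordinates.\<close>

definition reg :: "(param => complex) => bool" where
 "reg f \<longleftrightarrow> (\<lambda>t\<in>TT. f t) \<in> regT"

lemma regT_extensional: "f \<in> regT ==> f \<in> extensional TT" by (induction rule: regT.induct) (rule restrict_extensional)+

lemma has_derivative_vec_nth [derivative_intros]:
 "(f has_derivative f') F ==> ((%x. f x $ k) has_derivative (%h. f' h $ k)) F"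
 by (rule bounded_linear.has_derivative[OF bounded_linear_vec_nth])

lemma bounded_linear_axis: "bounded_linear (axis k :: 'a::euclidean_space => 'a ^ 'n::finite)"
 unfolding linear_conv_bounded_linear[symmetric] by (rule linearI) (auto simp: vec_eq_iff axis_def)

lemma reg_regT: "f \<in> regT ==> reg f" by (metis reg_def regT_extensional extensional_restrict)

lemma restrict_cong_simple: "(!!t. t \<in> A ==> f t = g t) ==> restrict f A = restrict g A" by (rule restrict_ext)

lemma reg_const [intro]: "reg (%t. z)" and reg_coord [intro]: "reg (%t. t $ k)" unfolding reg_def by (rule regT.const regT.coord)+

lemma reg_add [intro]: "reg f ==> reg g ==> reg (%t. f t + g t)"
 unfolding reg_def by (drule (1) regT.add) (auto cong: restrict_cong_simple)

lemma reg_mult [intro]: "reg f ==> reg g ==> reg (%t. f t * g t)"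
 unfolding reg_def by (drule (1) regT.mult) (auto cong: restrict_cong_simple)

lemma reg_uminus [intro]: "reg f ==> reg (%t. - f t)" using reg_mult[OF reg_const[of "-1"], of f] by simp

lemma reg_diff [intro]: "reg f ==> reg g ==> reg (%t. f t - g t)" using reg_add[OF _ reg_uminus, of f g] by simp

lemma reg_power [intro]: "reg f ==> reg (%t. f t ^ n)" by (induction n) auto

lemma reg_sum [intro]: "(!!i. i \<in> A ==> reg (f i)) ==> reg (%t. \<Sum>i\<in>A. f i t)"
 by (induction A rule: infinite_finite_induct) auto

lemma reg_t3 [intro]: "reg t3" unfolding t3_def by (intro reg_diff reg_mult reg_power reg_const reg_coord)

lemma reg_divide_Disc [intro]: "reg f ==> reg (%t. f t / Disc t)"
proof -
 assume "reg f"
 moreover have "reg (%t. 1 / Disc t)" unfolding reg_def by (rule regT.inv_Disc)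
 ultimately have "reg (%t. f t * (1 / Disc t))" by (rule reg_mult)
 then show ?thesis by simp
qed

lemma reg_divide_const [intro]: "reg f ==> reg (%t. f t / c)" using reg_mult[OF reg_const[of "1/c"], of f] by simp

lemmas reg_intros = reg_diff reg_uminus reg_mult reg_add reg_power reg_divide_const reg_divide_Disc
 reg_t3 reg_coord reg_const

text \<open>\<open>TT\<close> is open, so a derivative at one of its points cannot see the
  \<open>undefined\<close> values outside.\<close>

lemma has_derivative_restrict_TT:
 assumes "t \<in> TT"
 shows "((\<lambda>t\<in>TT. f t) has_derivative D) (at t) \<longleftrightarrow> (f has_derivative D) (at t)"
proof -
 have "((\<lambda>t\<in>TT. f t) has_derivative D) (at t)" if "(f has_derivative D) (at t)" for f
  by (rule has_derivative_transform_within_open[OF that open_TT assms]) auto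
 moreover have "(f has_derivative D) (at t)" if "((\<lambda>t\<in>TT. f t) has_derivative D) (at t)"
  by (rule has_derivative_transform_within_open[OF that open_TT assms]) auto
 ultimately show ?thesis by blast
qed

lemma t3_has_derivative:
 "(t3 has_derivative (%v. v $ 1 * (12 * (t $ 1)^2 - t $ 5) + v $ 2 * (- 2 * t $ 2) + v $ 5 * (- t $ 1))) (at t)"
 unfolding t3_def by (auto intro!: derivative_eq_intros simp: algebra_simps power2_eq_square)

lemma Disc_has_derivative:
 "(Disc has_derivative (%v. v $ 1 * (54 * t3 t * (12 * (t $ 1)^2 - t $ 5))
   + v $ 2 * (54 * t3 t * (- 2 * t $ 2))
   + v $ 5 * (54 * t3 t * (- t $ 1) - 3 * (t $ 5)^2))) (at t)" unfolding Disc_def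
 by (auto intro!: derivative_eq_intros t3_has_derivative simp: algebra_simps power2_eq_square)

text \<open>Induction over the generators of \<open>regT\<close>. Total differentiability and
  regularity of the coefficients are carried together; \<open>1 / Disc\<close> only contributes
  further factors \<open>1 / Disc\<close>.\<close>

lemma reg_derivative:
 assumes "f \<in> regT"
 shows "\<exists>g. (\<forall>k. reg (g k)) & (\<forall>t\<in>TT. (f has_derivative (%v. \<Sum>k\<in>UNIV. v $ k * g k t)) (at t))"
 using assms
proof induction
 case (const z)
 have "((%t. z) has_derivative (%v. \<Sum>k\<in>UNIV. v $ k * 0)) (at t)" for t :: param by simp
 then show ?case by (intro exI[of _ "%j t. 0"] conjI allI ballI reg_const has_derivative_restrict_TT[THEN iffD2])
next
 case (coord k)
 have "((%t. t $ k) has_derivative (%v. \<Sum>j\<in>UNIV. v $ j * (if j = k then 1 else 0))) (at t)" for t :: param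
  by (auto intro!: derivative_eq_intros simp: if_distrib sum.delta cong: if_cong)
 then show ?case by (intro exI[of _ "%j t. if j = k then 1 else 0"] conjI allI ballI reg_const
    has_derivative_restrict_TT[THEN iffD2])
next
 case inv_Disc
 \<comment> \<open>The partial derivatives of \<open>Disc\<close>: only a, b and t_2 enter, through
   t_3 and t_2^3.\<close>
 define g :: "5 => param => complex" where
  "g k t = (if k = 1 then 54 * t3 t * (12 * (t $ 1)^2 - t $ 5) else
       if k = 2 then 54 * t3 t * (- 2 * t $ 2) else
       if k = 5 then 54 * t3 t * (- t $ 1) - 3 * (t $ 5)^2 else 0)" for k t
 have reg: "reg (%t. - (g k t / Disc t / Disc t))" for k
 proof (intro reg_uminus reg_divide_Disc)
  show "reg (g k)" using exhaust_5[of k] by (elim disjE; simp add: g_def[abs_def]; intro reg_intros)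
 qed
 have "((%t. 1 / Disc t) has_derivative (%v. \<Sum>k\<in>UNIV. v $ k * - (g k t / Disc t / Disc t))) (at t)"
  if "t \<in> TT" for t using that by (auto intro!: derivative_eq_intros Disc_has_derivative simp: TT_def sum_5 g_def field_simps)
 then show ?case using reg by (intro exI[of _ "%k t. - (g k t / Disc t / Disc t)"] conjI allI ballI
    has_derivative_restrict_TT[THEN iffD2])
next
 case (add f1 f2)
 then obtain g1 g2 where g:
  "\<forall>k. reg (g1 k)" "\<forall>t\<in>TT. (f1 has_derivative (%v. \<Sum>k\<in>UNIV. v $ k * g1 k t)) (at t)"
  "\<forall>k. reg (g2 k)" "\<forall>t\<in>TT. (f2 has_derivative (%v. \<Sum>k\<in>UNIV. v $ k * g2 k t)) (at t)" by blast
 show ?case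
 proof (intro exI conjI allI ballI has_derivative_restrict_TT[THEN iffD2])
  show "reg (%t. g1 k t + g2 k t)" for k using g by (intro reg_add) auto
  show "((%t. f1 t + f2 t) has_derivative (%v. \<Sum>k\<in>UNIV. v $ k * (g1 k t + g2 k t))) (at t)"
   if "t \<in> TT" for t
   by (rule has_derivative_eq_rhs[OF has_derivative_add[OF g(2)[rule_format, OF that] g(4)[rule_format, OF that]]])
    (simp add: fun_eq_iff algebra_simps sum.distrib)
 qed
next
 case (mult f1 f2)
 then obtain g1 g2 where g:
  "\<forall>k. reg (g1 k)" "\<forall>t\<in>TT. (f1 has_derivative (%v. \<Sum>k\<in>UNIV. v $ k * g1 k t)) (at t)"
  "\<forall>k. reg (g2 k)" "\<forall>t\<in>TT. (f2 has_derivative (%v. \<Sum>k\<in>UNIV. v $ k * g2 k t)) (at t)" by blast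
 show ?case
 proof (intro exI conjI allI ballI has_derivative_restrict_TT[THEN iffD2])
  show "reg (%t. g1 k t * f2 t + f1 t * g2 k t)" for k
   using g reg_regT[OF mult.hyps(1)] reg_regT[OF mult.hyps(2)] by (intro reg_add reg_mult) auto
  show "((%t. f1 t * f2 t) has_derivative (%v. \<Sum>k\<in>UNIV. v $ k * (g1 k t * f2 t + f1 t * g2 k t))) (at t)"
   if "t \<in> TT" for t
   by (rule has_derivative_eq_rhs[OF has_derivative_mult[OF g(2)[rule_format, OF that] g(4)[rule_format, OF that]]])
    (simp add: fun_eq_iff algebra_simps sum.distrib sum_distrib_left)
 qed
qed

lemma has_derivative_coordinate_line:
 "((%z::complex. \<chi> j. if j = k then z else t $ j) has_derivative axis k) (at z)"
proof -
 have "(%z. \<chi> j. if j = k then z else t $ j) = (%z. t - axis k (t $ k) + axis k z)"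
  by (auto simp: fun_eq_iff vec_eq_iff axis_def)
 then show ?thesis by (auto intro!: derivative_eq_intros bounded_linear.has_derivative[OF bounded_linear_axis])
qed

lemma partialT_eq:
 assumes "(f has_derivative (%v. \<Sum>k\<in>UNIV. v $ k * g k)) (at t)" "t \<in> TT"
 shows "partialT k f t = g k"
proof -
 have eq: "(\<chi> j. if j = k then t $ k else t $ j) = t" by (simp add: vec_eq_iff)
 have "((%z. f (\<chi> j. if j = k then z else t $ j)) has_derivative
   (%h. \<Sum>j\<in>UNIV. axis k h $ j * g j)) (at (t $ k))"
  using has_derivative_compose[OF has_derivative_coordinate_line[of k t "t $ k"]] assms(1) eq by (simp add: o_def)
 also have "(%h. \<Sum>j\<in>UNIV. axis k h $ j * g j) = (%h. g k * h)"
  by (simp add: axis_def if_distrib[of "%x. _ * x"] mult.commute cong: if_cong)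
 finally have "((%z. f (\<chi> j. if j = k then z else t $ j)) has_field_derivative g k) (at (t $ k))"
  by (simp add: has_field_derivative_def)
 then show ?thesis using assms(2) by (simp add: partialT_def DERIV_imp_deriv)
qed

lemma partialT_regT:
 assumes "f \<in> regT"
 shows "partialT k f \<in> regT" and "t \<in> TT ==> (f has_derivative (%v. \<Sum>k\<in>UNIV. v $ k * partialT k f t)) (at t)"
proof -
 obtain g where g: "\<forall>k. reg (g k)" "\<forall>t\<in>TT. (f has_derivative (%v. \<Sum>k\<in>UNIV. v $ k * g k t)) (at t)"
  using reg_derivative[OF assms] by blast
 then have eq: "partialT k f t = g k t" if "t \<in> TT" for k t using that by (intro partialT_eq[where g = "%k. g k t"]) auto
 have "partialT k f = (\<lambda>t\<in>TT. g k t)" using eq by (intro extensionalityI[of _ TT]) (auto simp: partialT_def)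
 then show "partialT k f \<in> regT" using g by (simp add: reg_def)
 show "t \<in> TT ==> (f has_derivative (%v. \<Sum>k\<in>UNIV. v $ k * partialT k f t)) (at t)" using g eq by simp
qed

section \<open>Identity principle on the parameter space\<close>

lemma poly_Disc_line: "\<exists>d. \<forall>z. Disc (t0 + z *s (t - t0)) = poly d z"
proof -
 define c where "c k = [:t0 $ k, t $ k - t0 $ k:]" for k
 have c: "(t0 + z *s (t - t0)) $ k = poly (c k) z" for k z by (simp add: c_def algebra_simps)
 have "\<forall>z. Disc (t0 + z *s (t - t0)) =
   poly (27 * (4 * c 1 ^ 3 - c 5 * c 1 - c 2 ^ 2)^2 - c 5 ^ 3) z" unfolding Disc_def t3_def c by simp
 then show ?thesis by blast
qed

text \<open>Along a complex line a regular function becomes a polynomial once a power of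
  \<open>Disc\<close> is cleared. Adding the exponents in both inductive steps provides a common
  power.\<close>

lemma regT_on_line:
 assumes "f \<in> regT"
 shows "\<exists>n p. \<forall>z. t0 + z *s (t - t0) \<in> TT -->
   f (t0 + z *s (t - t0)) * Disc (t0 + z *s (t - t0)) ^ n = poly p z" using assms
proof induction
 case (const c)
 show ?case by (rule exI[of _ 0], rule exI[of _ "[:c:]"]) auto
next
 case (coord k)
 show ?case by (rule exI[of _ 0], rule exI[of _ "[:t0 $ k, t $ k - t0 $ k:]"]) (auto simp: algebra_simps)
next
 case inv_Disc
 show ?case by (rule exI[of _ 1], rule exI[of _ 1]) (auto simp: TT_def)
next
 case (add f g)
 obtain d where d: "\<forall>z. Disc (t0 + z *s (t - t0)) = poly d z" using poly_Disc_line by blast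
 from add obtain n p m q where
  "\<forall>z. t0 + z *s (t - t0) \<in> TT --> f (t0 + z *s (t - t0)) * Disc (t0 + z *s (t - t0)) ^ n = poly p z"
  "\<forall>z. t0 + z *s (t - t0) \<in> TT --> g (t0 + z *s (t - t0)) * Disc (t0 + z *s (t - t0)) ^ m = poly q z" by metis
 note pq = this[rule_format]
 show ?case
 proof (intro exI allI impI)
  fix z assume z: "t0 + z *s (t - t0) \<in> TT"
  show "(\<lambda>t\<in>TT. f t + g t) (t0 + z *s (t - t0)) * Disc (t0 + z *s (t - t0)) ^ (n + m)
    = poly (p * d ^ m + q * d ^ n) z"
   using z by (simp only: pq[OF z, symmetric] poly_add poly_mult poly_power d[rule_format, symmetric]
     restrict_apply if_True power_add) (simp only: algebra_simps)
 qed
next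
 case (mult f g)
 from mult obtain n p m q where
  "\<forall>z. t0 + z *s (t - t0) \<in> TT --> f (t0 + z *s (t - t0)) * Disc (t0 + z *s (t - t0)) ^ n = poly p z"
  "\<forall>z. t0 + z *s (t - t0) \<in> TT --> g (t0 + z *s (t - t0)) * Disc (t0 + z *s (t - t0)) ^ m = poly q z" by metis
 note pq = this[rule_format]
 show ?case
 proof (intro exI allI impI)
  fix z assume z: "t0 + z *s (t - t0) \<in> TT"
  show "(\<lambda>t\<in>TT. f t * g t) (t0 + z *s (t - t0)) * Disc (t0 + z *s (t - t0)) ^ (n + m) = poly (p * q) z"
   using z by (simp only: pq[OF z, symmetric] poly_mult
     restrict_apply if_True power_add) (simp only: mult.assoc mult.left_commute)
 qed
qed

text \<open>On the complex line from \<open>t0\<close> to \<open>t\<close> the cleared function is a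
  polynomial that vanishes on a disc around 0, hence identically; its value at 1 gives the claim,
  whether or not the line leaves \<open>TT\<close> in between.\<close>

lemma regT_identity:
 assumes "f \<in> regT" "open V" "V <= TT" "t0 \<in> V" "!!t. t \<in> V ==> f t = 0" "t \<in> TT"
 shows "f t = 0"
proof -
 obtain n p where p: "!!z. t0 + z *s (t - t0) \<in> TT ==>
   f (t0 + z *s (t - t0)) * Disc (t0 + z *s (t - t0)) ^ n = poly p z" using regT_on_line[OF assms(1)] by blast
 have cont: "continuous_on UNIV (%z. t0 + z *s (t - t0))" unfolding vector_scalar_mult_def by (intro continuous_intros)
 have "open ((%z. t0 + z *s (t - t0)) -` V)" by (rule open_vimage[OF assms(2) cont])
 moreover have "0 \<in> (%z. t0 + z *s (t - t0)) -` V" using assms(4) by simp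
 ultimately obtain r where r: "r > 0" "ball 0 r <= (%z. t0 + z *s (t - t0)) -` V" by (meson open_contains_ball)
 have "poly p z = 0" if "z \<in> ball 0 r" for z using r(2) that assms(3,5) p[of z] by (auto simp: vimage_def subset_iff)
 then have "ball 0 r <= {z. poly p z = 0}" by auto
 moreover have "infinite (ball (0::complex) r)" using uncountable_ball[OF r(1)] countable_finite by blast
 ultimately have "p = 0" using poly_roots_finite[of p] finite_subset by blast
 then show ?thesis using p[of 1] assms(6) by (auto simp: TT_def)
qed

section \<open>Polynomial functions of two variables and regular functions\<close>

text \<open>Allows polynomials in two variables to be given by formulas, keeping the nested
  coefficients of \<open>poly2\<close> out of sight.\<close>

definition pol :: "(complex => complex => complex) => bool" where
 "pol F \<longleftrightarrow> (\<exists>P. \<forall>x y. poly2 P x y = F x y)"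

lemma pol_poly2: "pol (poly2 P)" unfolding pol_def by blast

lemma pol_const: "pol (%x y. c)" unfolding pol_def by (rule exI[of _ "[:[:c:]:]"]) (simp add: poly2_def)

lemma pol_x: "pol (%x y. x)" unfolding pol_def by (rule exI[of _ "[:0, 1:]"]) (simp add: poly2_def)

lemma pol_y: "pol (%x y. y)" unfolding pol_def by (rule exI[of _ "[:[:0, 1:]:]"]) (simp add: poly2_def)

lemma pol_add: "pol F ==> pol G ==> pol (%x y. F x y + G x y)" unfolding pol_def by (metis poly2_def poly_add)

lemma pol_mult: "pol F ==> pol G ==> pol (%x y. F x y * G x y)" unfolding pol_def by (metis poly2_def poly_mult)

lemma pol_diff: "pol F ==> pol G ==> pol (%x y. F x y - G x y)" unfolding pol_def by (metis poly2_def poly_diff)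

lemma pol_power: "pol F ==> pol (%x y. F x y ^ n)" by (induction n) (simp_all add: pol_const pol_mult)

lemma pol_divide: "pol F ==> pol (%x y. F x y / c)" using pol_mult[OF pol_const[of "1/c"], of F] by simp

lemmas pol_intros = pol_add pol_mult pol_diff pol_power pol_divide pol_const pol_x pol_y

lemma poly2_pCons: "poly2 (pCons c P) x y = poly c y + x * poly2 P x y" by (simp add: poly2_def)

lemma continuous_on_poly2 [continuous_intros]:
 assumes "continuous_on S x" "continuous_on S y"
 shows "continuous_on S (%s. poly2 P (x s) (y s))"
proof (induction P)
 case 0
 then show ?case by (simp add: poly2_def)
next
 case (pCons c P)
 then show ?case using assms by (auto simp: poly2_pCons intro!: continuous_intros)
qed

lemma holomorphic_on_poly2 [holomorphic_intros]:
 assumes "x holomorphic_on S" "y holomorphic_on S"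
 shows "(%s. poly2 P (x s) (y s)) holomorphic_on S"
proof (induction P)
 case 0
 then show ?case by (simp add: poly2_def)
next
 case (pCons c P)
 then show ?case using assms by (auto simp: poly2_pCons intro!: holomorphic_intros)
qed

lemma regular_at_SomeI:
 assumes "pol F" "pol G" "G x0 y0 ~= 0"
  "!!x y. Some (x, y) \<in> U ==> G x y ~= 0 ==> f (Some (x, y)) = F x y / G x y"
 shows "regular_at U f (Some (x0, y0))"
proof -
 obtain P Q where "!!x y. poly2 P x y = F x y" "!!x y. poly2 Q x y = G x y" using assms(1,2) unfolding pol_def by blast
 then show ?thesis using assms unfolding regular_at_def option.case prod.case by (intro exI[of _ P] exI[of _ Q]) simp
qed

lemma regular_at_NoneI:
 assumes "pol F" "pol G" "G 0 0 ~= 0" "f None = F 0 0 / G 0 0"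
  "!!x y. Some (x, y) \<in> U ==> y ~= 0 ==> G (x / y) (1 / y) ~= 0 ==>
    f (Some (x, y)) = F (x / y) (1 / y) / G (x / y) (1 / y)"
 shows "regular_at U f None"
proof -
 obtain P Q where "!!x y. poly2 P x y = F x y" "!!x y. poly2 Q x y = G x y" using assms(1,2) unfolding pol_def by blast
 then show ?thesis using assms unfolding regular_at_def option.case by (intro exI[of _ P] exI[of _ Q]) simp
qed

lemma regular_at_SomeE:
 assumes "regular_at U f (Some (x0, y0))"
 obtains P Q where "poly2 Q x0 y0 ~= 0"
  "!!x y. Some (x, y) \<in> U ==> poly2 Q x y ~= 0 ==> f (Some (x, y)) = poly2 P x y / poly2 Q x y"
 using assms unfolding regular_at_def by auto

lemma regular_at_NoneE:
 assumes "regular_at U f None"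
 obtains P Q where "poly2 Q 0 0 ~= 0" "f None = poly2 P 0 0 / poly2 Q 0 0"
  "!!x y. Some (x, y) \<in> U ==> y ~= 0 ==> poly2 Q (x / y) (1 / y) ~= 0 ==>
    f (Some (x, y)) = poly2 P (x / y) (1 / y) / poly2 Q (x / y) (1 / y)" using assms unfolding regular_at_def by auto

lemma regular_at_const: "regular_at U (%_. c) p"
proof (cases p)
 case None
 then show ?thesis by (auto intro!: regular_at_NoneI[where F = "%_ _. c" and G = "%_ _. 1"] pol_intros)
next
 case (Some q)
 then show ?thesis by (cases q) (auto intro!: regular_at_SomeI[where F = "%_ _. c" and G = "%_ _. 1"] pol_intros)
qed

lemma regular_at_add:
 assumes "regular_at U f p" "regular_at U g p"
 shows "regular_at U (%p. f p + g p) p"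
proof (cases p)
 case None
 obtain P Q where 1: "poly2 Q 0 0 ~= 0" "f None = poly2 P 0 0 / poly2 Q 0 0"
  "!!x y. Some (x, y) \<in> U ==> y ~= 0 ==> poly2 Q (x / y) (1 / y) ~= 0 ==>
    f (Some (x, y)) = poly2 P (x / y) (1 / y) / poly2 Q (x / y) (1 / y)" using assms(1) None regular_at_NoneE by metis
 obtain P' Q' where 2: "poly2 Q' 0 0 ~= 0" "g None = poly2 P' 0 0 / poly2 Q' 0 0"
  "!!x y. Some (x, y) \<in> U ==> y ~= 0 ==> poly2 Q' (x / y) (1 / y) ~= 0 ==>
    g (Some (x, y)) = poly2 P' (x / y) (1 / y) / poly2 Q' (x / y) (1 / y)" using assms(2) None regular_at_NoneE by metis
 show ?thesis unfolding None by (rule regular_at_NoneI[where F = "%x y. poly2 P x y * poly2 Q' x y + poly2 P' x y * poly2 Q x y"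
     and G = "%x y. poly2 Q x y * poly2 Q' x y"])
   (use 1 2 in "auto intro!: pol_intros pol_poly2 simp: add_frac_eq")
next
 case (Some q)
 obtain x0 y0 where q: "q = (x0, y0)" by (cases q)
 obtain P Q where 1: "poly2 Q x0 y0 ~= 0"
  "!!x y. Some (x, y) \<in> U ==> poly2 Q x y ~= 0 ==> f (Some (x, y)) = poly2 P x y / poly2 Q x y"
  using assms(1) Some q regular_at_SomeE by metis
 obtain P' Q' where 2: "poly2 Q' x0 y0 ~= 0"
  "!!x y. Some (x, y) \<in> U ==> poly2 Q' x y ~= 0 ==> g (Some (x, y)) = poly2 P' x y / poly2 Q' x y"
  using assms(2) Some q regular_at_SomeE by metis
 show ?thesis unfolding Some q by (rule regular_at_SomeI[where F = "%x y. poly2 P x y * poly2 Q' x y + poly2 P' x y * poly2 Q x y"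
     and G = "%x y. poly2 Q x y * poly2 Q' x y"])
   (use 1 2 in "auto intro!: pol_intros pol_poly2 simp: add_frac_eq")
qed

lemma regular_at_cmult:
 assumes "regular_at U f p"
 shows "regular_at U (%p. c * f p) p"
proof (cases p)
 case None
 obtain P Q where 1: "poly2 Q 0 0 ~= 0" "f None = poly2 P 0 0 / poly2 Q 0 0"
  "!!x y. Some (x, y) \<in> U ==> y ~= 0 ==> poly2 Q (x / y) (1 / y) ~= 0 ==>
    f (Some (x, y)) = poly2 P (x / y) (1 / y) / poly2 Q (x / y) (1 / y)" using assms(1) None regular_at_NoneE by metis
 show ?thesis unfolding None by (rule regular_at_NoneI[where F = "%x y. c * poly2 P x y" and G = "%x y. poly2 Q x y"])
   (use 1 in "auto intro!: pol_intros pol_poly2")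
next
 case (Some q)
 obtain x0 y0 where q: "q = (x0, y0)" by (cases q)
 obtain P Q where 1: "poly2 Q x0 y0 ~= 0"
  "!!x y. Some (x, y) \<in> U ==> poly2 Q x y ~= 0 ==> f (Some (x, y)) = poly2 P x y / poly2 Q x y"
  using assms(1) Some q regular_at_SomeE by metis
 show ?thesis unfolding Some q by (rule regular_at_SomeI[where F = "%x y. c * poly2 P x y" and G = "%x y. poly2 Q x y"])
   (use 1 in "auto intro!: pol_intros pol_poly2")
qed

lemma regular_at_subset: "regular_at U f p ==> W <= U ==> regular_at W f p"
 unfolding regular_at_def by (fastforce split: option.splits)

lemma regular_at_cong:
 assumes "regular_at U f p" "!!p. p \<in> U ==> f p = g p" "p \<in> U"
 shows "regular_at U g p"
proof (cases p)
 case None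
 then show ?thesis using assms unfolding regular_at_def by simp
next
 case (Some q)
 then show ?thesis using assms unfolding regular_at_def by (auto split: prod.splits)
qed

lemma regular_on_const: "regular_on U (%_. c)"
 and regular_on_add: "regular_on U f ==> regular_on U g ==> regular_on U (%p. f p + g p)"
 and regular_on_cmult: "regular_on U f ==> regular_on U (%p. c * f p)"
 and regular_on_subset: "regular_on U f ==> W <= U ==> regular_on W f"
 and regular_on_cong: "regular_on U f ==> (!!p. p \<in> U ==> f p = g p) ==> regular_on U g" unfolding regular_on_def
 using regular_at_const regular_at_add regular_at_cmult regular_at_subset regular_at_cong by (blast, blast, blast, blast, metis)

lemma regular_on_diff: "regular_on U f ==> regular_on U g ==> regular_on U (%p. f p - g p)"
 using regular_on_add[OF _ regular_on_cmult, of U f g "-1"] by simp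

lemma regular_on_holomorphic:
 assumes "regular_on U f" "open S" "x holomorphic_on S" "y holomorphic_on S"
  "!!w. w \<in> S ==> Some (x w, y w) \<in> U"
 shows "(%w. f (Some (x w, y w))) holomorphic_on S"
proof -
 have "(%w. f (Some (x w, y w))) field_differentiable at w0" if w0: "w0 \<in> S" for w0
 proof -
  obtain P Q where 1: "poly2 Q (x w0) (y w0) ~= 0"
   "!!x y. Some (x, y) \<in> U ==> poly2 Q x y ~= 0 ==> f (Some (x, y)) = poly2 P x y / poly2 Q x y"
   using assms(1,5) w0 regular_at_SomeE unfolding regular_on_def by metis
  define T where "T = {w \<in> S. poly2 Q (x w) (y w) ~= 0}"
  have "continuous_on S (%w. poly2 Q (x w) (y w))" using assms by (intro continuous_intros holomorphic_on_imp_continuous_on)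
  from continuous_open_preimage[OF this assms(2) open_Compl[OF closed_singleton[of 0]]]
  moreover have "T = S \<inter> (%w. poly2 Q (x w) (y w)) -` (- {0})" by (auto simp: T_def)
  ultimately have T: "open T" by simp
  have "x holomorphic_on T" "y holomorphic_on T" using assms(3,4) by (auto simp: T_def intro: holomorphic_on_subset)
  then have "(%w. poly2 P (x w) (y w) / poly2 Q (x w) (y w)) holomorphic_on T" by (intro holomorphic_intros) (auto simp: T_def)
  then have "(%w. f (Some (x w, y w))) holomorphic_on T" by (rule holomorphic_transform) (use 1 assms(5) in "auto simp: T_def")
  then show ?thesis using T w0 1(1) by (auto simp: holomorphic_on_open field_differentiable_def T_def)
 qed
 then show ?thesis by (auto simp: holomorphic_on_def intro: field_differentiable_at_within)
qed

section \<open>Holomorphic germs on the curve\<close>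

definition cubic :: "param => complex => complex" where
 "cubic t x = 4 * x^3 - t $ 5 * x - t3 t"

definition dcubic :: "param => complex => complex" where
 "dcubic t x = 12 * x^2 - t $ 5"

lemma affine_curve_iff: "(x, y) \<in> affine_curve t \<longleftrightarrow> y^2 = cubic t x"
 by (simp add: affine_curve_def cubic_def)

lemma DERIV_cubic: "(cubic t has_field_derivative dcubic t x) (at x)"
 unfolding cubic_def dcubic_def by (auto intro!: derivative_eq_intros)

text \<open>Smoothness of the affine curve: a double root x forces t_2 = 12 x^2 and t_3 = -8 x^3,
  and then both terms of the discriminant equal 1728 x^6.\<close>

lemma dcubic_nonzero:
 assumes "t \<in> TT" "cubic t x = 0"
 shows "dcubic t x ~= 0"
proof
 assume "dcubic t x = 0"
 then have t2: "t $ 5 = 12 * x^2" by (simp add: dcubic_def)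
 with assms(2) have t3: "t3 t = - 8 * x^3" by (simp add: cubic_def pow_eqs algebra_simps)
 have "Disc t = 0" unfolding Disc_def t2 t3 by (simp add: power_mult_distrib flip: power_mult)
 with assms(1) show False by (simp add: TT_def)
qed

lemma germ_curve_deriv:
 assumes "open S" "x holomorphic_on S" "y holomorphic_on S" "!!w. w \<in> S ==> (x w, y w) \<in> affine_curve t"
  "w \<in> S"
 shows "2 * y w * deriv y w = dcubic t (x w) * deriv x w"
proof -
 have x: "(x has_field_derivative deriv x w) (at w)" and y: "(y has_field_derivative deriv y w) (at w)"
  using assms by (auto intro: holomorphic_derivI)
 have "((%w. y w ^ 2 - cubic t (x w)) has_field_derivative
   2 * y w * deriv y w - dcubic t (x w) * deriv x w) (at w)"
  by (auto intro!: derivative_eq_intros x y DERIV_chain2[OF DERIV_cubic])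
 moreover have "((%w. y w ^ 2 - cubic t (x w)) has_field_derivative 0) (at w)"
  by (rule has_field_derivative_transform_within_open[OF DERIV_const[of 0] assms(1,5)])
   (use assms(4) affine_curve_iff in auto)
 ultimately show ?thesis using DERIV_unique by fastforce
qed

lemma DERIV_nonzero_eventually_neq:
 fixes f :: "complex => complex"
 assumes "(f has_field_derivative d) (at z)" "d ~= 0"
 shows "eventually (%w. f w ~= f z) (at z)"
proof -
 have "((%w. (f w - f z) / (w - z)) ---> d) (at z)" using assms(1) by (simp add: has_field_derivative_iff)
 then have "eventually (%w. (f w - f z) / (w - z) ~= 0) (at z)" using assms(2) by (rule tendsto_imp_eventually_ne)
 then show ?thesis by eventually_elim auto
qed

text \<open>\<open>k\<close> is the coefficient of dx/y in the coordinate w: x'/y where y is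
  non-zero, and 2 y'/f'(x) around a branch point, f being the cubic. Shrinking the disc keeps the
  zeros of y and the finite set \<open>B\<close>, later a set of poles, away from all points but the
  centre.\<close>

lemma germ_invariant_differential:
 assumes t: "t \<in> TT" and r: "r > 0" and x: "x holomorphic_on ball 0 r" and y: "y holomorphic_on ball 0 r"
  and c: "!!w. w \<in> ball 0 r ==> (x w, y w) \<in> affine_curve t" and d: "(deriv x 0, deriv y 0) ~= (0, 0)" and B: "finite B"
 obtains r' k where "0 < r'" "r' \<le> r" "k holomorphic_on ball 0 r'"
  "!!w. w \<in> ball 0 r' ==> deriv x w = k w * y w"
  "!!w. w \<in> ball 0 r' - {0} ==> y w ~= 0 & (x w, y w) \<notin> B"
proof -
 have x0: "(x has_field_derivative deriv x 0) (at 0)" and y0: "(y has_field_derivative deriv y 0) (at 0)"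
  using r x y by (auto intro: holomorphic_derivI[of _ "ball 0 r"])
 have cx: "continuous (at 0) x" and cy: "continuous (at 0) y" using x0 y0 DERIV_isCont by blast+
 have dcont: "continuous (at 0) (%w. dcubic t (x w))" unfolding dcubic_def using cx by (intro continuous_intros)
 have rel: "2 * y w * deriv y w = dcubic t (x w) * deriv x w" if "w \<in> ball 0 r" for w
  using germ_curve_deriv[OF open_ball x y c that] .
 have dne: "dcubic t (x 0) ~= 0" if "y 0 = 0" using that c[of 0] r dcubic_nonzero[OF t] by (auto simp: affine_curve_iff)
 have "eventually (%w. y w ~= 0) (at 0)"
 proof (cases "y 0 = 0")
  case True
  \<comment> \<open>At a branch point the differentiated equation gives x' = 0, so an immersed germ
    has non-zero y'.\<close>
  then have "deriv y 0 ~= 0" using rel[of 0] dne d r by auto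
  from DERIV_nonzero_eventually_neq[OF y0 this] show ?thesis using True by simp
 next
  case False
  then show ?thesis using cy tendsto_imp_eventually_ne by (auto simp: continuous_at isCont_def)
 qed
 moreover have "eventually (%w. (x w, y w) ~= b) (at 0)" for b
 proof (cases "(x 0, y 0) = b")
  case True
  then show ?thesis using DERIV_nonzero_eventually_neq[OF x0] DERIV_nonzero_eventually_neq[OF y0] d
   by (cases "deriv x 0 = 0") (auto elim!: eventually_mono)
 next
  case False
  have "((%w. (x w, y w)) ---> (x 0, y 0)) (at 0)" using cx cy by (intro tendsto_Pair) (auto simp: continuous_at isCont_def)
  then show ?thesis using False tendsto_imp_eventually_ne by blast
 qed
 then have "eventually (%w. \<forall>b\<in>B. (x w, y w) ~= b) (at 0)" using B by (simp add: eventually_ball_finite_distrib)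
 moreover have "eventually (%w. y 0 = 0 --> dcubic t (x w) ~= 0) (at 0)"
  using dne dcont tendsto_imp_eventually_ne[of "%w. dcubic t (x w)"]
  by (cases "y 0 = 0") (auto simp: continuous_at isCont_def elim!: eventually_mono)
 ultimately have "eventually (%w. y w ~= 0 & (x w, y w) \<notin> B & (y 0 = 0 --> dcubic t (x w) ~= 0)) (at 0)"
  by eventually_elim auto
 then obtain r0 where r0: "r0 > 0" "!!w. w \<in> ball 0 r0 - {0} ==>
   y w ~= 0 & (x w, y w) \<notin> B & (y 0 = 0 --> dcubic t (x w) ~= 0)" unfolding eventually_at by (auto simp: dist_commute)
 define r' where "r' = min r r0"
 have r': "0 < r'" "r' \<le> r" "r' \<le> r0" using r r0(1) by (auto simp: r'_def)
 have holx: "x holomorphic_on ball 0 r'" and holy: "y holomorphic_on ball 0 r'"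
  using x y r' by (auto intro: holomorphic_on_subset)
 then have holdx: "deriv x holomorphic_on ball 0 r'" and holdy: "deriv y holomorphic_on ball 0 r'"
  by (auto intro: holomorphic_deriv)
 have P: "y w ~= 0 & (x w, y w) \<notin> B" if "w \<in> ball 0 r' - {0}" for w using r0(2)[of w] that r' by auto
 show thesis
 proof (cases "y 0 = 0")
  case True
  have dz: "dcubic t (x w) ~= 0" if "w \<in> ball 0 r'" for w using r0(2)[of w] that r' dne True by (cases "w = 0") auto
  have "(%w. 2 * deriv y w / dcubic t (x w)) holomorphic_on ball 0 r'"
   using dz unfolding dcubic_def by (intro holomorphic_intros holx holdy) auto
  moreover have "deriv x w = 2 * deriv y w / dcubic t (x w) * y w" if "w \<in> ball 0 r'" for w
   using rel[of w] dz[OF that] that r' by (simp add: field_simps)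
  ultimately show thesis using that r' P by blast
 next
  case False
  then have yz: "y w ~= 0" if "w \<in> ball 0 r'" for w using P[of w] that by (cases "w = 0") auto
  then have "(%w. deriv x w / y w) holomorphic_on ball 0 r'" by (intro holomorphic_intros holy holdx) auto
  then show thesis using that[of r' "%w. deriv x w / y w"] r' P yz by auto
 qed
qed

text \<open>The integral of a derivative over a small circle vanishes.\<close>

lemma residue_primitive:
 assumes "r > 0" "F holomorphic_on ball 0 r - {0}" "!!w. w \<in> ball 0 r - {0} ==> f w = deriv F w"
 shows "residue f 0 = 0"
proof -
 have op: "open (ball (0::complex) r - {0})" by (simp add: open_delete)
 have der: "(F has_field_derivative f w) (at w)" if "w \<in> ball 0 r - {0}" for w
  using holomorphic_derivI[OF assms(2) op that] assms(3)[OF that] by simp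
 have "f holomorphic_on ball 0 r - {0}" using holomorphic_deriv[OF assms(2) op] assms(3) holomorphic_transform by metis
 then have "(f has_contour_integral 2 * pi * \<i> * residue f 0) (circlepath 0 (r/2))"
  by (intro base_residue[of "ball 0 r"]) (use assms(1) in auto)
 moreover have "(f has_contour_integral 0) (circlepath 0 (r/2))"
 proof (rule Cauchy_theorem_primitive)
  show "(F has_field_derivative f w) (at w within (ball 0 r - {0}))" if "w \<in> ball 0 r - {0}" for w
   using der[OF that] by (rule has_field_derivative_at_within)
 qed (use assms(1) in auto)
 ultimately show ?thesis using has_contour_integral_unique by fastforce
qed

section \<open>Relative de Rham cohomology as a module\<close>

text \<open>A residue depends on the punctured germ only. One may therefore pass to a disc where
  dx/y = \<open>k\<close> dw with holomorphic \<open>k\<close> and where at most the centre lies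
  outside \<open>U\<close>.\<close>

lemma no_residue_atI:
 assumes t: "t \<in> TT" and U: "finite (XX t - U)"
  and res: "!!r x y k. r > 0 ==> x holomorphic_on ball 0 r ==> y holomorphic_on ball 0 r ==>
   k holomorphic_on ball 0 r ==> (x 0, y 0) = q ==> (deriv x 0, deriv y 0) ~= (0, 0) ==>
   (!!w. w \<in> ball 0 r ==> (x w, y w) \<in> affine_curve t) ==>
   (!!w. w \<in> ball 0 r ==> deriv x w = k w * y w) ==>
   (!!w. w \<in> ball 0 r - {0} ==> y w ~= 0 & Some (x w, y w) \<in> U) ==>
   residue (%w. g (Some (x w, y w)) * k w) 0 = 0"
 shows "no_residue_at t g q" unfolding no_residue_at_def
proof (intro allI impI, elim conjE)
 fix r x y
 assume r: "(0::real) < r" and x: "x holomorphic_on ball 0 r" and y: "y holomorphic_on ball 0 r"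
  and c: "\<forall>w\<in>ball 0 r. (x w, y w) \<in> affine_curve t" and q: "(x 0, y 0) = q"
  and d: "(deriv x 0, deriv y 0) ~= (0, 0)"
 have B: "finite {q. Some q \<in> XX t - U}" using finite_vimageI[OF U, of Some] by (simp add: vimage_def)
 obtain r' k where r': "0 < r'" "r' \<le> r" and k: "k holomorphic_on ball 0 r'"
  "!!w. w \<in> ball 0 r' ==> deriv x w = k w * y w"
  "!!w. w \<in> ball 0 r' - {0} ==> y w ~= 0 & (x w, y w) \<notin> {q. Some q \<in> XX t - U}"
  using germ_invariant_differential[OF t r x y c[rule_format] d B] by blast
 have sub: "ball 0 r' <= ball (0::complex) r" using r' by auto
 have U': "Some (x w, y w) \<in> U" if "w \<in> ball 0 r' - {0}" for w using k(3)[OF that] c that sub by (auto simp: XX_def)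
 have "residue (%w. g (Some (x w, y w)) * k w) 0 = 0" by (rule res[of r' x y k])
   (use r' k U' q c d sub x y in "auto intro: holomorphic_on_subset")
 also have "residue (%w. g (Some (x w, y w)) * k w) 0 = residue (%w. g (Some (x w, y w)) * deriv x w / y w) 0"
 proof (rule residue_cong)
  have "eventually (%w. w \<in> ball 0 r' - {0}) (at (0::complex))" using r'(1) by (intro eventually_at_in_open) auto
  then show "eventually (%w. g (Some (x w, y w)) * k w = g (Some (x w, y w)) * deriv x w / y w) (at 0)"
   by eventually_elim (use k in auto)
 qed auto
 finally show "residue (%w. g (Some (x w, y w)) * deriv x w / y w) 0 = 0" .
qed

lemma no_residue_atD:
 assumes "no_residue_at t g q" and t: "t \<in> TT" and r: "r > 0"
  and x: "x holomorphic_on ball 0 r" and y: "y holomorphic_on ball 0 r"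
  and c: "!!w. w \<in> ball 0 r ==> (x w, y w) \<in> affine_curve t" and q: "(x 0, y 0) = q"
  and d: "(deriv x 0, deriv y 0) ~= (0, 0)" and k: "!!w. w \<in> ball 0 r ==> deriv x w = k w * y w"
  and yz: "!!w. w \<in> ball 0 r - {0} ==> y w ~= 0"
 shows "residue (%w. g (Some (x w, y w)) * k w) 0 = 0"
proof -
 have "residue (%w. g (Some (x w, y w)) * k w) 0 = residue (%w. g (Some (x w, y w)) * deriv x w / y w) 0"
 proof (rule residue_cong)
  have "eventually (%w. w \<in> ball 0 r - {0}) (at (0::complex))" using r(1) by (intro eventually_at_in_open) auto
  then show "eventually (%w. g (Some (x w, y w)) * k w = g (Some (x w, y w)) * deriv x w / y w) (at 0)"
   by eventually_elim (use k yz in auto)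
 qed auto
 also have "\<dots> = 0" using assms(1)[unfolded no_residue_at_def, rule_format, of r x y] r x y c q d by blast
 finally show ?thesis .
qed

lemma formsD:
 assumes "(U, g) \<in> forms t"
 shows "affine_open t U" "YY t <= U" "regular_on U g" "finite (XX t - U)" "U <= XX t"
 using assms by (auto simp: forms_def affine_open_def)

lemma affine_open_Int: "affine_open t U ==> affine_open t U' ==> affine_open t (U \<inter> U')"
 unfolding affine_open_def by (auto simp: Diff_Int)

text \<open>At points of \<open>U\<close> the form is holomorphic. So residues vanish at all finite
  points, which is what sums of forms living on different \<open>U\<close> require.\<close>

lemma forms_no_residue:
 assumes t: "t \<in> TT" and f: "(U, g) \<in> forms t" and q: "Some q \<in> XX t"
 shows "no_residue_at t g q"
proof (cases "Some q \<in> U")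
 case True
 show ?thesis
 proof (rule no_residue_atI[OF t formsD(4)[OF f]])
  fix r x y k
  assume *: "(0::real) < r" "x holomorphic_on ball 0 r" "y holomorphic_on ball 0 r"
   "k holomorphic_on ball 0 r" "(x 0, y 0) = q"
   "!!w. w \<in> ball 0 r - {0} ==> y w ~= 0 & Some (x w, y w) \<in> U"
  have "Some (x w, y w) \<in> U" if "w \<in> ball 0 r" for w using *(5,6) True that by (cases "w = 0") auto
  then have "(%w. g (Some (x w, y w))) holomorphic_on ball 0 r" by (intro regular_on_holomorphic[OF formsD(3)[OF f]] *) auto
  then have "(%w. g (Some (x w, y w)) * k w) holomorphic_on ball 0 r" using * by (intro holomorphic_intros)
  then show "residue (%w. g (Some (x w, y w)) * k w) 0 = 0" using *(1) by (intro residue_holo[of "ball 0 r"]) auto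
 qed
next
 case False
 then show ?thesis using f q unfolding forms_def by blast
qed

lemma forms_punctured_holomorphic:
 assumes f: "(U, g) \<in> forms t" and x: "x holomorphic_on ball 0 r" and y: "y holomorphic_on ball 0 r"
  and k: "k holomorphic_on ball 0 r" and U: "!!w. w \<in> ball 0 r - {0} ==> Some (x w, y w) \<in> U"
 shows "(%w. g (Some (x w, y w)) * k w) holomorphic_on ball 0 r - {0}"
proof -
 have "(%w. g (Some (x w, y w))) holomorphic_on ball 0 r - {0}" by (rule regular_on_holomorphic[OF formsD(3)[OF f]])
   (use U x y in "auto intro: holomorphic_on_subset open_delete")
 then show ?thesis using k by (intro holomorphic_intros) (auto intro: holomorphic_on_subset)
qed

lemma forms_add:
 assumes t: "t \<in> TT" and f: "(U, g) \<in> forms t" and f': "(U', g') \<in> forms t"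
 shows "(U \<inter> U', %p. g p + g' p) \<in> forms t"
proof -
 have fin: "finite (XX t - U \<inter> U')" using formsD(4)[OF f] formsD(4)[OF f'] by (simp add: Diff_Int)
 have "no_residue_at t (%p. g p + g' p) q" if q: "Some q \<in> XX t" for q
 proof (rule no_residue_atI[OF t fin])
  fix r x y k
  assume *: "(0::real) < r" "x holomorphic_on ball 0 r" "y holomorphic_on ball 0 r"
   "k holomorphic_on ball 0 r" "(x 0, y 0) = q" "(deriv x 0, deriv y 0) ~= (0, 0)"
   "!!w. w \<in> ball 0 r ==> (x w, y w) \<in> affine_curve t"
   "!!w. w \<in> ball 0 r ==> deriv x w = k w * y w"
   "!!w. w \<in> ball 0 r - {0} ==> y w ~= 0 & Some (x w, y w) \<in> U \<inter> U'"
  have "residue (%w. g (Some (x w, y w)) * k w) 0 = 0"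
   by (rule no_residue_atD[OF forms_no_residue[OF t f q] t *(1-3) *(7,5,6,8)]) (use * in auto)
  moreover have "residue (%w. g' (Some (x w, y w)) * k w) 0 = 0"
   by (rule no_residue_atD[OF forms_no_residue[OF t f' q] t *(1-3) *(7,5,6,8)]) (use * in auto)
  moreover have "residue (%w. g (Some (x w, y w)) * k w + g' (Some (x w, y w)) * k w) 0 =
    residue (%w. g (Some (x w, y w)) * k w) 0 + residue (%w. g' (Some (x w, y w)) * k w) 0" by (rule residue_add[of "ball 0 r"])
    (use * in "blast intro: forms_punctured_holomorphic[OF f] forms_punctured_holomorphic[OF f'] open_ball centre_in_ball[THEN iffD2]")+
  ultimately show "residue (%w. (g (Some (x w, y w)) + g' (Some (x w, y w))) * k w) 0 = 0" by (simp add: distrib_right)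
 qed
 then show ?thesis using f f' by (auto simp: forms_def intro!: affine_open_Int regular_on_add intro: regular_on_subset)
qed

lemma forms_cmult:
 assumes t: "t \<in> TT" and f: "(U, g) \<in> forms t"
 shows "(U, %p. z * g p) \<in> forms t"
proof -
 have "no_residue_at t (%p. z * g p) q" if q: "Some q \<in> XX t" for q
 proof (rule no_residue_atI[OF t formsD(4)[OF f]])
  fix r x y k
  assume *: "(0::real) < r" "x holomorphic_on ball 0 r" "y holomorphic_on ball 0 r"
   "k holomorphic_on ball 0 r" "(x 0, y 0) = q" "(deriv x 0, deriv y 0) ~= (0, 0)"
   "!!w. w \<in> ball 0 r ==> (x w, y w) \<in> affine_curve t"
   "!!w. w \<in> ball 0 r ==> deriv x w = k w * y w"
   "!!w. w \<in> ball 0 r - {0} ==> y w ~= 0 & Some (x w, y w) \<in> U"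
  have "residue (%w. g (Some (x w, y w)) * k w) 0 = 0"
   by (rule no_residue_atD[OF forms_no_residue[OF t f q] t *(1-3) *(7,5,6,8)]) (use * in auto)
  moreover have "residue (%w. z * (g (Some (x w, y w)) * k w)) 0 = z * residue (%w. g (Some (x w, y w)) * k w) 0"
   by (rule residue_lmul[of "ball 0 r"])
    (use * in "blast intro: forms_punctured_holomorphic[OF f] open_ball centre_in_ball[THEN iffD2]")+
  ultimately show "residue (%w. z * g (Some (x w, y w)) * k w) 0 = 0" by (simp add: mult.assoc)
 qed
 then show ?thesis using f by (auto simp: forms_def intro!: regular_on_cmult)
qed

lemma forms_cong:
 assumes t: "t \<in> TT" and f: "(U, g) \<in> forms t" and eq: "!!p. p \<in> U ==> g p = g' p"
 shows "(U, g') \<in> forms t"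
proof -
 have "no_residue_at t g' q" if q: "Some q \<in> XX t" for q
 proof (rule no_residue_atI[OF t formsD(4)[OF f]])
  fix r x y k
  assume *: "(0::real) < r" "x holomorphic_on ball 0 r" "y holomorphic_on ball 0 r"
   "k holomorphic_on ball 0 r" "(x 0, y 0) = q" "(deriv x 0, deriv y 0) ~= (0, 0)"
   "!!w. w \<in> ball 0 r ==> (x w, y w) \<in> affine_curve t"
   "!!w. w \<in> ball 0 r ==> deriv x w = k w * y w"
   "!!w. w \<in> ball 0 r - {0} ==> y w ~= 0 & Some (x w, y w) \<in> U"
  have "residue (%w. g (Some (x w, y w)) * k w) 0 = 0"
   by (rule no_residue_atD[OF forms_no_residue[OF t f q] t *(1-3) *(7,5,6,8)]) (use * in auto)
  also have "residue (%w. g (Some (x w, y w)) * k w) 0 = residue (%w. g' (Some (x w, y w)) * k w) 0"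
  proof (rule residue_cong)
   have "eventually (%w. w \<in> ball 0 r - {0}) (at (0::complex))" using *(1) by (intro eventually_at_in_open) auto
   then show "eventually (%w. g (Some (x w, y w)) * k w = g' (Some (x w, y w)) * k w) (at 0)"
    by eventually_elim (use *(9) eq in auto)
  qed auto
  finally show "residue (%w. g' (Some (x w, y w)) * k w) 0 = 0" .
 qed
 then show ?thesis using f eq by (auto simp: forms_def intro: regular_on_cong)
qed

section \<open>Exact forms and the relation between forms\<close>

lemma is_differentialD:
 assumes "is_differential U f h" "open S" "x holomorphic_on S" "y holomorphic_on S"
  "!!w. w \<in> S ==> Some (x w, y w) \<in> U" "w \<in> S"
 shows "deriv (%w. f (Some (x w, y w))) w * y w = h (Some (x w, y w)) * deriv x w"
 using assms(1)[unfolded is_differential_def, THEN spec, THEN spec, THEN spec, of S x y] assms(2-) by simp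

lemma is_differential_subset: "is_differential U f h ==> W <= U ==> is_differential W f h" unfolding is_differential_def by blast

lemma is_differential_cong:
 assumes "is_differential U f h" "!!p. p \<in> U ==> h p = h' p"
 shows "is_differential U f h'" using assms(1) unfolding is_differential_def by (simp add: assms(2)[symmetric])

lemma is_differential_const: "is_differential U (%_. c) (%_. 0)" by (simp add: is_differential_def)

lemma is_differential_add:
 assumes "regular_on U f" "is_differential U f h" "regular_on U f'" "is_differential U f' h'"
 shows "is_differential U (%p. f p + f' p) (%p. h p + h' p)" unfolding is_differential_def
proof (intro allI impI ballI, elim conjE)
 fix S x y w
 assume S: "open S" "x holomorphic_on S" "y holomorphic_on S" "\<forall>w\<in>S. Some (x w, y w) \<in> U" and w: "w \<in> S"
 have "(%w. f (Some (x w, y w))) field_differentiable at w"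
  "(%w. f' (Some (x w, y w))) field_differentiable at w"
  using regular_on_holomorphic[OF assms(1) S(1-3)] regular_on_holomorphic[OF assms(3) S(1-3)] S w
  by (simp_all add: holomorphic_on_open field_differentiable_def)
 then have "deriv (%w. f (Some (x w, y w)) + f' (Some (x w, y w))) w =
   deriv (%w. f (Some (x w, y w))) w + deriv (%w. f' (Some (x w, y w))) w" by simp
 moreover have "deriv (%w. f (Some (x w, y w))) w * y w = h (Some (x w, y w)) * deriv x w"
  "deriv (%w. f' (Some (x w, y w))) w * y w = h' (Some (x w, y w)) * deriv x w"
  by (rule is_differentialD[OF _ S(1-3) _ w], use assms S in auto)+
 ultimately show "deriv (%w. f (Some (x w, y w)) + f' (Some (x w, y w))) w * y w =
   (h (Some (x w, y w)) + h' (Some (x w, y w))) * deriv x w" by (simp add: distrib_right)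
qed

lemma is_differential_cmult:
 assumes "regular_on U f" "is_differential U f h"
 shows "is_differential U (%p. z * f p) (%p. z * h p)" unfolding is_differential_def
proof (intro allI impI ballI, elim conjE)
 fix S x y w
 assume S: "open S" "x holomorphic_on S" "y holomorphic_on S" "\<forall>w\<in>S. Some (x w, y w) \<in> U" and w: "w \<in> S"
 have "(%w. f (Some (x w, y w))) field_differentiable at w" using regular_on_holomorphic[OF assms(1) S(1-3)] S w
  by (simp add: holomorphic_on_open field_differentiable_def)
 then have "deriv (%w. z * f (Some (x w, y w))) w = z * deriv (%w. f (Some (x w, y w))) w" by (rule deriv_cmult)
 moreover have "deriv (%w. f (Some (x w, y w))) w * y w = h (Some (x w, y w)) * deriv x w"
  by (rule is_differentialD[OF assms(2) S(1-3) _ w]) (use S in auto)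
 ultimately show "deriv (%w. z * f (Some (x w, y w))) w * y w = z * h (Some (x w, y w)) * deriv x w" by (simp add: mult.assoc)
qed

lemma dR_relI:
 assumes "(U, g) \<in> forms t" "(U', g') \<in> forms t" "affine_open t W" "YY t <= W" "W <= U \<inter> U'"
  "regular_on W f" "!!p. p \<in> YY t ==> f p = 0" "is_differential W f (%p. g p - g' p)"
 shows "((U, g), (U', g')) \<in> dR_rel t" using assms unfolding dR_rel_def by blast

lemma dR_relE:
 assumes "((U, g), (U', g')) \<in> dR_rel t"
 obtains W f where "(U, g) \<in> forms t" "(U', g') \<in> forms t" "affine_open t W" "YY t <= W" "W <= U \<inter> U'"
  "regular_on W f" "!!p. p \<in> YY t ==> f p = 0" "is_differential W f (%p. g p - g' p)"
 using assms unfolding dR_rel_def by blast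

lemma dR_rel_cong:
 assumes t: "t \<in> TT" and f: "(U, g) \<in> forms t" and f': "(U', g') \<in> forms t"
  and eq: "!!p. p \<in> U ==> p \<in> U' ==> g p = g' p"
 shows "((U, g), (U', g')) \<in> dR_rel t" by (rule dR_relI[OF f f', where W = "U \<inter> U'" and f = "%_. 0"])
  (use formsD[OF f] formsD[OF f'] eq in
   \<open>auto intro: affine_open_Int regular_on_const is_differential_cong[OF is_differential_const]\<close>)

lemma dR_rel_combine:
 assumes t: "t \<in> TT" and 1: "((U1, g1), (U1', g1')) \<in> dR_rel t" and 2: "((U2, g2), (U2', g2')) \<in> dR_rel t"
 shows "((U1 \<inter> U2, %p. g1 p + g2 p), (U1' \<inter> U2', %p. g1' p + g2' p)) \<in> dR_rel t"
proof -
 obtain W1 f1 where W1: "(U1, g1) \<in> forms t" "(U1', g1') \<in> forms t" "affine_open t W1" "YY t <= W1"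
  "W1 <= U1 \<inter> U1'" "regular_on W1 f1" "!!p. p \<in> YY t ==> f1 p = 0"
  "is_differential W1 f1 (%p. g1 p - g1' p)" by (rule dR_relE[OF 1]) blast
 obtain W2 f2 where W2: "(U2, g2) \<in> forms t" "(U2', g2') \<in> forms t" "affine_open t W2" "YY t <= W2"
  "W2 <= U2 \<inter> U2'" "regular_on W2 f2" "!!p. p \<in> YY t ==> f2 p = 0"
  "is_differential W2 f2 (%p. g2 p - g2' p)" by (rule dR_relE[OF 2]) blast
 have reg: "regular_on (W1 \<inter> W2) f1" "regular_on (W1 \<inter> W2) f2" using W1 W2 by (auto intro: regular_on_subset)
 have "is_differential (W1 \<inter> W2) (%p. f1 p + f2 p) (%p. (g1 p - g1' p) + (g2 p - g2' p))"
  by (intro is_differential_add reg) (use W1 W2 in "auto intro: is_differential_subset")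
 then have diff: "is_differential (W1 \<inter> W2) (%p. f1 p + f2 p) (%p. (g1 p + g2 p) - (g1' p + g2' p))"
  by (rule is_differential_cong) simp
 show ?thesis by (rule dR_relI[OF forms_add[OF t W1(1) W2(1)] forms_add[OF t W1(2) W2(2)]
     affine_open_Int[OF W1(3) W2(3)] _ _ regular_on_add[OF reg] _ diff])
   (use W1(4,5,7) W2(4,5,7) in auto)
qed

lemma dR_rel_cmult:
 assumes t: "t \<in> TT" and 1: "((U1, g1), (U1', g1')) \<in> dR_rel t"
 shows "((U1, %p. z * g1 p), (U1', %p. z * g1' p)) \<in> dR_rel t"
proof -
 obtain W1 f1 where W1: "(U1, g1) \<in> forms t" "(U1', g1') \<in> forms t" "affine_open t W1" "YY t <= W1"
  "W1 <= U1 \<inter> U1'" "regular_on W1 f1" "!!p. p \<in> YY t ==> f1 p = 0"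
  "is_differential W1 f1 (%p. g1 p - g1' p)" by (rule dR_relE[OF 1]) blast
 have diff: "is_differential W1 (%p. z * f1 p) (%p. z * g1 p - z * g1' p)"
  using is_differential_cmult[OF W1(6,8), of z] by (rule is_differential_cong) (simp add: right_diff_distrib)
 show ?thesis by (rule dR_relI[OF forms_cmult[OF t W1(1)] forms_cmult[OF t W1(2)] W1(3-5)
     regular_on_cmult[OF W1(6)] _ diff])
   (use W1(7) in auto)
qed

lemma dR_rel_sym:
 assumes 1: "((U, g), (U', g')) \<in> dR_rel t"
 shows "((U', g'), (U, g)) \<in> dR_rel t"
proof -
 obtain W f where W: "(U, g) \<in> forms t" "(U', g') \<in> forms t" "affine_open t W" "YY t <= W"
  "W <= U \<inter> U'" "regular_on W f" "!!p. p \<in> YY t ==> f p = 0" "is_differential W f (%p. g p - g' p)"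
  by (rule dR_relE[OF 1]) blast
 have diff: "is_differential W (%p. - 1 * f p) (%p. g' p - g p)"
  using is_differential_cmult[OF W(6,8), of "-1"] by (rule is_differential_cong) simp
 show ?thesis by (rule dR_relI[OF W(2,1,3,4) _ regular_on_cmult[OF W(6)] _ diff]) (use W(5,7) in auto)
qed

lemma dR_rel_trans:
 assumes 1: "((U, g), (U', g')) \<in> dR_rel t" and 2: "((U', g'), (U'', g'')) \<in> dR_rel t"
 shows "((U, g), (U'', g'')) \<in> dR_rel t"
proof -
 obtain W f where W: "(U, g) \<in> forms t" "(U', g') \<in> forms t" "affine_open t W" "YY t <= W"
  "W <= U \<inter> U'" "regular_on W f" "!!p. p \<in> YY t ==> f p = 0" "is_differential W f (%p. g p - g' p)"
  by (rule dR_relE[OF 1]) blast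
 obtain W' f' where W': "(U', g') \<in> forms t" "(U'', g'') \<in> forms t" "affine_open t W'" "YY t <= W'"
  "W' <= U' \<inter> U''" "regular_on W' f'" "!!p. p \<in> YY t ==> f' p = 0" "is_differential W' f' (%p. g' p - g'' p)"
  by (rule dR_relE[OF 2]) blast
 have reg: "regular_on (W \<inter> W') f" "regular_on (W \<inter> W') f'" using W W' by (auto intro: regular_on_subset)
 have "is_differential (W \<inter> W') (%p. f p + f' p) (%p. (g p - g' p) + (g' p - g'' p))"
  by (intro is_differential_add reg) (use W W' in "auto intro: is_differential_subset")
 then have diff: "is_differential (W \<inter> W') (%p. f p + f' p) (%p. g p - g'' p)" by (rule is_differential_cong) simp
 show ?thesis by (rule dR_relI[OF W(1) W'(2) affine_open_Int[OF W(3) W'(3)] _ _ regular_on_add[OF reg] _ diff])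
   (use W(4,5,7) W'(4,5,7) in auto)
qed

lemma equiv_dR_rel:
 assumes t: "t \<in> TT"
 shows "equiv (forms t) (dR_rel t)"
proof (rule equivI)
 show "dR_rel t <= forms t \<times> forms t" unfolding dR_rel_def by blast
 show "refl_on (forms t) (dR_rel t)"
 proof (rule refl_onI)
  fix p assume "p \<in> forms t"
  then show "(p, p) \<in> dR_rel t" using dR_rel_cong[OF t, of "fst p" "snd p" "fst p" "snd p"] by simp
 qed
 show "sym (dR_rel t)"
 proof (rule symI)
  fix p q assume "(p, q) \<in> dR_rel t"
  then show "(q, p) \<in> dR_rel t" using dR_rel_sym[of "fst p" "snd p" "fst q" "snd q"] by simp
 qed
 show "trans (dR_rel t)"
 proof (rule transI)
  fix p q r assume "(p, q) \<in> dR_rel t" "(q, r) \<in> dR_rel t"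
  then show "(p, r) \<in> dR_rel t" using dR_rel_trans[of "fst p" "snd p" "fst q" "snd q" t "fst r" "snd r"] by simp
 qed
qed

abbreviation dR_class :: "param => point set => (point => complex) => dR_class" where
 "dR_class t U g \<equiv> dR_rel t `` {(U, g)}"

section \<open>Operations on classes are independent of representatives\<close>

lemma dR_class_eqI:
 "t \<in> TT ==> ((U, g), (U', g')) \<in> dR_rel t ==> dR_class t U g = dR_class t U' g'"
 using equiv_class_eq[OF equiv_dR_rel] by blast

lemma H1dR_add:
 assumes t: "t \<in> TT" and f: "(U, g) \<in> forms t" "(U', g') \<in> forms t"
 shows "dR_class t U g \<oplus>\<^bsub>H1dR t\<^esub> dR_class t U' g' = dR_class t (U \<inter> U') (%p. g p + g' p)"
proof -
 let ?F = "%q q'. dR_class t (fst q \<inter> fst q') (%p. snd q p + snd q' p)"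
 have "congruent2 (dR_rel t) (dR_rel t) ?F" by (rule congruent2I') (auto intro!: dR_class_eqI[OF t] dR_rel_combine[OF t])
 from UN_equiv_class2[OF equiv_dR_rel[OF t] equiv_dR_rel[OF t] this f]
 show ?thesis by (simp add: H1dR_def split_def)
qed

lemma H1dR_smult:
 assumes t: "t \<in> TT" and f: "(U, g) \<in> forms t"
 shows "z \<odot>\<^bsub>H1dR t\<^esub> dR_class t U g = dR_class t U (%p. z * g p)"
proof -
 let ?F = "%q. dR_class t (fst q) (%p. z * snd q p)"
 have "?F respects (dR_rel t)" by (auto simp: congruent_def intro!: dR_class_eqI[OF t] dR_rel_cmult[OF t])
 from UN_equiv_class[OF equiv_dR_rel[OF t] this f]
 show ?thesis by (simp add: H1dR_def split_def)
qed

lemma H1dR_carrier: "carrier (H1dR t) = forms t // dR_rel t" by (simp add: H1dR_def)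

text \<open>The zero forms on all admissible open sets are related by restriction, so the union
  defining the zero is a single class.\<close>

lemma H1dR_zero:
 assumes t: "t \<in> TT" and f: "(U, %p. 0) \<in> forms t"
 shows "\<zero>\<^bsub>H1dR t\<^esub> = dR_class t U (%p. 0)"
proof -
 have eq: "dR_class t U' (%p. 0) = dR_class t U (%p. 0)" if "(U', %p. 0) \<in> forms t" for U'
  by (rule dR_class_eqI[OF t dR_rel_cong[OF t that f]]) (rule refl)
 have "(\<Union>U \<in> {U. (U, %p. 0) \<in> forms t}. dR_class t U (%p. 0)) = dR_class t U (%p. 0)"
 proof (rule UN_constant_eq[where a = U])
  show "\<forall>U'\<in>{U. (U, %p. 0) \<in> forms t}. dR_class t U' (%p. 0) = dR_class t U (%p. 0)"
   by (intro ballI eq) (drule CollectD)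
 qed (rule CollectI, rule f)
 then show ?thesis unfolding H1dR_def ring.simps .
qed

lemma H1dR_cases:
 assumes "C \<in> carrier (H1dR t)"
 obtains U g where "(U, g) \<in> forms t" "C = dR_class t U g" using assms unfolding H1dR_carrier by (auto elim!: quotientE)

lemma dR_class_closed: "(U, g) \<in> forms t ==> dR_class t U g \<in> carrier (H1dR t)" unfolding H1dR_carrier by (rule quotientI)

text \<open>This structure is what \<open>finsum\<close> needs. The given form supplies an
  admissible open set on which a zero form lives.\<close>

lemma abelian_monoid_H1dR:
 assumes t: "t \<in> TT" and ne: "(U0, g0) \<in> forms t"
 shows "abelian_monoid (H1dR t)"
proof -
 have f0: "(U0, %p. 0) \<in> forms t" using forms_cmult[OF t ne, of 0] by simp
 note zero = H1dR_zero[OF t f0]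
 show ?thesis
 proof (rule abelian_monoidI)
  fix C D E assume "C \<in> carrier (H1dR t)" "D \<in> carrier (H1dR t)" "E \<in> carrier (H1dR t)"
  then obtain U g V h W k where fs: "(U, g) \<in> forms t" "(V, h) \<in> forms t" "(W, k) \<in> forms t"
   and CDE: "C = dR_class t U g" "D = dR_class t V h" "E = dR_class t W k" by (elim H1dR_cases) blast
  show "C \<oplus>\<^bsub>H1dR t\<^esub> D \<oplus>\<^bsub>H1dR t\<^esub> E = C \<oplus>\<^bsub>H1dR t\<^esub> (D \<oplus>\<^bsub>H1dR t\<^esub> E)"
   by (simp add: CDE H1dR_add[OF t] fs forms_add[OF t] Int_assoc add.assoc)
 next
  fix C D assume "C \<in> carrier (H1dR t)" "D \<in> carrier (H1dR t)"
  then obtain U g V h where fs: "(U, g) \<in> forms t" "(V, h) \<in> forms t" and CD: "C = dR_class t U g" "D = dR_class t V h"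
   by (elim H1dR_cases) blast
  show "C \<oplus>\<^bsub>H1dR t\<^esub> D \<in> carrier (H1dR t)"
   by (simp add: CD H1dR_add[OF t] fs dR_class_closed forms_add[OF t])
  show "C \<oplus>\<^bsub>H1dR t\<^esub> D = D \<oplus>\<^bsub>H1dR t\<^esub> C"
   by (simp add: CD H1dR_add[OF t] fs Int_commute add.commute)
 next
  fix C assume "C \<in> carrier (H1dR t)"
  then obtain U g where fs: "(U, g) \<in> forms t" and C: "C = dR_class t U g" by (elim H1dR_cases) blast
  \<comment> \<open>Restricting a form to a smaller open set does not change its class.\<close>
  have "dR_class t (U0 \<inter> U) g = dR_class t U g"
  proof (rule dR_class_eqI[OF t dR_rel_cong[OF t _ fs]])
   show "(U0 \<inter> U, g) \<in> forms t" using forms_add[OF t f0 fs] by simp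
  qed (rule refl)
  then show "\<zero>\<^bsub>H1dR t\<^esub> \<oplus>\<^bsub>H1dR t\<^esub> C = C" by (simp add: zero C H1dR_add[OF t] fs f0)
 next
  show "\<zero>\<^bsub>H1dR t\<^esub> \<in> carrier (H1dR t)" by (simp add: zero dR_class_closed f0)
 qed
qed

section \<open>Explicit representatives of the frame\<close>

text \<open>Coefficient of d((x-a)/(x-e)) with respect to dx/y. Here and in the next definitions the
  value at \<open>None\<close> is the limit at O.\<close>

definition gfun :: "complex => param => point => complex" where
 "gfun e t p = (case p of None => 0 | Some (x, y) => (t $ 1 - e) * y / (x - e)^2)"

text \<open>Coefficient of x dx/y - d(y/(2(x-e))), with y^2 eliminated by the equation of the curve.
  The coefficients 2e and 2 of x^2 in numerator and denominator give the value e at O.\<close>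

definition hfun :: "complex => param => point => complex" where
 "hfun e t p = (case p of None => e | Some (x, y) =>
   (2 * e * x^2 + (2 * e^2 - t $ 5 / 2) * x - (e * t $ 5 / 2 + t3 t)) / (2 * (x - e)^2))"

definition ffun :: "complex => param => point => complex" where
 "ffun e t p = (case p of None => 1 | Some (x, y) => (x - t $ 1) / (x - e))"

text \<open>This is y/(2(x-e)) - y/(2(x-e')). Each term has a simple pole at O, which cancels in the
  difference.\<close>

definition sdiff :: "complex => complex => point => complex" where
 "sdiff e e' p = (case p of None => 0 | Some (x, y) => (e - e') * y / (2 * (x - e) * (x - e')))"

definition kap :: "complex => param => complex" where
 "kap e t = t $ 3 - t $ 2 / (2 * (t $ 1 - e))"

text \<open>Representative, with pole at x = \<open>e\<close>, of the class with coordinates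
  \<open>z\<close> in the frame.\<close>

definition rep :: "complex => param => complex ^ 3 => point => complex" where
 "rep e t z p = z $ 1 * gfun e t p + z $ 2 + z $ 3 * (kap e t * gfun e t p + t $ 4 + hfun e t p)"

lemma Some_in_XX: "Some (x, y) \<in> XX t \<longleftrightarrow> y^2 = cubic t x" by (auto simp: XX_def affine_curve_iff image_iff)

lemma Some_in_U_frame: "Some (x, y) \<in> U_frame e t \<longleftrightarrow> y^2 = cubic t x & x ~= e"
 by (auto simp: U_frame_def Some_in_XX)

lemma None_in_U_frame: "None \<in> U_frame e t" by (simp add: U_frame_def)

lemma U_frame_subset: "U_frame e t <= XX t" by (auto simp: U_frame_def XX_def)

lemma affine_open_U_frame: "affine_open t (U_frame e t)"
proof -
 define y0 where "y0 = csqrt (cubic t e)"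
 have y0: "y0^2 = cubic t e" by (simp add: y0_def)
 have "XX t - U_frame e t = {Some (e, y0), Some (e, - y0)}"
 proof (intro equalityI subsetI)
  fix p assume p: "p \<in> XX t - U_frame e t"
  then obtain x y where xy: "p = Some (x, y)" by (cases p) (auto simp: None_in_U_frame)
  then have "y^2 = y0^2" "x = e" using p by (auto simp: Some_in_U_frame Some_in_XX y0)
  then show "p \<in> {Some (e, y0), Some (e, - y0)}" using xy by (auto simp: power2_eq_iff)
 qed (auto simp: Some_in_U_frame Some_in_XX y0)
 then show ?thesis by (simp add: affine_open_def U_frame_subset)
qed

lemma point_on_curve: "(t $ 2)^2 = cubic t (t $ 1)" by (simp add: cubic_def t3_def)

lemma YY_subset_U_frame: "e ~= t $ 1 ==> YY t <= U_frame e t"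
 by (auto simp: YY_def None_in_U_frame Some_in_U_frame point_on_curve)

text \<open>With u = x/y and v = 1/y the unit M = 1 + t_2 u v + t_3 v^2 satisfies x = M/(4 u^2) and
  4 u^2 (x-e) = M - 4 e u^2. The last expression is 1 at O, so it can serve as denominator in the
  regularity proofs at O.\<close>

lemma chart_at_O:
 assumes "y^2 = cubic t x" "y ~= 0"
 shows "1 + t $ 5 * (x / y) * (1 / y) + t3 t * (1 / y)^2 = 4 * x^3 / y^2"
  and "1 + t $ 5 * (x / y) * (1 / y) + t3 t * (1 / y)^2 - 4 * e * (x / y)^2 = 4 * x^2 * (x - e) / y^2"
 using assms by (simp_all add: cubic_def field_simps pow_eqs)

lemma chart_fractions:
 fixes x y :: complex
 assumes "x ~= 0" "y ~= 0"
 shows "N / d = (4 * x^2 * N / y^2) / (4 * x^2 * d / y^2)"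
  and "N * y / d^2 = 4 * N * (x / y) * (4 * x^3 / y^2) / (4 * x^2 * d / y^2)^2"
  and "N * y / (2 * d * d') = 2 * N * (x / y) * (4 * x^3 / y^2) / ((4 * x^2 * d / y^2) * (4 * x^2 * d' / y^2))"
  and "N / (2 * d^2) = (16 * x^4 / y^4 * N) / (2 * (4 * x^2 * d / y^2)^2)"
 using assms by (simp_all add: divide_simps, simp_all add: pow_eqs power4_eq_xxxx)

lemma regular_gfun: "regular_on (U_frame e t) (gfun e t)" unfolding regular_on_def
proof
 fix p assume p: "p \<in> U_frame e t"
 show "regular_at (U_frame e t) (gfun e t) p"
 proof (cases p)
  case None
  show ?thesis unfolding None
  proof (rule regular_at_NoneI[where F = "%u v. 4 * (t $ 1 - e) * u * (1 + t $ 5 * u * v + t3 t * v^2)"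
     and G = "%u v. (1 + t $ 5 * u * v + t3 t * v^2 - 4 * e * u^2)^2"])
   fix x y assume *: "Some (x, y) \<in> U_frame e t" "y ~= 0"
    "(1 + t $ 5 * (x / y) * (1 / y) + t3 t * (1 / y)^2 - 4 * e * (x / y)^2)^2 ~= 0"
   then have c: "y^2 = cubic t x" by (simp add: Some_in_U_frame)
   have "x ~= 0" "x ~= e" using *(3) unfolding chart_at_O(2)[OF c *(2)] by auto
   then show "gfun e t (Some (x, y)) = 4 * (t $ 1 - e) * (x / y) * (1 + t $ 5 * (x / y) * (1 / y) + t3 t * (1 / y)^2)
     / (1 + t $ 5 * (x / y) * (1 / y) + t3 t * (1 / y)^2 - 4 * e * (x / y)^2)^2"
    unfolding chart_at_O(2)[OF c *(2)] unfolding chart_at_O(1)[OF c *(2)] gfun_def option.case prod.case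
    by (intro chart_fractions *(2))
  qed (intro pol_intros | simp add: gfun_def)+
 next
  case (Some q)
  obtain x y where q: "q = (x, y)" by (cases q)
  show ?thesis unfolding Some q by (rule regular_at_SomeI[where F = "%x y. (t $ 1 - e) * y" and G = "%x y. (x - e)^2"])
    (use p Some q in "auto intro!: pol_intros simp: gfun_def Some_in_U_frame")
 qed
qed

lemma regular_hfun: "regular_on (U_frame e t) (hfun e t)" unfolding regular_on_def
proof
 fix p assume p: "p \<in> U_frame e t"
 show "regular_at (U_frame e t) (hfun e t) p"
 proof (cases p)
  case None
  show ?thesis unfolding None
  proof (rule regular_at_NoneI[where F = "%u v. 2 * e * (1 + t $ 5 * u * v + t3 t * v^2)^2
      + (2 * e^2 - t $ 5 / 2) * 4 * u^2 * (1 + t $ 5 * u * v + t3 t * v^2)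
      - (e * t $ 5 / 2 + t3 t) * 16 * u^4" and G = "%u v. 2 * (1 + t $ 5 * u * v + t3 t * v^2 - 4 * e * u^2)^2"])
   fix x y assume *: "Some (x, y) \<in> U_frame e t" "y ~= 0"
    "2 * (1 + t $ 5 * (x / y) * (1 / y) + t3 t * (1 / y)^2 - 4 * e * (x / y)^2)^2 ~= 0"
   then have c: "y^2 = cubic t x" by (simp add: Some_in_U_frame)
   have x: "x ~= 0" "x ~= e" using *(3) unfolding chart_at_O(2)[OF c *(2)] by auto
   define N where "N = 2 * e * x^2 + (2 * e^2 - t $ 5 / 2) * x - (e * t $ 5 / 2 + t3 t)"
   have eqN: "2 * e * (4 * x^3 / y^2)^2 + (2 * e^2 - t $ 5 / 2) * 4 * (x / y)^2 * (4 * x^3 / y^2)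
      - (e * t $ 5 / 2 + t3 t) * 16 * (x / y)^4 = 16 * x^4 / y^4 * N"
   proof -
    define s where "s = 4 * x^2 / y^2"
    have 1: "4 * x^3 / y^2 = x * s" by (simp add: s_def pow_eqs)
    have 2: "A * 4 * (x / y)^2 = A * s" for A by (simp add: s_def power_divide)
    have 3: "A * 16 * (x / y)^4 = A * s^2" for A by (simp add: s_def power_divide power_mult_distrib flip: power_mult)
    have 4: "16 * x^4 / y^4 = s^2" by (simp add: s_def power_divide power_mult_distrib flip: power_mult)
    show ?thesis unfolding 1 2 3 4 N_def by (simp add: algebra_simps power2_eq_square)
   qed
   show "hfun e t (Some (x, y)) = (2 * e * (1 + t $ 5 * (x / y) * (1 / y) + t3 t * (1 / y)^2)^2
      + (2 * e^2 - t $ 5 / 2) * 4 * (x / y)^2 * (1 + t $ 5 * (x / y) * (1 / y) + t3 t * (1 / y)^2)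
      - (e * t $ 5 / 2 + t3 t) * 16 * (x / y)^4)
     / (2 * (1 + t $ 5 * (x / y) * (1 / y) + t3 t * (1 / y)^2 - 4 * e * (x / y)^2)^2)"
    unfolding chart_at_O(2)[OF c *(2)] unfolding chart_at_O(1)[OF c *(2)] hfun_def option.case prod.case eqN N_def[symmetric]
    by (rule chart_fractions(4)[OF x(1) *(2)])
  qed (intro pol_intros | simp add: hfun_def)+
 next
  case (Some q)
  obtain x y where q: "q = (x, y)" by (cases q)
  show ?thesis unfolding Some q
   by (rule regular_at_SomeI[where F = "%x y. 2 * e * x^2 + (2 * e^2 - t $ 5 / 2) * x - (e * t $ 5 / 2 + t3 t)"
      and G = "%x y. 2 * (x - e)^2"])
    (use p Some q in "auto intro!: pol_intros simp: hfun_def Some_in_U_frame")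
 qed
qed

lemma regular_ffun: "regular_on (U_frame e t) (ffun e t)" unfolding regular_on_def
proof
 fix p assume p: "p \<in> U_frame e t"
 show "regular_at (U_frame e t) (ffun e t) p"
 proof (cases p)
  case None
  show ?thesis unfolding None
  proof (rule regular_at_NoneI[where F = "%u v. 1 + t $ 5 * u * v + t3 t * v^2 - 4 * (t $ 1) * u^2"
     and G = "%u v. 1 + t $ 5 * u * v + t3 t * v^2 - 4 * e * u^2"])
   fix x y assume *: "Some (x, y) \<in> U_frame e t" "y ~= 0"
    "1 + t $ 5 * (x / y) * (1 / y) + t3 t * (1 / y)^2 - 4 * e * (x / y)^2 ~= 0"
   then have c: "y^2 = cubic t x" by (simp add: Some_in_U_frame)
   have "x ~= 0" "x ~= e" using *(3) unfolding chart_at_O(2)[OF c *(2)] by auto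
   then show "ffun e t (Some (x, y)) = (1 + t $ 5 * (x / y) * (1 / y) + t3 t * (1 / y)^2 - 4 * (t $ 1) * (x / y)^2)
     / (1 + t $ 5 * (x / y) * (1 / y) + t3 t * (1 / y)^2 - 4 * e * (x / y)^2)"
    unfolding chart_at_O(2)[OF c *(2)] ffun_def option.case prod.case by (intro chart_fractions *(2))
  qed (intro pol_intros | simp add: ffun_def)+
 next
  case (Some q)
  obtain x y where q: "q = (x, y)" by (cases q)
  show ?thesis unfolding Some q by (rule regular_at_SomeI[where F = "%x y. x - t $ 1" and G = "%x y. x - e"])
    (use p Some q in "auto intro!: pol_intros simp: ffun_def Some_in_U_frame")
 qed
qed

lemma regular_sdiff: "regular_on (U_frame e t \<inter> U_frame e' t) (sdiff e e')" unfolding regular_on_def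
proof
 fix p assume p: "p \<in> U_frame e t \<inter> U_frame e' t"
 show "regular_at (U_frame e t \<inter> U_frame e' t) (sdiff e e') p"
 proof (cases p)
  case None
  show ?thesis unfolding None
  proof (rule regular_at_NoneI[where F = "%u v. 2 * (e - e') * u * (1 + t $ 5 * u * v + t3 t * v^2)"
     and G = "%u v. (1 + t $ 5 * u * v + t3 t * v^2 - 4 * e * u^2) *
       (1 + t $ 5 * u * v + t3 t * v^2 - 4 * e' * u^2)"])
   fix x y assume *: "Some (x, y) \<in> U_frame e t \<inter> U_frame e' t" "y ~= 0"
    "(1 + t $ 5 * (x / y) * (1 / y) + t3 t * (1 / y)^2 - 4 * e * (x / y)^2) *
     (1 + t $ 5 * (x / y) * (1 / y) + t3 t * (1 / y)^2 - 4 * e' * (x / y)^2) ~= 0"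
   then have c: "y^2 = cubic t x" by (simp add: Some_in_U_frame)
   have "x ~= 0" "x ~= e" "x ~= e'" using *(3) unfolding chart_at_O(2)[OF c *(2)] by auto
   then show "sdiff e e' (Some (x, y)) = 2 * (e - e') * (x / y) * (1 + t $ 5 * (x / y) * (1 / y) + t3 t * (1 / y)^2)
     / ((1 + t $ 5 * (x / y) * (1 / y) + t3 t * (1 / y)^2 - 4 * e * (x / y)^2) *
       (1 + t $ 5 * (x / y) * (1 / y) + t3 t * (1 / y)^2 - 4 * e' * (x / y)^2))"
    unfolding chart_at_O(2)[OF c *(2)] unfolding chart_at_O(1)[OF c *(2)] sdiff_def option.case prod.case
    by (intro chart_fractions *(2))
  qed (intro pol_intros | simp add: sdiff_def)+
 next
  case (Some q)
  obtain x y where q: "q = (x, y)" by (cases q)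
  show ?thesis unfolding Some q by (rule regular_at_SomeI[where F = "%x y. (e - e') * y" and G = "%x y. 2 * (x - e) * (x - e')"])
    (use p Some q in "auto intro!: pol_intros simp: sdiff_def Some_in_U_frame")
 qed
qed

text \<open>Reduces the test on germs to a single point: all that matters there is a pair x', y'
  satisfying the differentiated equation of the curve.\<close>

lemma is_differentialI:
 assumes U: "U <= XX t" and d: "!!x y w x' y'. (x has_field_derivative x') (at w) ==> (y has_field_derivative y') (at w) ==>
   2 * y w * y' = dcubic t (x w) * x' ==> Some (x w, y w) \<in> U ==>
   \<exists>d. ((%w. f (Some (x w, y w))) has_field_derivative d) (at w) & d * y w = h (Some (x w, y w)) * x'"
 shows "is_differential U f h" unfolding is_differential_def
proof (intro allI impI ballI, elim conjE)
 fix S x y w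
 assume S: "open S" "x holomorphic_on S" "y holomorphic_on S" "\<forall>w\<in>S. Some (x w, y w) \<in> U" and w: "w \<in> S"
 have c: "(x w, y w) \<in> affine_curve t" if "w \<in> S" for w
  using S(4) that U by (auto simp: affine_curve_iff Some_in_XX[symmetric])
 have "2 * y w * deriv y w = dcubic t (x w) * deriv x w" by (rule germ_curve_deriv[OF S(1-3) c w])
 moreover have "(x has_field_derivative deriv x w) (at w)" "(y has_field_derivative deriv y w) (at w)"
  using S w by (auto intro: holomorphic_derivI)
 ultimately obtain d where "((%w. f (Some (x w, y w))) has_field_derivative d) (at w)"
  "d * y w = h (Some (x w, y w)) * deriv x w" using d S(4) w by blast
 then show "deriv (%w. f (Some (x w, y w))) w * y w = h (Some (x w, y w)) * deriv x w" by (simp add: DERIV_imp_deriv)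
qed

lemma is_differential_ffun: "is_differential (U_frame e t) (ffun e t) (gfun e t)"
proof (rule is_differentialI[OF U_frame_subset])
 fix x y w x' y'
 assume x: "(x has_field_derivative x') (at w)" and U: "Some (x w, y w) \<in> U_frame e t"
 have "((%w. (x w - t $ 1) / (x w - e)) has_field_derivative (t $ 1 - e) * x' / (x w - e)^2) (at w)"
  using U by (auto intro!: derivative_eq_intros x simp: Some_in_U_frame power2_eq_square field_simps)
 then show "\<exists>d. ((%w. ffun e t (Some (x w, y w))) has_field_derivative d) (at w) &
   d * y w = gfun e t (Some (x w, y w)) * x'" by (intro exI[of _ "(t $ 1 - e) * x' / (x w - e)^2"]) (simp add: ffun_def gfun_def)
qed

text \<open>\<open>h\<^sub>e = x - D (y / (2 (x - e)))\<close> for the derivation \<open>D = y \<partial>\<^sub>x + (6 x\<^sup>2 - t\<^sub>2 / 2) \<partial>\<^sub>y\<close>.\<close>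

lemma dsigma_fractions:
 fixes d :: complex
 assumes "d ~= 0"
 shows "x - (D / (4 * d) - Y / (2 * d^2)) = (4 * x * d^2 - D * d + 2 * Y) / (4 * d^2)"
  and "(y' / (2 * d) - y * x' / (2 * d^2)) * y = (2 * y * y') / (4 * d) - y^2 * x' / (2 * d^2)"
 using assms by (simp_all add: divide_simps, simp_all add: algebra_simps power2_eq_square)

lemma hfun_eq:
 assumes "y^2 = cubic t x" "x ~= e"
 shows "hfun e t (Some (x, y)) = x - (dcubic t x / (4 * (x - e)) - y^2 / (2 * (x - e)^2))"
proof -
 have "x - (dcubic t x / (4 * (x - e)) - y^2 / (2 * (x - e)^2)) =
   (4 * x * (x - e)^2 - dcubic t x * (x - e) + 2 * y^2) / (4 * (x - e)^2)" using assms(2) by (intro dsigma_fractions) simp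
 also have "4 * x * (x - e)^2 - dcubic t x * (x - e) + 2 * y^2 =
   2 * (2 * e * x^2 + (2 * e^2 - t $ 5 / 2) * x - (e * t $ 5 / 2 + t3 t))"
  unfolding assms(1) cubic_def dcubic_def by (simp add: algebra_simps pow_eqs)
 finally have eq: "x - (dcubic t x / (4 * (x - e)) - y^2 / (2 * (x - e)^2)) =
   2 * (2 * e * x^2 + (2 * e^2 - t $ 5 / 2) * x - (e * t $ 5 / 2 + t3 t)) / (4 * (x - e)^2)" .
 have half: "2 * N / (4 * Q) = N / (2 * Q)" for N Q :: complex by (cases "Q = 0") (simp_all add: divide_simps)
 show ?thesis unfolding eq half hfun_def option.case prod.case ..
qed

lemma DERIV_sigma:
 fixes x y :: "complex => complex"
 assumes x: "(x has_field_derivative x') (at w)" and y: "(y has_field_derivative y') (at w)" and "x w ~= e"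
 shows "((%w. y w / (2 * (x w - e))) has_field_derivative y' / (2 * (x w - e)) - y w * x' / (2 * (x w - e)^2)) (at w)"
 using assms(3) by (auto intro!: derivative_eq_intros x y simp: power2_eq_square divide_simps) (simp add: algebra_simps)

text \<open>Each h_e is x minus the D-derivative of y/(2(x-e)); in the difference of two of them x
  drops out.\<close>

lemma is_differential_sdiff:
 "is_differential (U_frame e t \<inter> U_frame e' t) (sdiff e e') (%p. hfun e' t p - hfun e t p)"
proof (rule is_differentialI[where t = t])
 show "U_frame e t \<inter> U_frame e' t <= XX t" using U_frame_subset by blast
 fix x y w x' y'
 assume x: "(x has_field_derivative x') (at w)" and y: "(y has_field_derivative y') (at w)"
  and r: "2 * y w * y' = dcubic t (x w) * x'" and U: "Some (x w, y w) \<in> U_frame e t \<inter> U_frame e' t"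
 have ne: "x w ~= e" "x w ~= e'" and c: "y w ^ 2 = cubic t (x w)" using U by (auto simp: Some_in_U_frame)
 have S: "((%w. y w / (2 * (x w - e))) has_field_derivative y' / (2 * (x w - e)) - y w * x' / (2 * (x w - e)^2)) (at w)"
  if "x w ~= e" for e using that by (rule DERIV_sigma[OF x y])
 have A: "(y' / (2 * (x w - e)) - y w * x' / (2 * (x w - e)^2)) * y w =
   (x w - hfun e t (Some (x w, y w))) * x'" if "x w ~= e" for e
 proof -
  have "(y' / (2 * (x w - e)) - y w * x' / (2 * (x w - e)^2)) * y w =
    (2 * y w * y') / (4 * (x w - e)) - y w ^ 2 * x' / (2 * (x w - e)^2)" using that by (intro dsigma_fractions) simp
  also have "\<dots> = (dcubic t (x w) / (4 * (x w - e)) - y w ^ 2 / (2 * (x w - e)^2)) * x'"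
   unfolding r by (simp add: left_diff_distrib)
  also have "\<dots> = (x w - hfun e t (Some (x w, y w))) * x'" by (simp add: hfun_eq[OF c that])
  finally show ?thesis .
 qed
 have "eventually (%w. x w ~= e & x w ~= e') (nhds w)"
 proof -
  have "isCont x w" using x DERIV_isCont by blast
  then have "(x ---> x w) (nhds w)" by (simp add: isCont_def tendsto_nhds_iff)
  then show ?thesis using ne by (intro eventually_conj) (auto intro: tendsto_imp_eventually_ne)
 qed
 then have ev: "eventually (%w. y w / (2 * (x w - e)) - y w / (2 * (x w - e')) = sdiff e e' (Some (x w, y w))) (nhds w)"
  by eventually_elim (simp add: sdiff_def divide_simps, simp add: algebra_simps)
 have "((%w. y w / (2 * (x w - e)) - y w / (2 * (x w - e'))) has_field_derivative
   (y' / (2 * (x w - e)) - y w * x' / (2 * (x w - e)^2)) - (y' / (2 * (x w - e')) - y w * x' / (2 * (x w - e')^2))) (at w)"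
  by (intro DERIV_diff S ne)
 then have "((%w. sdiff e e' (Some (x w, y w))) has_field_derivative
   (y' / (2 * (x w - e)) - y w * x' / (2 * (x w - e)^2)) - (y' / (2 * (x w - e')) - y w * x' / (2 * (x w - e')^2))) (at w)"
  unfolding DERIV_cong_ev[OF refl ev refl] .
 moreover have "((y' / (2 * (x w - e)) - y w * x' / (2 * (x w - e)^2)) - (y' / (2 * (x w - e')) - y w * x' / (2 * (x w - e')^2))) * y w
   = (hfun e' t (Some (x w, y w)) - hfun e t (Some (x w, y w))) * x'"
  unfolding left_diff_distrib[of "y' / (2 * (x w - e)) - y w * x' / (2 * (x w - e)^2)"] A[OF ne(1)] A[OF ne(2)]
  by (simp add: algebra_simps)
 ultimately show "\<exists>d. ((%w. sdiff e e' (Some (x w, y w))) has_field_derivative d) (at w) &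
   d * y w = (hfun e' t (Some (x w, y w)) - hfun e t (Some (x w, y w))) * x'" by blast
qed

text \<open>Residues vanish because the pulled back forms have single-valued primitives on the
  punctured disc: (x-a)/(x-e) for \<open>gfun\<close>, and X - y/(2(x-e)) for \<open>hfun\<close>,
  where X is a holomorphic primitive of x dx/y.\<close>

lemma forms_rep:
 assumes t: "t \<in> TT" and e: "e ~= t $ 1"
 shows "(U_frame e t, rep e t z) \<in> forms t"
proof -
 let ?U = "U_frame e t"
 have fin: "finite (XX t - ?U)" using affine_open_U_frame by (simp add: affine_open_def)
 have formI: "(?U, g) \<in> forms t" if "regular_on ?U g" "!!q. no_residue_at t g q" for g
  using that by (simp add: forms_def affine_open_U_frame YY_subset_U_frame[OF e])
 have one: "(?U, %_. 1) \<in> forms t"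
 proof (rule formI[OF regular_on_const no_residue_atI[OF t fin]])
  fix r and k :: "complex => complex" assume "(0::real) < r" "k holomorphic_on ball 0 r"
  then show "residue (%w. 1 * k w) 0 = 0" by (intro residue_holo[of "ball 0 r"]) auto
 qed
 have g: "(?U, gfun e t) \<in> forms t"
 proof (rule formI[OF regular_gfun no_residue_atI[OF t fin]])
  fix r and x y k :: "complex => complex"
  assume *: "(0::real) < r" "x holomorphic_on ball 0 r" "y holomorphic_on ball 0 r"
   "!!w. w \<in> ball 0 r ==> deriv x w = k w * y w"
   "!!w. w \<in> ball 0 r - {0} ==> y w ~= 0 & Some (x w, y w) \<in> ?U"
  have U: "x w ~= e" if "w \<in> ball 0 r - {0}" for w using *(5)[OF that] by (simp add: Some_in_U_frame)
  show "residue (%w. gfun e t (Some (x w, y w)) * k w) 0 = 0"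
  proof (rule residue_primitive[OF *(1), of "%w. (x w - t $ 1) / (x w - e)"])
   have "x holomorphic_on ball 0 r - {0}" using *(2) by (rule holomorphic_on_subset) auto
   then show "(%w. (x w - t $ 1) / (x w - e)) holomorphic_on ball 0 r - {0}" using U by (intro holomorphic_intros) auto
   fix w :: complex assume w: "w \<in> ball 0 r - {0}"
   have x: "(x has_field_derivative deriv x w) (at w)" using *(2) w by (auto intro: holomorphic_derivI)
   have "((%w. (x w - t $ 1) / (x w - e)) has_field_derivative (t $ 1 - e) * deriv x w / (x w - e)^2) (at w)"
    using U[OF w] by (auto intro!: derivative_eq_intros x simp: power2_eq_square field_simps)
   then show "gfun e t (Some (x w, y w)) * k w = deriv (%w. (x w - t $ 1) / (x w - e)) w"
    using *(4)[of w] w by (simp add: DERIV_imp_deriv gfun_def)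
  qed
 qed
 have h: "(?U, hfun e t) \<in> forms t"
 proof (rule formI[OF regular_hfun no_residue_atI[OF t fin]])
  fix r and x y k :: "complex => complex"
  assume *: "(0::real) < r" "x holomorphic_on ball 0 r" "y holomorphic_on ball 0 r" "k holomorphic_on ball 0 r"
   "!!w. w \<in> ball 0 r ==> (x w, y w) \<in> affine_curve t"
   "!!w. w \<in> ball 0 r ==> deriv x w = k w * y w"
   "!!w. w \<in> ball 0 r - {0} ==> y w ~= 0 & Some (x w, y w) \<in> ?U"
  have U: "x w ~= e" "y w ~= 0" if "w \<in> ball 0 r - {0}" for w using *(7)[OF that] by (auto simp: Some_in_U_frame)
  have "(%w. x w * k w) holomorphic_on ball 0 r" by (intro holomorphic_intros *)
  then obtain X where X: "!!w. w \<in> ball 0 r ==> (X has_field_derivative x w * k w) (at w within ball 0 r)"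
   using holomorphic_convex_primitive'[of "ball 0 r"] by auto
  then have X': "(X has_field_derivative x w * k w) (at w)" if "w \<in> ball 0 r" for w
   using that by (metis at_within_open open_ball)
  have Xh: "X holomorphic_on ball 0 r" using X' holomorphic_on_open open_ball by blast
  show "residue (%w. hfun e t (Some (x w, y w)) * k w) 0 = 0"
  proof (rule residue_primitive[OF *(1), of "%w. X w - y w / (2 * (x w - e))"])
   have "x holomorphic_on ball 0 r - {0}" "y holomorphic_on ball 0 r - {0}" "X holomorphic_on ball 0 r - {0}"
    using *(2,3) Xh by (auto intro: holomorphic_on_subset)
   then show "(%w. X w - y w / (2 * (x w - e))) holomorphic_on ball 0 r - {0}" using U by (intro holomorphic_intros) auto
   fix w :: complex assume w: "w \<in> ball 0 r - {0}"
   then have wb: "w \<in> ball 0 r" by simp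
   have x: "(x has_field_derivative deriv x w) (at w)" and y: "(y has_field_derivative deriv y w) (at w)"
    using *(2,3) wb by (auto intro: holomorphic_derivI)
   have "2 * y w * deriv y w = dcubic t (x w) * deriv x w" by (rule germ_curve_deriv[OF open_ball *(2,3,5) wb])
   then have y': "deriv y w = dcubic t (x w) * k w / 2" using U(2)[OF w] by (simp add: *(6)[OF wb] field_simps)
   have c: "y w ^ 2 = cubic t (x w)" using *(5)[OF wb] by (simp add: affine_curve_iff)
   have "((%w. X w - y w / (2 * (x w - e))) has_field_derivative
     x w * k w - (deriv y w / (2 * (x w - e)) - y w * deriv x w / (2 * (x w - e)^2))) (at w)"
    by (intro DERIV_diff X'[OF wb] DERIV_sigma x y U(1)[OF w])
   then have "deriv (%w. X w - y w / (2 * (x w - e))) w =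
     x w * k w - (deriv y w / (2 * (x w - e)) - y w * deriv x w / (2 * (x w - e)^2))" by (rule DERIV_imp_deriv)
   also have "\<dots> = hfun e t (Some (x w, y w)) * k w"
    unfolding hfun_eq[OF c U(1)[OF w]] y' *(6)[OF wb] by (simp add: algebra_simps power2_eq_square)
   finally show "hfun e t (Some (x w, y w)) * k w = deriv (%w. X w - y w / (2 * (x w - e))) w" ..
  qed
 qed
 note add = forms_add[OF t, of ?U _ ?U, unfolded Int_absorb]
 have "(?U, %p. (z $ 1 + z $ 3 * kap e t) * gfun e t p + ((z $ 2 + z $ 3 * t $ 4) * 1 + z $ 3 * hfun e t p)) \<in> forms t"
  by (intro add forms_cmult[OF t] g one h)
 then show ?thesis by (rule forms_cong[OF t]) (simp add: rep_def algebra_simps)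
qed

text \<open>Here the constants c - b/(2(a-e)) of the frame show their purpose. The primitive
  \<open>f\<close> of the difference has to vanish at O, which fixes its additive constant as
  \<open>kap e' t - kap e t\<close>, and at P, where \<open>sdiff\<close> takes exactly this
  value.\<close>

lemma rep_independent:
 assumes t: "t \<in> TT" and e: "e ~= t $ 1" "e' ~= t $ 1"
 shows "dR_class t (U_frame e t) (rep e t z) = dR_class t (U_frame e' t) (rep e' t z)"
proof (rule dR_class_eqI[OF t])
 let ?W = "U_frame e t \<inter> U_frame e' t"
 define f where "f p = z $ 1 * (ffun e t p + (- 1) * ffun e' t p) +
   z $ 3 * ((kap e t * ffun e t p + (- kap e' t) * ffun e' t p) +
    ((- 1) * sdiff e e' p + (kap e' t - kap e t)))" for p
 have reg: "regular_on ?W (ffun e t)" "regular_on ?W (ffun e' t)" using regular_ffun by (auto intro: regular_on_subset)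
 have dif: "is_differential ?W (ffun e t) (gfun e t)" "is_differential ?W (ffun e' t) (gfun e' t)"
  using is_differential_ffun by (auto intro: is_differential_subset)
 note regs = regular_on_add regular_on_cmult regular_on_const reg regular_sdiff
 have "is_differential ?W f (%p. z $ 1 * (gfun e t p + (- 1) * gfun e' t p) +
   z $ 3 * ((kap e t * gfun e t p + (- kap e' t) * gfun e' t p) +
    ((- 1) * (hfun e' t p - hfun e t p) + 0)))" unfolding f_def[abs_def]
  by (intro is_differential_add is_differential_cmult dif is_differential_const is_differential_sdiff regs)
 then have diff: "is_differential ?W f (%p. rep e t z p - rep e' t z p)"
  by (rule is_differential_cong) (simp add: rep_def algebra_simps)
 show "((U_frame e t, rep e t z), (U_frame e' t, rep e' t z)) \<in> dR_rel t"
 proof (rule dR_relI[OF forms_rep[OF t e(1)] forms_rep[OF t e(2)] _ _ subset_refl _ _ diff])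
  show "affine_open t ?W" by (intro affine_open_Int affine_open_U_frame)
  show "YY t <= ?W" using YY_subset_U_frame e by blast
  show "regular_on ?W f" unfolding f_def[abs_def] by (intro regs)
  fix p assume "p \<in> YY t"
  then consider "p = None" | "p = Some (t $ 1, t $ 2)" by (auto simp: YY_def)
  then show "f p = 0"
  proof cases
   case 1
   then show ?thesis by (simp add: f_def ffun_def sdiff_def)
  next
   case 2
   have "sdiff e e' p = kap e' t - kap e t"
    using e unfolding 2 sdiff_def kap_def by (simp add: divide_simps) (simp add: algebra_simps)
   then show ?thesis using 2 by (simp add: f_def ffun_def)
  qed
 qed
qed

text \<open>On the curve a bound on x bounds y, so leaving every bounded set means that x tends to
  infinity. Non-triviality of the filter makes the limit in \<open>extend_to_O\<close>
  unique.\<close>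

lemma curve_at_infinity:
 fixes t :: param
 defines "F \<equiv> inf at_infinity (principal (affine_curve t))"
 shows "filterlim fst at_infinity F" "F ~= bot"
proof -
 show "filterlim fst at_infinity F" unfolding filterlim_at_infinity[OF order_refl]
 proof (intro allI impI)
  fix B :: real assume B: "B > 0"
  define C where "C = 4 * B^3 + norm (t $ 5) * B + norm (t3 t)"
  have "eventually (%q. norm q \<ge> B + (C + 1) + 1) (at_infinity :: (complex \<times> complex) filter)"
   unfolding eventually_at_infinity by blast
  then have "eventually (%q. q \<in> affine_curve t --> B \<le> norm (fst q)) at_infinity"
  proof eventually_elim
   case (elim q)
   obtain x y where q: "q = (x, y)" by (cases q)
   show ?case
   proof (rule impI, rule ccontr)
    assume "q \<in> affine_curve t" "\<not> B \<le> norm (fst q)"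
    then have c: "y^2 = cubic t x" and x: "norm x \<le> B" by (auto simp: q affine_curve_iff)
    have "norm y ^ 2 = norm (cubic t x)" by (metis c norm_power)
    also have "\<dots> \<le> norm (4 * x^3) + norm (t $ 5 * x) + norm (t3 t)" unfolding cubic_def
     using norm_triangle_ineq4[of "4 * x^3 - t $ 5 * x" "t3 t"] norm_triangle_ineq4[of "4 * x^3" "t $ 5 * x"] by linarith
    also have "\<dots> = 4 * norm x ^ 3 + norm (t $ 5) * norm x + norm (t3 t)" by (simp add: norm_mult norm_power)
    also have "\<dots> \<le> C" unfolding C_def using x by (intro add_mono mult_left_mono power_mono) auto
    finally have "norm y ^ 2 \<le> C" .
    \<comment> \<open>Turns the bound on the square into a bound on the norm of y.\<close>
    moreover have "2 * norm y \<le> norm y ^ 2 + 1" using zero_le_power2[of "norm y - 1"] by (simp add: power2_diff)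
    ultimately have "norm y \<le> C + 1" using zero_le_power2[of "norm y"] by linarith
    moreover have "norm q \<le> norm x + norm y" unfolding q by (rule norm_Pair_le)
    ultimately show False using elim x by linarith
   qed
  qed
  then show "eventually (%q. B \<le> norm (fst q)) F" by (simp add: F_def eventually_inf_principal)
 qed
 show "F ~= bot"
 proof
  assume "F = bot"
  then have "eventually (%q. q \<in> affine_curve t --> False) at_infinity"
   using eventually_inf_principal[of "%_. False" at_infinity "affine_curve t"] by (simp add: F_def)
  then obtain B where B: "!!q :: complex \<times> complex. norm q \<ge> B ==> q \<notin> affine_curve t"
   by (auto simp: eventually_at_infinity)
  define x where "x = complex_of_real \<bar>B\<bar>"
  have "(x, csqrt (cubic t x)) \<in> affine_curve t" by (simp add: affine_curve_iff)
  moreover have "norm (x, csqrt (cubic t x)) \<ge> B" using norm_fst_le[of x "csqrt (cubic t x)"] by (simp add: x_def)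
  ultimately show False using B by blast
 qed
qed

text \<open>\<open>hfun\<close> is rational in 1/x, so its limit is immediate. \<open>gfun\<close>
  contains y, but its square is rational in 1/x with limit 0, which is enough.\<close>

lemma rep_tendsto_O:
 "((%q. rep e t z (Some q)) ---> rep e t z None) (inf at_infinity (principal (affine_curve t)))"
proof -
 let ?F = "inf at_infinity (principal (affine_curve t))"
 define r where "r q = inverse (fst q)" for q :: "complex \<times> complex"
 have r: "(r ---> 0) ?F" unfolding r_def by (rule filterlim_compose[OF tendsto_inverse_0 curve_at_infinity(1)])
 have ev: "eventually (%q. q \<in> affine_curve t & fst q ~= 0 & fst q ~= e) ?F"
 proof -
  have "eventually (%q. norm e + 1 \<le> norm (fst q)) ?F"
   using curve_at_infinity(1)[of t] unfolding filterlim_at_infinity[OF order_refl] by (simp add: add_nonneg_pos)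
  moreover have "eventually (%q. q \<in> affine_curve t) ?F" by (simp add: eventually_inf_principal)
  ultimately show ?thesis
  proof eventually_elim
   case (elim q)
   then have "norm (fst q) > 0" using norm_ge_zero[of e] by linarith
   then show ?case using elim by auto
  qed
 qed
 have "((%q. (2 * e + (2 * e^2 - t $ 5 / 2) * r q - (e * t $ 5 / 2 + t3 t) * r q ^ 2) / (2 * (1 - e * r q)^2)) --->
   (2 * e + (2 * e^2 - t $ 5 / 2) * 0 - (e * t $ 5 / 2 + t3 t) * 0 ^ 2) / (2 * (1 - e * 0)^2)) ?F"
  by (intro tendsto_intros r) simp
 moreover have "eventually (%q. (2 * e + (2 * e^2 - t $ 5 / 2) * r q - (e * t $ 5 / 2 + t3 t) * r q ^ 2)
   / (2 * (1 - e * r q)^2) = hfun e t (Some q)) ?F" using ev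
 proof eventually_elim
  case (elim q)
  obtain x y where q: "q = (x, y)" by (cases q)
  define d where "d = x - e"
  have d: "1 - e * inverse x = d / x" "d ~= 0" "x ~= 0" using elim q by (auto simp: field_simps d_def)
  have gen: "(C + A * inverse x - B * inverse x ^ 2) / (2 * (d / x)^2) = (C * x^2 + A * x - B) / (2 * d^2)"
   for A B C using d(2,3) by (simp add: divide_simps) (simp add: algebra_simps power2_eq_square)
  show ?case unfolding r_def q fst_conv hfun_def option.case prod.case d(1) gen by (simp only: d_def)
 qed
 ultimately have h: "((%q. hfun e t (Some q)) ---> hfun e t None) ?F"
  by (rule Lim_transform_eventually[THEN tendsto_eq_rhs]) (simp add: hfun_def)
 have "((%q. (t $ 1 - e)^2 * (4 - t $ 5 * r q ^ 2 - t3 t * r q ^ 3) * r q / (1 - e * r q)^4) --->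
   (t $ 1 - e)^2 * (4 - t $ 5 * 0 ^ 2 - t3 t * 0 ^ 3) * 0 / (1 - e * 0)^4) ?F" by (intro tendsto_intros r) simp
 moreover have "eventually (%q. (t $ 1 - e)^2 * (4 - t $ 5 * r q ^ 2 - t3 t * r q ^ 3) * r q / (1 - e * r q)^4
   = gfun e t (Some q) ^ 2) ?F" using ev
 proof eventually_elim
  case (elim q)
  obtain x y where q: "q = (x, y)" by (cases q)
  define d where "d = x - e"
  have d: "1 - e * inverse x = d / x" "d ~= 0" "x ~= 0" using elim q by (auto simp: field_simps d_def)
  have "gfun e t (Some q) ^ 2 = (t $ 1 - e)^2 * y^2 / d^4"
   by (simp add: gfun_def q d_def power_divide power_mult_distrib flip: power_mult)
  also have "y^2 = cubic t x" using elim q by (simp add: affine_curve_iff)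
  also have "(t $ 1 - e)^2 * cubic t x / d^4 =
    (t $ 1 - e)^2 * (4 - t $ 5 * inverse x ^ 2 - t3 t * inverse x ^ 3) * inverse x / (d / x)^4"
  proof -
   have 1: "cubic t x = x^3 * (4 - t $ 5 * inverse x ^ 2 - t3 t * inverse x ^ 3)"
   proof -
    have "x^3 * inverse x ^ 2 = x" "x^3 * inverse x ^ 3 = 1" using d(3) by (simp_all add: field_simps pow_eqs)
    then show ?thesis by (simp only: cubic_def right_diff_distrib mult.left_commute[of "x^3"]) (simp add: mult.commute)
   qed
   have 2: "A * (x^3 * Q) / d^4 = A * Q * inverse x / (d / x)^4" for A Q
    using d(2,3) by (simp add: divide_simps) (simp add: power3_eq_cube power4_eq_xxxx)
   show ?thesis unfolding 1 2 ..
  qed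
  finally show ?case by (simp add: r_def q d)
 qed
 ultimately have "((%q. gfun e t (Some q) ^ 2) ---> 0) ?F" by (rule Lim_transform_eventually[THEN tendsto_eq_rhs]) simp
 then have "((%q. sqrt (norm (gfun e t (Some q) ^ 2))) ---> sqrt (norm (0::complex))) ?F" by (intro tendsto_intros)
 then have "((%q. gfun e t (Some q)) ---> 0) ?F" by (simp add: norm_power tendsto_norm_zero_iff)
 then have "((%q. gfun e t (Some q)) ---> gfun e t None) ?F" by (simp add: gfun_def)
 with h show ?thesis unfolding rep_def by (intro tendsto_intros)
qed

lemma frame_coeff_eq:
 assumes c: "y^2 = cubic t x" and x: "x ~= e"
 shows "frame_coeff e i t (x, y) = rep e t (axis i 1) (Some (x, y))"
proof -
 have D1: "((%ks. (ks - a) / (ks - e)) has_field_derivative (a - e) / (x - e)^2) (at x)" for a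
  using x by (auto intro!: derivative_eq_intros simp: power2_eq_square)
 have d1: "d_coeff t (%x y. (x - t $ 1) / (x - e)) (x, y) = gfun e t (Some (x, y))"
  by (simp add: d_coeff_def gfun_def DERIV_imp_deriv[OF D1])
 have D2: "((%ks. y / (2 * (ks - e))) has_field_derivative - y / (2 * (x - e)^2)) (at x)"
 proof -
  have "((%ks. (y / 2) * inverse (ks - e)) has_field_derivative
    (y / 2) * - (inverse (x - e) * (1 - 0) * inverse (x - e))) (at x)"
   by (rule DERIV_cmult[OF DERIV_inverse'[OF DERIV_diff[OF DERIV_ident DERIV_const]]]) (use x in simp)
  moreover have "y / (2 * d) = (y / 2) * inverse d" for d by (cases "d = 0") (simp_all add: field_simps)
  moreover have "- y / (2 * d^2) = (y / 2) * - (inverse d * (1 - 0) * inverse d)" for d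
   by (cases "d = 0") (simp_all add: field_simps power2_eq_square)
  ultimately show ?thesis by (simp only:)
 qed
 have D3: "((%et. et / (2 * (x - e))) has_field_derivative 1 / (2 * (x - e))) (at y)"
  using x by (auto intro!: derivative_eq_intros)
 have d2: "x - d_coeff t (%x y. y / (2 * (x - e))) (x, y) = hfun e t (Some (x, y))"
  unfolding hfun_eq[OF c x] d_coeff_def prod.case DERIV_imp_deriv[OF D2] DERIV_imp_deriv[OF D3] dcubic_def
 proof -
  have "x - (- y / (2 * d^2) * y + 1 / (2 * d) * (6 * x^2 - t $ 5 / 2)) =
    x - ((12 * x^2 - t $ 5) / (4 * d) - y^2 / (2 * d^2))" if "d ~= 0" for d
   using that by (simp add: divide_simps) (simp add: algebra_simps power2_eq_square)
  from this[of "x - e"] x show "x - (- y / (2 * (x - e)^2) * y + 1 / (2 * (x - e)) * (6 * x^2 - t $ 5 / 2)) =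
    x - ((12 * x^2 - t $ 5) / (4 * (x - e)) - y^2 / (2 * (x - e)^2))" by simp
 qed
 have "frame_coeff e i t (x, y) = (if i = 1 then gfun e t (Some (x, y)) else if i = 2 then 1
   else kap e t * gfun e t (Some (x, y)) + t $ 4 + hfun e t (Some (x, y)))"
  unfolding d2[symmetric] d1[symmetric] by (simp add: frame_coeff_def Let_def kap_def)
 also have "\<dots> = rep e t (axis i 1) (Some (x, y))" using exhaust_3[of i] by (auto simp: rep_def axis_def)
 finally show ?thesis .
qed

lemma extend_to_O_frame_coeff:
 assumes "p \<in> U_frame e t"
 shows "extend_to_O t (frame_coeff e i t) p = rep e t (axis i 1) p"
proof (cases p)
 case None
 have "eventually (%q. q \<in> affine_curve t & norm e + 1 \<le> norm (fst q)) (inf at_infinity (principal (affine_curve t)))"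
  using curve_at_infinity(1)[of t] unfolding filterlim_at_infinity[OF order_refl]
  by (intro eventually_conj) (simp_all add: eventually_inf_principal add_nonneg_pos)
 then have "eventually (%q. rep e t (axis i 1) (Some q) = frame_coeff e i t q) (inf at_infinity (principal (affine_curve t)))"
 proof eventually_elim
  case (elim q)
  then have "fst q ~= e" by auto
  with elim frame_coeff_eq[of "snd q" t "fst q" e i] show ?case by (cases q) (simp add: affine_curve_iff)
 qed
 from Lim_transform_eventually[OF rep_tendsto_O this] show ?thesis
  unfolding None by (simp add: extend_to_O_def tendsto_Lim[OF curve_at_infinity(2)])
next
 case (Some q)
 then show ?thesis using assms by (cases q) (simp add: extend_to_O_def frame_coeff_eq Some_in_U_frame)
qed

text \<open>The choice of the pole \<open>e\<close> of the representative does not matter, see \<open>cls_eq\<close>.\<close>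

definition cls :: "param => complex ^ 3 => dR_class" where
 "cls t z = (let e = (if t $ 1 ~= 0 then 0 else 1) in dR_class t (U_frame e t) (rep e t z))"

lemma cls_eq:
 assumes "t \<in> TT" "e ~= t $ 1"
 shows "cls t z = dR_class t (U_frame e t) (rep e t z)"
 unfolding cls_def Let_def by (rule rep_independent[OF assms(1) _ assms(2)]) auto

lemma ex_pole: "\<exists>e. e ~= (a::complex)" by (metis zero_neq_one)

lemma frame_eq_cls:
 assumes t: "t \<in> TT"
 shows "frame i t = cls t (axis i 1)"
proof -
 define e where "e = (if t $ 1 ~= 0 then 0 else 1 :: complex)"
 have e: "e ~= t $ 1" by (auto simp: e_def)
 have f: "(U_frame e t, rep e t (axis i 1)) \<in> forms t" by (rule forms_rep[OF t e])
 have f': "(U_frame e t, extend_to_O t (frame_coeff e i t)) \<in> forms t"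
  by (rule forms_cong[OF t f]) (rule extend_to_O_frame_coeff[symmetric])
 have "dR_class t (U_frame e t) (extend_to_O t (frame_coeff e i t)) = dR_class t (U_frame e t) (rep e t (axis i 1))"
  by (rule dR_class_eqI[OF t dR_rel_cong[OF t f' f]]) (rule extend_to_O_frame_coeff)
 then show ?thesis using t unfolding frame_def cls_eq[OF t e] by (simp add: e_def)
qed

lemma cls_closed: "t \<in> TT ==> cls t z \<in> carrier (H1dR t)"
 using ex_pole[of "t $ 1"] by (metis cls_eq dR_class_closed forms_rep)

text \<open>With a common pole, classes add as coefficient functions do. This and the lemmas on
  \<open>cls\<close> that follow carry the vector space operations over to
  \<open>complex ^ 3\<close>.\<close>

lemma cls_add:
 assumes t: "t \<in> TT"
 shows "cls t z \<oplus>\<^bsub>H1dR t\<^esub> cls t z' = cls t (z + z')"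
proof -
 obtain e where e: "e ~= t $ 1" using ex_pole by blast
 have "(%p. rep e t z p + rep e t z' p) = rep e t (z + z')" by (rule ext) (simp add: rep_def algebra_simps)
 then show ?thesis by (simp add: cls_eq[OF t e] H1dR_add[OF t forms_rep[OF t e] forms_rep[OF t e]])
qed

lemma cls_smult:
 assumes t: "t \<in> TT"
 shows "c \<odot>\<^bsub>H1dR t\<^esub> cls t z = cls t (c *s z)"
proof -
 obtain e where e: "e ~= t $ 1" using ex_pole by blast
 have "(%p. c * rep e t z p) = rep e t (c *s z)" by (rule ext) (simp add: rep_def algebra_simps)
 then show ?thesis by (simp add: cls_eq[OF t e] H1dR_smult[OF t forms_rep[OF t e]])
qed

lemma cls_zero:
 assumes t: "t \<in> TT"
 shows "\<zero>\<^bsub>H1dR t\<^esub> = cls t 0"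
proof -
 obtain e where e: "e ~= t $ 1" using ex_pole by blast
 have eq: "(%p. 0) = rep e t 0" by (rule ext) (simp add: rep_def)
 show ?thesis unfolding cls_eq[OF t e] eq[symmetric] by (rule H1dR_zero[OF t]) (unfold eq, rule forms_rep[OF t e])
qed

lemma finsum_cls:
 assumes t: "t \<in> TT" and A: "finite A"
 shows "finsum (H1dR t) (%i. cls t (z i)) A = cls t (sum z A)"
proof -
 obtain e where e: "e ~= t $ 1" using ex_pole by blast
 interpret abelian_monoid "H1dR t" by (rule abelian_monoid_H1dR[OF t forms_rep[OF t e]])
 show ?thesis using A
 proof (induction A rule: finite_induct)
  case empty
  then show ?case by (simp add: cls_zero[OF t])
 next
  case (insert i A)
  then show ?case by (simp add: finsum_insert cls_closed[OF t] cls_add[OF t])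
 qed
qed

lemma finsum_smult_cls:
 assumes t: "t \<in> TT"
 shows "finsum (H1dR t) (%k::'n::finite. c k \<odot>\<^bsub>H1dR t\<^esub> cls t (z k)) UNIV = cls t (\<Sum>k\<in>UNIV. c k *s z k)"
 unfolding cls_smult[OF t] by (rule finsum_cls[OF t]) simp

lemma finsum_frame:
 assumes t: "t \<in> TT"
 shows "finsum (H1dR t) (%i. c i \<odot>\<^bsub>H1dR t\<^esub> frame i t) UNIV = cls t (\<chi> i. c i)"
proof -
 have "(\<Sum>i\<in>UNIV. c i *s (axis i 1 :: complex ^ 3)) = (\<chi> i. c i)"
  by (simp add: vec_eq_iff axis_def if_distrib cong: if_cong)
 then show ?thesis unfolding frame_eq_cls[OF t] finsum_smult_cls[OF t] by simp
qed

section \<open>The invariant differential along paths\<close>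

lemma on_cone_affine:
 assumes "on_cone t p" "p $ 3 ~= 0"
 shows "(p $ 2 / p $ 3)^2 = cubic t (p $ 1 / p $ 3)"
proof -
 have eq: "(p $ 2)^2 * p $ 3 = 4 * (p $ 1)^3 - t $ 5 * p $ 1 * (p $ 3)^2 - t3 t * (p $ 3)^3"
  using assms(1) by (simp add: on_cone_def)
 have "(p $ 2 / p $ 3)^2 = (p $ 2)^2 * p $ 3 / (p $ 3)^3" using assms(2) by (simp add: field_simps pow_eqs)
 also have "\<dots> = cubic t (p $ 1 / p $ 3)" unfolding eq cubic_def using assms(2)
  by (simp add: diff_divide_distrib power_divide) (simp add: pow_eqs)
 finally show ?thesis .
qed

lemma on_cone_None: "on_cone t p ==> p $ 3 = 0 ==> p $ 1 = 0 & p $ 2 ~= 0" by (auto simp: on_cone_def vec_eq_iff forall_3)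

lemma pt_in_XX: "on_cone t p ==> pt p \<in> XX t" using on_cone_affine[of t p] by (auto simp: pt_def XX_def affine_curve_iff)

lemma on_cone_chart_at_O:
 assumes "on_cone t p" "p $ 2 ~= 0"
 defines "u \<equiv> p $ 1 / p $ 2" and "w \<equiv> p $ 3 / p $ 2"
 shows "w = 4 * u^3 - t $ 5 * u * w^2 - t3 t * w^3"
proof -
 have eq: "(p $ 2)^2 * p $ 3 = 4 * (p $ 1)^3 - t $ 5 * p $ 1 * (p $ 3)^2 - t3 t * (p $ 3)^3"
  using assms(1) by (simp add: on_cone_def)
 have "w = (p $ 2)^2 * p $ 3 / (p $ 2)^3" using assms(2) by (simp add: w_def pow_eqs)
 also have "\<dots> = 4 * u^3 - t $ 5 * u * w^2 - t3 t * w^3" unfolding eq u_def w_def using assms(2)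
  by (simp add: diff_divide_distrib power_divide) (simp add: pow_eqs)
 finally show ?thesis .
qed

definition gradF :: "param => complex ^ 3 => complex ^ 3" where
 "gradF t p = vector [t $ 5 * (p $ 3)^2 - 12 * (p $ 1)^2, 2 * p $ 2 * p $ 3,
   (p $ 2)^2 + 2 * t $ 5 * p $ 1 * p $ 3 + 3 * t3 t * (p $ 3)^2]"

text \<open>Smoothness of the projective curve: at O the third component is Y^2, at finite points
  \<open>dcubic_nonzero\<close> applies.\<close>

lemma gradF_nonzero:
 assumes t: "t \<in> TT" and p: "on_cone t p"
 shows "gradF t p ~= 0"
proof
 assume "gradF t p = 0"
 then have g: "t $ 5 * (p $ 3)^2 - 12 * (p $ 1)^2 = 0" "2 * p $ 2 * p $ 3 = 0"
  "(p $ 2)^2 + 2 * t $ 5 * p $ 1 * p $ 3 + 3 * t3 t * (p $ 3)^2 = 0" by (auto simp: gradF_def vec_eq_iff forall_3)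
 show False
 proof (cases "p $ 3 = 0")
  case True
  then show False using g(3) on_cone_None[OF p] by simp
 next
  case False
  then have "p $ 2 = 0" using g(2) by simp
  then have "cubic t (p $ 1 / p $ 3) = 0" using on_cone_affine[OF p False] by simp
  moreover have "dcubic t (p $ 1 / p $ 3) = - (t $ 5 * (p $ 3)^2 - 12 * (p $ 1)^2) / (p $ 3)^2"
   using False by (simp add: dcubic_def field_simps)
  ultimately show False using dcubic_nonzero[OF t] g(1) by simp
 qed
qed

text \<open>A non-zero component of the gradient determines l, so the description by
  \<open>THE\<close> is legitimate.\<close>

lemma inv_diff_eq:
 assumes t: "t \<in> TT" and p: "on_cone t p"
  and l: "2 * (p $ 2 * v $ 3 - p $ 3 * v $ 2) = l * (t $ 5 * (p $ 3)^2 - 12 * (p $ 1)^2)"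
   "2 * (p $ 3 * v $ 1 - p $ 1 * v $ 3) = l * (2 * p $ 2 * p $ 3)"
   "2 * (p $ 1 * v $ 2 - p $ 2 * v $ 1) = l * ((p $ 2)^2 + 2 * t $ 5 * p $ 1 * p $ 3 + 3 * t3 t * (p $ 3)^2)"
 shows "inv_diff t p v = l" unfolding inv_diff_def
proof (rule the_equality)
 fix m
 assume m: "2 * (p $ 2 * v $ 3 - p $ 3 * v $ 2) = m * (t $ 5 * (p $ 3)^2 - 12 * (p $ 1)^2) &
   2 * (p $ 3 * v $ 1 - p $ 1 * v $ 3) = m * (2 * p $ 2 * p $ 3) &
   2 * (p $ 1 * v $ 2 - p $ 2 * v $ 1) = m * ((p $ 2)^2 + 2 * t $ 5 * p $ 1 * p $ 3 + 3 * t3 t * (p $ 3)^2)"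
 obtain i where "gradF t p $ i ~= 0" using gradF_nonzero[OF t p] by (auto simp: vec_eq_iff)
 moreover have "m * gradF t p $ i = l * gradF t p $ i"
 proof -
  have "m * (t $ 5 * (p $ 3)^2 - 12 * (p $ 1)^2) = l * (t $ 5 * (p $ 3)^2 - 12 * (p $ 1)^2)"
   by (rule trans[OF conjunct1[OF m, symmetric] l(1)])
  moreover have "m * (2 * p $ 2 * p $ 3) = l * (2 * p $ 2 * p $ 3)"
   by (rule trans[OF conjunct1[OF conjunct2[OF m], symmetric] l(2)])
  moreover have "m * ((p $ 2)^2 + 2 * t $ 5 * p $ 1 * p $ 3 + 3 * t3 t * (p $ 3)^2) =
    l * ((p $ 2)^2 + 2 * t $ 5 * p $ 1 * p $ 3 + 3 * t3 t * (p $ 3)^2)"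
   by (rule trans[OF conjunct2[OF conjunct2[OF m], symmetric] l(3)])
  ultimately show ?thesis using exhaust_3[of i] by (elim disjE) (simp_all only: gradF_def vector_3)
 qed
 ultimately show "m = l" by simp
qed (intro conjI l)

text \<open>Both equations l y = x' and l f'(x) = 2 y' are carried along since y or f'(x), though
  never both, may vanish. The equation for the third component of the gradient follows by Euler's
  relation.\<close>

lemma inv_diff_affine:
 assumes t: "t \<in> TT" and p: "on_cone t p" and z: "p $ 3 ~= 0" and x': "x' = (v $ 1 * p $ 3 - p $ 1 * v $ 3) / (p $ 3)^2"
  and y': "y' = (v $ 2 * p $ 3 - p $ 2 * v $ 3) / (p $ 3)^2"
  and l: "l * (p $ 2 / p $ 3) = x'" "l * dcubic t (p $ 1 / p $ 3) = 2 * y'"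
 shows "inv_diff t p v = l"
proof -
 define x y where "x = p $ 1 / p $ 3" and "y = p $ 2 / p $ 3"
 define Z where "Z = p $ 3"
 have p12: "p $ 1 = x * Z" "p $ 2 = y * Z" "p $ 3 = Z" and Z: "Z ~= 0" using z by (auto simp: x_def y_def Z_def)
 have c: "y^2 = cubic t x" using on_cone_affine[OF p z] by (simp add: x_def y_def)
 have "Z * v $ 1 = Z * (l * y * Z + x * v $ 3)"
  using l(1) x' z unfolding y_def[symmetric] p12 using Z by (simp add: field_simps power2_eq_square)
 then have v1: "v $ 1 = l * y * Z + x * v $ 3" using Z by simp
 have "Z * v $ 2 = Z * (l * dcubic t x / 2 * Z + y * v $ 3)"
  using l(2) y' z unfolding x_def[symmetric] p12 using Z by (simp add: field_simps power2_eq_square)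
 then have v2: "v $ 2 = l * dcubic t x / 2 * Z + y * v $ 3" using Z by simp
 show ?thesis
 proof (rule inv_diff_eq[OF t p])
  show "2 * (p $ 2 * v $ 3 - p $ 3 * v $ 2) = l * (t $ 5 * (p $ 3)^2 - 12 * (p $ 1)^2)"
   unfolding v1 v2 p12 dcubic_def by (simp add: field_simps power2_eq_square)
  show "2 * (p $ 3 * v $ 1 - p $ 1 * v $ 3) = l * (2 * p $ 2 * p $ 3)"
   unfolding v1 v2 p12 by (simp add: algebra_simps power2_eq_square)
  have "2 * (p $ 1 * v $ 2 - p $ 2 * v $ 1) = l * Z^2 * (x * dcubic t x - 2 * y^2)"
   unfolding v1 v2 p12 by (simp add: algebra_simps power2_eq_square)
  also have "x * dcubic t x - 2 * y^2 = y^2 + 2 * t $ 5 * x + 3 * t3 t"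
   unfolding c cubic_def dcubic_def by (simp add: algebra_simps pow_eqs)
  finally show "2 * (p $ 1 * v $ 2 - p $ 2 * v $ 1) = l * ((p $ 2)^2 + 2 * t $ 5 * p $ 1 * p $ 3 + 3 * t3 t * (p $ 3)^2)"
   unfolding p12 by (simp add: algebra_simps power2_eq_square)
 qed
qed

text \<open>The derivative of the homogeneous equation with respect to Z, divided by Y^2, in the
  coordinates u = X/Y and w = Z/Y; its value at O is 1.\<close>

definition chartE :: "param => complex => complex => complex" where
 "chartE t u w = 1 + 2 * t $ 5 * u * w + 3 * t3 t * w^2"

lemma inv_diff_at_O:
 assumes t: "t \<in> TT" and p: "on_cone t p" and y: "p $ 2 ~= 0" and u': "u' = (v $ 1 * p $ 2 - p $ 1 * v $ 2) / (p $ 2)^2"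
  and w': "w' = (v $ 3 * p $ 2 - p $ 3 * v $ 2) / (p $ 2)^2" and l: "l * chartE t (p $ 1 / p $ 2) (p $ 3 / p $ 2) = - 2 * u'"
   "l * (t $ 5 * (p $ 3 / p $ 2)^2 - 12 * (p $ 1 / p $ 2)^2) = 2 * w'"
 shows "inv_diff t p v = l"
proof -
 define u w where "u = p $ 1 / p $ 2" and "w = p $ 3 / p $ 2"
 define Y where "Y = p $ 2"
 have p12: "p $ 1 = u * Y" "p $ 3 = w * Y" "p $ 2 = Y" and Y: "Y ~= 0" using y by (auto simp: u_def w_def Y_def)
 have c: "w = 4 * u^3 - t $ 5 * u * w^2 - t3 t * w^3" using on_cone_chart_at_O[OF p y] by (simp add: u_def w_def)
 define A B where "A = chartE t u w" and "B = t $ 5 * w^2 - 12 * u^2"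
 have AB: "l * A = - 2 * u'" "l * B = 2 * w'" using l by (simp_all add: A_def B_def u_def w_def)
 have "u' * Y^2 = v $ 1 * Y - u * Y * v $ 2" "w' * Y^2 = v $ 3 * Y - w * Y * v $ 2" using u' w' Y unfolding p12 by simp_all
 then have "Y * v $ 1 = Y * (- l * A / 2 * Y + u * v $ 2)" "Y * v $ 3 = Y * (l * B / 2 * Y + w * v $ 2)"
  unfolding minus_mult_left[symmetric] AB by (simp_all add: algebra_simps power2_eq_square)
 then have v1: "v $ 1 = - l * chartE t u w / 2 * Y + u * v $ 2" and v3: "v $ 3 = l * (t $ 5 * w^2 - 12 * u^2) / 2 * Y + w * v $ 2"
  using Y unfolding A_def B_def by simp_all
 show ?thesis
 proof (rule inv_diff_eq[OF t p])
  show "2 * (p $ 2 * v $ 3 - p $ 3 * v $ 2) = l * (t $ 5 * (p $ 3)^2 - 12 * (p $ 1)^2)"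
   unfolding v1 v3 p12 by (simp add: field_simps power2_eq_square)
  have "2 * (p $ 3 * v $ 1 - p $ 1 * v $ 3) = l * Y^2 * (- w - 3 * t $ 5 * u * w^2 - 3 * t3 t * w^3 + 12 * u^3)"
   unfolding v1 v3 p12 chartE_def by (simp add: field_simps pow_eqs)
  also have "- w - 3 * t $ 5 * u * w^2 - 3 * t3 t * w^3 + 12 * u^3 = 2 * w"
  proof -
   have "- w - 3 * A - 3 * B + 3 * U = 2 * w" if "w = U - A - B" for A B U unfolding that by (simp add: algebra_simps)
   from this[OF c] show ?thesis by (simp add: mult.assoc)
  qed
  finally show "2 * (p $ 3 * v $ 1 - p $ 1 * v $ 3) = l * (2 * p $ 2 * p $ 3)"
   unfolding p12 by (simp add: algebra_simps power2_eq_square)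
  show "2 * (p $ 1 * v $ 2 - p $ 2 * v $ 1) = l * ((p $ 2)^2 + 2 * t $ 5 * p $ 1 * p $ 3 + 3 * t3 t * (p $ 3)^2)"
   unfolding v1 v3 p12 chartE_def by (simp add: field_simps power2_eq_square)
 qed
qed

section \<open>Differentiation along paths\<close>

lemma hvd_vec_nth [derivative_intros]:
 "(f hvd f') F ==> ((%x. f x $ k) hvd f' $ k) F" by (rule bounded_linear.has_vector_derivative[OF bounded_linear_vec_nth])

lemma hvd_quotient:
 fixes f g :: "real => complex"
 assumes "(f hvd f') (at s within T)" "(g hvd g') (at s within T)" "g s ~= 0"
 shows "((%s. f s / g s) hvd (f' * g s - f s * g') / (g s)^2) (at s within T)"
 using has_derivative_divide'[OF assms(1,2)[unfolded hvd_def] assms(3)] unfolding hvd_def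
 by (rule has_derivative_eq_rhs) (use assms(3) in "simp add: fun_eq_iff power2_eq_square scaleR_conv_of_real field_simps")

text \<open>At a zero of f the product rule gets by with continuity of g. This spares
  differentiating the square roots that occur in the coordinates at branch points and at O.\<close>

lemma hvd_mult_zero:
 fixes f g :: "real => complex"
 assumes f: "(f hvd f') (at s within T)" and "f s = 0" and g: "(g ---> g s) (at s within T)"
 shows "((%s. f s * g s) hvd f' * g s) (at s within T)"
proof -
 let ?A = "%x. (1 / norm (x - s)) *\<^sub>R (f x - (f s + (x - s) *\<^sub>R f'))"
 let ?B = "%x. ((x - s) / norm (x - s)) *\<^sub>R (f' * (g x - g s))"
 have A: "(?A ---> 0) (at s within T)" using f unfolding hvd_def has_derivative_within by blast
 have "((%x. f' * (g x - g s)) ---> f' * (g s - g s)) (at s within T)" by (intro tendsto_intros g)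
 then have B0: "((%x. f' * (g x - g s)) ---> 0) (at s within T)" by simp
 have "(?B ---> 0) (at s within T)"
 proof (rule Lim_null_comparison)
  show "eventually (%x. norm (?B x) \<le> norm (f' * (g x - g s))) (at s within T)" by (intro always_eventually allI) simp
  show "((%x. norm (f' * (g x - g s))) ---> 0) (at s within T)" using B0 by (rule tendsto_norm_zero)
 qed
 then have "((%x. ?A x * g x + ?B x) ---> 0 * g s + 0) (at s within T)" by (intro tendsto_intros A g)
 moreover have "?A x * g x + ?B x = (1 / norm (x - s)) *\<^sub>R (f x * g x - (f s * g s + (x - s) *\<^sub>R (f' * g s)))" for x
  unfolding assms(2) scaleR_conv_of_real by (simp add: algebra_simps diff_divide_distrib add_divide_distrib)
 ultimately show ?thesis unfolding hvd_def has_derivative_within by (simp add: bounded_linear_scaleR_left)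
qed

text \<open>The coefficients may vary with s: they are constant along a path in a fixed curve, and
  they move when s runs along a line in the parameter space.\<close>

lemma curve_relation:
 fixes x y c2 c3 :: "real => complex"
 assumes "(x hvd x') (at s within T)" "(y hvd y') (at s within T)"
  "(c2 hvd c2') (at s within T)" "(c3 hvd c3') (at s within T)"
  and ev: "eventually (%s. y s ^ 2 = 4 * x s ^ 3 - c2 s * x s - c3 s) (at s within T)"
  and eq: "y s ^ 2 = 4 * x s ^ 3 - c2 s * x s - c3 s" and nt: "at s within T ~= bot" and sT: "s \<in> T"
 shows "2 * y s * y' = (12 * x s ^ 2 - c2 s) * x' - c2' * x s - c3'"
proof -
 have "((%s. y s * y s - (4 * (x s * x s * x s) - c2 s * x s - c3 s)) hvd
   y s * y' + y' * y s - (4 * ((x s * x s) * x' + (x s * x' + x' * x s) * x s) - (c2 s * x' + c2' * x s) - c3'))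
   (at s within T)" by (auto intro!: derivative_eq_intros assms(1-4))
 moreover have "((%s. y s * y s - (4 * (x s * x s * x s) - c2 s * x s - c3 s)) hvd 0) (at s within T)"
 proof -
  have "((%s. 0::complex) hvd 0) (at s within T)" by simp
  moreover have "eventually (%s. 0 = y s * y s - (4 * (x s * x s * x s) - c2 s * x s - c3 s)) (at s within T)"
   using ev by eventually_elim (simp add: pow_eqs)
  moreover have "0 = y s * y s - (4 * (x s * x s * x s) - c2 s * x s - c3 s)" using eq by (simp add: pow_eqs)
  ultimately show ?thesis unfolding hvd_def by (rule has_derivative_transform_eventually[OF _ _ _ sT])
 qed
 ultimately have "y s * y' + y' * y s - (4 * ((x s * x s) * x' + (x s * x' + x' * x s) * x s) - (c2 s * x' + c2' * x s) - c3') = 0"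
  by (rule vector_derivative_unique_within[OF nt])
 then show ?thesis by (simp add: algebra_simps power2_eq_square)
qed

text \<open>Derivatives are taken within \<open>T\<close>, which admits the ends of a path; the
  non-trivial filter makes them unique.\<close>

definition path_at :: "param => real set => (real => complex ^ 3) => real => complex ^ 3 => bool" where
 "path_at t T ga s v \<longleftrightarrow> s \<in> T & at s within T ~= bot & (ga hvd v) (at s within T) &
   (\<forall>s'\<in>T. on_cone t (ga s'))"

lemma hvd_tendsto:
 "(f hvd f') (at s within T) ==> (f ---> f s) (at s within T)" using has_vector_derivative_continuous continuous_within by blast

lemma path_at_affine:
 assumes t: "t \<in> TT" and p: "path_at t T ga s v" and z: "ga s $ 3 ~= 0"
 obtains x' y' where "((%s. ga s $ 1 / ga s $ 3) hvd x') (at s within T)"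
  "((%s. ga s $ 2 / ga s $ 3) hvd y') (at s within T)"
  "eventually (%s'. s' \<in> T & ga s' $ 3 ~= 0 & (ga s' $ 2 / ga s' $ 3)^2 = cubic t (ga s' $ 1 / ga s' $ 3)) (at s within T)"
  "2 * (ga s $ 2 / ga s $ 3) * y' = dcubic t (ga s $ 1 / ga s $ 3) * x'"
  "!!l. l * (ga s $ 2 / ga s $ 3) = x' ==> l * dcubic t (ga s $ 1 / ga s $ 3) = 2 * y' ==> inv_diff t (ga s) v = l"
proof -
 have g: "(ga hvd v) (at s within T)" and c: "!!s'. s' \<in> T ==> on_cone t (ga s')"
  and s: "s \<in> T" and nt: "at s within T ~= bot" using p by (auto simp: path_at_def)
 define x' y' where "x' = (v $ 1 * ga s $ 3 - ga s $ 1 * v $ 3) / (ga s $ 3)^2"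
  and "y' = (v $ 2 * ga s $ 3 - ga s $ 2 * v $ 3) / (ga s $ 3)^2"
 have X: "((%s. ga s $ 1 / ga s $ 3) hvd x') (at s within T)" and Y: "((%s. ga s $ 2 / ga s $ 3) hvd y') (at s within T)"
  unfolding x'_def y'_def by (intro hvd_quotient hvd_vec_nth g z)+
 have "eventually (%s'. ga s' $ 3 ~= 0) (at s within T)"
  by (rule tendsto_imp_eventually_ne[OF hvd_tendsto[OF hvd_vec_nth[OF g]] z])
 moreover have "eventually (%s'. s' \<in> T) (at s within T)" by (auto simp: eventually_at_filter)
 ultimately have ev: "eventually (%s'. s' \<in> T & ga s' $ 3 ~= 0 &
   (ga s' $ 2 / ga s' $ 3)^2 = cubic t (ga s' $ 1 / ga s' $ 3)) (at s within T)" by eventually_elim (use on_cone_affine c in auto)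
 have rel: "2 * (ga s $ 2 / ga s $ 3) * y' = (12 * (ga s $ 1 / ga s $ 3)^2 - t $ 5) * x' - 0 * (ga s $ 1 / ga s $ 3) - 0"
 proof (rule curve_relation[OF X Y hvd_const hvd_const _ _ nt s])
  show "eventually (%s. (ga s $ 2 / ga s $ 3)^2 = 4 * (ga s $ 1 / ga s $ 3)^3 - t $ 5 * (ga s $ 1 / ga s $ 3) - t3 t) (at s within T)"
   using ev by eventually_elim (auto simp: cubic_def)
  show "(ga s $ 2 / ga s $ 3)^2 = 4 * (ga s $ 1 / ga s $ 3)^3 - t $ 5 * (ga s $ 1 / ga s $ 3) - t3 t"
   using on_cone_affine[OF c[OF s] z] by (simp add: cubic_def)
 qed
 show thesis
 proof (rule that[OF X Y ev])
  show "2 * (ga s $ 2 / ga s $ 3) * y' = dcubic t (ga s $ 1 / ga s $ 3) * x'" using rel unfolding dcubic_def by simp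
  show "inv_diff t (ga s) v = l" if "l * (ga s $ 2 / ga s $ 3) = x'" "l * dcubic t (ga s $ 1 / ga s $ 3) = 2 * y'" for l
   by (rule inv_diff_affine[OF t c[OF s] z x'_def y'_def that])
 qed
qed

text \<open>Around O the curve is w = 4 u^3 - t_2 u w^2 - t_3 w^3 with u = w = 0 at O, so w has
  derivative 0 and dx/y is -2 du there.\<close>

lemma path_at_O:
 assumes t: "t \<in> TT" and p: "path_at t T ga s v" and z: "ga s $ 3 = 0"
 obtains u' where "((%s. ga s $ 1 / ga s $ 2) hvd u') (at s within T)"
  "((%s. ga s $ 3 / ga s $ 2) hvd 0) (at s within T)"
  "eventually (%s'. s' \<in> T & ga s' $ 2 ~= 0) (at s within T)"
  "inv_diff t (ga s) v = - 2 * u'"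
proof -
 have g: "(ga hvd v) (at s within T)" and c: "!!s'. s' \<in> T ==> on_cone t (ga s')"
  and s: "s \<in> T" and nt: "at s within T ~= bot" using p by (auto simp: path_at_def)
 have y: "ga s $ 2 ~= 0" and x: "ga s $ 1 = 0" using on_cone_None[OF c[OF s] z] by auto
 define u' w' where "u' = (v $ 1 * ga s $ 2 - ga s $ 1 * v $ 2) / (ga s $ 2)^2"
  and "w' = (v $ 3 * ga s $ 2 - ga s $ 3 * v $ 2) / (ga s $ 2)^2"
 have U: "((%s. ga s $ 1 / ga s $ 2) hvd u') (at s within T)" and W: "((%s. ga s $ 3 / ga s $ 2) hvd w') (at s within T)"
  unfolding u'_def w'_def by (intro hvd_quotient hvd_vec_nth g y)+
 define u w where "u s = ga s $ 1 / ga s $ 2" and "w s = ga s $ 3 / ga s $ 2" for s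
 have "eventually (%s'. ga s' $ 2 ~= 0) (at s within T)"
  by (rule tendsto_imp_eventually_ne[OF hvd_tendsto[OF hvd_vec_nth[OF g]] y])
 moreover have "eventually (%s'. s' \<in> T) (at s within T)" by (auto simp: eventually_at_filter)
 ultimately have ev: "eventually (%s'. s' \<in> T & ga s' $ 2 ~= 0) (at s within T)" by eventually_elim auto
 have eq: "w s' = 4 * (u s' * u s' * u s') - t $ 5 * (u s' * (w s' * w s')) - t3 t * (w s' * w s' * w s')"
  if "s' \<in> T" "ga s' $ 2 ~= 0" for s' using on_cone_chart_at_O[OF c[OF that(1)] that(2)]
  unfolding u_def[symmetric] w_def[symmetric] pow_eqs by (simp only: mult.assoc)
 have us: "u s = 0" "w s = 0" using x z by (auto simp: u_def w_def)
 have U': "(u hvd u') (at s within T)" and W': "(w hvd w') (at s within T)"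
  using U W by (simp_all add: u_def[abs_def] w_def[abs_def])
 have "((%s'. 4 * (u s' * u s' * u s') - t $ 5 * (u s' * (w s' * w s')) - t3 t * (w s' * w s' * w s')) hvd 0) (at s within T)"
  by (auto intro!: derivative_eq_intros U' W' simp: us)
 then have "(w hvd 0) (at s within T)" unfolding hvd_def
 proof (rule has_derivative_transform_eventually)
  show "eventually (%s'. 4 * (u s' * u s' * u s') - t $ 5 * (u s' * (w s' * w s')) - t3 t * (w s' * w s' * w s') = w s') (at s within T)"
   using ev by eventually_elim (use eq in auto)
 qed (simp_all add: us s)
 then have w'0: "w' = 0" by (rule vector_derivative_unique_within[OF nt W'])
 show thesis
 proof (rule that[OF U W[unfolded w'0] ev])
  show "inv_diff t (ga s) v = - 2 * u'"
  proof (rule inv_diff_at_O[OF t c[OF s] y u'_def w'_def])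
   show "- 2 * u' * chartE t (ga s $ 1 / ga s $ 2) (ga s $ 3 / ga s $ 2) = - 2 * u'" by (simp add: chartE_def x z)
   show "- 2 * u' * (t $ 5 * (ga s $ 3 / ga s $ 2)^2 - 12 * (ga s $ 1 / ga s $ 2)^2) = 2 * w'" by (simp add: x z w'0)
  qed
 qed
qed

section \<open>Local coordinates on the curve\<close>

text \<open>A local coordinate \<open>z\<close> at \<open>q\<close>: \<open>fi\<close> parametrises a neighbourhood of \<open>q\<close> with \<open>fi 0 = q\<close>, the affine
 coordinates off the centre are \<open>ks, et\<close>, and \<open>dx/y = ka dz\<close>. The last clause lifts paths through \<open>q\<close>
 to the coordinate.\<close>

abbreviation "lifts t T ga s v fi k \<equiv> \<exists>ze ze'. ze s = 0 & (ze hvd ze') (at s within T) &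
  eventually (%s'. pt (ga s') = fi (ze s')) (at s within T) & inv_diff t (ga s) v = k * ze'"

abbreviation "affine_lifts t T ga s v ks et k \<equiv> \<exists>ze ze'. ze s = 0 & (ze hvd ze') (at s within T) &
  eventually (%s'. ga s' $ 3 ~= 0 & ga s' $ 1 / ga s' $ 3 = ks (ze s') & ga s' $ 2 / ga s' $ 3 = et (ze s')) (at s within T) &
  inv_diff t (ga s) v = k * ze'"

definition chart :: "param => point => real => (complex => point) => (complex => complex) =>
  (complex => complex) => (complex => complex) => bool" where
 "chart t q r fi ks et ka \<longleftrightarrow> r > 0 & fi 0 = q &
   (\<forall>z\<in>ball 0 r - {0}. fi z = Some (ks z, et z) & et z ~= 0 & (ks z, et z) \<in> affine_curve t &
    deriv ks z = ka z * et z) &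
   ks holomorphic_on ball 0 r - {0} & et holomorphic_on ball 0 r - {0} & ka holomorphic_on ball 0 r &
   (\<forall>b. eventually (%z. fi z ~= b) (at 0)) &
   (\<forall>U f. regular_at U f q --> q \<in> U --> eventually (%z. fi z \<in> U) (at 0) --> isCont (%z. f (fi z)) 0) &
   (\<forall>T ga s v. path_at t T ga s v --> pt (ga s) = q -->
    (lifts t T ga s v fi (ka 0)))"

lemma Re_pos_not_nonpos: "Re z > 0 ==> z \<notin> \<real>\<^sub>\<le>\<^sub>0" by (auto simp: complex_nonpos_Reals_iff)

lemma tendsto_csqrt:
 assumes "(f ---> l) F" "Re l > 0"
 shows "((%x. csqrt (f x)) ---> csqrt l) F"
 by (rule isCont_tendsto_compose[OF continuous_at_csqrt[OF Re_pos_not_nonpos[OF assms(2)]] assms(1)])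

lemma isCont_Re_pos_ball:
 assumes "isCont f (0::complex)" "Re (f 0) > 0"
 obtains r where "r > 0" "!!z. z \<in> ball 0 r ==> Re (f z) > 0"
proof -
 have "((%z. Re (f z)) ---> Re (f 0)) (at 0)" using assms(1) by (intro tendsto_Re) (simp add: isCont_def)
 from order_tendstoD(1)[OF this assms(2)] obtain r where r: "r > 0" "!!z. z ~= 0 ==> dist z 0 < r ==> Re (f z) > 0"
  unfolding eventually_at by blast
 show thesis
 proof (rule that[OF r(1)])
  fix z :: complex assume "z \<in> ball 0 r"
  then show "Re (f z) > 0" using r(2)[of z] assms(2) by (cases "z = 0") auto
 qed
qed

lemma cont_at_affine_point:
 assumes reg: "regular_at U f (Some (x0, y0))" and U: "Some (x0, y0) \<in> U"
  and ev: "eventually (%z. Some (ks z, et z) \<in> U) F" and x: "(ks ---> x0) F" and y: "(et ---> y0) F"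
 shows "((%z. f (Some (ks z, et z))) ---> f (Some (x0, y0))) F"
proof -
 obtain P Q where Q: "poly2 Q x0 y0 ~= 0"
  and f: "!!x y. Some (x, y) \<in> U ==> poly2 Q x y ~= 0 ==> f (Some (x, y)) = poly2 P x y / poly2 Q x y"
  by (rule regular_at_SomeE[OF reg]) (rule that)
 have lim: "((%z. poly2 R (ks z) (et z)) ---> poly2 R x0 y0) F" for R
 proof -
  have "continuous_on UNIV (%q. poly2 R (fst q) (snd q))" by (intro continuous_intros)
  then have "isCont (%q. poly2 R (fst q) (snd q)) (x0, y0)" by (simp add: continuous_on_eq_continuous_at)
  from isCont_tendsto_compose[OF this tendsto_Pair[OF x y]] show ?thesis by simp
 qed
 have "((%z. poly2 P (ks z) (et z) / poly2 Q (ks z) (et z)) ---> poly2 P x0 y0 / poly2 Q x0 y0) F" by (intro tendsto_divide lim Q)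
 moreover have "eventually (%z. poly2 P (ks z) (et z) / poly2 Q (ks z) (et z) = f (Some (ks z, et z))) F"
  using ev tendsto_imp_eventually_ne[OF lim Q] by eventually_elim (simp add: f)
 ultimately show ?thesis unfolding f[OF U Q] by (rule Lim_transform_eventually)
qed

lemma cont_at_O:
 assumes reg: "regular_at U f None" and ev: "eventually (%z. Some (ks z, et z) \<in> U & et z ~= 0) F"
  and x: "((%z. ks z / et z) ---> 0) F" and y: "((%z. 1 / et z) ---> 0) F"
 shows "((%z. f (Some (ks z, et z))) ---> f None) F"
proof -
 obtain P Q where Q: "poly2 Q 0 0 ~= 0" and f0: "f None = poly2 P 0 0 / poly2 Q 0 0"
  and f: "!!x y. Some (x, y) \<in> U ==> y ~= 0 ==> poly2 Q (x / y) (1 / y) ~= 0 ==>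
    f (Some (x, y)) = poly2 P (x / y) (1 / y) / poly2 Q (x / y) (1 / y)" by (rule regular_at_NoneE[OF reg]) (rule that)
 have lim: "((%z. poly2 R (ks z / et z) (1 / et z)) ---> poly2 R 0 0) F" for R
 proof -
  have "continuous_on UNIV (%q. poly2 R (fst q) (snd q))" by (intro continuous_intros)
  then have "isCont (%q. poly2 R (fst q) (snd q)) (0, 0)" by (simp add: continuous_on_eq_continuous_at)
  from isCont_tendsto_compose[OF this tendsto_Pair[OF x y]] show ?thesis by simp
 qed
 have "((%z. poly2 P (ks z / et z) (1 / et z) / poly2 Q (ks z / et z) (1 / et z)) ---> poly2 P 0 0 / poly2 Q 0 0) F"
  by (intro tendsto_divide lim Q)
 moreover have "eventually (%z. poly2 P (ks z / et z) (1 / et z) / poly2 Q (ks z / et z) (1 / et z) = f (Some (ks z, et z))) F"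
  using ev tendsto_imp_eventually_ne[OF lim Q] by eventually_elim (simp add: f)
 ultimately show ?thesis unfolding f0 by (rule Lim_transform_eventually)
qed

text \<open>The part shared by the charts at finite points; left open are the parametrisation and
  the lifting of paths.\<close>

lemma chart_affineI:
 assumes r: "r > 0" and x: "ks holomorphic_on ball 0 r" and y: "et holomorphic_on ball 0 r" and k: "ka holomorphic_on ball 0 r"
  and z: "!!z. z \<in> ball 0 r - {0} ==> et z ~= 0 & deriv ks z = ka z * et z & (ks z, et z) ~= (ks 0, et 0)"
  and c: "!!z. z \<in> ball 0 r ==> et z ^ 2 = cubic t (ks z)"
  and lift: "!!T ga s v. path_at t T ga s v ==> ga s $ 3 ~= 0 ==> ga s $ 1 / ga s $ 3 = ks 0 ==> ga s $ 2 / ga s $ 3 = et 0 ==>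
   affine_lifts t T ga s v ks et (ka 0)"
 shows "chart t (Some (ks 0, et 0)) r (%z. Some (ks z, et z)) ks et ka"
proof -
 have cx: "(ks ---> ks 0) (at 0)" and cy: "(et ---> et 0) (at 0)"
  using x y r by (auto dest!: holomorphic_on_imp_continuous_on simp: continuous_on_eq_continuous_at isCont_def)
 have ne: "eventually (%z. Some (ks z, et z) ~= b) (at 0)" for b
 proof (cases "b = Some (ks 0, et 0)")
  case True
  have "eventually (%w. w \<in> ball 0 r - {0}) (at (0::complex))" using r by (intro eventually_at_in_open) auto
  then show ?thesis unfolding True by eventually_elim (use z in auto)
 next
  case False
  show ?thesis
  proof (cases b)
   case (Some q)
   have "((%z. (ks z, et z)) ---> (ks 0, et 0)) (at 0)" by (intro tendsto_Pair cx cy)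
   moreover have "(ks 0, et 0) ~= q" using False Some by simp
   ultimately show ?thesis unfolding Some using tendsto_imp_eventually_ne by fastforce
  qed simp
 qed
 have cont: "isCont (%z. f (Some (ks z, et z))) 0"
  if "regular_at U f (Some (ks 0, et 0))" "Some (ks 0, et 0) \<in> U" "eventually (%z. Some (ks z, et z) \<in> U) (at 0)" for U f
  unfolding isCont_def by (rule cont_at_affine_point[OF that cx cy])
 show ?thesis unfolding chart_def
 proof (intro conjI allI impI ballI)
  show "ks holomorphic_on ball 0 r - {0}" "et holomorphic_on ball 0 r - {0}" using x y by (auto intro: holomorphic_on_subset)
  show "(ks z, et z) \<in> affine_curve t" if "z \<in> ball 0 r - {0}" for z using c[of z] that by (simp add: affine_curve_iff)
  show "\<exists>ze ze'. ze s = 0 & (ze hvd ze') (at s within T) &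
      eventually (%s'. pt (ga s') = Some (ks (ze s'), et (ze s'))) (at s within T) & inv_diff t (ga s) v = ka 0 * ze'"
   if p: "path_at t T ga s v" and q: "pt (ga s) = Some (ks 0, et 0)" for T ga s v
  proof -
   have aff: "ga s $ 3 ~= 0" "ga s $ 1 / ga s $ 3 = ks 0" "ga s $ 2 / ga s $ 3 = et 0"
    using q by (auto simp: pt_def split: if_splits)
   obtain ze ze' where l: "ze s = 0" "(ze hvd ze') (at s within T)"
    "eventually (%s'. ga s' $ 3 ~= 0 & ga s' $ 1 / ga s' $ 3 = ks (ze s') & ga s' $ 2 / ga s' $ 3 = et (ze s')) (at s within T)"
    "inv_diff t (ga s) v = ka 0 * ze'" using lift[OF p aff] by (elim exE conjE) (rule that)
   have "eventually (%s'. pt (ga s') = Some (ks (ze s'), et (ze s'))) (at s within T)"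
    using l(3) by eventually_elim (simp add: pt_def)
   with l(1,2,4) show ?thesis by (intro exI conjI)
  qed
 qed (use r k z in "simp_all add: ne cont")
qed

text \<open>The coordinate is x - x0, and y is \<open>y0\<close> times the principal root of
  f(x)/y0^2, which stays near 1. Paths lift with the right sign because y/y0 stays in the right
  half-plane.\<close>

lemma chart_exists_generic:
 assumes t: "t \<in> TT" and c: "y0^2 = cubic t x0" and y0: "y0 ~= 0"
 shows "\<exists>r fi ks et ka. chart t (Some (x0, y0)) r fi ks et ka"
proof -
 define R where "R z = cubic t (x0 + z) / y0^2" for z
 have "isCont R 0" unfolding R_def cubic_def using y0 by (intro continuous_intros) auto
 moreover have R0: "R 0 = 1" using c y0 by (simp add: R_def flip: c)
 ultimately obtain r where r: "r > 0" and Rr: "!!z. z \<in> ball 0 r ==> Re (R z) > 0" using isCont_Re_pos_ball[of R] by auto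
 define ks where "ks z = x0 + z" for z
 define et where "et z = y0 * csqrt (R z)" for z
 have eta: "et z ~= 0" if "z \<in> ball 0 r" for z using Rr[OF that] y0 by (auto simp: et_def)
 have hol: "et holomorphic_on ball 0 r" unfolding et_def R_def cubic_def using y0 Rr unfolding R_def cubic_def
  by (intro holomorphic_intros) (auto intro!: Re_pos_not_nonpos)
 have d: "deriv ks z = 1" for z unfolding ks_def by (intro DERIV_imp_deriv) (auto intro!: derivative_eq_intros)
 have ch: "chart t (Some (ks 0, et 0)) r (%z. Some (ks z, et z)) ks et (%z. 1 / et z)"
 proof (rule chart_affineI[OF r])
  show "ks holomorphic_on ball 0 r" unfolding ks_def by (intro holomorphic_intros)
  show "(%z. 1 / et z) holomorphic_on ball 0 r" using eta by (intro holomorphic_intros hol) auto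
  show "et z ~= 0 & deriv ks z = 1 / et z * et z & (ks z, et z) ~= (ks 0, et 0)" if "z \<in> ball 0 r - {0}" for z
   using eta[of z] that by (simp add: d) (simp add: ks_def)
  show "et z ^ 2 = cubic t (ks z)" for z using y0 by (simp add: et_def ks_def power_mult_distrib R_def)
  fix T ga s v
  assume p: "path_at t T ga s v" and z: "ga s $ 3 ~= 0" and s1: "ga s $ 1 / ga s $ 3 = ks 0" and s2: "ga s $ 2 / ga s $ 3 = et 0"
  define x y where "x s = ga s $ 1 / ga s $ 3" and "y s = ga s $ 2 / ga s $ 3" for s
  have xy: "x s = x0" "y s = y0" using s1 s2 by (simp_all add: x_def y_def ks_def et_def R0)
  obtain x' y' where X: "(x hvd x') (at s within T)" and Y: "(y hvd y') (at s within T)"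
   and ev: "eventually (%s'. s' \<in> T & ga s' $ 3 ~= 0 & y s' ^ 2 = cubic t (x s')) (at s within T)"
   and rel: "2 * y s * y' = dcubic t (x s) * x'"
   and inv: "!!l. l * y s = x' ==> l * dcubic t (x s) = 2 * y' ==> inv_diff t (ga s) v = l"
   by (rule path_at_affine[OF t p z, folded x_def y_def]) (rule that)
  have "((%s. y s / y0) ---> y s / y0) (at s within T)" using hvd_tendsto[OF Y] y0 by (intro tendsto_intros)
  then have "((%s. Re (y s / y0)) ---> Re (y s / y0)) (at s within T)" by (rule tendsto_Re)
  moreover have "Re (y s / y0) > 0" using xy y0 by simp
  ultimately have ev2: "eventually (%s. Re (y s / y0) > 0) (at s within T)" by (rule order_tendstoD(1))
  show "affine_lifts t T ga s v ks et (1 / et 0)"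
  proof (intro exI conjI)
   show "x s - x0 = 0" using xy by simp
   show "((%s. x s - x0) hvd x') (at s within T)" using hvd_diff[OF X hvd_const] by simp
   show "eventually (%s'. ga s' $ 3 ~= 0 & ga s' $ 1 / ga s' $ 3 = ks (x s' - x0) & ga s' $ 2 / ga s' $ 3 = et (x s' - x0)) (at s within T)"
    using ev ev2
   proof eventually_elim
    case (elim s')
    have "R (x s' - x0) = (y s' / y0)^2" using elim by (simp add: R_def power_divide)
    moreover have "csqrt ((y s' / y0)^2) = y s' / y0" by (rule csqrt_square) (use elim in blast)
    ultimately have "csqrt (R (x s' - x0)) = y s' / y0" by (simp only:)
    then have "et (x s' - x0) = y s'" using y0 by (simp add: et_def)
    then show ?case using elim by (simp add: ks_def x_def y_def)
   qed
   have "inv_diff t (ga s) v = x' / y0"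
   proof (rule inv)
    show "x' / y0 * y s = x'" using xy y0 by simp
    show "x' / y0 * dcubic t (x s) = 2 * y'" using rel y0 unfolding xy by (simp add: field_simps)
   qed
   then show "inv_diff t (ga s) v = 1 / et 0 * x'" by (simp add: et_def R0)
  qed
 qed (rule hol)
 have "ks 0 = x0" "et 0 = y0" by (simp_all add: ks_def et_def R0)
 with ch show ?thesis by (intro exI) (simp only:)
qed

text \<open>The coordinate satisfies x = x0 + z^2. Since f(x0 + \<delta>) = \<delta> D(\<delta>),
  one has y = z S(z^2) with S^2 = D, and dx/y = (2/S) dz. A path lifts to z = y/S(x - x0),
  differentiable by \<open>hvd_mult_zero\<close> because y vanishes at the branch point.\<close>

lemma chart_exists_branch:
 assumes t: "t \<in> TT" and c: "cubic t x0 = 0"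
 shows "\<exists>r fi ks et ka. chart t (Some (x0, 0)) r fi ks et ka"
proof -
 define d0 where "d0 = dcubic t x0"
 have d0: "d0 ~= 0" unfolding d0_def by (rule dcubic_nonzero[OF t c])
 define D where "D \<delta> = d0 + 12 * x0 * \<delta> + 4 * \<delta>^2" for \<delta>
 have cub: "cubic t (x0 + \<delta>) = \<delta> * D \<delta>" for \<delta>
 proof -
  have "cubic t (x0 + \<delta>) = cubic t x0 + \<delta> * D \<delta>"
   unfolding cubic_def D_def d0_def dcubic_def by (simp add: algebra_simps pow_eqs)
  then show ?thesis using c by simp
 qed
 \<comment> \<open>Splitting off the root of \<open>d0\<close> keeps the argument of the other
   principal root near 1, away from the cut.\<close>
 define S where "S \<delta> = csqrt d0 * csqrt (D \<delta> / d0)" for \<delta>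
 have S2: "S \<delta> ^ 2 = D \<delta>" for \<delta> using d0 by (simp add: S_def power_mult_distrib)
 have S0: "S 0 = csqrt d0" using d0 by (simp add: S_def D_def)
 have D0: "D 0 = d0" by (simp add: D_def)
 have "isCont (%z. D (z^2) / d0) 0" unfolding D_def using d0 by (intro continuous_intros) auto
 then obtain r where r: "r > 0" and Rr: "!!z. z \<in> ball 0 r ==> Re (D (z^2) / d0) > 0"
  using isCont_Re_pos_ball[of "%z. D (z^2) / d0"] d0 D0 by auto
 have Snz: "S (z^2) ~= 0" if "z \<in> ball 0 r" for z using Rr[OF that] d0 by (auto simp: S_def)
 define ks where "ks z = x0 + z^2" for z
 define et where "et z = z * S (z^2)" for z
 have holS: "(%z. S (z^2)) holomorphic_on ball 0 r" unfolding S_def D_def using d0 Rr unfolding D_def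
  by (intro holomorphic_intros) (auto intro!: Re_pos_not_nonpos)
 have d: "deriv ks z = 2 * z" for z unfolding ks_def by (intro DERIV_imp_deriv) (auto intro!: derivative_eq_intros)
 have ch: "chart t (Some (ks 0, et 0)) r (%z. Some (ks z, et z)) ks et (%z. 2 / S (z^2))"
 proof (rule chart_affineI[OF r])
  show "ks holomorphic_on ball 0 r" unfolding ks_def by (intro holomorphic_intros)
  show "et holomorphic_on ball 0 r" unfolding et_def by (intro holomorphic_intros holS)
  show "(%z. 2 / S (z^2)) holomorphic_on ball 0 r" using Snz by (intro holomorphic_intros holS) auto
  show "et z ~= 0 & deriv ks z = 2 / S (z^2) * et z & (ks z, et z) ~= (ks 0, et 0)" if "z \<in> ball 0 r - {0}" for z
   using Snz[of z] that by (simp add: d) (simp add: ks_def et_def)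
  show "et z ^ 2 = cubic t (ks z)" for z by (simp add: et_def ks_def power_mult_distrib S2 cub)
  fix T ga s v
  assume p: "path_at t T ga s v" and z: "ga s $ 3 ~= 0" and s1: "ga s $ 1 / ga s $ 3 = ks 0" and s2: "ga s $ 2 / ga s $ 3 = et 0"
  define x y where "x s = ga s $ 1 / ga s $ 3" and "y s = ga s $ 2 / ga s $ 3" for s
  have xy: "x s = x0" "y s = 0" using s1 s2 by (simp_all add: x_def y_def ks_def et_def)
  obtain x' y' where X: "(x hvd x') (at s within T)" and Y: "(y hvd y') (at s within T)"
   and ev: "eventually (%s'. s' \<in> T & ga s' $ 3 ~= 0 & y s' ^ 2 = cubic t (x s')) (at s within T)"
   and rel: "2 * y s * y' = dcubic t (x s) * x'"
   and inv: "!!l. l * y s = x' ==> l * dcubic t (x s) = 2 * y' ==> inv_diff t (ga s) v = l"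
   by (rule path_at_affine[OF t p z, folded x_def y_def]) (rule that)
  have "((%s. D (x s - x0) / d0) ---> D (x s - x0) / d0) (at s within T)"
   unfolding D_def using d0 by (intro tendsto_intros hvd_tendsto[OF X])
  then have lim: "((%s. D (x s - x0) / d0) ---> 1) (at s within T)" using xy d0 by (simp add: D0)
  have ev2: "eventually (%s'. D (x s' - x0) / d0 ~= 0) (at s within T)" by (rule tendsto_imp_eventually_ne[OF lim]) simp
  have limS: "((%s. S (x s - x0)) ---> S (x s - x0)) (at s within T)"
   unfolding S_def using xy d0 tendsto_csqrt[OF lim] by (intro tendsto_intros) (simp add: D0)
  have Ss: "S (x s - x0) = csqrt d0" using xy S0 by simp
  show "affine_lifts t T ga s v ks et (2 / S (0^2))"
  proof (intro exI conjI)
   show "y s * (1 / S (x s - x0)) = 0" using xy by simp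
   show "((%s. y s * (1 / S (x s - x0))) hvd y' * (1 / S (x s - x0))) (at s within T)" by (rule hvd_mult_zero[OF Y xy(2)])
     (intro tendsto_intros limS, use Ss d0 in simp)
   show "eventually (%s'. ga s' $ 3 ~= 0 & ga s' $ 1 / ga s' $ 3 = ks (y s' * (1 / S (x s' - x0))) &
     ga s' $ 2 / ga s' $ 3 = et (y s' * (1 / S (x s' - x0)))) (at s within T)" using ev ev2
   proof eventually_elim
    case (elim s')
    have Dn: "D (x s' - x0) ~= 0" using elim by auto
    then have Sn: "S (x s' - x0) ~= 0" using S2 by (metis power_zero_numeral)
    have "(y s' * (1 / S (x s' - x0)))^2 = y s' ^ 2 / D (x s' - x0)" by (simp add: power_mult_distrib power_divide S2)
    also have "\<dots> = x s' - x0" using elim Dn cub[of "x s' - x0"] by simp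
    finally have sq: "(y s' * (1 / S (x s' - x0)))^2 = x s' - x0" .
    show ?case using elim Sn unfolding ks_def et_def sq by (simp add: x_def y_def)
   qed
   have dd: "csqrt d0 * csqrt d0 = d0" by (metis power2_csqrt power2_eq_square)
   have "inv_diff t (ga s) v = 2 * y' / d0"
   proof (rule inv)
    show "2 * y' / d0 * y s = x'" using rel xy d0 by (simp add: d0_def)
    show "2 * y' / d0 * dcubic t (x s) = 2 * y'" using xy d0 by (simp add: d0_def)
   qed
   also have "2 * y' / d0 = 2 / S (0^2) * (y' * (1 / S (x s - x0)))" using S0 Ss dd by simp
   finally show "inv_diff t (ga s) v = 2 / S (0^2) * (y' * (1 / S (x s - x0)))" .
  qed
 qed
 have "ks 0 = x0" "et 0 = 0" by (simp_all add: ks_def et_def)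
 with ch show ?thesis by (intro exI) (simp only:)
qed

text \<open>The coordinate satisfies x = 1/z^2 and y = 2 S(z^2)/z^3, where S(\<rho>)^2 = 1 - t_2
  \<rho>^2/4 - t_3 \<rho>^3/4. Along a path \<rho> = 1/x is computed as 4 u^2/M, which makes sense
  at O too, and z = 2 u S(\<rho>).\<close>

lemma chart_exists_O:
 assumes t: "t \<in> TT"
 shows "\<exists>r fi ks et ka. chart t None r fi ks et ka"
proof -
 define D where "D rh = 1 - t $ 5 * rh^2 / 4 - t3 t * rh^3 / 4" for rh
 define S where "S rh = csqrt (D rh)" for rh
 have S2: "S rh ^ 2 = D rh" for rh by (simp add: S_def)
 have S0: "S 0 = 1" "D 0 = 1" by (simp_all add: S_def D_def)
 have "isCont (%z. D (z^2)) 0" unfolding D_def by (intro continuous_intros) auto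
 then obtain r where r: "r > 0" and Rr: "!!z. z \<in> ball 0 r ==> Re (D (z^2)) > 0"
  using isCont_Re_pos_ball[of "%z. D (z^2)"] S0 by auto
 have Snz: "S (z^2) ~= 0" if "z \<in> ball 0 r" for z using Rr[OF that] by (auto simp: S_def)
 define ks where "ks z = 1 / z^2" for z :: complex
 define et where "et z = 2 * S (z^2) / z^3" for z
 define fi where "fi z = (if z = 0 then None else Some (ks z, et z))" for z
 have holS: "(%z. S (z^2)) holomorphic_on ball 0 r" unfolding S_def D_def using Rr unfolding D_def
  by (intro holomorphic_intros) (auto intro!: Re_pos_not_nonpos)
 then have holS': "(%z. S (z^2)) holomorphic_on ball 0 r - {0}" by (rule holomorphic_on_subset) auto
 have "isCont (%z. S (z^2)) 0"
  using holomorphic_on_imp_continuous_on[OF holS] r continuous_on_eq_continuous_at[OF open_ball, of 0 r] by (metis centre_in_ball)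
 then have contS: "((%z. S (z^2)) ---> 1) (at 0)" by (simp add: isCont_def S0)
 have d: "deriv ks z = - 2 / z^3" if "z ~= 0" for z unfolding ks_def using that
  by (intro DERIV_imp_deriv) (auto intro!: derivative_eq_intros simp: pow_eqs)
 have ball: "eventually (%w. w \<in> ball 0 r - {0}) (at (0::complex))" using r by (intro eventually_at_in_open) auto
 have u0: "((%z. ks z / et z) ---> 0) (at 0)"
 proof (rule Lim_transform_eventually)
  show "((%z. z / (2 * S (z^2))) ---> 0) (at 0)" by (auto intro!: tendsto_eq_intros contS)
  show "eventually (%z. z / (2 * S (z^2)) = ks z / et z) (at 0)"
   using ball by eventually_elim (use Snz in "simp add: ks_def et_def field_simps pow_eqs")
 qed
 have v0: "((%z. 1 / et z) ---> 0) (at 0)"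
 proof (rule Lim_transform_eventually)
  show "((%z. z^3 / (2 * S (z^2))) ---> 0) (at 0)" by (auto intro!: tendsto_eq_intros contS)
  show "eventually (%z. z^3 / (2 * S (z^2)) = 1 / et z) (at 0)" using ball by eventually_elim (simp add: et_def)
 qed
 have "chart t None r fi ks et (%z. - 1 / S (z^2))" unfolding chart_def
 proof (intro conjI allI impI ballI)
  show "ks holomorphic_on ball 0 r - {0}" unfolding ks_def by (intro holomorphic_intros) auto
  show "et holomorphic_on ball 0 r - {0}" unfolding et_def by (intro holomorphic_intros holS') auto
  show "(%z. - 1 / S (z^2)) holomorphic_on ball 0 r" using Snz by (intro holomorphic_intros holS) auto
  fix z :: complex assume z: "z \<in> ball 0 r - {0}"
  then have z': "z ~= 0" "S (z^2) ~= 0" using Snz by auto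
  show "fi z = Some (ks z, et z)" using z by (simp add: fi_def)
  show "et z ~= 0" using z' by (simp add: et_def)
  have "et z ^ 2 = 4 * D (z^2) / z^6" by (simp add: et_def power_divide power_mult_distrib S2 flip: power_mult)
  also have "\<dots> = cubic t (ks z)"
   using z' by (simp add: cubic_def D_def ks_def power_divide diff_divide_distrib flip: power_mult)
    (simp add: field_simps power_numeral_reduce)
  finally show "(ks z, et z) \<in> affine_curve t" by (simp add: affine_curve_iff)
  show "deriv ks z = - 1 / S (z^2) * et z" using z' by (simp add: d et_def)
 next
  fix b :: point
  show "eventually (%z. fi z ~= b) (at 0)"
  proof (cases b)
   case None
   show ?thesis using ball by eventually_elim (simp add: fi_def None)
  next
   case (Some q)
   have "((%z. fst q * z^2) ---> fst q * 0^2) (at 0)" by (intro tendsto_intros)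
   then have "eventually (%z. fst q * z^2 ~= 1) (at 0)" by (intro tendsto_imp_eventually_ne[of _ 0]) simp_all
   with ball show ?thesis by eventually_elim (auto simp: fi_def Some ks_def)
  qed
 next
  fix U f assume f: "regular_at U f None" and U: "eventually (%z. fi z \<in> U) (at 0)"
  have "eventually (%z. Some (ks z, et z) \<in> U & et z ~= 0) (at 0)"
   using U ball by eventually_elim (use Snz in "auto simp: fi_def et_def")
  from cont_at_O[OF f this u0 v0] have "((%z. f (Some (ks z, et z))) ---> f None) (at 0)" .
  moreover have "eventually (%z. f (Some (ks z, et z)) = f (fi z)) (at 0)" using ball by eventually_elim (simp add: fi_def)
  ultimately show "isCont (%z. f (fi z)) 0" unfolding isCont_def by (simp add: fi_def Lim_transform_eventually)
 next
  fix T ga s v assume p: "path_at t T ga s v" and q: "pt (ga s) = None"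
  then have z: "ga s $ 3 = 0" by (auto simp: pt_def split: if_splits)
  have c: "!!s'. s' \<in> T ==> on_cone t (ga s')" and s: "s \<in> T" using p by (auto simp: path_at_def)
  define u w where "u s = ga s $ 1 / ga s $ 2" and "w s = ga s $ 3 / ga s $ 2" for s
  obtain u' where U: "(u hvd u') (at s within T)" and W: "(w hvd 0) (at s within T)"
   and ev: "eventually (%s'. s' \<in> T & ga s' $ 2 ~= 0) (at s within T)" and inv: "inv_diff t (ga s) v = - 2 * u'"
   by (rule path_at_O[OF t p z, folded u_def w_def]) (rule that)
  have us: "u s = 0" "w s = 0" using z on_cone_None[OF c[OF s] z] by (auto simp: u_def w_def)
  define M where "M s = 1 + t $ 5 * u s * w s + t3 t * w s ^ 2" for s
  have "(M ---> M s) (at s within T)" unfolding M_def by (intro tendsto_intros hvd_tendsto[OF U] hvd_tendsto[OF W])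
  then have M: "(M ---> 1) (at s within T)" using us by (simp add: M_def)
  then have ev2: "eventually (%s. M s ~= 0) (at s within T)" by (rule tendsto_imp_eventually_ne) simp
  define rh where "rh s = 4 * u s ^ 2 / M s" for s
  have "(rh ---> 4 * u s ^ 2 / 1) (at s within T)" unfolding rh_def by (intro tendsto_intros hvd_tendsto[OF U] M) simp
  then have rho: "(rh ---> 0) (at s within T)" using us by simp
  have "((%s. D (rh s)) ---> D 0) (at s within T)" unfolding D_def by (intro tendsto_intros rho) simp_all
  then have limS: "((%s. 2 * S (rh s)) ---> 2 * 1) (at s within T)"
   unfolding S_def S0 using tendsto_csqrt[of _ 1] by (intro tendsto_intros) simp
  have Ss: "S (rh s) = 1" using us S0 by (simp add: rh_def)
  show "lifts t T ga s v fi (- 1 / S (0^2))"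
  proof (intro exI conjI)
   show "u s * (2 * S (rh s)) = 0" using us by simp
   show "((%s. u s * (2 * S (rh s))) hvd u' * (2 * S (rh s))) (at s within T)"
    by (rule hvd_mult_zero[OF U us(1)]) (use limS Ss in simp)
   show "inv_diff t (ga s) v = - 1 / S (0^2) * (u' * (2 * S (rh s)))" using inv S0 Ss by simp
   show "eventually (%s'. pt (ga s') = fi (u s' * (2 * S (rh s')))) (at s within T)" using ev ev2
   proof eventually_elim
    case (elim s')
    have E: "w s' * M s' = 4 * u s' ^ 3"
    proof -
     have "w s' = 4 * u s' ^ 3 - t $ 5 * u s' * w s' ^ 2 - t3 t * w s' ^ 3"
      using on_cone_chart_at_O[OF c[of s']] elim unfolding u_def[symmetric] w_def[symmetric] by blast
     moreover have "b = U - A - B ==> b + A + B = U" for b U A B :: complex by simp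
     ultimately have "w s' + t $ 5 * u s' * w s' ^ 2 + t3 t * w s' ^ 3 = 4 * u s' ^ 3" by blast
     moreover have "w s' * M s' = w s' + t $ 5 * u s' * w s' ^ 2 + t3 t * w s' ^ 3" by (simp add: M_def algebra_simps pow_eqs)
     ultimately show ?thesis by simp
    qed
    show ?case
    proof (cases "ga s' $ 3 = 0")
     case True
     then have "u s' = 0" using on_cone_None[OF c[of s']] elim by (simp add: u_def)
     then show ?thesis using True by (simp add: pt_def fi_def)
    next
     case False
     define x y where "x = ga s' $ 1 / ga s' $ 3" and "y = ga s' $ 2 / ga s' $ 3"
     have wn: "w s' ~= 0" using False elim by (simp add: w_def)
     then have un: "u s' ~= 0" using E elim by auto
     have yw: "y = 1 / w s'" and xu: "x = u s' / w s'" using elim False by (simp_all add: x_def y_def u_def w_def)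
     have rw: "rh s' = w s' / u s'" using E elim un by (simp add: rh_def field_simps pow_eqs)
     have yc: "y^2 = cubic t x" using on_cone_affine[OF c[of s'] False] elim by (simp add: x_def y_def)
     have xr: "x = 1 / rh s'" "rh s' ~= 0" using xu rw un wn by simp_all
     have "D (rh s') = rh s' ^ 3 * cubic t x / 4" unfolding xr(1) D_def cubic_def using xr(2) by (simp add: field_simps pow_eqs)
     then have "S (rh s') ^ 2 = rh s' ^ 3 * y^2 / 4" unfolding S2 yc .
     then have sq: "(u s' * (2 * S (rh s')))^2 = rh s'"
      unfolding power_mult_distrib yw rw using un wn by (simp add: field_simps pow_eqs)
     have zn: "u s' * (2 * S (rh s')) ~= 0" using sq xr(2) by (metis power_zero_numeral)
     have "et (u s' * (2 * S (rh s'))) = 2 * S (rh s') / ((u s' * (2 * S (rh s')))^2 * (u s' * (2 * S (rh s'))))"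
      unfolding et_def sq[unfolded power2_eq_square] power3_eq_cube power2_eq_square by simp
     also have "\<dots> = 1 / (rh s' * u s')" unfolding sq using zn by (simp add: field_simps)
     also have "\<dots> = y" unfolding yw rw using un by simp
     finally have "et (u s' * (2 * S (rh s'))) = y" .
     moreover have "ks (u s' * (2 * S (rh s'))) = x" unfolding ks_def sq xr(1) ..
     ultimately show ?thesis using False zn by (simp add: pt_def fi_def x_def y_def)
    qed
   qed
  qed
 qed (use r in "simp_all add: fi_def")
 then show ?thesis by blast
qed

lemma chart_exists:
 assumes t: "t \<in> TT" and q: "q \<in> XX t"
 obtains r fi ks et ka where "chart t q r fi ks et ka"
proof (cases q)
 case None
 then show ?thesis using chart_exists_O[OF t] that by blast
next
 case (Some p)
 obtain x y where p: "p = (x, y)" by (cases p)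
 have c: "y^2 = cubic t x" using q Some p by (simp add: Some_in_XX)
 show ?thesis
 proof (cases "y = 0")
  case True
  then show ?thesis using chart_exists_branch[OF t, of x] c Some p that by fastforce
 next
  case False
  then show ?thesis using chart_exists_generic[OF t c] Some p that by blast
 qed
qed

section \<open>Integrating exact forms along paths\<close>

lemma chartD:
 assumes "chart t q r fi ks et ka"
 shows "r > 0" "fi 0 = q"
  and "!!z. z \<in> ball 0 r - {0} ==> fi z = Some (ks z, et z) & et z ~= 0 & (ks z, et z) \<in> affine_curve t &
    deriv ks z = ka z * et z"
  and "ks holomorphic_on ball 0 r - {0}" "et holomorphic_on ball 0 r - {0}" "ka holomorphic_on ball 0 r"
  and "!!b. eventually (%z. fi z ~= b) (at 0)"
  and "!!U f. regular_at U f q ==> q \<in> U ==> eventually (%z. fi z \<in> U) (at 0) ==> isCont (%z. f (fi z)) 0"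
  and "!!T ga s v. path_at t T ga s v ==> pt (ga s) = q ==>
    lifts t T ga s v fi (ka 0)"
proof -
 note c1 = assms[unfolded chart_def]
 note c2 = c1[THEN conjunct2] note c3 = c2[THEN conjunct2] note c4 = c3[THEN conjunct2]
 note c5 = c4[THEN conjunct2] note c6 = c5[THEN conjunct2] note c7 = c6[THEN conjunct2]
 note c8 = c7[THEN conjunct2] note c9 = c8[THEN conjunct2]
 show "r > 0" "fi 0 = q" by (rule c1[THEN conjunct1] c2[THEN conjunct1])+
 show "fi z = Some (ks z, et z) & et z ~= 0 & (ks z, et z) \<in> affine_curve t & deriv ks z = ka z * et z"
  if "z \<in> ball 0 r - {0}" for z by (rule c3[THEN conjunct1, rule_format, OF that])
 show "ks holomorphic_on ball 0 r - {0}" "et holomorphic_on ball 0 r - {0}" "ka holomorphic_on ball 0 r"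
  by (rule c4[THEN conjunct1] c5[THEN conjunct1] c6[THEN conjunct1])+
 show "eventually (%z. fi z ~= b) (at 0)" for b by (rule c7[THEN conjunct1, THEN spec])
 show "isCont (%z. f (fi z)) 0" if "regular_at U f q" "q \<in> U" "eventually (%z. fi z \<in> U) (at 0)" for U f
  using c8[THEN conjunct1, THEN spec, THEN spec, of U f] that by (iprover elim: impE)
 show "lifts t T ga s v fi (ka 0)"
  if "path_at t T ga s v" "pt (ga s) = q" for T ga s v
  by (rule c9[THEN spec, THEN spec, THEN spec, THEN spec, THEN mp, THEN mp, OF that])
qed

text \<open>\<open>q\<close> may be a point outside \<open>W\<close>, where \<open>f\<close> carries
  no information. But the pull-back of h dx/y to the chart is continuous at the centre, hence
  holomorphic there, and has a primitive G. On the connected punctured disc f - G is constant, so f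
  extends across the centre.\<close>

lemma local_primitive:
 assumes W: "finite (XX t - W)" "W <= U" and h: "regular_on U h" and f: "regular_on W f" and d: "is_differential W f h"
  and ch: "chart t q r fi ks et ka" and q: "q \<in> U"
 shows "eventually (%z. fi z \<in> W) (at 0)" and "\<exists>c. (q \<in> W --> c = f q) &
   ((%z. if z = 0 then c else f (fi z)) has_field_derivative h q * ka 0) (at 0)"
proof -
 note r = chartD(1)[OF ch] and q0 = chartD(2)[OF ch] and z = chartD(3)[OF ch] and hol = chartD(4-6)[OF ch]
  and ne = chartD(7)[OF ch] and cont = chartD(8)[OF ch]
 have "eventually (%z. \<forall>b\<in>XX t - W. fi z ~= b) (at 0)" using ne by (simp add: eventually_ball_finite_distrib[OF W(1)])
 moreover have "eventually (%w. w \<in> ball 0 r - {0}) (at (0::complex))" using r by (intro eventually_at_in_open) auto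
 ultimately show ev: "eventually (%z. fi z \<in> W) (at 0)"
 proof eventually_elim
  case (elim w)
  then have "fi w \<in> XX t" using z by (auto simp: XX_def)
  then show ?case using elim by blast
 qed
 then obtain r0 where r0: "r0 > 0" "!!z. z ~= 0 ==> dist z 0 < r0 ==> fi z \<in> W" unfolding eventually_at by blast
 define B where "B = ball (0::complex) (min r r0)"
 have B: "open B" "0 \<in> B" "open (B - {0})" using r r0(1) by (auto simp: B_def intro: open_delete)
 have Bz: "fi w = Some (ks w, et w)" "et w ~= 0" "deriv ks w = ka w * et w" "fi w \<in> W"
  if "w \<in> B - {0}" for w using that z[of w] r0(2)[of w] by (auto simp: B_def)
 have BU: "fi w \<in> U" if "w \<in> B" for w
 proof (cases "w = 0")
  case True
  show ?thesis unfolding True q0 by (rule q)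
 next
  case False
  then show ?thesis using Bz(4)[of w] W(2) that by blast
 qed
 have holB: "ks holomorphic_on B - {0}" "et holomorphic_on B - {0}" "ka holomorphic_on B"
  by (rule holomorphic_on_subset[OF hol(1)] holomorphic_on_subset[OF hol(2)] holomorphic_on_subset[OF hol(3)],
    force simp: B_def)+
 have BzW: "Some (ks w, et w) \<in> W" if "w \<in> B - {0}" for w using Bz(1,4)[OF that] by simp
 have holf: "(%w. f (Some (ks w, et w))) holomorphic_on B - {0}" by (rule regular_on_holomorphic[OF f B(3) holB(1,2) BzW])
 have holh: "(%w. h (Some (ks w, et w))) holomorphic_on B - {0}"
  by (rule regular_on_holomorphic[OF h B(3) holB(1,2)]) (use BzW W(2) in blast)
 define H where "H w = h (fi w) * ka w" for w
 have holk: "ka holomorphic_on B - {0}" using holB(3) by (rule holomorphic_on_subset) auto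
 have holH: "H holomorphic_on B - {0}"
 proof (rule holomorphic_transform)
  show "(%w. h (Some (ks w, et w)) * ka w) holomorphic_on B - {0}" by (intro holomorphic_intros holh holk)
 qed (simp add: H_def Bz)
 have "isCont H w" if w: "w \<in> B" for w
 proof (cases "w = 0")
  case True
  have "eventually (%z. fi z \<in> U) (at 0)" using ev by eventually_elim (use W(2) in blast)
  moreover have "regular_at U h q" using h q by (simp add: regular_on_def)
  ultimately have "isCont (%z. h (fi z)) 0" using cont q by blast
  moreover have "isCont ka 0" using holomorphic_on_imp_continuous_on[OF holB(3)] B continuous_on_eq_continuous_at by blast
  ultimately show ?thesis unfolding True H_def[abs_def] by (intro continuous_intros)
 next
  case False
  then show ?thesis using holomorphic_on_imp_continuous_on[OF holH] B(3) w continuous_on_eq_continuous_at by blast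
 qed
 then have "continuous_on B H" using B(1) by (simp add: continuous_on_eq_continuous_at)
 from no_isolated_singularity[OF this holH B(1)] have "H holomorphic_on B" by simp
 then obtain G where G: "!!w. w \<in> B ==> (G has_field_derivative H w) (at w within B)"
  using holomorphic_convex_primitive'[of B H] B(1) unfolding B_def by auto
 then have G': "(G has_field_derivative H w) (at w)" if "w \<in> B" for w using that B(1) by (metis at_within_open)
 have d0: "((%w. f (Some (ks w, et w)) - G w) has_field_derivative 0) (at w)" if w: "w \<in> B - {0}" for w
 proof -
  have "deriv (%w. f (Some (ks w, et w))) w * et w = h (Some (ks w, et w)) * deriv ks w"
   by (rule is_differentialD[OF d B(3) holB(1,2) BzW w])
  then have "deriv (%w. f (Some (ks w, et w))) w = H w" using Bz(2)[OF w] by (simp add: H_def Bz(1,3)[OF w])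
  then have "((%w. f (Some (ks w, et w))) has_field_derivative H w) (at w)" using holomorphic_derivI[OF holf B(3) w] by simp
  from DERIV_diff[OF this G'[of w]] w show ?thesis by simp
 qed
 have conn: "connected (B - {0})" unfolding B_def by (rule connected_open_delete) auto
 obtain k where k: "!!w. w \<in> B - {0} ==> f (Some (ks w, et w)) - G w = k"
 proof (rule DERIV_zero_connected_constant[OF conn B(3) finite.emptyI])
  show "continuous_on (B - {0}) (%w. f (Some (ks w, et w)) - G w)"
   using d0 B(3) by (auto simp: continuous_on_eq_continuous_at intro: DERIV_isCont)
  show "\<forall>x\<in>B - {0} - {}. ((%w. f (Some (ks w, et w)) - G w) has_field_derivative 0) (at x)" using d0 by simp
 qed (rule that)
 have fG: "f (fi w) = G w + k" if "w \<in> B - {0}" for w using k[OF that] Bz(1)[OF that] by (simp add: algebra_simps)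
 have "((%w. G w + k) has_field_derivative H 0) (at 0)" using DERIV_add[OF G'[OF B(2)] DERIV_const[of k]] by simp
 then have "((%z. if z = 0 then G 0 + k else f (fi z)) has_field_derivative H 0) (at 0)"
  by (rule has_field_derivative_transform_within_open[OF _ B(1,2)]) (simp add: fG)
 then have D: "((%z. if z = 0 then G 0 + k else f (fi z)) has_field_derivative h q * ka 0) (at 0)" by (simp add: H_def q0)
 have "G 0 + k = f q" if "q \<in> W"
 proof -
  have "regular_at W f q" using f that by (simp add: regular_on_def)
  from cont[OF this that ev] have "((%z. f (fi z)) ---> f q) (at 0)" by (simp add: isCont_def q0)
  moreover have "((%z. f (fi z)) ---> G 0 + k) (at 0)"
  proof (rule Lim_transform_eventually)
   have "isCont G 0" using G'[OF B(2)] DERIV_isCont by blast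
   then show "((%z. G z + k) ---> G 0 + k) (at 0)" by (intro tendsto_intros) (simp add: isCont_def)
   have "eventually (%w. w \<in> B - {0}) (at (0::complex))" using B by (intro eventually_at_in_open) auto
   then show "eventually (%z. G z + k = f (fi z)) (at 0)" by eventually_elim (simp add: fG)
  qed
  ultimately show ?thesis using LIM_unique by blast
 qed
 then show "\<exists>c. (q \<in> W --> c = f q) &
   ((%z. if z = 0 then c else f (fi z)) has_field_derivative h q * ka 0) (at 0)" using D by (intro exI[of _ "G 0 + k"]) simp
qed

text \<open>Two related forms differ by df on some \<open>W\<close> that may miss points of the
  cycle. Filling the missing points with the local constants gives a primitive along every path in
  \<open>U\<close>.\<close>

lemma path_primitive:
 assumes t: "t \<in> TT" and W: "finite (XX t - W)" "W <= U" "U <= XX t"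
  and h: "regular_on U h" and f: "regular_on W f" and d: "is_differential W f h"
 obtains F where "!!p. p \<in> W ==> F p = f p"
  "!!T ga s v. path_at t T ga s v ==> pt (ga s) \<in> U ==>
    ((%s. F (pt (ga s))) hvd h (pt (ga s)) * inv_diff t (ga s) v) (at s within T)"
proof -
 define P where "P q c \<longleftrightarrow> (q \<in> W --> c = f q) & (\<exists>r fi ks et ka. chart t q r fi ks et ka &
   ((%z. if z = 0 then c else f (fi z)) has_field_derivative h q * ka 0) (at 0))" for q c
 have ex: "\<exists>c. P q c" if q: "q \<in> U" for q
 proof -
  obtain r fi ks et ka where ch: "chart t q r fi ks et ka" by (rule chart_exists[OF t]) (use q W(3) in blast)+
  from local_primitive(2)[OF W(1,2) h f d ch q] obtain c where "q \<in> W --> c = f q"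
   "((%z. if z = 0 then c else f (fi z)) has_field_derivative h q * ka 0) (at 0)" by (elim exE conjE)
  then show ?thesis unfolding P_def using ch by (intro exI[of _ c] conjI exI)
 qed
 define C where "C q = (SOME c. P q c)" for q
 have C: "P q (C q)" if "q \<in> U" for q unfolding C_def using ex[OF that] by (rule someI_ex)
 define F where "F p = (if p \<in> W then f p else C p)" for p
 have FC: "F q = C q" if "q \<in> U" for q using C[OF that] by (simp add: F_def P_def)
 show thesis
 proof (rule that[of F])
  fix T ga s v assume p: "path_at t T ga s v" and q: "pt (ga s) \<in> U"
  obtain r fi ks et ka where ch: "chart t (pt (ga s)) r fi ks et ka"
   and D: "((%z. if z = 0 then C (pt (ga s)) else f (fi z)) has_field_derivative h (pt (ga s)) * ka 0) (at 0)"
   using C[OF q] unfolding P_def by (elim exE conjE) (rule that)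
  obtain ze ze' where z0: "ze s = 0" and z: "(ze hvd ze') (at s within T)"
   and ev: "eventually (%s'. pt (ga s') = fi (ze s')) (at s within T)" and inv: "inv_diff t (ga s) v = ka 0 * ze'"
   using chartD(9)[OF ch p refl] by (elim exE conjE) (rule that)
  have phi0: "fi 0 = pt (ga s)" by (rule chartD(2)[OF ch])
  have "eventually (%z. z ~= 0 --> fi z \<in> W) (nhds 0)"
   using local_primitive(1)[OF W(1,2) h f d ch q] by (simp add: eventually_at_filter)
  moreover have "filterlim ze (nhds 0) (at s within T)" using hvd_tendsto[OF z] z0 by simp
  ultimately have evW: "eventually (%s'. ze s' ~= 0 --> fi (ze s') \<in> W) (at s within T)"
   by (rule eventually_compose_filterlim)
  let ?\<Phi> = "%z. if z = 0 then C (pt (ga s)) else f (fi z)"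
  have "(?\<Phi> has_field_derivative h (pt (ga s)) * ka 0) (at (ze s) within ze ` T)"
   using D unfolding z0 by (rule has_field_derivative_at_within)
  from field_vector_diff_chain_within[OF z this]
  have "((?\<Phi> \<circ> ze) hvd ze' * (h (pt (ga s)) * ka 0)) (at s within T)" .
  then have "((%s. F (pt (ga s))) hvd ze' * (h (pt (ga s)) * ka 0)) (at s within T)" unfolding hvd_def
  proof (rule has_derivative_transform_eventually)
   show "eventually (%s'. (?\<Phi> \<circ> ze) s' = F (pt (ga s'))) (at s within T)" using ev evW
   proof eventually_elim
    case (elim s')
    show ?case
    proof (cases "ze s' = 0")
     case True
     then show ?thesis using elim(1) phi0 FC[OF q] by simp
    next
     case False
     then show ?thesis using elim by (simp add: F_def)
    qed
   qed
   show "(?\<Phi> \<circ> ze) s = F (pt (ga s))" using z0 FC[OF q] by simp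
   show "s \<in> T" using p by (simp add: path_at_def)
  qed
  then show "((%s. F (pt (ga s))) hvd h (pt (ga s)) * inv_diff t (ga s) v) (at s within T)"
   unfolding inv by (simp only: mult.commute mult.left_commute mult.assoc)
 qed (simp add: F_def)
qed

text \<open>The solution l of l grad F = 2 (p \<times> v), found by pairing with the conjugate
  gradient. Unlike the description by \<open>THE\<close>, this formula is visibly smooth in all its
  data.\<close>

definition ldiff :: "param => complex ^ 3 => complex ^ 3 => complex" where
 "ldiff t p v = 2 * ((p $ 2 * v $ 3 - p $ 3 * v $ 2) * cnj (gradF t p $ 1) +
   (p $ 3 * v $ 1 - p $ 1 * v $ 3) * cnj (gradF t p $ 2) +
   (p $ 1 * v $ 2 - p $ 2 * v $ 1) * cnj (gradF t p $ 3)) /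
  (gradF t p $ 1 * cnj (gradF t p $ 1) + gradF t p $ 2 * cnj (gradF t p $ 2) + gradF t p $ 3 * cnj (gradF t p $ 3))"

lemma norm_gradF_nonzero:
 assumes "t \<in> TT" "on_cone t p"
 shows "gradF t p $ 1 * cnj (gradF t p $ 1) + gradF t p $ 2 * cnj (gradF t p $ 2) + gradF t p $ 3 * cnj (gradF t p $ 3) ~= 0"
proof -
 have "gradF t p $ 1 * cnj (gradF t p $ 1) + gradF t p $ 2 * cnj (gradF t p $ 2) + gradF t p $ 3 * cnj (gradF t p $ 3)
   = of_real (norm (gradF t p $ 1)^2 + norm (gradF t p $ 2)^2 + norm (gradF t p $ 3)^2)"
  by (simp only: of_real_add complex_norm_square)
 moreover have "norm (gradF t p $ 1)^2 + norm (gradF t p $ 2)^2 + norm (gradF t p $ 3)^2 ~= 0" using gradF_nonzero[OF assms]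
  by (simp add: vec_eq_iff forall_3 add_nonneg_eq_0_iff)
 ultimately show ?thesis by (simp del: of_real_add of_real_power)
qed

lemma path_tangent:
 assumes p: "path_at t T ga s v"
 shows "gradF t (ga s) $ 1 * v $ 1 + gradF t (ga s) $ 2 * v $ 2 + gradF t (ga s) $ 3 * v $ 3 = 0"
proof -
 have g: "(ga hvd v) (at s within T)" and c: "!!s'. s' \<in> T ==> on_cone t (ga s')"
  and s: "s \<in> T" and nt: "at s within T ~= bot" using p by (auto simp: path_at_def)
 define F where "F p = p $ 2 * p $ 2 * p $ 3 - 4 * (p $ 1 * p $ 1 * p $ 1) + t $ 5 * (p $ 1 * (p $ 3 * p $ 3))
   + t3 t * (p $ 3 * p $ 3 * p $ 3)" for p :: "complex ^ 3"
 have "((%s. F (ga s)) hvd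
   gradF t (ga s) $ 1 * v $ 1 + gradF t (ga s) $ 2 * v $ 2 + gradF t (ga s) $ 3 * v $ 3) (at s within T)"
  unfolding F_def by (auto intro!: derivative_eq_intros g simp: gradF_def algebra_simps power2_eq_square)
 moreover have "((%s. F (ga s)) hvd 0) (at s within T)"
 proof (rule has_vector_derivative_transform[OF s])
  show "((%s. 0::complex) hvd 0) (at s within T)" by simp
  show "F (ga x) = 0" if "x \<in> T" for x using c[OF that] unfolding on_cone_def F_def by (simp add: pow_eqs algebra_simps)
 qed
 ultimately show ?thesis by (rule vector_derivative_unique_within[OF nt])
qed

text \<open>Both p \<times> v and grad F are orthogonal to p, by Euler's relation, and to v, by
  tangency. They are therefore parallel, and the pairing recovers the factor.\<close>

lemma inv_diff_eq_ldiff: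
 assumes t: "t \<in> TT" and p: "on_cone t p" and v: "gradF t p $ 1 * v $ 1 + gradF t p $ 2 * v $ 2 + gradF t p $ 3 * v $ 3 = 0"
 shows "inv_diff t p v = ldiff t p v"
proof -
 define n1 n2 n3 where "n1 = gradF t p $ 1" and "n2 = gradF t p $ 2" and "n3 = gradF t p $ 3"
 note n = n1_def[symmetric] n2_def[symmetric] n3_def[symmetric]
 have v: "n1 * v $ 1 + n2 * v $ 2 + n3 * v $ 3 = 0" using v unfolding n .
 have e: "n1 * p $ 1 + n2 * p $ 2 + n3 * p $ 3 = 0"
 proof -
  have "n1 * p $ 1 + n2 * p $ 2 + n3 * p $ 3 = 3 * ((p $ 2)^2 * p $ 3 - (4 * (p $ 1)^3 - t $ 5 * p $ 1 * (p $ 3)^2 - t3 t * (p $ 3)^3))"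
   unfolding n1_def n2_def n3_def gradF_def by (simp add: algebra_simps pow_eqs)
  then show ?thesis using p by (simp add: on_cone_def)
 qed
 define N where "N = n1 * cnj n1 + n2 * cnj n2 + n3 * cnj n3"
 have N: "N ~= 0" using norm_gradF_nonzero[OF t p] unfolding N_def n .
 define A B C where "A = p $ 2 * v $ 3 - p $ 3 * v $ 2" and "B = p $ 3 * v $ 1 - p $ 1 * v $ 3"
  and "C = p $ 1 * v $ 2 - p $ 2 * v $ 1"
 \<comment> \<open>The components of (p \<times> v) \<times> n, expanded by the triple product
   formula.\<close>
 have "B * n3 - C * n2 = v $ 1 * (n1 * p $ 1 + n2 * p $ 2 + n3 * p $ 3) - p $ 1 * (n1 * v $ 1 + n2 * v $ 2 + n3 * v $ 3)"
  "C * n1 - A * n3 = v $ 2 * (n1 * p $ 1 + n2 * p $ 2 + n3 * p $ 3) - p $ 2 * (n1 * v $ 1 + n2 * v $ 2 + n3 * v $ 3)"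
  "A * n2 - B * n1 = v $ 3 * (n1 * p $ 1 + n2 * p $ 2 + n3 * p $ 3) - p $ 3 * (n1 * v $ 1 + n2 * v $ 2 + n3 * v $ 3)"
  unfolding A_def B_def C_def by (simp_all add: algebra_simps)
 then have c: "B * n3 = C * n2" "C * n1 = A * n3" "A * n2 = B * n1" unfolding v e by simp_all
 define l where "l = 2 * (A * cnj n1 + B * cnj n2 + C * cnj n3) / N"
 have *: "l * m = 2 * D" if "D * n1 = A * m" "D * n2 = B * m" "D * n3 = C * m" for D m
 proof -
  have "(A * cnj n1 + B * cnj n2 + C * cnj n3) * m = (A * m) * cnj n1 + (B * m) * cnj n2 + (C * m) * cnj n3"
   by (simp add: algebra_simps)
  also have "\<dots> = D * N" unfolding that[symmetric] N_def by (simp add: algebra_simps)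
  finally have "l * m = 2 * (D * N) / N" unfolding l_def times_divide_eq_left mult.assoc by (simp only: mult.assoc)
  then show ?thesis using N by simp
 qed
 have "inv_diff t p v = l"
 proof (rule inv_diff_eq[OF t p, where v = v, folded A_def B_def C_def])
  show "2 * A = l * (t $ 5 * (p $ 3)^2 - 12 * (p $ 1)^2)" using *[of A n1] c by (simp add: n1_def gradF_def)
  show "2 * B = l * (2 * p $ 2 * p $ 3)" using *[of B n2] c by (simp add: n2_def gradF_def)
  show "2 * C = l * ((p $ 2)^2 + 2 * t $ 5 * p $ 1 * p $ 3 + 3 * t3 t * (p $ 3)^2)"
   using *[of C n3] c by (simp add: n3_def gradF_def)
 qed
 then show ?thesis unfolding l_def ldiff_def n A_def B_def C_def N_def .
qed

section \<open>Periods of relative cycles\<close>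

definition C1_path :: "param => (real => complex ^ 3) => bool" where
 "C1_path t ga \<longleftrightarrow> (\<forall>s\<in>{0..1}. on_cone t (ga s)) &
   (\<forall>s\<in>{0..1}. (ga hvd vector_derivative ga (at01 s)) (at01 s)) &
   continuous_on {0..1} (%s. vector_derivative ga (at01 s))"

lemma unit_interval_nontrivial: "s \<in> {0..1::real} ==> at s within {0..1} ~= bot"
 by (simp add: trivial_limit_within islimpt_Icc)

lemma C1_path_at:
 "C1_path t ga ==> s \<in> {0..1} ==> path_at t {0..1} ga s (vector_derivative ga (at01 s))"
 unfolding C1_path_def path_at_def using unit_interval_nontrivial by blast

lemma C1_path_continuous: "C1_path t ga ==> continuous_on {0..1} ga"
 unfolding C1_path_def using has_vector_derivative_continuous continuous_on_eq_continuous_within by blast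

lemma continuous_on_inv_diff:
 assumes t: "t \<in> TT" and g: "C1_path t ga"
 shows "continuous_on {0..1} (%s. inv_diff t (ga s) (vector_derivative ga (at01 s)))"
proof -
 have cone: "on_cone t (ga s)" if "s \<in> {0..1}" for s using g that by (auto simp: C1_path_def)
 define v where "v s = vector_derivative ga (at01 s)" for s
 have cv: "continuous_on {0..1} v" using g by (simp add: C1_path_def v_def[abs_def])
 have c: "continuous_on {0..1} (%s. ga s $ i)" and cv': "continuous_on {0..1} (%s. v s $ i)" for i
  by (rule bounded_linear.continuous_on[OF bounded_linear_vec_nth] C1_path_continuous[OF g] cv)+
 have cg: "continuous_on {0..1} (%s. gradF t (ga s) $ i)" for i using exhaust_3[of i]
 proof (elim disjE)
  assume "i = 1"
  then show ?thesis by (simp add: gradF_def) (intro continuous_intros c)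
 next
  assume "i = 2"
  then show ?thesis by (simp add: gradF_def) (intro continuous_intros c)
 next
  assume "i = 3"
  then show ?thesis by (simp add: gradF_def) (intro continuous_intros c)
 qed
 have C: "continuous_on {0..1} (%s. ldiff t (ga s) (v s))" unfolding ldiff_def
  by (intro continuous_on_divide continuous_on_mult continuous_on_add continuous_on_diff continuous_on_const
    continuous_on_cnj cg c cv') (rule ballI, rule norm_gradF_nonzero[OF t cone])
 have E: "ldiff t (ga s) (v s) = inv_diff t (ga s) (v s)" if s: "s \<in> {0..1}" for s
  using inv_diff_eq_ldiff[OF t cone[OF s] path_tangent[OF C1_path_at[OF g s]]] by (simp add: v_def)
 show ?thesis using iffD1[OF continuous_on_cong[OF refl E] C] unfolding v_def .
qed

text \<open>Where the path meets O, the function is a quotient of polynomials in X/Y and Z/Y, which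
  are continuous along the lift.\<close>

lemma continuous_on_regular_path:
 assumes reg: "regular_on U f" and g: "C1_path t ga" and U: "!!s. s \<in> {0..1} ==> pt (ga s) \<in> U"
 shows "continuous_on {0..1} (%s. f (pt (ga s)))"
proof -
 have cont: "((%s. ga s $ i) ---> ga s $ i) (at01 s)" if "s \<in> {0..1}" for i s using C1_path_continuous[OF g] that
  by (auto intro!: tendsto_vec_nth simp: continuous_on_def)
 have T: "eventually (%s'. s' \<in> {0..1}) (at s within {0..1::real})" for s by (auto simp: eventually_at_filter)
 have "((%s. f (pt (ga s))) ---> f (pt (ga s))) (at01 s)" if s: "s \<in> {0..1}" for s
 proof (cases "ga s $ 3 = 0")
  case False
  have ev: "eventually (%s'. ga s' $ 3 ~= 0) (at01 s)" by (rule tendsto_imp_eventually_ne[OF cont[OF s] False])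
  have p: "pt (ga s) = Some (ga s $ 1 / ga s $ 3, ga s $ 2 / ga s $ 3)" using False by (simp add: pt_def)
  have "((%s. f (Some (ga s $ 1 / ga s $ 3, ga s $ 2 / ga s $ 3))) --->
    f (Some (ga s $ 1 / ga s $ 3, ga s $ 2 / ga s $ 3))) (at01 s)"
  proof (rule cont_at_affine_point)
   show "regular_at U f (Some (ga s $ 1 / ga s $ 3, ga s $ 2 / ga s $ 3))" using reg U[OF s] p by (simp add: regular_on_def)
   show "Some (ga s $ 1 / ga s $ 3, ga s $ 2 / ga s $ 3) \<in> U" using U[OF s] p by simp
   show "eventually (%s. Some (ga s $ 1 / ga s $ 3, ga s $ 2 / ga s $ 3) \<in> U) (at01 s)" using ev T
   proof eventually_elim
    case (elim s')
    then show ?case using U[OF elim(2)] by (simp add: pt_def)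
   qed
  qed (intro tendsto_divide cont[OF s] False)+
  moreover have "eventually (%s. f (Some (ga s $ 1 / ga s $ 3, ga s $ 2 / ga s $ 3)) = f (pt (ga s))) (at01 s)"
   using ev by eventually_elim (simp add: pt_def)
  ultimately show ?thesis unfolding p by (rule Lim_transform_eventually)
 next
  case True
  have cone: "on_cone t (ga s)" if "s \<in> {0..1}" for s using g that by (auto simp: C1_path_def)
  have y: "ga s $ 2 ~= 0" and x: "ga s $ 1 = 0" using on_cone_None[OF cone[OF s] True] by auto
  have p: "pt (ga s) = None" using True by (simp add: pt_def)
  have "regular_at U f None" using reg U[OF s] p by (simp add: regular_on_def)
  then obtain P Q where Q: "poly2 Q 0 0 ~= 0" and f0: "f None = poly2 P 0 0 / poly2 Q 0 0"
   and f: "!!x y. Some (x, y) \<in> U ==> y ~= 0 ==> poly2 Q (x / y) (1 / y) ~= 0 ==>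
     f (Some (x, y)) = poly2 P (x / y) (1 / y) / poly2 Q (x / y) (1 / y)" by (rule regular_at_NoneE) (rule that)
  define u w where "u s = ga s $ 1 / ga s $ 2" and "w s = ga s $ 3 / ga s $ 2" for s
  have "(u ---> ga s $ 1 / ga s $ 2) (at01 s)" "(w ---> ga s $ 3 / ga s $ 2) (at01 s)"
   unfolding u_def w_def by (intro tendsto_divide cont[OF s] y)+
  then have uw: "(u ---> 0) (at01 s)" "(w ---> 0) (at01 s)" using x True by simp_all
  have lim: "((%s. poly2 R (u s) (w s)) ---> poly2 R 0 0) (at01 s)" for R
  proof -
   have "continuous_on UNIV (%q. poly2 R (fst q) (snd q))" by (intro continuous_intros)
   then have "isCont (%q. poly2 R (fst q) (snd q)) (0, 0)" by (simp add: continuous_on_eq_continuous_at)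
   from isCont_tendsto_compose[OF this tendsto_Pair[OF uw]] show ?thesis by simp
  qed
  have "((%s. poly2 P (u s) (w s) / poly2 Q (u s) (w s)) ---> f None) (at01 s)" unfolding f0 by (intro tendsto_divide lim Q)
  moreover have "eventually (%s. poly2 P (u s) (w s) / poly2 Q (u s) (w s) = f (pt (ga s))) (at01 s)"
   using T tendsto_imp_eventually_ne[OF lim Q] tendsto_imp_eventually_ne[OF cont[OF s] y]
  proof eventually_elim
   case (elim s')
   show ?case
   proof (cases "ga s' $ 3 = 0")
    case True
    then have "u s' = 0" "w s' = 0" using on_cone_None[OF cone[OF elim(1)]] by (auto simp: u_def w_def)
    then show ?thesis using True f0 by (simp add: pt_def)
   next
    case False
    define x y where "x = ga s' $ 1 / ga s' $ 3" and "y = ga s' $ 2 / ga s' $ 3"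
    have xy: "x / y = u s'" "1 / y = w s'" "y ~= 0" using False elim(3) by (simp_all add: x_def y_def u_def w_def)
    have ptg: "pt (ga s') = Some (x, y)" using False by (simp add: pt_def x_def y_def)
    show ?thesis unfolding ptg using f[of x y] U[OF elim(1)] elim(2) unfolding ptg xy using xy(3) by simp
   qed
  qed
  ultimately show ?thesis unfolding p by (rule Lim_transform_eventually)
 qed
 then show ?thesis by (simp add: continuous_on_def)
qed

lemma path_integrable:
 assumes t: "t \<in> TT" and reg: "regular_on U g" and ga: "C1_path t ga" and U: "!!s. s \<in> {0..1} ==> pt (ga s) \<in> U"
 shows "(%s. g (pt (ga s)) * inv_diff t (ga s) (vector_derivative ga (at01 s))) integrable_on {0..1}"
 by (intro integrable_continuous_real continuous_on_mult continuous_on_inv_diff[OF t ga]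
   continuous_on_regular_path[OF reg ga U])

lemma path_integral_lincomb:
 assumes t: "t \<in> TT" and reg: "regular_on U g" "regular_on U g'" and ga: "C1_path t ga"
  and U: "!!s. s \<in> {0..1} ==> pt (ga s) \<in> U"
 shows "path_integral t (%p. c * g p + c' * g' p) ga = c * path_integral t g ga + c' * path_integral t g' ga"
proof -
 note int = path_integrable[OF t _ ga U]
 have "path_integral t (%p. c * g p + c' * g' p) ga = integral {0..1} (%s.
   c * (g (pt (ga s)) * inv_diff t (ga s) (vector_derivative ga (at01 s))) +
   c' * (g' (pt (ga s)) * inv_diff t (ga s) (vector_derivative ga (at01 s))))"
  unfolding path_integral_def by (simp add: algebra_simps)
 also have "\<dots> = c * path_integral t g ga + c' * path_integral t g' ga" unfolding path_integral_def
  by (subst integral_add) (auto intro!: integrable_on_mult_right int reg)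
 finally show ?thesis .
qed

lemma chain_integral_lincomb:
 assumes t: "t \<in> TT" and reg: "regular_on U g" "regular_on U g'" and c: "!!n ga. (n, ga) \<in> set ch ==> C1_path t ga"
  and U: "!!n ga s. (n, ga) \<in> set ch ==> s \<in> {0..1} ==> pt (ga s) \<in> U"
 shows "chain_integral t (%p. z * g p + z' * g' p) ch = z * chain_integral t g ch + z' * chain_integral t g' ch" using c U
proof (induction ch)
 case Nil
 then show ?case by (simp add: chain_integral_def)
next
 case (Cons a ch)
 obtain n ga where a: "a = (n, ga)" by (cases a)
 have IH: "chain_integral t (%p. z * g p + z' * g' p) ch = z * chain_integral t g ch + z' * chain_integral t g' ch"
  by (rule Cons.IH) (use Cons.prems in "meson list.set_intros(2)")+
 have "C1_path t ga" using Cons.prems(1)[of n ga] a by simp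
 moreover have "pt (ga s) \<in> U" if "s \<in> {0..1}" for s using Cons.prems(2)[of n ga s] a that by simp
 ultimately have 1: "path_integral t (%p. z * g p + z' * g' p) ga = z * path_integral t g ga + z' * path_integral t g' ga"
  by (rule path_integral_lincomb[OF t reg])
 have step: "chain_integral t g (a # ch) = of_int n * path_integral t g ga + chain_integral t g ch" for g
  by (simp add: chain_integral_def a)
 show ?case unfolding step IH 1 by (simp add: algebra_simps)
qed

lemma path_integral_exact:
 assumes F: "!!T ga s v. path_at t T ga s v ==> pt (ga s) \<in> U ==>
    ((%s. F (pt (ga s))) hvd h (pt (ga s)) * inv_diff t (ga s) v) (at s within T)"
  and ga: "C1_path t ga" and U: "!!s. s \<in> {0..1} ==> pt (ga s) \<in> U"
 shows "path_integral t h ga = F (pt (ga 1)) - F (pt (ga 0))"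
proof -
 have "((%s. h (pt (ga s)) * inv_diff t (ga s) (vector_derivative ga (at01 s))) has_integral
   F (pt (ga 1)) - F (pt (ga 0))) {0..1}" by (rule fundamental_theorem_of_calculus) (simp_all add: F C1_path_at[OF ga] U)
 then show ?thesis unfolding path_integral_def by (rule integral_unique)
qed

section \<open>Boundaries of relative cycles\<close>

definition boundary_sum :: "(point => complex) => path_chain => complex" where
 "boundary_sum F c = (\<Sum>(n, ga)\<leftarrow>c. of_int n * (F (pt (ga 1)) - F (pt (ga 0))))"

lemma chain_integral_exact:
 assumes F: "!!T ga s v. path_at t T ga s v ==> pt (ga s) \<in> U ==>
    ((%s. F (pt (ga s))) hvd h (pt (ga s)) * inv_diff t (ga s) v) (at s within T)"
  and c: "!!n ga. (n, ga) \<in> set ch ==> C1_path t ga"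
  and U: "!!n ga s. (n, ga) \<in> set ch ==> s \<in> {0..1} ==> pt (ga s) \<in> U"
 shows "chain_integral t h ch = boundary_sum F ch"
proof -
 have "of_int n * path_integral t h ga = of_int n * (F (pt (ga 1)) - F (pt (ga 0)))" if "(n, ga) \<in> set ch" for n ga
  using path_integral_exact[of t U F h ga, OF F c[OF that] U[OF that]] by simp
 then show ?thesis unfolding chain_integral_def boundary_sum_def
  by (intro arg_cong[where f = sum_list] map_cong refl) (auto split: prod.split)
qed

text \<open>The only point of the standard 0-simplex.\<close>

definition vertex :: "nat => real" where
 "vertex i = (if i = 0 then 1 else 0)"

text \<open>The additive extension of F to singular 0-chains, with complex values so that it can be
  compared with integrals.\<close>

definition eval_chain :: "(point => complex) => point chain => complex" where
 "eval_chain F c = (\<Sum>sg\<in>Poly_Mapping.keys c. of_int (poly_mapping.lookup c sg) * F (sg vertex))"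

lemma eval_chain_superset:
 "finite K ==> Poly_Mapping.keys c <= K ==>
  eval_chain F c = (\<Sum>sg\<in>K. of_int (poly_mapping.lookup c sg) * F (sg vertex))"
 unfolding eval_chain_def by (rule sum.mono_neutral_left) (auto simp: in_keys_iff)

lemma eval_chain_add: "eval_chain F (c + d) = eval_chain F c + eval_chain F d"
proof -
 let ?K = "Poly_Mapping.keys c \<union> Poly_Mapping.keys d"
 have K: "finite ?K" by simp
 have "Poly_Mapping.keys (c + d) <= ?K" by (rule Poly_Mapping.keys_add)
 from eval_chain_superset[OF K this] show ?thesis by (simp add: eval_chain_superset[OF K] lookup_add distrib_right sum.distrib)
qed

lemma eval_chain_zero [simp]: "eval_chain F 0 = 0" by (simp add: eval_chain_def)

lemma eval_chain_cmul: "eval_chain F (frag_cmul n c) = of_int n * eval_chain F c"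
proof -
 have "Poly_Mapping.keys (frag_cmul n c) <= Poly_Mapping.keys c" by (rule keys_cmul)
 from eval_chain_superset[OF finite_keys this] show ?thesis by (simp add: eval_chain_def sum_distrib_left mult.assoc)
qed

lemma eval_chain_of: "eval_chain F (frag_of sg) = F (sg vertex)" by (simp add: eval_chain_def)

lemma vertex_simplex: "vertex \<in> standard_simplex 0" by (auto simp: standard_simplex_def vertex_def)

text \<open>The time of the path is the coordinate \<open>z 1\<close>; so the face omitting vertex 0
  is the final point and the face omitting vertex 1 the initial one.\<close>

lemma eval_boundary_simplex:
 "eval_chain F (chain_boundary 1 (frag_of (restrict (%z. pt (ga (z 1))) (standard_simplex 1)))) =
  F (pt (ga 1)) - F (pt (ga 0))"
proof -
 let ?sg = "restrict (%z. pt (ga (z 1))) (standard_simplex 1)"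
 have face: "singular_face 1 k ?sg vertex = pt (ga (simplical_face k vertex 1))" if "k \<le> 1" for k
  using vertex_simplex simplical_face_in_standard_simplex[of 1 k vertex] that by (simp add: singular_face_def)
 have "chain_boundary 1 (frag_of ?sg) = frag_of (singular_face 1 0 ?sg) + frag_cmul (- 1) (frag_of (singular_face 1 1 ?sg))"
  by (simp add: chain_boundary_of)
 then show ?thesis by (simp only: eval_chain_add eval_chain_cmul eval_chain_of face order_refl zero_le)
   (simp add: simplical_face_def vertex_def)
qed

lemma eval_boundary_chain:
 "eval_chain F (chain_boundary 1 (singular_chain_of c)) = boundary_sum F c"
proof (induction c)
 case Nil
 then show ?case by (simp add: singular_chain_of_def boundary_sum_def)
next
 case (Cons a c)
 obtain n ga where a: "a = (n, ga)" by (cases a)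
 have "singular_chain_of (a # c) =
   frag_cmul n (frag_of (restrict (%z. pt (ga (z 1))) (standard_simplex 1))) + singular_chain_of c"
  by (simp add: singular_chain_of_def a)
 then have "eval_chain F (chain_boundary 1 (singular_chain_of (a # c))) =
   of_int n * (F (pt (ga 1)) - F (pt (ga 0))) + boundary_sum F c"
  by (simp only: chain_boundary_add chain_boundary_cmul eval_chain_add eval_chain_cmul eval_boundary_simplex Cons.IH)
 then show ?case by (simp add: boundary_sum_def a)
qed

text \<open>The boundary is a 0-chain on {O, P} of degree 0, as the constant function 1 shows; hence
  it is m ([P] - [O]).\<close>

lemma relcycle_boundary:
 assumes "singular_relcycle 1 X (YY t) (singular_chain_of c)"
 obtains m where "!!F. boundary_sum F c = m * (F (Some (t $ 1, t $ 2)) - F None)"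
proof -
 define d where "d = chain_boundary 1 (singular_chain_of c)"
 have "singular_chain 0 (subtopology X (YY t)) d" using assms by (simp add: singular_relcycle d_def)
 then have Y: "sg vertex \<in> YY t" if "sg \<in> Poly_Mapping.keys d" for sg
 proof -
  have "continuous_map (subtopology (powertop_real UNIV) (standard_simplex 0)) (subtopology X (YY t)) sg"
   using \<open>singular_chain 0 _ d\<close> that by (auto simp: singular_chain_def singular_simplex_def)
  then have "sg vertex \<in> topspace (subtopology X (YY t))"
   using vertex_simplex by (metis continuous_map_image_subset_topspace image_subset_iff topspace_standard_simplex)
  then show ?thesis by simp
 qed
 define m where "m = (\<Sum>sg\<in>Poly_Mapping.keys d. of_int (poly_mapping.lookup d sg) *
   (if sg vertex = Some (t $ 1, t $ 2) then 1 else 0 :: complex))"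
 define m' where "m' = (\<Sum>sg\<in>Poly_Mapping.keys d. of_int (poly_mapping.lookup d sg) *
   (if sg vertex = None then 1 else 0 :: complex))"
 have ev: "eval_chain F d = m * F (Some (t $ 1, t $ 2)) + m' * F None" for F
  unfolding eval_chain_def m_def m'_def sum_distrib_right sum.distrib[symmetric]
 proof (rule sum.cong[OF refl])
  fix sg assume "sg \<in> Poly_Mapping.keys d"
  from Y[OF this] consider "sg vertex = None" | "sg vertex = Some (t $ 1, t $ 2)" by (auto simp: YY_def)
  then show "of_int (poly_mapping.lookup d sg) * F (sg vertex) =
    of_int (poly_mapping.lookup d sg) * (if sg vertex = Some (t $ 1, t $ 2) then 1 else 0) * F (Some (t $ 1, t $ 2)) +
    of_int (poly_mapping.lookup d sg) * (if sg vertex = None then 1 else 0) * F None" by cases simp_all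
 qed
 have bs: "boundary_sum F c = m * F (Some (t $ 1, t $ 2)) + m' * F None" for F
  unfolding eval_boundary_chain[symmetric] d_def[symmetric] by (rule ev)
 have "boundary_sum (%_. 1) c = 0" by (simp add: boundary_sum_def split_def)
 then have "m' = - m" using bs[of "%_. 1"] by (simp add: add_eq_0_iff)
 then show thesis using that[of m] bs by (simp add: algebra_simps)
qed

definition rel_chain :: "param => path_chain => bool" where
 "rel_chain t c \<longleftrightarrow> (\<forall>(n, ga)\<in>set c. C1_path t ga) & singular_relcycle 1 (curve_top t) (YY t) (singular_chain_of c)"

text \<open>Justifies the \<open>THE\<close> in \<open>period\<close>: two representatives differ by
  df with f = 0 on Y, and the integral of df over a relative cycle is a multiple of f(P) - f(O). As
  the cycle may leave the domain of f, the extension from \<open>path_primitive\<close> is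
  integrated.\<close>

lemma period_dR_class:
 assumes t: "t \<in> TT" and c: "rel_chain t c" and f: "(U, g) \<in> forms t"
  and U: "!!n ga s. (n, ga) \<in> set c ==> s \<in> {0..1} ==> pt (ga s) \<in> U"
 shows "period t c (dR_class t U g) = chain_integral t g c" unfolding period_def
proof (rule the_equality)
 have "(U, g) \<in> dR_class t U g" using equiv_class_self[OF equiv_dR_rel[OF t] f] .
 then show "\<exists>(U', g')\<in>dR_class t U g. (\<forall>(n, ga)\<in>set c. \<forall>s\<in>{0..1}. pt (ga s) \<in> U') & chain_integral t g c = chain_integral t g' c"
  using U by (intro bexI[of _ "(U, g)"]) auto
next
 fix z
 assume "\<exists>(U', g')\<in>dR_class t U g. (\<forall>(n, ga)\<in>set c. \<forall>s\<in>{0..1}. pt (ga s) \<in> U') & z = chain_integral t g' c"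
 then obtain U' g' where rel: "((U, g), (U', g')) \<in> dR_rel t"
  and U': "!!n ga s. (n, ga) \<in> set c ==> s \<in> {0..1} ==> pt (ga s) \<in> U'" and z: "z = chain_integral t g' c" by fast
 obtain W f where W: "(U', g') \<in> forms t" "affine_open t W" "YY t <= W"
   "W <= U \<inter> U'" "regular_on W f" "!!p. p \<in> YY t ==> f p = 0" "is_differential W f (%p. g p - g' p)"
  by (rule dR_relE[OF rel]) blast
 have C1: "!!n ga. (n, ga) \<in> set c ==> C1_path t ga" using c by (auto simp: rel_chain_def)
 have reg: "regular_on (U \<inter> U') g" "regular_on (U \<inter> U') g'"
  using formsD(3)[OF f] formsD(3)[OF W(1)] by (auto intro: regular_on_subset)
 have fin: "finite (XX t - W)" using W(2) by (simp add: affine_open_def)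
 have sub: "U \<inter> U' <= XX t" using formsD(5)[OF f] by blast
 have UU: "!!n ga s. (n, ga) \<in> set c ==> s \<in> {0..1} ==> pt (ga s) \<in> U \<inter> U'" using U U' by blast
 obtain F where F: "!!p. p \<in> W ==> F p = f p"
  "!!T ga s v. path_at t T ga s v ==> pt (ga s) \<in> U \<inter> U' ==>
    ((%s. F (pt (ga s))) hvd (g (pt (ga s)) - g' (pt (ga s))) * inv_diff t (ga s) v) (at s within T)"
  by (rule path_primitive[OF t fin W(4) sub regular_on_diff[OF reg] W(5,7)]) (rule that)
 have "chain_integral t (%p. g p - g' p) c = boundary_sum F c"
 proof (rule chain_integral_exact[where F = F and U = "U \<inter> U'" and h = "%p. g p - g' p"])
  show "((%s. F (pt (ga s))) hvd (g (pt (ga s)) - g' (pt (ga s))) * inv_diff t (ga s) v) (at s within T)"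
   if "path_at t T ga s v" "pt (ga s) \<in> U \<inter> U'" for T ga s v by (rule F(2)[OF that])
  show "C1_path t ga" if "(n, ga) \<in> set c" for n ga by (rule C1[OF that])
  show "pt (ga s) \<in> U \<inter> U'" if "(n, ga) \<in> set c" "s \<in> {0..1}" for n ga s by (rule UU[OF that])
 qed
 also have "\<dots> = 0"
 proof -
  have cyc: "singular_relcycle 1 (curve_top t) (YY t) (singular_chain_of c)" using c by (simp add: rel_chain_def)
  obtain m where "!!F. boundary_sum F c = m * (F (Some (t $ 1, t $ 2)) - F None)" by (rule relcycle_boundary[OF cyc]) (rule that)
  moreover have "F p = 0" if "p \<in> YY t" for p using F(1)[of p] W(3,6) that by auto
  ultimately show ?thesis by (simp add: YY_def)
 qed
 finally have 0: "chain_integral t (%p. 1 * g p + (- 1) * g' p) c = 0" by simp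
 have "chain_integral t (%p. 1 * g p + (- 1) * g' p) c = 1 * chain_integral t g c + (- 1) * chain_integral t g' c"
 proof (rule chain_integral_lincomb[OF t reg])
  show "C1_path t ga" if "(n, ga) \<in> set c" for n ga by (rule C1[OF that])
  show "pt (ga s) \<in> U \<inter> U'" if "(n, ga) \<in> set c" "s \<in> {0..1}" for n ga s by (rule UU[OF that])
 qed
 then show "z = chain_integral t g c" unfolding 0 z by simp
qed

section \<open>Continuously differentiable families\<close>

text \<open>\<open>C1_on\<close> for arbitrary target spaces, so that coordinates and coefficient
  functions are covered as well.\<close>

definition C1fun :: "(param \<times> real) set => (param \<times> real => 'b::real_normed_vector) => bool" where
 "C1fun S f \<longleftrightarrow> (\<exists>f'. continuous_on S f' &
   (\<forall>z\<in>S. (f has_derivative blinfun_apply (f' z)) (at z within S)))"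

lemma C1_on_eq: "C1_on S f = C1fun S f" by (simp add: C1_on_def C1fun_def)

lemma C1fun_continuous: "C1fun S f ==> continuous_on S f"
 unfolding C1fun_def continuous_on_eq_continuous_within using has_derivative_continuous by blast

lemma C1funE:
 assumes "C1fun S f"
 obtains f' where "continuous_on S f'" "!!z. z \<in> S ==> (f has_derivative blinfun_apply (f' z)) (at z within S)"
 using assms unfolding C1fun_def by blast

lemma C1fun_subset: "C1fun S f ==> T <= S ==> C1fun T f"
 unfolding C1fun_def by (meson continuous_on_subset has_derivative_subset subsetD)

lemma C1fun_const: "C1fun S (%z. c)" unfolding C1fun_def by (rule exI[of _ "%z. 0"]) (auto simp: zero_blinfun.rep_eq)

lemma C1fun_linear:
 assumes "C1fun S f" "bounded_linear L"
 shows "C1fun S (%z. L (f z))"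
proof -
 obtain f' where f': "continuous_on S f'" "!!z. z \<in> S ==> (f has_derivative blinfun_apply (f' z)) (at z within S)"
  by (rule C1funE[OF assms(1)]) (rule that)
 have "continuous_on S (%z. Blinfun L o\<^sub>L f' z)" by (intro continuous_intros f')
 moreover have "((%z. L (f z)) has_derivative blinfun_apply (Blinfun L o\<^sub>L f' z)) (at z within S)" if "z \<in> S" for z
  using bounded_linear.has_derivative[OF assms(2) f'(2)[OF that]]
  by (rule has_derivative_eq_rhs) (simp add: fun_eq_iff bounded_linear_Blinfun_apply[OF assms(2)])
 ultimately show ?thesis unfolding C1fun_def by blast
qed

lemma C1fun_add:
 assumes "C1fun S f" "C1fun S g"
 shows "C1fun S (%z. f z + g z)"
proof -
 obtain f' where f': "continuous_on S f'" "!!z. z \<in> S ==> (f has_derivative blinfun_apply (f' z)) (at z within S)"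
  by (rule C1funE[OF assms(1)]) (rule that)
 obtain g' where g': "continuous_on S g'" "!!z. z \<in> S ==> (g has_derivative blinfun_apply (g' z)) (at z within S)"
  by (rule C1funE[OF assms(2)]) (rule that)
 have "continuous_on S (%z. f' z + g' z)" by (intro continuous_intros f' g')
 moreover have "((%z. f z + g z) has_derivative blinfun_apply (f' z + g' z)) (at z within S)" if "z \<in> S" for z
  using has_derivative_add[OF f'(2)[OF that] g'(2)[OF that]]
  by (rule has_derivative_eq_rhs) (simp add: fun_eq_iff plus_blinfun.rep_eq)
 ultimately show ?thesis unfolding C1fun_def by blast
qed

lemma C1fun_mult:
 fixes f g :: "param \<times> real => complex"
 assumes "C1fun S f" "C1fun S g"
 shows "C1fun S (%z. f z * g z)"
proof -
 obtain f' where f': "continuous_on S f'" "!!z. z \<in> S ==> (f has_derivative blinfun_apply (f' z)) (at z within S)"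
  by (rule C1funE[OF assms(1)]) (rule that)
 obtain g' where g': "continuous_on S g'" "!!z. z \<in> S ==> (g has_derivative blinfun_apply (g' z)) (at z within S)"
  by (rule C1funE[OF assms(2)]) (rule that)
 have "continuous_on S (%z. (blinfun_mult_right (f z) o\<^sub>L g' z) + (blinfun_mult_left (g z) o\<^sub>L f' z))"
  by (intro continuous_intros f' g' C1fun_continuous[OF assms(1)] C1fun_continuous[OF assms(2)])
 moreover have "((%z. f z * g z) has_derivative
   blinfun_apply ((blinfun_mult_right (f z) o\<^sub>L g' z) + (blinfun_mult_left (g z) o\<^sub>L f' z))) (at z within S)" if "z \<in> S" for z
  using has_derivative_mult[OF f'(2)[OF that] g'(2)[OF that]]
  by (rule has_derivative_eq_rhs) (simp add: fun_eq_iff plus_blinfun.rep_eq)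
 ultimately show ?thesis unfolding C1fun_def by blast
qed

lemma C1fun_holomorphic:
 fixes f :: "param \<times> real => complex"
 assumes "C1fun S f" "open T" "ps holomorphic_on T" "!!z. z \<in> S ==> f z \<in> T"
 shows "C1fun S (%z. ps (f z))"
proof -
 obtain f' where f': "continuous_on S f'" "!!z. z \<in> S ==> (f has_derivative blinfun_apply (f' z)) (at z within S)"
  by (rule C1funE[OF assms(1)]) (rule that)
 have "continuous_on S (%z. deriv ps (f z))"
  by (rule continuous_on_compose2[OF holomorphic_on_imp_continuous_on[OF holomorphic_deriv[OF assms(3,2)]]
    C1fun_continuous[OF assms(1)]]) (use assms(4) in blast)
 then have "continuous_on S (%z. blinfun_mult_right (deriv ps (f z)) o\<^sub>L f' z)" by (intro continuous_intros f')
 moreover have "((%z. ps (f z)) has_derivative blinfun_apply (blinfun_mult_right (deriv ps (f z)) o\<^sub>L f' z)) (at z within S)"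
  if "z \<in> S" for z
 proof -
  have "(ps has_derivative (*) (deriv ps (f z))) (at (f z))"
   using holomorphic_derivI[OF assms(3,2) assms(4)[OF that]] by (simp add: has_field_derivative_def)
  from has_derivative_compose[OF f'(2)[OF that] this] show ?thesis by (rule has_derivative_eq_rhs) (simp add: fun_eq_iff)
 qed
 ultimately show ?thesis unfolding C1fun_def by blast
qed

lemma C1fun_uminus:
 assumes "C1fun S f" shows "C1fun S (%z. - f z)"
 using C1fun_linear[OF assms bounded_linear_minus[OF bounded_linear_ident]] by simp

lemma C1fun_diff:
 assumes "C1fun S f" "C1fun S g" shows "C1fun S (%z. f z - g z)" using C1fun_add[OF assms(1) C1fun_uminus[OF assms(2)]] by simp

lemma C1fun_divide:
 fixes f g :: "param \<times> real => complex"
 assumes "C1fun S f" "C1fun S g" "!!z. z \<in> S ==> g z ~= 0"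
 shows "C1fun S (%z. f z / g z)"
proof -
 have "inverse holomorphic_on (- {0::complex})" by (intro holomorphic_intros) auto
 then have "C1fun S (%z. inverse (g z))" by (intro C1fun_holomorphic[OF assms(2) _ _]) (use assms(3) in auto)
 from C1fun_mult[OF assms(1) this] show ?thesis by (simp add: divide_inverse)
qed

lemma C1fun_power:
 fixes f :: "param \<times> real => complex"
 assumes "C1fun S f" shows "C1fun S (%z. f z ^ n)" by (induction n) (simp_all add: C1fun_const C1fun_mult assms)

lemma C1fun_nth: "C1fun S f ==> C1fun S (%z. f z $ k)" by (rule C1fun_linear[OF _ bounded_linear_vec_nth])

lemma C1fun_fst: "C1fun S (%z. fst z)" unfolding C1fun_def by (rule exI[of _ "%z. Blinfun fst"])
  (auto intro!: derivative_eq_intros simp: bounded_linear_Blinfun_apply[OF bounded_linear_fst])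

lemma C1fun_snd: "C1fun S (%z. complex_of_real (snd z))"
proof -
 have "C1fun S (%z. snd z)" unfolding C1fun_def by (rule exI[of _ "%z. Blinfun snd"])
   (auto intro!: derivative_eq_intros simp: bounded_linear_Blinfun_apply[OF bounded_linear_snd])
 from C1fun_linear[OF this bounded_linear_of_real] show ?thesis .
qed

lemma C1fun_param: "C1fun S (%z. fst z $ k)" by (rule C1fun_nth[OF C1fun_fst])

lemma C1fun_cnj: "C1fun S f ==> C1fun S (%z. cnj (f z))" by (rule C1fun_linear[OF _ bounded_linear_cnj])

lemma C1fun_t3: "C1fun S (%z. t3 (fst z))" unfolding t3_def by (intro C1fun_diff C1fun_mult C1fun_power C1fun_const C1fun_param)

lemmas C1fun_intros = C1fun_add C1fun_diff C1fun_mult C1fun_power C1fun_uminus C1fun_const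
 C1fun_param C1fun_t3 C1fun_snd C1fun_cnj

lemma C1fun_vec3:
 fixes f :: "param \<times> real => complex ^ 3"
 assumes "!!i. C1fun S (%z. f z $ i)"
 shows "C1fun S f"
proof -
 have "C1fun S (%z. axis 1 (f z $ 1) + axis 2 (f z $ 2) + axis 3 (f z $ 3) :: complex ^ 3)"
  by (intro C1fun_add C1fun_linear[OF assms bounded_linear_axis])
 moreover have "axis 1 (f z $ 1) + axis 2 (f z $ 2) + axis 3 (f z $ 3) = f z" for z by (simp add: vec_eq_iff forall_3 axis_def)
 ultimately show ?thesis by simp
qed

lemma C1fun_slice:
 assumes "C1fun (V \<times> {a..b}) f" "open V" "a < b"
 obtains D E where
  "continuous_on (V \<times> {a..b}) (%(t, s). D t s)"
  "!!t s. t \<in> V ==> s \<in> {a..b} ==> ((%t. f (t, s)) has_derivative blinfun_apply (D t s)) (at t)"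
  "!!t s. t \<in> V ==> s \<in> {a..b} ==> ((%s. f (t, s)) hvd E t s) (at s within {a..b})"
proof -
 obtain f' where f': "continuous_on (V \<times> {a..b}) f'"
  "!!z. z \<in> V \<times> {a..b} ==> (f has_derivative blinfun_apply (f' z)) (at z within V \<times> {a..b})"
  by (rule C1funE[OF assms(1)]) (rule that)
 have bl: "bounded_linear (%v. (v, 0::real))" by (intro bounded_linear_Pair bounded_linear_ident bounded_linear_zero)
 define D where "D t s = f' (t, s) o\<^sub>L Blinfun (%v. (v, 0))" for t s
 define E where "E t s = f' (t, s) (0, 1)" for t s
 show thesis
 proof (rule that[of D E])
  have "continuous_on (V \<times> {a..b}) (%z. f' z o\<^sub>L Blinfun (%v. (v, 0)))" by (intro continuous_intros f')
  then show "continuous_on (V \<times> {a..b}) (%(t, s). D t s)" by (simp add: D_def split_def)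
  fix t s assume ts: "t \<in> V" "s \<in> {a..b}"
  have F: "(f has_derivative blinfun_apply (f' (t, s))) (at (t, s) within V \<times> {a..b})" using f'(2) ts by auto
  have "((%t. f (t, s)) has_derivative (%v. f' (t, s) (v, 0))) (at t within V)"
  proof (rule has_derivative_in_compose2[where t = "V \<times> {a..b}" and g = f and g' = "%z. blinfun_apply (f' z)"
     and f = "%t. (t, s)" and f' = "%v. (v, 0)" and s = V and x = t])
   show "((%t. (t, s)) has_derivative (%v. (v, 0))) (at t within V)" by (auto intro!: derivative_eq_intros)
  qed (use f'(2) ts in auto)
  moreover have "blinfun_apply (D t s) = (%v. f' (t, s) (v, 0))"
   by (simp add: D_def fun_eq_iff bounded_linear_Blinfun_apply[OF bl])
  ultimately show "((%t. f (t, s)) has_derivative blinfun_apply (D t s)) (at t)"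
   unfolding at_within_open[OF ts(1) assms(2)] by (simp only:)
  have "((%s. f (t, s)) has_derivative (%h. f' (t, s) (0, h))) (at s within {a..b})"
  proof (rule has_derivative_in_compose2[where t = "V \<times> {a..b}" and g = f and g' = "%z. blinfun_apply (f' z)"
     and f = "%s. (t, s)" and f' = "%h. (0, h)" and s = "{a..b}" and x = s])
   show "((%s. (t, s)) has_derivative (%h. (0, h))) (at s within {a..b})" by (auto intro!: derivative_eq_intros)
  qed (use f'(2) ts in auto)
  moreover have "f' (t, s) (0, h) = h *\<^sub>R E t s" for h unfolding E_def by (simp flip: blinfun.scaleR_right)
  ultimately show "((%s. f (t, s)) hvd E t s) (at s within {a..b})" by (simp add: hvd_def)
 qed
qed

text \<open>A variable upper limit is allowed, with the same \<open>D\<close> for all of them,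
  because mixed derivatives are obtained from integrals with moving end.\<close>

lemma C1fun_leibniz:
 fixes f :: "param \<times> real => 'b::euclidean_space"
 assumes f: "C1fun (V \<times> {a..b}) f" and V: "open V" "t0 \<in> V" and ab: "a < b"
 obtains D where
  "!!s. s \<in> {a..b} ==> ((%t. f (t, s)) has_derivative blinfun_apply (D s)) (at t0)"
  "continuous_on {a..b} D"
  "!!c. c \<in> {a<..b} ==> ((%t. integral {a..c} (%s. f (t, s))) has_derivative (%v. integral {a..c} (%s. D s v))) (at t0)"
proof -
 obtain D E where D: "continuous_on (V \<times> {a..b}) (%(t, s). D t s)"
  "!!t s. t \<in> V ==> s \<in> {a..b} ==> ((%t. f (t, s)) has_derivative blinfun_apply (D t s)) (at t)"
  "!!t s. t \<in> V ==> s \<in> {a..b} ==> ((%s. f (t, s)) hvd E t s) (at s within {a..b})"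
  by (rule C1fun_slice[OF f V(1) ab]) (rule that)
 obtain r where r: "r > 0" "ball t0 r <= V" using V by (meson open_contains_ball)
 have cD: "continuous_on {a..b} (D t0)"
 proof -
  have "continuous_on {a..b} (%s. (t0, s))" by (intro continuous_on_Pair continuous_on_const continuous_on_id)
  from continuous_on_compose2[OF D(1) this] V(2) show ?thesis by auto
 qed
 show thesis
 proof (rule that[of "D t0", OF _ cD])
  show "((%t. f (t, s)) has_derivative blinfun_apply (D t0 s)) (at t0)" if "s \<in> {a..b}" for s using D(2) V(2) that by blast
  fix c assume c: "c \<in> {a<..b}"
  have sub: "{a..c} <= {a..b}" using c by auto
  have "((%t. integral (cbox a c) (%s. f (t, s))) has_derivative blinfun_apply (integral (cbox a c) (D t0))) (at t0 within ball t0 r)"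
  proof (rule leibniz_rule)
   fix t s assume "t \<in> ball t0 r" "s \<in> cbox a c"
   then have "t \<in> V" "s \<in> {a..b}" using r(2) sub by auto
   then show "((%t. f (t, s)) has_derivative blinfun_apply (D t s)) (at t within ball t0 r)"
    by (rule has_derivative_at_withinI[OF D(2)])
  next
   fix t assume "t \<in> ball t0 r"
   then have "t \<in> V" using r(2) by blast
   then have c0: "continuous_on {a..b} (%s. f (t, s))" unfolding continuous_on_eq_continuous_within
    by (intro ballI has_vector_derivative_continuous[OF D(3)])
   show "(%s. f (t, s)) integrable_on cbox a c" by (rule integrable_continuous) (use c0 sub in "auto intro: continuous_on_subset")
  next
   show "continuous_on (ball t0 r \<times> cbox a c) (%(t, s). D t s)" using D(1) r(2) sub by (auto intro: continuous_on_subset)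
  qed (use r in auto)
  moreover have "blinfun_apply (integral (cbox a c) (D t0)) = (%v. integral {a..c} (%s. D t0 s v))"
  proof
   fix v
   have "D t0 integrable_on cbox a c" by (rule integrable_continuous) (use cD sub in "auto intro: continuous_on_subset")
   from blinfun_apply_integral[OF this, of v]
   show "blinfun_apply (integral (cbox a c) (D t0)) v = integral {a..c} (%s. D t0 s v)" by simp
  qed
  moreover have "t0 \<in> ball t0 r" using r(1) by simp
  ultimately show "((%t. integral {a..c} (%s. f (t, s))) has_derivative (%v. integral {a..c} (%s. D t0 s v))) (at t0)"
   by (simp only: at_within_open[OF _ open_ball] interval_cbox)
 qed
qed

lemma has_derivative_along_line:
 assumes "(f has_derivative D) (at t0)"
 shows "((%ep::real. f (t0 + ep *\<^sub>R v)) hvd D v) (at 0)"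
proof -
 have "((%ep::real. t0 + ep *\<^sub>R v) has_derivative (%h. h *\<^sub>R v)) (at 0)" by (auto intro!: derivative_eq_intros)
 from has_derivative_compose[OF this, of f D] assms
 have "((%ep. f (t0 + ep *\<^sub>R v)) has_derivative (%h. D (h *\<^sub>R v))) (at 0)" by simp
 moreover have "D (h *\<^sub>R v) = h *\<^sub>R D v" for h
  using has_derivative_bounded_linear[OF assms] by (simp add: linear_simps(5))
 ultimately show ?thesis by (simp add: hvd_def)
qed

text \<open>Differentiate \<open>f (t, s) - f (t, 0) = \<integral> f\<^sub>s (t, \<sigma>) d\<sigma>\<close>.\<close>

lemma mixed_derivative:
 fixes f g :: "param \<times> real => 'b::euclidean_space"
 assumes f: "C1fun (V \<times> {0..1}) f" and g: "C1fun (V \<times> {0..1}) g"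
  and fg: "!!t s. t \<in> V ==> s \<in> {0..1} ==> ((%s. f (t, s)) hvd g (t, s)) (at01 s)" and V: "open V" "t0 \<in> V"
 obtains d d' where
  "!!s. s \<in> {0..1} ==> ((%ep::real. f (t0 + ep *\<^sub>R v, s)) hvd d s) (at 0)"
  "!!s. s \<in> {0..1} ==> ((%ep::real. g (t0 + ep *\<^sub>R v, s)) hvd d' s) (at 0)"
  "!!s. s \<in> {0..1} ==> (d hvd d' s) (at01 s)"
proof -
 obtain D where D: "!!s. s \<in> {0..1} ==> ((%t. f (t, s)) has_derivative blinfun_apply (D s)) (at t0)"
  "continuous_on {0..1} D"
  "!!c. c \<in> {0<..1} ==> ((%t. integral {0..c} (%s. f (t, s))) has_derivative (%v. integral {0..c} (%s. D s v))) (at t0)"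
  by (rule C1fun_leibniz[OF f V zero_less_one]) (rule that)
 obtain G where G: "!!s. s \<in> {0..1} ==> ((%t. g (t, s)) has_derivative blinfun_apply (G s)) (at t0)"
  "continuous_on {0..1} G"
  "!!c. c \<in> {0<..1} ==> ((%t. integral {0..c} (%s. g (t, s))) has_derivative (%v. integral {0..c} (%s. G s v))) (at t0)"
  by (rule C1fun_leibniz[OF g V zero_less_one]) (rule that)
 have cG: "continuous_on {0..1} (%s. G s v)" by (intro continuous_intros G(2))
 have D_eq: "D s v = D 0 v + integral {0..s} (%s. G s v)" if s: "s \<in> {0..1}" for s
 proof (cases "s = 0")
  case False
  then have s': "s \<in> {0<..1}" using s by auto
  have "((%t. f (t, 0) + integral {0..s} (%s. g (t, s))) has_derivative (%v. D 0 v + integral {0..s} (%s. G s v))) (at t0)"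
   by (intro has_derivative_add D(1) G(3) s') auto
  then have "((%t. f (t, s)) has_derivative (%v. D 0 v + integral {0..s} (%s. G s v))) (at t0)"
  proof (rule has_derivative_transform_within_open[OF _ V])
   fix t assume "t \<in> V"
   then have "((%s. g (t, s)) has_integral f (t, s) - f (t, 0)) {0..s}" using s by (intro fundamental_theorem_of_calculus)
     (auto intro!: has_vector_derivative_within_subset[OF fg])
   then show "f (t, 0) + integral {0..s} (%s. g (t, s)) = f (t, s)" by (simp add: integral_unique)
  qed
  from has_derivative_unique[OF this D(1)[OF s]] show ?thesis by (simp add: fun_eq_iff)
 qed simp
 show thesis
 proof (rule that[of "%s. D s v" "%s. G s v"])
  fix s :: real assume s: "s \<in> {0..1}"
  show "((%ep::real. f (t0 + ep *\<^sub>R v, s)) hvd D s v) (at 0)" by (rule has_derivative_along_line[OF D(1)[OF s]])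
  show "((%ep::real. g (t0 + ep *\<^sub>R v, s)) hvd G s v) (at 0)" by (rule has_derivative_along_line[OF G(1)[OF s]])
  have "((%s. D 0 v + integral {0..s} (%s. G s v)) hvd 0 + G s v) (at01 s)"
   by (intro hvd_add hvd_const integral_has_vector_derivative cG s)
  then show "((%s. D s v) hvd G s v) (at01 s)" by (intro has_vector_derivative_transform[OF s D_eq]) simp_all
 qed
qed

section \<open>Variation of the integrands at finite points\<close>

definition dt3 :: "param => param => complex" where
 "dt3 t v = v $ 1 * (12 * (t $ 1)^2 - t $ 5) + v $ 2 * (- 2 * t $ 2) + v $ 5 * (- t $ 1)"

text \<open>The vector field \<open>(t\<^sub>2, t\<^sub>3) \<mapsto> al (- 6 t\<^sub>3, - t\<^sub>2\<^sup>2 / 3) + be (4 t\<^sub>2, 6 t\<^sub>3)\<close> lifts to the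
 polynomial vector field \<open>xi0 \<partial>\<^sub>x + psi0 \<partial>\<^sub>y\<close> along the curves.\<close>

definition lift_field :: "param => param => complex => complex => bool" where
 "lift_field t v al be \<longleftrightarrow> v $ 5 = - 6 * t3 t * al + 4 * t $ 5 * be &
   dt3 t v = - ((t $ 5)^2 / 3) * al + 6 * t3 t * be"

definition xi0 :: "param => complex => complex => complex => complex" where
 "xi0 t al be x = al * (- 2 * x^2 + t $ 5 / 3) + 2 * be * x"

definition psi0 :: "complex => complex => complex => complex => complex" where
 "psi0 al be x y = - 3 * al * x * y + 3 * be * y"

text \<open>The derivative of the equation of the curve along the lift of v: the lift is tangent to
  the family.\<close>

lemma lift_tangent:
 assumes l: "lift_field t v al be" and c: "y^2 = cubic t x"
 shows "2 * y * psi0 al be x y = dcubic t x * xi0 t al be x - v $ 5 * x - dt3 t v"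
proof -
 have "2 * y * psi0 al be x y = (- 6 * al * x + 6 * be) * y^2" by (simp add: psi0_def algebra_simps power2_eq_square)
 also have "\<dots> = dcubic t x * xi0 t al be x - v $ 5 * x - dt3 t v" using l unfolding c lift_field_def
  by (simp add: cubic_def dcubic_def xi0_def) (simp add: algebra_simps pow_eqs)
 finally show ?thesis .
qed

text \<open>The left side is the derivative of f'(x) = 12 x^2 - t_2 along the lift. It enters where
  dx/y is computed as 2 dy/f'(x).\<close>

lemma lift_identity:
 assumes l: "lift_field t v al be" and c: "y^2 = cubic t x"
 shows "24 * x * xi0 t al be x - v $ 5 = - 6 * al * y^2 + (4 * be - 2 * al * x) * dcubic t x" using l unfolding c lift_field_def
 by (simp add: cubic_def dcubic_def xi0_def) (simp add: algebra_simps pow_eqs)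

text \<open>When h dx/y is deformed along the regular lift, the derivative is the differential of
  this function plus (al t_2/12 + be h) dx/y. The identity \<open>P\<close> in
  \<open>finite_point_variation_h\<close> verifies the coefficients.\<close>

definition phifun :: "complex => param => complex => complex => point => complex" where
 "phifun e t al be p = (case p of None => 0 | Some (x, y) =>
   y * (al * ((2 * e^2 + t $ 5 / 6) * x + (2 * e^3 - 7 / 6 * e * t $ 5 - t3 t)) / (4 * (x - e)^3) + be * e / (x - e)^2))"

text \<open>\<open>b\<close> is the vertical part of the velocity \<open>d\<close> of a point \<open>p\<close>, measured by \<open>dx/y\<close>, relative to the
 lift \<open>xi0 \<partial>\<^sub>x + psi0 \<partial>\<^sub>y + al y / (2 (x - e)) D\<close>, which is regular at \<open>O\<close> and fixes \<open>O\<close>.\<close>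

definition vert :: "param => complex => complex => complex => complex ^ 3 => complex ^ 3 => complex => bool" where
 "vert t e al be p d b \<longleftrightarrow>
   (if p $ 3 = 0 then b = - 2 * ((d $ 1 * p $ 2 - p $ 1 * d $ 2) / (p $ 2)^2)
   else (d $ 1 * p $ 3 - p $ 1 * d $ 3) / (p $ 3)^2 = xi0 t al be (p $ 1 / p $ 3) +
        (b + al * ((p $ 2 / p $ 3) / (2 * (p $ 1 / p $ 3 - e)))) * (p $ 2 / p $ 3) &
      2 * ((d $ 2 * p $ 3 - p $ 2 * d $ 3) / (p $ 3)^2 - psi0 al be (p $ 1 / p $ 3) (p $ 2 / p $ 3)) =
        (b + al * ((p $ 2 / p $ 3) / (2 * (p $ 1 / p $ 3 - e)))) * dcubic t (p $ 1 / p $ 3))"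

lemma line_param: "((%ep::real. (t0 + ep *\<^sub>R v) $ k) hvd v $ k) (at 0)"
 by (rule has_derivative_along_line[OF bounded_linear.has_derivative[OF bounded_linear_vec_nth has_derivative_ident]])

lemma line_t3: "((%ep::real. t3 (t0 + ep *\<^sub>R v)) hvd dt3 t0 v) (at 0)"
 unfolding dt3_def by (rule has_derivative_along_line[OF t3_has_derivative])

lemma hvd_transform_nhds:
 assumes "(f hvd D) (at x)" and ev: "eventually (%y. f y = g y) (nhds x)"
 shows "(g hvd D) (at x)" using assms(1) unfolding hvd_def by (rule has_derivative_transform_eventually)
  (use ev eventually_nhds_x_imp_x[OF ev] in "auto simp: eventually_at_filter elim: eventually_mono")

lemma eventually_nonzero_nhds:
 assumes "(f hvd D) (at x)" and "f x ~= 0"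
 shows "eventually (%y. f y ~= 0) (nhds x)"
 using hvd_tendsto[OF assms(1)] assms(2) by (auto simp: tendsto_nhds_iff intro: tendsto_imp_eventually_ne)

lemma moving_point_relation:
 fixes P :: "real => complex ^ 3"
 assumes P: "(P hvd d) (at 0)" and z: "P 0 $ 3 ~= 0" and c: "eventually (%ep. on_cone (t0 + ep *\<^sub>R v) (P ep)) (nhds 0)"
 shows "2 * (P 0 $ 2 / P 0 $ 3) * ((d $ 2 * P 0 $ 3 - P 0 $ 2 * d $ 3) / (P 0 $ 3)^2) =
   dcubic t0 (P 0 $ 1 / P 0 $ 3) * ((d $ 1 * P 0 $ 3 - P 0 $ 1 * d $ 3) / (P 0 $ 3)^2)
    - v $ 5 * (P 0 $ 1 / P 0 $ 3) - dt3 t0 v"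
proof -
 have q: "((%ep. P ep $ k / P ep $ 3) hvd (d $ k * P 0 $ 3 - P 0 $ k * d $ 3) / (P 0 $ 3)^2) (at 0)" for k
  by (intro hvd_quotient hvd_vec_nth P z)
 note z' = eventually_nonzero_nhds[OF hvd_vec_nth[OF P] z]
 have ev: "eventually (%ep. (P ep $ 2 / P ep $ 3)^2 = 4 * (P ep $ 1 / P ep $ 3)^3
   - (t0 + ep *\<^sub>R v) $ 5 * (P ep $ 1 / P ep $ 3) - t3 (t0 + ep *\<^sub>R v)) (nhds 0)" using c z'
 proof eventually_elim
  case (elim ep)
  then show ?case by (rule on_cone_affine[unfolded cubic_def])
 qed
 have "2 * (P 0 $ 2 / P 0 $ 3) * ((d $ 2 * P 0 $ 3 - P 0 $ 2 * d $ 3) / (P 0 $ 3)^2) =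
   (12 * (P 0 $ 1 / P 0 $ 3)^2 - (t0 + 0 *\<^sub>R v) $ 5) * ((d $ 1 * P 0 $ 3 - P 0 $ 1 * d $ 3) / (P 0 $ 3)^2)
    - v $ 5 * (P 0 $ 1 / P 0 $ 3) - dt3 t0 v" by (rule curve_relation[OF q q line_param line_t3 _ eventually_nhds_x_imp_x[OF ev]])
   (use ev in "auto simp: eventually_at_filter elim: eventually_mono")
 then show ?thesis by (simp add: dcubic_def)
qed

text \<open>Velocity and lift lie over the same v, so their difference is tangent to the fixed
  curve, hence a multiple of y d/dx + (f'/2) d/dy. The factor is read off from whichever of y and f'
  is non-zero.\<close>

lemma vert_exists:
 fixes P :: "real => complex ^ 3"
 assumes t0: "t0 \<in> TT" and l: "lift_field t0 v al be" and P: "(P hvd d) (at 0)"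
  and c: "eventually (%ep. on_cone (t0 + ep *\<^sub>R v) (P ep)) (nhds 0)"
 shows "\<exists>b. vert t0 e al be (P 0) d b"
proof (cases "P 0 $ 3 = 0")
 case True
 then show ?thesis by (simp add: vert_def)
next
 case False
 have c0: "on_cone t0 (P 0)" using eventually_nhds_x_imp_x[OF c] by simp
 define x y xd yd where "x = P 0 $ 1 / P 0 $ 3" and "y = P 0 $ 2 / P 0 $ 3"
  and "xd = (d $ 1 * P 0 $ 3 - P 0 $ 1 * d $ 3) / (P 0 $ 3)^2" and "yd = (d $ 2 * P 0 $ 3 - P 0 $ 2 * d $ 3) / (P 0 $ 3)^2"
 have rel: "2 * y * yd = dcubic t0 x * xd - v $ 5 * x - dt3 t0 v"
  using moving_point_relation[OF P False c] unfolding x_def y_def xd_def yd_def .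
 have cc: "y^2 = cubic t0 x" using on_cone_affine[OF c0 False] by (simp add: x_def y_def)
 have eq: "2 * y * (yd - psi0 al be x y) = dcubic t0 x * (xd - xi0 t0 al be x)"
  using rel lift_tangent[OF l cc] by (simp add: right_diff_distrib)
 have "\<exists>my. xd = xi0 t0 al be x + my * y & 2 * (yd - psi0 al be x y) = my * dcubic t0 x"
 proof (cases "y = 0")
  case True
  then have "dcubic t0 x ~= 0" using cc dcubic_nonzero[OF t0] by simp
  then show ?thesis using eq True by (intro exI[of _ "2 * (yd - psi0 al be x y) / dcubic t0 x"]) simp
 next
  case False
  then show ?thesis using eq by (intro exI[of _ "(xd - xi0 t0 al be x) / y"]) (simp add: field_simps)
 qed
 then obtain my where "xd = xi0 t0 al be x + my * y" "2 * (yd - psi0 al be x y) = my * dcubic t0 x" by blast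
 then show ?thesis using False unfolding vert_def x_def[symmetric] y_def[symmetric] xd_def[symmetric] yd_def[symmetric]
  by (intro exI[of _ "my - al * (y / (2 * (x - e)))"]) simp
qed

text \<open>Turns \<open>inv_diff_affine\<close>, which verifies a candidate, into equations for
  \<open>inv_diff\<close> itself; a candidate exists because y and f'(x) do not vanish
  together.\<close>

lemma inv_diff_affine_eqs:
 assumes t: "t \<in> TT" and p: "path_at t T ga s v" and z: "ga s $ 3 ~= 0"
 shows "inv_diff t (ga s) v * (ga s $ 2 / ga s $ 3) = (v $ 1 * ga s $ 3 - ga s $ 1 * v $ 3) / (ga s $ 3)^2"
  and "inv_diff t (ga s) v * dcubic t (ga s $ 1 / ga s $ 3) = 2 * ((v $ 2 * ga s $ 3 - ga s $ 2 * v $ 3) / (ga s $ 3)^2)"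
proof -
 have g: "(ga hvd v) (at s within T)" and c: "on_cone t (ga s)" and nt: "at s within T ~= bot" using p by (auto simp: path_at_def)
 define x y where "x = ga s $ 1 / ga s $ 3" and "y = ga s $ 2 / ga s $ 3"
 obtain x' y' where X: "((%s. ga s $ 1 / ga s $ 3) hvd x') (at s within T)"
  and Y: "((%s. ga s $ 2 / ga s $ 3) hvd y') (at s within T)"
  and "eventually (%s'. s' \<in> T & ga s' $ 3 ~= 0 & (ga s' $ 2 / ga s' $ 3)^2 = cubic t (ga s' $ 1 / ga s' $ 3)) (at s within T)"
  and rel: "2 * y * y' = dcubic t x * x'" and inv: "!!l. l * y = x' ==> l * dcubic t x = 2 * y' ==> inv_diff t (ga s) v = l"
  by (rule path_at_affine[OF t p z, folded x_def y_def]) (rule that)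
 have q: "((%ep. ga ep $ k / ga ep $ 3) hvd (v $ k * ga s $ 3 - ga s $ k * v $ 3) / (ga s $ 3)^2) (at s within T)" for k
  by (intro hvd_quotient hvd_vec_nth g z)
 have x': "x' = (v $ 1 * ga s $ 3 - ga s $ 1 * v $ 3) / (ga s $ 3)^2"
  and y': "y' = (v $ 2 * ga s $ 3 - ga s $ 2 * v $ 3) / (ga s $ 3)^2"
  by (rule vector_derivative_unique_within[OF nt X q] vector_derivative_unique_within[OF nt Y q])+
 have cc: "y^2 = cubic t x" using on_cone_affine[OF c z] by (simp add: x_def y_def)
 have "\<exists>l. l * y = x' & l * dcubic t x = 2 * y'"
 proof (cases "y = 0")
  case True
  then have "dcubic t x ~= 0" using cc dcubic_nonzero[OF t] by simp
  then show ?thesis using rel True by (intro exI[of _ "2 * y' / dcubic t x"]) simp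
 next
  case False
  then show ?thesis using rel by (intro exI[of _ "x' / y"]) (simp add: field_simps)
 qed
 then obtain l where l: "l * y = x'" "l * dcubic t x = 2 * y'" by blast
 have "inv_diff t (ga s) v = l" by (rule inv[OF l])
 then show "inv_diff t (ga s) v * (ga s $ 2 / ga s $ 3) = (v $ 1 * ga s $ 3 - ga s $ 1 * v $ 3) / (ga s $ 3)^2"
  "inv_diff t (ga s) v * dcubic t (ga s $ 1 / ga s $ 3) = 2 * ((v $ 2 * ga s $ 3 - ga s $ 2 * v $ 3) / (ga s $ 3)^2)"
  using l unfolding x_def[symmetric] y_def[symmetric] x' y' by simp_all
qed

text \<open>Symmetry of second derivatives for a quotient: \<open>q\<close> is both the variation of
  its velocity and the velocity of its variation.\<close>

lemma mixed_quotient: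
 fixes A B As Bs :: "real => complex"
 assumes "(A hvd ad s) (at 0)" "(B hvd bd s) (at 0)"
  "(As hvd am) (at 0)" "(Bs hvd bm) (at 0)"
  "(a hvd as) (at s within T)" "(b hvd bs) (at s within T)"
  "(ad hvd am) (at s within T)" "(bd hvd bm) (at s within T)"
  "A 0 = a s" "B 0 = b s" "As 0 = as" "Bs 0 = bs" "b s ~= 0"
 obtains q where "((%ep. (As ep * B ep - A ep * Bs ep) / (B ep)^2) hvd q) (at 0)"
  "((%s. (ad s * b s - a s * bd s) / (b s)^2) hvd q) (at s within T)"
proof -
 have 1: "((%ep. (As ep * B ep - A ep * Bs ep) / (B ep * B ep)) hvd
   ((as * bd s + am * b s - (a s * bm + ad s * bs)) * (b s * b s) - (as * b s - a s * bs) * (b s * bd s + bd s * b s)) / (b s * b s)^2) (at 0)"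
  using hvd_quotient[OF
    hvd_diff[OF hvd_mult[OF assms(3,2)] hvd_mult[OF assms(1,4)]]
    hvd_mult[OF assms(2,2)]] assms(9-13) by simp
 have 2: "((%s. (ad s * b s - a s * bd s) / (b s * b s)) hvd
   ((ad s * bs + am * b s - (a s * bm + as * bd s)) * (b s * b s) - (ad s * b s - a s * bd s) * (b s * bs + bs * b s)) / (b s * b s)^2) (at s within T)"
  using hvd_quotient[OF
    hvd_diff[OF hvd_mult[OF assms(7,6)] hvd_mult[OF assms(5,8)]]
    hvd_mult[OF assms(6,6)]] assms(13) by simp
 have "(as * bd s + am * b s - (a s * bm + ad s * bs)) * (b s * b s) - (as * b s - a s * bs) * (b s * bd s + bd s * b s) =
  (ad s * bs + am * b s - (a s * bm + as * bd s)) * (b s * b s) - (ad s * b s - a s * bd s) * (b s * bs + bs * b s)"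
  by (simp add: algebra_simps)
 then show thesis using 1 2 that unfolding power2_eq_square[of "B _"] power2_eq_square[of "b _"] by simp
qed

text \<open>A path \<open>Ga\<close> moving with the parameter in the direction \<open>v\<close>; \<open>Gas\<close> is its velocity, \<open>d\<close> its
 variation and \<open>d'\<close> the mixed derivative.\<close>

locale moving_path =
 fixes t0 v :: param and e al be :: complex
  and Ga Gas :: "param => real => complex ^ 3" and d d' :: "real => complex ^ 3" and b :: "real => complex"
 assumes t0: "t0 \<in> TT" and lift: "lift_field t0 v al be"
  and d: "s \<in> {0..1} ==> ((%ep::real. Ga (t0 + ep *\<^sub>R v) s) hvd d s) (at 0)"
  and d': "s \<in> {0..1} ==> ((%ep::real. Gas (t0 + ep *\<^sub>R v) s) hvd d' s) (at 0)"
  and dd': "s \<in> {0..1} ==> (d hvd d' s) (at01 s)" and path: "eventually (%ep::real. t0 + ep *\<^sub>R v \<in> TT &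
    (\<forall>s\<in>{0..1}. path_at (t0 + ep *\<^sub>R v) {0..1} (Ga (t0 + ep *\<^sub>R v)) s (Gas (t0 + ep *\<^sub>R v) s))) (nhds 0)"
  and U: "s \<in> {0..1} ==> pt (Ga t0 s) \<in> U_frame e t0" and b: "s \<in> {0..1} ==> vert t0 e al be (Ga t0 s) (d s) (b s)"
begin

abbreviation "ivd s t \<equiv> inv_diff t (Ga t s) (Gas t s)"
abbreviation "hf s t \<equiv> hfun e t (pt (Ga t s))"
abbreviation "pf s \<equiv> phifun e t0 al be (pt (Ga t0 s))"
abbreviation "line ep \<equiv> t0 + ep *\<^sub>R v"

text \<open>The infinitesimal Gauss-Manin system on integrands. Up to the total derivatives of b and
  of h b + phi, dx/y varies by -(al h + be) dx/y and h dx/y varies by (al t_2/12 + be h)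
  dx/y.\<close>

abbreviation "varies s \<equiv> \<exists>b' b3'. (b hvd b') (at01 s) &
  ((%ep. ivd s (line ep)) hvd b' - al * hf s t0 * ivd s t0 - be * ivd s t0) (at 0) &
  ((%s. hf s t0 * b s + pf s) hvd b3') (at01 s) &
  ((%ep. hf s (line ep) * ivd s (line ep)) hvd b3' + (al * t0 $ 5 / 12 + be * hf s t0) * ivd s t0) (at 0)"

lemma path0: "s \<in> {0..1} ==> path_at t0 {0..1} (Ga t0) s (Gas t0 s)" using eventually_nhds_x_imp_x[OF path] by simp

lemma deriv_s: "s \<in> {0..1} ==> (Ga t0 hvd Gas t0 s) (at01 s)" using path0 by (simp add: path_at_def)

text \<open>The time derivative of b and the variation of dx/y contain the same mixed derivative of
  x, or of y, which cancels. The computation divides by f'(x) and uses y if f'(x) is non-zero;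
  otherwise it divides by y and uses x.\<close>

lemma finite_point_variation:
 assumes s: "s \<in> {0..1}" and z: "Ga t0 s $ 3 ~= 0"
 obtains b' where "(b hvd b') (at01 s)"
  "((%ep. ivd s (line ep)) hvd
    b' - al * hf s t0 * ivd s t0 - be * ivd s t0) (at 0)"
proof -
 define X Y where "X s = Ga t0 s $ 1 / Ga t0 s $ 3" and "Y s = Ga t0 s $ 2 / Ga t0 s $ 3" for s
 define Xd Yd where "Xd s = (d s $ 1 * Ga t0 s $ 3 - Ga t0 s $ 1 * d s $ 3) / (Ga t0 s $ 3)^2"
  and "Yd s = (d s $ 2 * Ga t0 s $ 3 - Ga t0 s $ 2 * d s $ 3) / (Ga t0 s $ 3)^2" for s
 define XE YE where "XE ep = Ga (line ep) s $ 1 / Ga (line ep) s $ 3" and "YE ep = Ga (line ep) s $ 2 / Ga (line ep) s $ 3" for ep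
 define Xs Ys where
  "Xs ep = (Gas (line ep) s $ 1 * Ga (line ep) s $ 3 - Ga (line ep) s $ 1 * Gas (line ep) s $ 3) / (Ga (line ep) s $ 3)^2"
  and "Ys ep = (Gas (line ep) s $ 2 * Ga (line ep) s $ 3 - Ga (line ep) s $ 2 * Gas (line ep) s $ 3) / (Ga (line ep) s $ 3)^2" for ep
 define l where "l = ivd s t0"
 define L where "L ep = ivd s (line ep)" for ep
 define h where "h = hf s t0"
 note nth = hvd_vec_nth
 obtain q1 where q1: "(Xs hvd q1) (at 0)" "(Xd hvd q1) (at01 s)" unfolding Xs_def Xd_def
  by (rule mixed_quotient[where a = "%s. Ga t0 s $ 1" and b = "%s. Ga t0 s $ 3" and ad = "%s. d s $ 1" and bd = "%s. d s $ 3",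
    OF nth[OF d[OF s]] nth[OF d[OF s]] nth[OF d'[OF s]] nth[OF d'[OF s]]
    nth[OF deriv_s[OF s]] nth[OF deriv_s[OF s]] nth[OF dd'[OF s]] nth[OF dd'[OF s]]]) (use z that in simp_all)
 obtain q2 where q2: "(Ys hvd q2) (at 0)" "(Yd hvd q2) (at01 s)" unfolding Ys_def Yd_def
  by (rule mixed_quotient[where a = "%s. Ga t0 s $ 2" and b = "%s. Ga t0 s $ 3" and ad = "%s. d s $ 2" and bd = "%s. d s $ 3",
    OF nth[OF d[OF s]] nth[OF d[OF s]] nth[OF d'[OF s]] nth[OF d'[OF s]]
    nth[OF deriv_s[OF s]] nth[OF deriv_s[OF s]] nth[OF dd'[OF s]] nth[OF dd'[OF s]]]) (use z that in simp_all)
 have l1: "l * Y s = Xs 0" and l2: "l * dcubic t0 (X s) = 2 * Ys 0"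
  using inv_diff_affine_eqs[OF t0 path0[OF s] z] by (simp_all add: l_def X_def Y_def Xs_def Ys_def)
 have X': "(X hvd l * Y s) (at01 s)" using hvd_quotient[OF nth[OF deriv_s[OF s], of 1] nth[OF deriv_s[OF s], of 3] z]
  unfolding l1 X_def Xs_def by simp
 have Y': "(Y hvd l * dcubic t0 (X s) / 2) (at01 s)"
 proof -
  have eq: "l * dcubic t0 (X s) / 2 = Ys 0" using l2 by simp
  show ?thesis unfolding eq using hvd_quotient[OF nth[OF deriv_s[OF s], of 2] nth[OF deriv_s[OF s], of 3] z]
   unfolding Y_def Ys_def by simp
 qed
 have XE: "(XE hvd Xd s) (at 0)" and YE: "(YE hvd Yd s) (at 0)" using hvd_quotient[OF nth[OF d[OF s], of 1] nth[OF d[OF s], of 3]]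
   hvd_quotient[OF nth[OF d[OF s], of 2] nth[OF d[OF s], of 3]] z unfolding XE_def YE_def Xd_def Yd_def by simp_all
 have E0: "XE 0 = X s" "YE 0 = Y s" by (simp_all add: XE_def YE_def X_def Y_def)
 have ptp: "pt (Ga t0 s) = Some (X s, Y s)" using z by (simp add: pt_def X_def Y_def)
 have cc: "Y s ^ 2 = cubic t0 (X s)" and Xe: "X s ~= e" using U[OF s] unfolding ptp by (auto simp: Some_in_U_frame)
 have zT: "eventually (%s'. Ga t0 s' $ 3 ~= 0) (at01 s)"
  by (rule tendsto_imp_eventually_ne[OF hvd_tendsto[OF nth[OF deriv_s[OF s]]] z])
 have inT: "eventually (%s'. s' \<in> {0..1}) (at01 s)" by (auto simp: eventually_at_filter)
 define sg where "sg s = Y s / (2 * (X s - e))" for s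
 \<comment> \<open>Along the path the derivative is l times D(y/(2(x-e))), which is l (x - h) by the
   meaning of h.\<close>
 have sig: "(sg hvd l * (X s - h)) (at01 s)"
 proof -
  have "((%s. 2 * (X s - e)) hvd 2 * (l * Y s - 0)) (at01 s)" by (intro hvd_mult_right hvd_diff X' hvd_const)
  from hvd_quotient[OF Y' this] Xe
  have "(sg hvd (l * dcubic t0 (X s) / 2 * (2 * (X s - e)) - Y s * (2 * (l * Y s - 0))) / (2 * (X s - e))^2) (at01 s)"
   unfolding sg_def by simp
  moreover have fr: "(l * D / 2 * (2 * x) - y * (2 * (l * y - 0))) / (2 * x)^2 = l * (D / (4 * x) - y^2 / (2 * x^2))"
   if "x ~= 0" for x y D using that by (simp add: divide_simps) (simp add: algebra_simps power2_eq_square)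
  have "(l * dcubic t0 (X s) / 2 * (2 * (X s - e)) - Y s * (2 * (l * Y s - 0))) / (2 * (X s - e))^2 =
    l * (dcubic t0 (X s) / (4 * (X s - e)) - Y s ^ 2 / (2 * (X s - e)^2))" by (rule fr) (use Xe in simp)
  moreover have "X s - h = dcubic t0 (X s) / (4 * (X s - e)) - Y s ^ 2 / (2 * (X s - e)^2)"
   unfolding h_def ptp hfun_eq[OF cc Xe] by simp
  ultimately show ?thesis by (simp only:)
 qed
 have bX: "Xd s' = xi0 t0 al be (X s') + (b s' + al * sg s') * Y s'"
  and bY: "2 * (Yd s' - psi0 al be (X s') (Y s')) = (b s' + al * sg s') * dcubic t0 (X s')"
  if "s' \<in> {0..1}" "Ga t0 s' $ 3 ~= 0" for s'
  using b[OF that(1)] that(2) unfolding vert_def X_def Y_def Xd_def Yd_def sg_def by simp_all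
 define my where "my = b s + al * sg s"
 note bX0 = bX[OF s z, folded my_def] and bY0 = bY[OF s z, folded my_def]
 have evz: "eventually (%ep. Ga (line ep) s $ 3 ~= 0) (nhds 0)" using eventually_nonzero_nhds[OF nth[OF d[OF s], of 3]] z by simp
 have L_eqs: "eventually (%ep. L ep * YE ep = Xs ep & L ep * (12 * (XE ep * XE ep) - line ep $ 5) = 2 * Ys ep) (nhds 0)"
  using path evz
 proof eventually_elim
  case (elim ep)
  then show ?case using inv_diff_affine_eqs[of "line ep" "{0..1}" "Ga (line ep)" s "Gas (line ep) s"] s
   by (simp add: L_def XE_def YE_def Xs_def Ys_def dcubic_def power2_eq_square)
 qed
 note fin = that
 \<comment> \<open>Serves both cases: b + al sg = N/F along the path, and the integrand is M/G in
   the parameter direction, with G starting at the value of F. The assumption \<open>id\<close>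
   compares the derivatives of M and N, in which the mixed derivative is common.\<close>
 have thesis_if: thesis
  if N': "(N hvd n') (at01 s)" and F': "(F hvd f') (at01 s)" and F0: "F s ~= 0"
   and N: "!!s'. s' \<in> {0..1} ==> Ga t0 s' $ 3 ~= 0 ==> N s' = (b s' + al * sg s') * F s'"
   and G': "(G hvd g') (at 0)" and G0: "G 0 = F s" and M': "(M hvd m') (at 0)" and M0: "M 0 = l * F s"
   and LG: "eventually (%ep. L ep * G ep = M ep) (nhds 0)" and id: "m' - l * g' = n' - my * f' - (al * (l * X s) + be * l) * F s"
  for N F G M :: "_ => complex" and n' f' g' m'
 proof -
  define b' where "b' = (n' - my * f') / F s - al * (l * (X s - h))"
  have Ns: "N s = my * F s" using N[OF s z] by (simp add: my_def)
  have evF: "eventually (%s'. F s' ~= 0) (at01 s)" by (rule tendsto_imp_eventually_ne[OF hvd_tendsto[OF F'] F0])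
  have "((%s. N s / F s - al * sg s) hvd (n' * F s - N s * f') / (F s)^2 - al * (l * (X s - h))) (at01 s)"
   by (intro hvd_diff hvd_mult_right sig hvd_quotient N' F' F0)
  moreover have "(n' * F s - N s * f') / (F s)^2 = (n' - my * f') / F s"
   using F0 unfolding Ns by (simp add: field_simps power2_eq_square)
  ultimately have bN: "((%s. N s / F s - al * sg s) hvd b') (at01 s)" by (simp add: b'_def)
  have "eventually (%s'. N s' / F s' - al * sg s' = b s') (at01 s)" using zT inT evF by eventually_elim (simp add: N)
  from this _ s have bb: "(b hvd b') (at01 s)"
   unfolding hvd_def by (rule has_derivative_transform_eventually[OF bN[unfolded hvd_def]]) (use Ns F0 in "simp add: my_def")
  have "((%ep. M ep / G ep) hvd (m' * G 0 - M 0 * g') / (G 0)^2) (at 0)" by (intro hvd_quotient M' G') (simp add: G0 F0)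
  moreover have "(m' * G 0 - M 0 * g') / (G 0)^2 = (m' - l * g') / F s"
   using F0 unfolding G0 M0 by (simp add: field_simps power2_eq_square)
  moreover have "(m' - l * g') / F s = b' - al * h * l - be * l" unfolding id b'_def using F0 by (simp add: field_simps)
  ultimately have "((%ep. M ep / G ep) hvd b' - al * h * l - be * l) (at 0)" by simp
  moreover have "eventually (%ep. G ep ~= 0) (nhds 0)" using eventually_nonzero_nhds[OF G'] F0 unfolding G0 .
  with LG have "eventually (%ep. M ep / G ep = L ep) (nhds 0)" by eventually_elim (simp add: field_simps)
  ultimately have "(L hvd b' - al * h * l - be * l) (at 0)" by (rule hvd_transform_nhds)
  then show thesis using fin[OF bb] unfolding L_def[abs_def] l_def h_def by simp
 qed
 show thesis
 proof (cases "dcubic t0 (X s) = 0")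
  case False
  define F where "F s = 12 * (X s * X s) - t0 $ 5" for s
  have FD: "F s' = dcubic t0 (X s')" for s' by (simp add: F_def dcubic_def power2_eq_square)
  show thesis
  proof (rule thesis_if)
   show "((%s. 2 * (Yd s - (- 3 * al * (X s * Y s) + 3 * be * Y s))) hvd
     2 * (q2 - (- 3 * al * (X s * (l * F s / 2) + l * Y s * Y s) + 3 * be * (l * F s / 2)))) (at01 s)"
    by (intro hvd_mult_right hvd_diff hvd_add hvd_mult X' Y'[folded FD] q2(2))
   show "(F hvd 24 * X s * (l * Y s)) (at01 s)" unfolding F_def by (auto intro!: derivative_eq_intros X')
   show "F s ~= 0" using False by (simp add: FD)
   show "2 * (Yd s' - (- 3 * al * (X s' * Y s') + 3 * be * Y s')) = (b s' + al * sg s') * F s'"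
    if "s' \<in> {0..1}" "Ga t0 s' $ 3 ~= 0" for s' using bY[OF that] by (simp add: FD psi0_def mult.assoc)
   show "((%ep. 12 * (XE ep * XE ep) - line ep $ 5) hvd 24 * X s * Xd s - v $ 5) (at 0)"
    by (rule hvd_eq_rhs[OF hvd_diff[OF hvd_mult_right[OF hvd_mult[OF XE XE]] line_param]]) (simp add: E0)
   show "((%ep. 2 * Ys ep) hvd 2 * q2) (at 0)" by (intro hvd_mult_right q2)
   show "eventually (%ep. L ep * (12 * (XE ep * XE ep) - line ep $ 5) = 2 * Ys ep) (nhds 0)" using L_eqs by eventually_elim simp
   have id: "24 * X s * xi0 t0 al be (X s) - v $ 5 = - 6 * al * Y s ^ 2 + (4 * be - 2 * al * X s) * F s"
    using lift_identity[OF lift cc] by (simp add: FD)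
   have "2 * q2 - l * (24 * X s * Xd s - v $ 5) =
     2 * q2 - l * ((24 * X s * xi0 t0 al be (X s) - v $ 5) + 24 * X s * (my * Y s))" unfolding bX0 by (simp add: algebra_simps)
   also have "\<dots> =
     2 * (q2 - (- 3 * al * (X s * (l * F s / 2) + l * Y s * Y s) + 3 * be * (l * F s / 2)))
     - my * (24 * X s * (l * Y s)) - (al * (l * X s) + be * l) * F s" unfolding id by (simp add: field_simps power2_eq_square)
   finally show "2 * q2 - l * (24 * X s * Xd s - v $ 5) = \<dots>" .
  qed (use l2 in "simp_all add: E0 F_def dcubic_def power2_eq_square")
 next
  case True
  then have Y0: "Y s ~= 0" using cc dcubic_nonzero[OF t0] by fastforce
  show thesis
  proof (rule thesis_if)
   show "((%s. Xd s - (al * (- 2 * (X s * X s) + t0 $ 5 / 3) + 2 * be * X s)) hvd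
     q1 - (- 4 * al * X s + 2 * be) * (l * Y s)) (at01 s)" by (auto intro!: derivative_eq_intros X' q1(2) simp: algebra_simps)
   show "Xd s' - (al * (- 2 * (X s' * X s') + t0 $ 5 / 3) + 2 * be * X s') = (b s' + al * sg s') * Y s'"
    if "s' \<in> {0..1}" "Ga t0 s' $ 3 ~= 0" for s' using bX[OF that] by (simp add: xi0_def power2_eq_square)
   show "eventually (%ep. L ep * YE ep = Xs ep) (nhds 0)" using L_eqs by eventually_elim simp
   have Yd: "Yd s = psi0 al be (X s) (Y s)" using bY0 True by simp
   show "q1 - l * Yd s = q1 - (- 4 * al * X s + 2 * be) * (l * Y s) - my * (l * dcubic t0 (X s) / 2)
     - (al * (l * X s) + be * l) * Y s" unfolding Yd True psi0_def by (simp add: algebra_simps)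
  qed (use l1 in "simp_all add: E0 q1 Y' YE Y0")
 qed
qed

text \<open>The product rule reduces the claim for h dx/y to the variation of h. After the terms
  with b and b' have cancelled, an identity between rational functions of x with poles at x = e only
  is left, y^2 being replaced by the cubic.\<close>

lemma finite_point_variation_h:
 assumes s: "s \<in> {0..1}" and z: "Ga t0 s $ 3 ~= 0"
 shows "varies s"
proof -
 define X Y where "X s = Ga t0 s $ 1 / Ga t0 s $ 3" and "Y s = Ga t0 s $ 2 / Ga t0 s $ 3" for s
 define xd where "xd = (d s $ 1 * Ga t0 s $ 3 - Ga t0 s $ 1 * d s $ 3) / (Ga t0 s $ 3)^2"
 define XE where "XE ep = Ga (line ep) s $ 1 / Ga (line ep) s $ 3" for ep
 define l where "l = ivd s t0"
 define h where "h = hf s t0"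
 note nth = hvd_vec_nth
 obtain b' where b': "(b hvd b') (at01 s)" and L': "((%ep. ivd s (line ep)) hvd
    b' - al * h * l - be * l) (at 0)" by (rule finite_point_variation[OF s z, folded l_def h_def]) (rule that)
 have l1: "l * Y s = (Gas t0 s $ 1 * Ga t0 s $ 3 - Ga t0 s $ 1 * Gas t0 s $ 3) / (Ga t0 s $ 3)^2"
  and l2: "l * dcubic t0 (X s) = 2 * ((Gas t0 s $ 2 * Ga t0 s $ 3 - Ga t0 s $ 2 * Gas t0 s $ 3) / (Ga t0 s $ 3)^2)"
  using inv_diff_affine_eqs[OF t0 path0[OF s] z] by (simp_all add: l_def X_def Y_def)
 have l2': "l * dcubic t0 (X s) / 2 = (Gas t0 s $ 2 * Ga t0 s $ 3 - Ga t0 s $ 2 * Gas t0 s $ 3) / (Ga t0 s $ 3)^2"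
  unfolding l2 by (rule nonzero_mult_div_cancel_left) simp
 have X': "(X hvd l * Y s) (at01 s)" unfolding l1 X_def by (rule hvd_quotient[OF nth[OF deriv_s[OF s]] nth[OF deriv_s[OF s]] z])
 have Y': "(Y hvd l * dcubic t0 (X s) / 2) (at01 s)"
  unfolding l2' Y_def by (rule hvd_quotient[OF nth[OF deriv_s[OF s]] nth[OF deriv_s[OF s]] z])
 have XE: "(XE hvd xd) (at 0)" using hvd_quotient[OF nth[OF d[OF s], of 1] nth[OF d[OF s], of 3]] z
  unfolding XE_def xd_def by simp
 have E0: "XE 0 = X s" by (simp add: XE_def X_def)
 have ptp: "pt (Ga t0 s) = Some (X s, Y s)" using z by (simp add: pt_def X_def Y_def)
 have cc: "Y s ^ 2 = cubic t0 (X s)" and Xe: "X s ~= e" using U[OF s] unfolding ptp by (auto simp: Some_in_U_frame)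
 define dd i where "dd = X s - e" and "i = 1 / dd"
 have dd0: "dd ~= 0" using Xe by (simp add: dd_def)
 have bX: "xd = xi0 t0 al be (X s) + (b s + al * (Y s * i / 2)) * Y s"
  using b[OF s] z unfolding vert_def X_def Y_def xd_def i_def dd_def by simp
 define I where "I s = 1 / (X s - e)" for s
 have Is: "I s = i" by (simp add: I_def i_def dd_def)
 have I': "(I hvd - (l * Y s) * (i * i)) (at01 s)" unfolding I_def by (rule hvd_eq_rhs[OF hvd_quotient[OF hvd_const
     hvd_diff[OF X' hvd_const]]])
    (use dd0 in "simp_all add: dd_def i_def power2_eq_square")
 define IE where "IE ep = 1 / (XE ep - e)" for ep
 have IE0: "IE 0 = i" by (simp add: IE_def E0 i_def dd_def)
 have IE: "(IE hvd - xd * (i * i)) (at 0)" unfolding IE_def by (rule hvd_eq_rhs[OF hvd_quotient[OF hvd_const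
     hvd_diff[OF XE hvd_const]]])
    (use dd0 in "simp_all add: dd_def i_def E0 power2_eq_square")
 define c2 c3 where "c2 = t0 $ 5" and "c3 = t3 t0"
 define N where "N x = 2 * e * (x * x) + (2 * e^2 - c2 / 2) * x - (e * c2 / 2 + c3)" for x
 define Nx where "Nx = 4 * e * X s + (2 * e^2 - c2 / 2)"
 define A K where "A = 2 * e^2 + c2 / 6" and "K x = A * x + (2 * e^3 - 7 / 6 * e * c2 - c3)" for x
 define H where "H s = N (X s) * (I s * I s) / 2" for s
 have HH: "hfun e t0 (Some (x, y)) = N x * (1 / (x - e) * (1 / (x - e))) / 2" for x y
  by (simp add: hfun_def N_def c2_def c3_def power2_eq_square)
 have PP: "phifun e t0 al be (Some (x, y)) =
   y * (al / 4 * (K x * (1 / (x - e) * (1 / (x - e) * (1 / (x - e))))) + be * e * (1 / (x - e) * (1 / (x - e))))" for x y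
  by (simp add: phifun_def K_def A_def c2_def c3_def pow_eqs)
 have hH: "h = N (X s) * (i * i) / 2" by (simp add: h_def ptp HH i_def dd_def)
 have N': "((%s. N (X s)) hvd Nx * (l * Y s)) (at01 s)"
  unfolding N_def Nx_def by (auto intro!: derivative_eq_intros X' simp: algebra_simps)
 have H': "(H hvd (N (X s) * (i * (- (l * Y s) * (i * i)) + - (l * Y s) * (i * i) * i) + Nx * (l * Y s) * (i * i)) / 2) (at01 s)"
  unfolding H_def using hvd_divide[OF hvd_mult[OF N' hvd_mult[OF I' I']], of 2] unfolding Is .
 define Q where "Q s = al / 4 * (K (X s) * (I s * (I s * I s))) + be * e * (I s * I s)" for s
 have K': "((%s. K (X s)) hvd A * (l * Y s)) (at01 s)"
  unfolding K_def by (auto intro!: derivative_eq_intros X' simp: algebra_simps)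
 \<comment> \<open>\<open>Q\<close> is \<open>phifun\<close> divided by y, and \<open>Q'\<close> is
   its derivative with respect to x.\<close>
 define Q' where "Q' = al / 4 * (A * i^3 - 3 * K (X s) * i^4) - 2 * be * e * i^3"
 have Qd: "(Q hvd Q' * (l * Y s)) (at01 s)" unfolding Q_def by (rule hvd_eq_rhs[OF hvd_add[OF
     hvd_mult_right[OF hvd_mult[OF K' hvd_mult[OF I' hvd_mult[OF I' I']]]]
     hvd_mult_right[OF hvd_mult[OF I' I']]]])
   (simp add: Is Q'_def algebra_simps eval_nat_numeral)
 define B3' where "B3' = H s * b' + (N (X s) * (i * (- (l * Y s) * (i * i)) + - (l * Y s) * (i * i) * i) + Nx * (l * Y s) * (i * i)) / 2 * b s
   + (Y s * (Q' * (l * Y s)) + l * dcubic t0 (X s) / 2 * Q s)"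
 have B3: "((%s. H s * b s + Y s * Q s) hvd B3') (at01 s)" unfolding B3'_def by (intro hvd_add hvd_mult H' b' Y' Qd)
 have zT: "eventually (%s'. Ga t0 s' $ 3 ~= 0) (at01 s)"
  by (rule tendsto_imp_eventually_ne[OF hvd_tendsto[OF nth[OF deriv_s[OF s]]] z])
 have eq1: "H s' * b s' + Y s' * Q s' = hfun e t0 (pt (Ga t0 s')) * b s' + phifun e t0 al be (pt (Ga t0 s'))"
  if "Ga t0 s' $ 3 ~= 0" for s'
 proof -
  have "pt (Ga t0 s') = Some (X s', Y s')" using that by (simp add: pt_def X_def Y_def)
  then show ?thesis by (simp only: HH PP H_def Q_def I_def)
 qed
 have eq1': "eventually (%s'. H s' * b s' + Y s' * Q s' =
   hfun e t0 (pt (Ga t0 s')) * b s' + phifun e t0 al be (pt (Ga t0 s'))) (at01 s)" using zT by eventually_elim (rule eq1)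
 have B3f: "((%s. hf s t0 * b s + pf s) hvd B3') (at01 s)" using B3 unfolding hvd_def
  by (rule has_derivative_transform_eventually[OF _ eq1' eq1[OF z] s])
 define NE where "NE ep = 2 * e * (XE ep * XE ep) + (2 * e^2 - line ep $ 5 / 2) * XE ep - (e * line ep $ 5 / 2 + t3 (line ep))" for ep
 have NE0: "NE 0 = N (X s)" by (simp add: NE_def N_def E0 c2_def c3_def)
 have NE': "(NE hvd Nx * xd - (X s + e) / 2 * v $ 5 - dt3 t0 v) (at 0)" unfolding NE_def Nx_def c2_def
  by (rule hvd_eq_rhs, (rule hvd_diff hvd_add hvd_mult_right
    hvd_mult[where f = XE] hvd_mult[where g = XE] hvd_divide
    hvd_const line_param line_t3 XE)+)
   (simp add: E0 field_simps)
 have HE': "((%ep. NE ep * (IE ep * IE ep) / 2) hvd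
   (N (X s) * (i * (- xd * (i * i)) + - xd * (i * i) * i) + (Nx * xd - (X s + e) / 2 * v $ 5 - dt3 t0 v) * (i * i)) / 2) (at 0)"
  using hvd_divide[OF hvd_mult[OF NE' hvd_mult[OF IE IE]], of 2] unfolding IE0 NE0 .
 have evz: "eventually (%ep. Ga (line ep) s $ 3 ~= 0) (nhds 0)" using eventually_nonzero_nhds[OF nth[OF d[OF s], of 3]] z by simp
 have eq2: "NE ep * (IE ep * IE ep) / 2 = hf s (line ep)" if "Ga (line ep) s $ 3 ~= 0" for ep
  using that by (simp add: pt_def hfun_def NE_def IE_def XE_def power2_eq_square)
 have eq2': "eventually (%ep. NE ep * (IE ep * IE ep) / 2 = hf s (line ep)) (nhds 0)" using evz by eventually_elim (rule eq2)
 have HE: "((%ep. hf s (line ep)) hvd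
   (N (X s) * (i * (- xd * (i * i)) + - xd * (i * i) * i) + (Nx * xd - (X s + e) / 2 * v $ 5 - dt3 t0 v) * (i * i)) / 2) (at 0)"
  by (rule hvd_transform_nhds[OF HE' eq2'])
 define hd where "hd = (N (X s) * (i * (- xd * (i * i)) + - xd * (i * i) * i) + (Nx * xd - (X s + e) / 2 * v $ 5 - dt3 t0 v) * (i * i)) / 2"
 have "((%ep. hf s (line ep) * ivd s (line ep)) hvd
   h * (b' - al * h * l - be * l) + hd * l) (at 0)" using hvd_mult[OF HE L'] by (simp add: hd_def h_def l_def)
 moreover have "h * (b' - al * h * l - be * l) + hd * l = B3' + (al * t0 $ 5 / 12 + be * h) * l"
 proof -
  define ff f' ks where "ff = cubic t0 (X s)" and "f' = dcubic t0 (X s)" and "ks = xi0 t0 al be (X s)"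
  have x: "X s = e + dd" by (simp add: dd_def)
  \<comment> \<open>This is \<open>R\<close> below multiplied by 4 dd^4. With x = e + dd, and with v
    $ 5 and \<open>dt3\<close> eliminated by the lift equations, it is a polynomial
    identity.\<close>
  have P: "(2 * dd^2 * Nx - 4 * dd * N (X s)) * ks + al * (Nx * ff * dd - 2 * N (X s) * ff) - (X s + e) * dd^2 * v $ 5
    - 2 * dd^2 * dt3 t0 v - al * (N (X s))^2 - 4 * be * dd^2 * N (X s) - al * c2 / 3 * dd^4 =
    al * (dd * K (X s) * f' / 2 + (dd * A - 3 * K (X s)) * ff) + be * (2 * e * dd^2 * f' - 8 * e * dd * ff)"
   using lift unfolding lift_field_def c2_def[symmetric] c3_def[symmetric]
   by (simp add: ff_def f'_def ks_def cubic_def dcubic_def xi0_def c2_def[symmetric] c3_def[symmetric] N_def Nx_def K_def A_def x)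
    (simp add: field_simps eval_nat_numeral)
  have R: "(Nx * i^2 / 2 - N (X s) * i^3) * (ks + al * (ff * i / 2)) - (X s + e) * i^2 / 4 * v $ 5
    - i^2 / 2 * dt3 t0 v - al * (N (X s) * i^2 / 2)^2 - 2 * be * (N (X s) * i^2 / 2) - al * c2 / 12 =
    Q' * ff + Q s * f' / 2"
  proof -
   have i1: "i^4 * dd^4 = 1" "i^4 * dd^2 = i^2" "i^4 * dd = i^3" using dd0 by (simp_all add: i_def field_simps eval_nat_numeral)
   have "(Nx * i^2 / 2 - N (X s) * i^3) * (ks + al * (ff * i / 2)) - (X s + e) * i^2 / 4 * v $ 5
    - i^2 / 2 * dt3 t0 v - al * (N (X s) * i^2 / 2)^2 - 2 * be * (N (X s) * i^2 / 2) - al * c2 / 12 =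
    (Nx * i^2 / 2 - N (X s) * i^3) * ks + al * (Nx * ff * i^3 - 2 * N (X s) * ff * i^4) / 4 - (X s + e) * i^2 / 4 * v $ 5
    - i^2 / 2 * dt3 t0 v - al * ((N (X s))^2 * i^4 / 4) - be * (N (X s) * i^2) - al * c2 / 12 * 1"
    by (simp add: field_simps eval_nat_numeral)
   also have "\<dots> = i^4 * ((2 * dd^2 * Nx - 4 * dd * N (X s)) * ks + al * (Nx * ff * dd - 2 * N (X s) * ff) - (X s + e) * dd^2 * v $ 5
    - 2 * dd^2 * dt3 t0 v - al * (N (X s))^2 - 4 * be * dd^2 * N (X s) - al * c2 / 3 * dd^4) / 4"
    unfolding i1(1)[symmetric] i1(2,3)[symmetric] by (simp add: field_simps)
   also have "\<dots> = al * ((i^4 * dd) * K (X s) * f' / 2 + ((i^4 * dd) * A - 3 * K (X s) * i^4) * ff) / 4 + be * (2 * e * (i^4 * dd^2) * f' - 8 * e * (i^4 * dd) * ff) / 4"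
    unfolding P by (simp add: field_simps)
   also have "\<dots> = Q' * ff + Q s * f' / 2" unfolding i1 Q'_def Q_def Is by (simp add: field_simps eval_nat_numeral)
   finally show ?thesis .
  qed
  have Hs: "H s = h" by (simp add: H_def hH Is)
  have hdx: "hd = (Nx * i^2 / 2 - N (X s) * i^3) * xd - (X s + e) * i^2 / 4 * v $ 5 - i^2 / 2 * dt3 t0 v"
   unfolding hd_def by (simp add: field_simps eval_nat_numeral)
  have xdx: "xd = (ks + al * (ff * i / 2)) + b s * Y s"
   unfolding bX ks_def ff_def cc[symmetric] by (simp add: field_simps power2_eq_square)
  have hh: "h = N (X s) * i^2 / 2" by (simp add: hH power2_eq_square)
  have B3x: "B3' = h * b' + (Nx * i^2 / 2 - N (X s) * i^3) * (l * Y s * b s) + l * (Q' * ff + Q s * f' / 2)"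
   unfolding B3'_def Hs ff_def f'_def cc[symmetric] by (simp add: field_simps eval_nat_numeral)
  have "h * (b' - al * h * l - be * l) + hd * l - (B3' + (al * t0 $ 5 / 12 + be * h) * l) =
    l * (((Nx * i^2 / 2 - N (X s) * i^3) * (ks + al * (ff * i / 2)) - (X s + e) * i^2 / 4 * v $ 5 - i^2 / 2 * dt3 t0 v
     - al * h^2 - 2 * be * h - al * c2 / 12) - (Q' * ff + Q s * f' / 2))"
   unfolding B3x hdx xdx c2_def by (simp add: algebra_simps power2_eq_square)
  also have "\<dots> = 0" unfolding hh R by simp
  finally show ?thesis by simp
 qed
 ultimately show ?thesis using b' L' B3f by (intro exI[of _ b'] exI[of _ B3'] conjI) (simp_all add: h_def l_def)
qed

end

section \<open>Variation of the integrands at the point at infinity\<close>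

text \<open>Holds in the whole chart where Y is non-zero, not just at O, and can therefore be
  differentiated at O in the direction of the parameter.\<close>

lemma inv_diff_chartE:
 assumes t: "t \<in> TT" and p: "path_at t T ga s v" and y: "ga s $ 2 ~= 0"
 shows "inv_diff t (ga s) v * chartE t (ga s $ 1 / ga s $ 2) (ga s $ 3 / ga s $ 2) =
   - 2 * ((v $ 1 * ga s $ 2 - ga s $ 1 * v $ 2) / (ga s $ 2)^2)"
proof (cases "ga s $ 3 = 0")
 case True
 have g: "(ga hvd v) (at s within T)" and c: "on_cone t (ga s)" and nt: "at s within T ~= bot" using p by (auto simp: path_at_def)
 obtain u' where u': "((%s. ga s $ 1 / ga s $ 2) hvd u') (at s within T)" and i: "inv_diff t (ga s) v = - 2 * u'"
  by (rule path_at_O[OF t p True]) (rule that)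
 have "u' = (v $ 1 * ga s $ 2 - ga s $ 1 * v $ 2) / (ga s $ 2)^2" by (rule vector_derivative_unique_within[OF nt u'])
   (intro hvd_quotient hvd_vec_nth g y)
 then show ?thesis using i on_cone_None[OF c True] True by (simp add: chartE_def)
next
 case False
 define x y l where "x = ga s $ 1 / ga s $ 3" and "y = ga s $ 2 / ga s $ 3" and "l = inv_diff t (ga s) v"
 define x' y' where "x' = (v $ 1 * ga s $ 3 - ga s $ 1 * v $ 3) / (ga s $ 3)^2"
  and "y' = (v $ 2 * ga s $ 3 - ga s $ 2 * v $ 3) / (ga s $ 3)^2"
 have y0: "y ~= 0" using assms(3) False by (simp add: y_def)
 have l: "l * y = x'" "l * dcubic t x = 2 * y'"
  using inv_diff_affine_eqs[OF t p False] by (simp_all add: x_def y_def l_def x'_def y'_def)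
 have "y^2 = cubic t x" using on_cone_affine[of t "ga s"] p False by (auto simp: x_def y_def path_at_def)
 then have t3: "t3 t = 4 * x^3 - t $ 5 * x - y^2" by (simp add: cubic_def)
 have E: "(y^2 + 2 * t $ 5 * x + 3 * t3 t) = x * dcubic t x - 2 * y^2"
  unfolding t3 by (simp add: dcubic_def algebra_simps pow_eqs)
 have u: "(v $ 1 * ga s $ 2 - ga s $ 1 * v $ 2) / (ga s $ 2)^2 = (x' * y - x * y') / y^2"
  using False assms(3) by (simp add: x_def y_def x'_def y'_def field_simps power2_eq_square)
 have uw: "ga s $ 1 / ga s $ 2 = x / y" "ga s $ 3 / ga s $ 2 = 1 / y" using False by (simp_all add: x_def y_def)
 have "l * chartE t (x / y) (1 / y) = l * (y^2 + 2 * t $ 5 * x + 3 * t3 t) / y^2"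
  using y0 by (simp add: chartE_def field_simps power2_eq_square)
 also have "\<dots> = (x * (l * dcubic t x) - 2 * (l * y) * y) / y^2" unfolding E by (simp add: algebra_simps power2_eq_square)
 also have "\<dots> = - 2 * ((x' * y - x * y') / y^2)" unfolding l by (simp add: divide_simps)
 finally show ?thesis unfolding u uw l_def .
qed

text \<open>Rewrites \<open>hfun\<close>, \<open>phifun\<close> and the vertical velocity in u = X/Y
  and w = Z/Y by means of r = 4 u^2/M, which is 1/x off O. The denominators are 1 at O, so the
  formulas can be differentiated there.\<close>

lemma near_O:
 assumes c: "on_cone t p" and p2: "p $ 2 ~= 0"
 defines "u \<equiv> p $ 1 / p $ 2" and "w \<equiv> p $ 3 / p $ 2"
 defines "M \<equiv> 1 + t $ 5 * (u * w) + t3 t * (w * w)"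
 defines "r \<equiv> 4 * (u * u) / M"
 assumes M: "M ~= 0" and er: "1 - e * r ~= 0"
 shows "hfun e t (pt p) = (2 * e + (2 * e^2 - t $ 5 / 2) * r - (e * t $ 5 / 2 + t3 t) * (r * r)) / 2 * (1 / (1 - e * r) * (1 / (1 - e * r)))" (is ?A)
  and "phifun e t al be (pt p) = u * (1 / M * (al * ((2 * e^2 + t $ 5 / 6) + (2 * e^3 - 7 / 6 * e * t $ 5 - t3 t) * r) *
     (1 / (1 - e * r) * (1 / (1 - e * r) * (1 / (1 - e * r)))) + 4 * be * e * (1 / (1 - e * r) * (1 / (1 - e * r)))))" (is ?B)
  and "vert t e al be p d b ==> b * chartE t u w = - 2 * ((d $ 1 * p $ 2 - p $ 1 * d $ 2) / (p $ 2)^2)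
     - al * ((2 * e * u + t $ 5 / 2 * w + t3 t * (w * r)) * (1 / (1 - e * r))) - 2 * be * u + 2 * al * t $ 5 / 3 * w"
   (is "?V ==> ?C")
proof (atomize(full), cases "p $ 3 = 0")
 case True
 then have "u = 0" "w = 0" "r = 0" "pt p = None" "M = 1" "p $ 1 = 0"
  using on_cone_None[OF c True] by (simp_all add: u_def w_def r_def pt_def M_def)
 then show "?A & ?B & (?V --> ?C)" using True by (simp add: hfun_def phifun_def vert_def chartE_def)
next
 case False
 define x y where "x = p $ 1 / p $ 3" and "y = p $ 2 / p $ 3"
 have y0: "y ~= 0" using p2 False by (simp add: y_def)
 have uw: "u = x / y" "w = 1 / y" using False by (simp_all add: u_def w_def x_def y_def)
 have cc: "y^2 = cubic t x" using on_cone_affine[OF c False] by (simp add: x_def y_def)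
 have Mx: "M = 4 * x^3 / y^2" using chart_at_O(1)[OF cc y0] by (simp add: M_def uw power2_eq_square mult.assoc)
 have x0: "x ~= 0" using M Mx by auto
 have rx: "r = 1 / x" using x0 y0 unfolding r_def Mx uw by (simp add: field_simps pow_eqs)
 have xe: "x ~= e" using er x0 unfolding rx by auto
 define dd where "dd = x - e"
 have dd0: "dd ~= 0" using xe by (simp add: dd_def)
 have ix: "1 / (1 - e * r) = x / dd" using x0 dd0 unfolding rx dd_def by (simp add: field_simps)
 have ptp: "pt p = Some (x, y)" using False by (simp add: pt_def x_def y_def)
 have uM: "u * (1 / M * k) = y / (4 * x^2) * k" for k using x0 y0 unfolding Mx uw by (simp add: field_simps pow_eqs)
 have 1: ?A
 proof -
  have "(2 * e * x^2 + A * x - B) / (2 * dd^2) = (2 * e + A * (1 / x) - B * ((1 / x) * (1 / x))) / 2 * (x / dd * (x / dd))" for A B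
   using x0 dd0 by (simp add: divide_simps) (simp add: algebra_simps power2_eq_square)
  from this[unfolded dd_def] show ?thesis unfolding ptp hfun_def ix unfolding rx dd_def option.simps prod.case .
 qed
 have 2: ?B
 proof -
  have "y * (al * (A * x + B) / (4 * dd^3) + be * e / dd^2) =
    y / (4 * x^2) * (al * (A + B * (1 / x)) * (x / dd * (x / dd * (x / dd))) + 4 * be * e * (x / dd * (x / dd)))" for A B
   using x0 dd0 by (simp add: divide_simps) (simp add: algebra_simps eval_nat_numeral)
  from this[unfolded dd_def] show ?thesis unfolding ptp uM phifun_def ix unfolding rx dd_def option.simps prod.case .
 qed
 have 3: ?C if v: ?V
 proof -
  define x' y' where "x' = (d $ 1 * p $ 3 - p $ 1 * d $ 3) / (p $ 3)^2" and "y' = (d $ 2 * p $ 3 - p $ 2 * d $ 3) / (p $ 3)^2"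
  define B where "B = b + al * (y / (2 * dd))"
  have X: "x' = xi0 t al be x + B * y" and Y: "2 * y' = 2 * psi0 al be x y + B * dcubic t x"
   using v False by (simp_all add: vert_def x_def y_def x'_def y'_def B_def dd_def right_diff_distrib diff_eq_eq)
  have ud: "(d $ 1 * p $ 2 - p $ 1 * d $ 2) / (p $ 2)^2 = (x' * y - x * y') / y^2"
   using False p2 by (simp add: x_def y_def x'_def y'_def field_simps power2_eq_square)
  define S where "S = y^2 + 2 * t $ 5 * x + 3 * t3 t"
  have t3: "t3 t = 4 * x^3 - t $ 5 * x - y^2" using cc by (simp add: cubic_def)
  have S: "S = x * dcubic t x - 2 * y^2" "S = 4 * x^3 + t $ 5 * x + 2 * t3 t"
   unfolding S_def t3 by (simp_all add: dcubic_def algebra_simps pow_eqs)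
  have xd: "x = e + dd" by (simp add: dd_def)
  have key: "(2 * e * x^2 + t $ 5 * x / 2 + t3 t) / dd = S / (2 * dd) - 2 * x^2"
  proof -
   define K where "K = 2 * e * x^2 + t $ 5 * x / 2 + t3 t"
   have "S - 4 * x^2 * dd = 2 * K" unfolding S(2) dd_def K_def by (simp add: algebra_simps pow_eqs)
   moreover have "S / (2 * dd) - 2 * x^2 = (S - 4 * x^2 * dd) / (2 * dd)" using dd0 by (simp add: field_simps)
   ultimately show ?thesis unfolding K_def[symmetric] by simp
  qed
  have "- 2 * ((x' * y - x * y') / y^2) = (x * (2 * y') - 2 * x' * y) / y^2" by (simp add: divide_simps)
  also have "x * (2 * y') - 2 * x' * y = B * S + y * (- 2 * al * x^2 - 2 / 3 * al * t $ 5 + 2 * be * x)"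
   unfolding X Y S(1) xi0_def psi0_def by (simp add: algebra_simps power2_eq_square)
  finally have A: "- 2 * ((x' * y - x * y') / y^2) = (B * S + y * (- 2 * al * x^2 - 2 / 3 * al * t $ 5 + 2 * be * x)) / y^2" .
  have C: "(2 * e * u + t $ 5 / 2 * w + t3 t * (w * r)) * (1 / (1 - e * r)) = ((2 * e * x^2 + t $ 5 * x / 2 + t3 t) / dd) / y"
   unfolding ix unfolding uw rx using x0 y0 dd0 by (simp add: divide_simps) (simp add: algebra_simps power2_eq_square)
  have "b * chartE t u w = (B - al * (y / (2 * dd))) * (S / y^2)"
   using y0 unfolding chartE_def uw S_def B_def by (simp add: field_simps power2_eq_square)
  also have "\<dots> = (B * S + y * (- 2 * al * x^2 - 2 / 3 * al * t $ 5 + 2 * be * x)) / y^2 -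
    al * ((S / (2 * dd) - 2 * x^2) / y) - 2 * be * (x / y) + 2 * al * t $ 5 / 3 * (1 / y)"
   using y0 dd0 by (simp add: divide_simps) (simp add: algebra_simps power2_eq_square)
  finally show ?thesis unfolding ud A C unfolding key unfolding uw .
 qed
 show "?A & ?B & (?V --> ?C)" using 1 2 3 by blast
qed

context moving_path
begin

text \<open>At O both u and w vanish, and w has derivative 0 along the path. Hence M, r and
  \<open>chartE\<close> are stationary and h keeps its value e to first order; only the velocity of
  u and its mixed derivative survive.\<close>

lemma O_point_variation:
 assumes s: "s \<in> {0..1}" and z: "Ga t0 s $ 3 = 0"
 shows "varies s"
proof -
 note nth = hvd_vec_nth
 have c0: "on_cone t0 (Ga t0 s')" if "s' \<in> {0..1}" for s' using path0[OF that] that by (simp add: path_at_def)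
 have p1: "Ga t0 s $ 1 = 0" and p2: "Ga t0 s $ 2 ~= 0" using on_cone_None[OF c0[OF s] z] by auto
 define u w where "u s = Ga t0 s $ 1 / Ga t0 s $ 2" and "w s = Ga t0 s $ 3 / Ga t0 s $ 2" for s
 define ud where "ud s = (d s $ 1 * Ga t0 s $ 2 - Ga t0 s $ 1 * d s $ 2) / (Ga t0 s $ 2)^2" for s
 define UE WE where "UE ep = Ga (line ep) s $ 1 / Ga (line ep) s $ 2" and "WE ep = Ga (line ep) s $ 3 / Ga (line ep) s $ 2" for ep
 define us where
  "us ep = (Gas (line ep) s $ 1 * Ga (line ep) s $ 2 - Ga (line ep) s $ 1 * Gas (line ep) s $ 2) / (Ga (line ep) s $ 2)^2" for ep
 define l where "l = ivd s t0"
 define L where "L ep = ivd s (line ep)" for ep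
 obtain q where q: "(us hvd q) (at 0)" "(ud hvd q) (at01 s)" unfolding us_def ud_def
  by (rule mixed_quotient[where a = "%s. Ga t0 s $ 1" and b = "%s. Ga t0 s $ 2" and ad = "%s. d s $ 1" and bd = "%s. d s $ 2",
    OF nth[OF d[OF s]] nth[OF d[OF s]] nth[OF d'[OF s]] nth[OF d'[OF s]]
    nth[OF deriv_s[OF s]] nth[OF deriv_s[OF s]] nth[OF dd'[OF s]] nth[OF dd'[OF s]]]) (use p2 that in simp_all)
 obtain u' where u': "(u hvd u') (at01 s)" and w': "(w hvd 0) (at01 s)"
  and ev2: "eventually (%s'. s' \<in> {0..1} & Ga t0 s' $ 2 ~= 0) (at01 s)" and l: "l = - 2 * u'"
  by (rule path_at_O[OF t0 path0[OF s] z, folded u_def w_def l_def]) (rule that)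
 have u0: "u s = 0" and w0: "w s = 0" by (simp_all add: u_def w_def p1 z)
 define M where "M s = 1 + t0 $ 5 * (u s * w s) + t3 t0 * (w s * w s)" for s
 have M0: "M s = 1" by (simp add: M_def u0 w0)
 have M': "(M hvd 0) (at01 s)" unfolding M_def by (auto intro!: derivative_eq_intros u' w' simp: u0 w0)
 define r where "r s = 4 * (u s * u s) / M s" for s
 have r0: "r s = 0" by (simp add: r_def u0)
 have r': "(r hvd 0) (at01 s)" unfolding r_def by (rule hvd_eq_rhs[OF hvd_quotient[OF
     hvd_mult_right[OF hvd_mult[OF u' u']] M']]) (simp_all add: M0 u0)
 define ri where "ri s = 1 / (1 - e * r s)" for s
 have ri0: "ri s = 1" by (simp add: ri_def r0)
 have er': "((%s. 1 - e * r s) hvd 0) (at01 s)" by (auto intro!: derivative_eq_intros r')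
 have ri': "(ri hvd 0) (at01 s)" unfolding ri_def by (rule hvd_eq_rhs[OF hvd_quotient[OF hvd_const er']]) (simp_all add: r0)
 have evM: "eventually (%s'. M s' ~= 0) (at01 s)" by (rule tendsto_imp_eventually_ne[OF hvd_tendsto[OF M']]) (simp add: M0)
 have evr: "eventually (%s'. 1 - e * r s' ~= 0) (at01 s)"
  by (rule tendsto_imp_eventually_ne[OF hvd_tendsto[OF er']]) (simp add: r0)
 define k where "k = 2 * e^2 - t0 $ 5 / 2"
 define k' where "k' = e * t0 $ 5 / 2 + t3 t0"
 define A where "A = 2 * e^2 + t0 $ 5 / 6"
 define B where "B = 2 * e^3 - 7 / 6 * e * t0 $ 5 - t3 t0"
 define H where "H s = (2 * e + k * r s - k' * (r s * r s)) / 2 * (ri s * ri s)" for s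
 have H0: "H s = e" by (simp add: H_def r0 ri0)
 have H': "(H hvd 0) (at01 s)" unfolding H_def by (auto intro!: derivative_eq_intros r' ri' simp: r0)
 define G where "G s = 1 / M s * (al * (A + B * r s) * (ri s * (ri s * ri s)) + 4 * be * e * (ri s * ri s))" for s
 have G0: "G s = al * A + 4 * be * e" by (simp add: G_def r0 ri0 M0)
 have Gc: "(G ---> G s) (at01 s)" unfolding G_def
  by (intro tendsto_intros hvd_tendsto[OF M'] hvd_tendsto[OF r'] hvd_tendsto[OF ri'])
   (simp add: M0)
 have P': "((%s. u s * G s) hvd u' * (al * A + 4 * be * e)) (at01 s)" using hvd_mult_zero[OF u' u0 Gc] unfolding G0 .
 define E where "E s = chartE t0 (u s) (w s)" for s
 have E0: "E s = 1" by (simp add: E_def chartE_def u0 w0)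
 have E': "(E hvd 0) (at01 s)"
  unfolding E_def chartE_def power2_eq_square by (auto intro!: derivative_eq_intros u' w' simp: u0 w0)
 have evE: "eventually (%s'. E s' ~= 0) (at01 s)" by (rule tendsto_imp_eventually_ne[OF hvd_tendsto[OF E']]) (simp add: E0)
 define num where "num s = - 2 * ud s - al * ((2 * e * u s + t0 $ 5 / 2 * w s + t3 t0 * (w s * r s)) * ri s) - 2 * be * u s + 2 * al * t0 $ 5 / 3 * w s" for s
 have num': "(num hvd - 2 * q - al * (2 * e * u') - 2 * be * u') (at01 s)"
  unfolding num_def by (auto intro!: derivative_eq_intros q(2) u' w' r' ri' simp: u0 w0 r0 ri0)
 define b' where "b' = - 2 * q - al * (2 * e * u') - 2 * be * u'"
 have b_num: "b s' * E s' = num s'" if "s' \<in> {0..1}" "Ga t0 s' $ 2 ~= 0" "M s' ~= 0" "1 - e * r s' ~= 0" for s'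
  using near_O(3)[OF c0[OF that(1)] that(2), folded u_def w_def, folded M_def, folded r_def, OF that(3,4) b[OF that(1)]]
  unfolding E_def num_def ri_def ud_def .
 have bs: "b s * E s = num s" by (rule b_num) (use s p2 M0 r0 in auto)
 have nE: "((%s. num s / E s) hvd b') (at01 s)" by (rule hvd_eq_rhs[OF hvd_quotient[OF num' E']]) (simp_all add: E0 b'_def)
 have ev_b: "eventually (%s'. num s' / E s' = b s') (at01 s)" using ev2 evM evr evE
 proof eventually_elim
  case (elim s')
  then have "b s' * E s' = num s'" by (intro b_num) auto
  then show ?case using elim by (simp add: field_simps)
 qed
 have bb: "(b hvd b') (at01 s)" using nE unfolding hvd_def
  by (rule has_derivative_transform_eventually[OF _ ev_b _ s]) (use bs E0 in simp)
 have HP: "hfun e t0 (pt (Ga t0 s')) = H s'" "phifun e t0 al be (pt (Ga t0 s')) = u s' * G s'"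
  if "s' \<in> {0..1}" "Ga t0 s' $ 2 ~= 0" "M s' ~= 0" "1 - e * r s' ~= 0" for s'
  using near_O(1,2)[OF c0[OF that(1)] that(2), folded u_def w_def, folded M_def, folded r_def, OF that(3,4)]
  unfolding H_def G_def ri_def A_def B_def k_def k'_def .
 have HPs: "hf s t0 = H s" "pf s = u s * G s" by (rule HP; use s p2 M0 r0 in simp)+
 define b3' where "b3' = e * b' + u' * (al * A + 4 * be * e)"
 have "((%s. H s * b s + u s * G s) hvd b3') (at01 s)" by (rule hvd_eq_rhs[OF hvd_add[OF hvd_mult[OF H' bb] P']])
   (simp add: b3'_def H0)
 moreover have "eventually (%s'. H s' * b s' + u s' * G s' = hfun e t0 (pt (Ga t0 s')) * b s' + phifun e t0 al be (pt (Ga t0 s'))) (at01 s)"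
  using ev2 evM evr by eventually_elim (simp add: HP)
 moreover have "H s * b s + u s * G s = hf s t0 * b s + pf s" unfolding HPs ..
 ultimately have B3: "((%s. hf s t0 * b s + pf s) hvd b3') (at01 s)"
  unfolding hvd_def by (rule has_derivative_transform_eventually[OF _ _ _ s])
 have UE': "(UE hvd ud s) (at 0)" using hvd_quotient[OF nth[OF d[OF s], of 1] nth[OF d[OF s], of 2]] p2
  unfolding UE_def ud_def by simp
 obtain wd where WE': "(WE hvd wd) (at 0)" using hvd_quotient[OF nth[OF d[OF s], of 3] nth[OF d[OF s], of 2]] p2
  unfolding WE_def by auto
 have UE0: "UE 0 = 0" and WE0: "WE 0 = 0" by (simp_all add: UE_def WE_def p1 z)
 note lp = line_param[of t0 v 5] and lt = line_t3[of t0 v]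
 define ME where "ME ep = 1 + line ep $ 5 * (UE ep * WE ep) + t3 (line ep) * (WE ep * WE ep)" for ep
 have ME0: "ME 0 = 1" by (simp add: ME_def UE0 WE0)
 have ME': "(ME hvd 0) (at 0)" unfolding ME_def by (rule hvd_eq_rhs[OF hvd_add[OF hvd_add[OF hvd_const
    hvd_mult[OF lp hvd_mult[OF UE' WE']]] hvd_mult[OF lt hvd_mult[OF WE' WE']]]])
   (simp add: UE0 WE0)
 define rE where "rE ep = 4 * (UE ep * UE ep) / ME ep" for ep
 have rE0: "rE 0 = 0" by (simp add: rE_def UE0)
 have rE': "(rE hvd 0) (at 0)" unfolding rE_def by (rule hvd_eq_rhs[OF hvd_quotient[OF
     hvd_mult_right[OF hvd_mult[OF UE' UE']] ME']]) (simp_all add: ME0 UE0)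
 have eE': "((%ep. 1 - e * rE ep) hvd 0) (at 0)" by (auto intro!: derivative_eq_intros rE')
 define riE where "riE ep = 1 / (1 - e * rE ep)" for ep
 have riE0: "riE 0 = 1" by (simp add: riE_def rE0)
 have riE': "(riE hvd 0) (at 0)" unfolding riE_def by (rule hvd_eq_rhs[OF hvd_quotient[OF hvd_const eE']]) (simp_all add: rE0)
 define HE where "HE ep = (2 * e + (2 * e^2 - line ep $ 5 / 2) * rE ep - (e * line ep $ 5 / 2 + t3 (line ep)) * (rE ep * rE ep)) / 2 * (riE ep * riE ep)" for ep
 have HE0: "HE 0 = e" by (simp add: HE_def rE0 riE0)
 have HE': "(HE hvd 0) (at 0)" unfolding HE_def by (rule hvd_eq_rhs[OF hvd_mult[OF hvd_divide[OF
    hvd_diff[OF hvd_add[OF hvd_const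
     hvd_mult[OF hvd_diff[OF hvd_const hvd_divide[OF lp]] rE']]
     hvd_mult[OF hvd_add[OF hvd_divide[OF hvd_mult_right[OF lp]] lt]
      hvd_mult[OF rE' rE']]]] hvd_mult[OF riE' riE']]])
   (simp add: rE0 riE0)
 define EE where "EE ep = 1 + 2 * line ep $ 5 * UE ep * WE ep + 3 * t3 (line ep) * (WE ep * WE ep)" for ep
 have EE0: "EE 0 = 1" by (simp add: EE_def UE0 WE0)
 have EE': "(EE hvd 0) (at 0)" unfolding EE_def by (rule hvd_eq_rhs[OF hvd_add[OF hvd_add[OF hvd_const
    hvd_mult[OF hvd_mult[OF hvd_mult_right[OF lp] UE'] WE']]
    hvd_mult[OF hvd_mult_right[OF lt] hvd_mult[OF WE' WE']]]])
   (simp add: UE0 WE0)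
 note near = eventually_nonzero_nhds
 have evE2: "eventually (%ep. Ga (line ep) s $ 2 ~= 0) (nhds 0)" by (rule near[OF nth[OF d[OF s]]]) (simp add: p2)
 have evEM: "eventually (%ep. ME ep ~= 0) (nhds 0)" by (rule near[OF ME']) (simp add: ME0)
 have evEr: "eventually (%ep. 1 - e * rE ep ~= 0) (nhds 0)" by (rule near[OF eE']) (simp add: rE0)
 have evEE: "eventually (%ep. EE ep ~= 0) (nhds 0)" by (rule near[OF EE']) (simp add: EE0)
 have evH: "eventually (%ep. HE ep = hf s (line ep)) (nhds 0)" using evE2 evEM evEr path
 proof eventually_elim
  case (elim ep)
  have c: "on_cone (line ep) (Ga (line ep) s)" using elim(4) s by (auto simp: path_at_def)
  show ?case using near_O(1)[OF c elim(1), folded UE_def WE_def, folded ME_def, folded rE_def, OF elim(2,3)]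
   unfolding HE_def riE_def by (rule sym)
 qed
 have evL: "eventually (%ep. - 2 * us ep / EE ep = L ep) (nhds 0)" using evE2 evEE path
 proof eventually_elim
  case (elim ep)
  have t: "line ep \<in> TT" and p: "path_at (line ep) {0..1} (Ga (line ep)) s (Gas (line ep) s)" using elim(3) s by auto
  have "L ep * EE ep = - 2 * us ep"
   using inv_diff_chartE[OF t p elim(1)] unfolding L_def EE_def us_def chartE_def UE_def WE_def by (simp add: power2_eq_square mult.assoc)
  then show ?case using elim(2) by (simp add: field_simps)
 qed
 have L': "(L hvd - 2 * q) (at 0)"
  by (rule hvd_transform_nhds[OF _ evL], rule hvd_eq_rhs[OF hvd_quotient[OF hvd_mult_right[OF q(1)] EE']])
   (simp_all add: EE0)
 have Hh: "((%ep. hf s (line ep)) hvd 0) (at 0)" by (rule hvd_transform_nhds[OF HE' evH])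
 have he: "hf s t0 = e" using HPs(1) H0 by simp
 have hL: "((%ep. hf s (line ep) * L ep) hvd e * (- 2 * q)) (at 0)" by (rule hvd_eq_rhs[OF hvd_mult[OF Hh L']]) (simp add: he)
 have e1: "- 2 * q = b' - al * e * l - be * l" unfolding b'_def l by (simp add: algebra_simps)
 have e2: "e * (- 2 * q) = b3' + (al * t0 $ 5 / 12 + be * e) * l"
  unfolding b3'_def b'_def l A_def by (simp add: field_simps power2_eq_square)
 show ?thesis
  by (intro exI[of _ b'] exI[of _ b3'] conjI bb B3) (use L' hL in "simp_all only: he l_def[symmetric] L_def[symmetric] e1[symmetric] e2[symmetric]")
qed

lemma point_variation: "s \<in> {0..1} ==> varies s"
 by (cases "Ga t0 s $ 3 = 0") (rule O_point_variation finite_point_variation_h; assumption)+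

end

section \<open>Differentiating path integrals\<close>

abbreviation velocity :: "(real => complex ^ 3) => real => complex ^ 3" where
 "velocity ga s \<equiv> vector_derivative ga (at01 s)"

definition C1_family :: "param set => (param => real => complex ^ 3) => bool" where
 "C1_family V Ga \<longleftrightarrow> open V & V <= TT & (\<forall>t\<in>V. \<forall>s\<in>{0..1}. on_cone t (Ga t s)) &
   C1fun (V \<times> {0..1}) (%z. Ga (fst z) (snd z)) &
   C1fun (V \<times> {0..1}) (%z. velocity (Ga (fst z)) (snd z))"

lemma C1_family_velocity:
 assumes f: "C1_family V Ga" and t: "t \<in> V" and s: "s \<in> {0..1}"
 shows "(Ga t hvd velocity (Ga t) s) (at01 s)"
proof -
 obtain D E where "!!t s. t \<in> V ==> s \<in> {0..1} ==> ((%s. Ga (fst (t, s)) (snd (t, s))) hvd E t s) (at s within {0..1::real})"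
  by (rule C1fun_slice[of V 0 1 "%z. Ga (fst z) (snd z)"]) (use f in "auto simp: C1_family_def")
 then have "(Ga t hvd E t s) (at01 s)" using t s by simp
 then show ?thesis using vector_derivative_within[OF unit_interval_nontrivial[OF s]] by metis
qed

lemma C1_family_path:
 assumes f: "C1_family V Ga" and t: "t \<in> V"
 shows "C1_path t (Ga t)"
proof -
 have "continuous_on (V \<times> {0..1}) (%z. velocity (Ga (fst z)) (snd z))"
  using f by (auto simp: C1_family_def intro: C1fun_continuous)
 then have "continuous_on {0..1} ((%z. velocity (Ga (fst z)) (snd z)) \<circ> (%s. (t, s)))"
  by (intro continuous_on_compose) (auto intro!: continuous_intros elim!: continuous_on_subset simp: t)
 then show ?thesis using C1_family_velocity[OF f t] f t by (simp add: C1_path_def C1_family_def o_def)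
qed

text \<open>Homogeneous denominators of \<open>hfun\<close>, one from the affine chart and one from
  the chart at O. On the curve they vanish simultaneously exactly outside \<open>U_frame\<close>;
  pairing with their conjugates, as in \<open>hfun_smooth\<close>, gives one formula for h valid
  across both charts.\<close>

definition frame_den :: "complex => param => complex ^ 3 => complex \<times> complex" where
 "frame_den e t p = (2 * (p $ 1 - e * p $ 3)^2,
   2 * ((p $ 2)^2 + t $ 5 * p $ 1 * p $ 3 + t3 t * (p $ 3)^2 - 4 * e * (p $ 1)^2)^2)"

definition frame_num :: "complex => param => complex ^ 3 => complex \<times> complex" where
 "frame_num e t p = (2 * e * (p $ 1)^2 + (2 * e^2 - t $ 5 / 2) * p $ 1 * p $ 3 - (e * t $ 5 / 2 + t3 t) * (p $ 3)^2,
   2 * e * ((p $ 2)^2 + t $ 5 * p $ 1 * p $ 3 + t3 t * (p $ 3)^2)^2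
   + (2 * e^2 - t $ 5 / 2) * (4 * (p $ 1)^2) * ((p $ 2)^2 + t $ 5 * p $ 1 * p $ 3 + t3 t * (p $ 3)^2)
   - (e * t $ 5 / 2 + t3 t) * (16 * (p $ 1)^4))"

definition frame_norm :: "complex => param => complex ^ 3 => complex" where
 "frame_norm e t p = fst (frame_den e t p) * cnj (fst (frame_den e t p)) + snd (frame_den e t p) * cnj (snd (frame_den e t p))"

lemma frame_norm_eq_0: "frame_norm e t p = 0 \<longleftrightarrow> frame_den e t p = (0, 0)"
proof -
 have *: "x * cnj x + y * cnj y = of_real ((cmod x)^2 + (cmod y)^2)" for x y by (simp add: complex_norm_square[symmetric])
 show ?thesis unfolding frame_norm_def * of_real_eq_0_iff by (simp add: sum_power2_eq_zero_iff prod_eq_iff)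
qed

lemma frame_den_props:
 assumes c: "on_cone t p"
 shows "frame_den e t p = (0, 0) \<longleftrightarrow> pt p \<notin> U_frame e t" (is ?A)
  and "pt p \<in> U_frame e t ==> hfun e t (pt p) * fst (frame_den e t p) = fst (frame_num e t p)" (is "?U ==> ?B")
  and "pt p \<in> U_frame e t ==> hfun e t (pt p) * snd (frame_den e t p) = snd (frame_num e t p)" (is "_ ==> ?C")
proof (atomize(full), cases "p $ 3 = 0")
 case True
 then have "p $ 1 = 0" "p $ 2 ~= 0" "pt p = None" using on_cone_None[OF c True] by (auto simp: pt_def)
 then show "?A & (?U --> ?B) & (?U --> ?C)" using True by (simp add: frame_den_def frame_num_def None_in_U_frame hfun_def)
next
 case False
 define x where "x = p $ 1 / p $ 3"
 have p1: "p $ 1 = x * p $ 3" using False by (simp add: x_def)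
 have cc: "(p $ 2 / p $ 3)^2 = cubic t x" using on_cone_affine[OF c False] by (simp add: x_def)
 have ptp: "pt p = Some (x, p $ 2 / p $ 3)" using False by (simp add: pt_def x_def)
 have U: "pt p \<in> U_frame e t \<longleftrightarrow> x ~= e" unfolding ptp Some_in_U_frame using cc by simp
 define z where "z = p $ 3"
 have z: "z ~= 0" using False by (simp add: z_def)
 have p2: "(p $ 2)^2 = cubic t x * z^2" using cc z by (simp add: z_def field_simps)
 have M: "(p $ 2)^2 + t $ 5 * p $ 1 * p $ 3 + t3 t * (p $ 3)^2 = 4 * x^3 * z^2"
  unfolding p2 p1 z_def[symmetric] by (simp add: cubic_def algebra_simps power2_eq_square)
 define d where "d = x - e"
 have xd: "x = e + d" by (simp add: d_def)
 have den: "frame_den e t p = (2 * (z * d)^2, 2 * (4 * x^2 * z^2 * d)^2)"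
  unfolding frame_den_def M unfolding p1 z_def[symmetric] d_def by (simp add: algebra_simps pow_eqs)
 define N where "N = 2 * e * x^2 + (2 * e^2 - t $ 5 / 2) * x - (e * t $ 5 / 2 + t3 t)"
 have num: "frame_num e t p = (N * z^2, 16 * x^4 * z^4 * N)"
  unfolding frame_num_def M unfolding p1 z_def[symmetric] N_def by (simp add: algebra_simps eval_nat_numeral)
 have "frame_den e t p = (0, 0) \<longleftrightarrow> d = 0" unfolding den using z by auto
 moreover have "hfun e t (pt p) = N / (2 * d^2)" unfolding ptp hfun_def N_def d_def by simp
 moreover have "N / (2 * d^2) * (2 * (z * d)^2) = N * z^2" if "d ~= 0" using that by (simp add: field_simps)
 moreover have "N / (2 * d^2) * (2 * (4 * x^2 * z^2 * d)^2) = 16 * x^4 * z^4 * N" if "d ~= 0"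
  using that by (simp add: field_simps eval_nat_numeral)
 ultimately show "?A & (?U --> ?B) & (?U --> ?C)" unfolding U den num by (auto simp: d_def)
qed

lemma hfun_smooth:
 assumes c: "on_cone t p" and U: "pt p \<in> U_frame e t"
 shows "hfun e t (pt p) = (fst (frame_num e t p) * cnj (fst (frame_den e t p)) +
   snd (frame_num e t p) * cnj (snd (frame_den e t p))) / frame_norm e t p"
proof -
 have "frame_norm e t p ~= 0" using frame_den_props(1)[OF c] U by (simp add: frame_norm_eq_0)
 moreover have "hfun e t (pt p) * frame_norm e t p = fst (frame_num e t p) * cnj (fst (frame_den e t p)) +
   snd (frame_num e t p) * cnj (snd (frame_den e t p))"
  by (simp only: frame_norm_def distrib_left mult.assoc[symmetric] frame_den_props(2,3)[OF c U])
 ultimately show ?thesis by (simp add: nonzero_eq_divide_eq)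
qed

lemma C1fun_frame:
 assumes f: "C1fun S f"
 shows "C1fun S (%z. fst (frame_den e (fst z) (f z)))" "C1fun S (%z. snd (frame_den e (fst z) (f z)))"
  "C1fun S (%z. fst (frame_num e (fst z) (f z)))" "C1fun S (%z. snd (frame_num e (fst z) (f z)))"
  "C1fun S (%z. frame_norm e (fst z) (f z))"
proof -
 have h: "C1fun S (%z. fst z $ 5 / 2)" by (rule C1fun_divide) (intro C1fun_intros, intro C1fun_intros, simp)
 have h': "C1fun S (%z. e * fst z $ 5 / 2)" by (rule C1fun_divide) (intro C1fun_intros, intro C1fun_intros, simp)
 show "C1fun S (%z. fst (frame_den e (fst z) (f z)))" "C1fun S (%z. snd (frame_den e (fst z) (f z)))"
  "C1fun S (%z. fst (frame_num e (fst z) (f z)))" "C1fun S (%z. snd (frame_num e (fst z) (f z)))"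
  "C1fun S (%z. frame_norm e (fst z) (f z))" unfolding frame_norm_def frame_den_def frame_num_def fst_conv snd_conv
  by (intro C1fun_intros C1fun_nth[OF f] h h')+
qed

lemma C1fun_ldiff:
 assumes "C1fun S f" "C1fun S g" "!!z. z \<in> S ==> fst z \<in> TT & on_cone (fst z) (f z)"
 shows "C1fun S (%z. ldiff (fst z) (f z) (g z))"
proof -
 have G: "C1fun S (%z. gradF (fst z) (f z) $ 1)" "C1fun S (%z. gradF (fst z) (f z) $ 2)" "C1fun S (%z. gradF (fst z) (f z) $ 3)"
  unfolding gradF_def vector_3 by (intro C1fun_intros C1fun_nth assms)+
 show ?thesis unfolding ldiff_def
 proof (rule C1fun_divide)
  show "gradF (fst z) (f z) $ 1 * cnj (gradF (fst z) (f z) $ 1) + gradF (fst z) (f z) $ 2 * cnj (gradF (fst z) (f z) $ 2) +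
    gradF (fst z) (f z) $ 3 * cnj (gradF (fst z) (f z) $ 3) ~= 0" if "z \<in> S" for z
   using norm_gradF_nonzero assms(3)[OF that] by blast
 qed (intro C1fun_mult C1fun_add C1fun_diff C1fun_cnj C1fun_const G C1fun_nth[OF assms(1)] C1fun_nth[OF assms(2)])+
qed

text \<open>Tube lemma for the compact time interval: an open condition holding along the whole path
  at \<open>t0\<close> holds along the paths at nearby parameters.\<close>

lemma tube_open:
 fixes f :: "param \<times> real => 'b::topological_space"
 assumes f: "continuous_on (V \<times> {0..1}) f" and T: "open T" and V: "open V" "t0 \<in> V"
  and t0: "!!s. s \<in> {0..1} ==> f (t0, s) \<in> T"
 shows "\<exists>V'. open V' & t0 \<in> V' & V' <= V & (\<forall>t\<in>V'. \<forall>s\<in>{0..1}. f (t, s) \<in> T)"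
proof -
 have "openin (top_of_set (V \<times> {0..1})) ((V \<times> {0..1}) \<inter> f -` T)"
  using f T by (rule continuous_openin_preimage_gen)
 then obtain W where W: "open W" "(V \<times> {0..1}) \<inter> f -` T = (V \<times> {0..1}) \<inter> W"
  unfolding openin_open by blast
 have "{t0} \<times> {0..1} <= W"
 proof
  fix z assume "z \<in> {t0} \<times> {0..1::real}"
  then obtain s where z: "z = (t0, s)" "s \<in> {0..1}" by blast
  then have "z \<in> (V \<times> {0..1}) \<inter> f -` T" using t0[OF z(2)] V by simp
  then show "z \<in> W" using W(2) by blast
 qed
 from Elementary_Topology.tube_lemma[OF compact_Icc W(1) this]
 obtain X0 where X0: "t0 \<in> X0" "open X0" "X0 \<times> {0..1} <= W" by blast
 have "f (t, s) \<in> T" if "t \<in> X0 \<inter> V" "s \<in> {0..1}" for t s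
 proof -
  have "(t, s) \<in> (V \<times> {0..1}) \<inter> W" using that X0(3) by blast
  then show ?thesis using W(2) by blast
 qed
 then show ?thesis using X0 V by (intro exI[of _ "X0 \<inter> V"]) auto
qed

lemma ex_frame_near:
 assumes f: "C1_family V Ga" and t0: "t0 \<in> V" and U: "!!s. s \<in> {0..1} ==> pt (Ga t0 s) \<in> U_frame e t0"
 shows "\<exists>V'. open V' & t0 \<in> V' & V' <= V & (\<forall>t\<in>V'. \<forall>s\<in>{0..1}. pt (Ga t s) \<in> U_frame e t)"
proof -
 define N where "N z = frame_norm e (fst z) (Ga (fst z) (snd z))" for z
 have cone: "on_cone t (Ga t s)" if "t \<in> V" "s \<in> {0..1}" for t s using f that by (auto simp: C1_family_def)
 have NU: "N (t, s) ~= 0 \<longleftrightarrow> pt (Ga t s) \<in> U_frame e t" if "t \<in> V" "s \<in> {0..1}" for t s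
  using frame_den_props(1)[OF cone[OF that]] by (simp add: N_def frame_norm_eq_0)
 have V: "open V" using f by (simp add: C1_family_def)
 have "continuous_on (V \<times> {0..1}) N"
  unfolding N_def by (rule C1fun_continuous[OF C1fun_frame(5)]) (use f in "simp add: C1_family_def")
 from tube_open[OF this open_Compl[OF closed_singleton] V t0, of 0] obtain V' where
  "open V'" "t0 \<in> V'" "V' <= V" "\<forall>t\<in>V'. \<forall>s\<in>{0..1}. N (t, s) ~= 0" using NU U t0 by auto
 then show ?thesis using NU by (intro exI[of _ V']) blast
qed

text \<open>The x-coordinates of finitely many differentiable paths form a null set in the plane, so
  some pole e misses them all.\<close>

lemma ex_frame_avoiding:
 assumes fin: "finite P" and P: "!!ga. ga \<in> P ==> C1_path t ga"
 obtains e where "e ~= a" "!!ga s. ga \<in> P ==> s \<in> {0..1} ==> pt (ga s) \<in> U_frame e t"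
proof -
 define B where "B = insert a (\<Union>ga\<in>P. (%s. ga s $ 1 / ga s $ 3) ` {s\<in>{0..1}. ga s $ 3 ~= 0})"
 have "negligible ((%s. ga s $ 1 / ga s $ 3) ` {s\<in>{0..1}. ga s $ 3 ~= 0})" if "ga \<in> P" for ga
 proof (rule negligible_differentiable_image_lowdim)
  show "(%s. ga s $ 1 / ga s $ 3) differentiable_on {s\<in>{0..1}. ga s $ 3 ~= 0}" unfolding differentiable_on_def
  proof
   fix s assume s: "s \<in> {s\<in>{0..1}. ga s $ 3 ~= 0}"
   then have "(ga hvd velocity ga s) (at01 s)" using P[OF that] by (simp add: C1_path_def)
   then have "(ga hvd velocity ga s) (at s within {s\<in>{0..1}. ga s $ 3 ~= 0})"
    by (rule has_vector_derivative_within_subset) auto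
   from hvd_quotient[OF hvd_vec_nth[OF this] hvd_vec_nth[OF this]] s
   show "(%s. ga s $ 1 / ga s $ 3) differentiable at s within {s\<in>{0..1}. ga s $ 3 ~= 0}"
    by (auto simp: hvd_def differentiable_def)
  qed
 qed simp
 then have "negligible B" unfolding B_def negligible_insert using fin by (intro negligible_Union) auto
 then have "B ~= UNIV" by auto
 then obtain e where e: "e \<notin> B" by blast
 show thesis
 proof (rule that)
  show "e ~= a" using e by (auto simp: B_def)
  fix ga s assume g: "ga \<in> P" "s \<in> {0..1::real}"
  have c: "on_cone t (ga s)" using P[OF g(1)] g(2) by (simp add: C1_path_def)
  show "pt (ga s) \<in> U_frame e t"
  proof (cases "ga s $ 3 = 0")
   case True
   then show ?thesis by (simp add: pt_def None_in_U_frame)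
  next
   case False
   then have "ga s $ 1 / ga s $ 3 ~= e" using e g by (force simp: B_def)
   then show ?thesis using False on_cone_affine[OF c False] by (simp add: pt_def Some_in_U_frame)
  qed
 qed
qed

definition vert_of :: "param => complex => complex => complex => (real => complex ^ 3) => complex" where
 "vert_of t e al be p = (SOME b. vert t e al be (p 0) (vector_derivative p (at 0)) b)"

lemma vert_of:
 assumes t0: "t0 \<in> TT" and l: "lift_field t0 v al be" and P: "(P hvd d) (at 0)"
  and c: "eventually (%ep. on_cone (t0 + ep *\<^sub>R v) (P ep)) (nhds 0)"
 shows "vert t0 e al be (P 0) d (vert_of t0 e al be P)"
proof -
 have "vector_derivative P (at 0) = d" by (rule vector_derivative_at[OF P])
 then show ?thesis using someI_ex[OF vert_exists[OF t0 l P c, of e]] unfolding vert_of_def by simp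
qed

lemma eventually_line:
 fixes V :: "param set"
 assumes "open V" "t0 \<in> V"
 shows "eventually (%ep::real. t0 + ep *\<^sub>R v \<in> V) (nhds 0)"
proof -
 have "((%ep::real. t0 + ep *\<^sub>R v) ---> t0 + 0 *\<^sub>R v) (at 0)" by (intro tendsto_intros)
 then have "eventually (%ep::real. t0 + ep *\<^sub>R v \<in> V) (at 0)" using assms by (intro topological_tendstoD[of _ t0]) simp_all
 then show ?thesis using assms by (simp add: eventually_nhds_conv_at)
qed

text \<open>\<open>varies\<close> integrated over the path: end terms plus combinations of the two
  integrals. \<open>D2\<close> and \<open>D3\<close> are total derivatives; only their evaluation in
  the direction v refers to al and be.\<close>

definition path_rates :: "complex => param => (param => real => complex ^ 3) => (param => complex) => (param => complex) => bool" where
 "path_rates e t0 Ga D2 D3 \<longleftrightarrow>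
  ((%t. path_integral t (%_. 1) (Ga t)) has_derivative D2) (at t0) &
  ((%t. path_integral t (hfun e t) (Ga t)) has_derivative D3) (at t0) &
  (\<forall>v al be. lift_field t0 v al be --> D2 v =
    vert_of t0 e al be (%ep. Ga (t0 + ep *\<^sub>R v) 1) - vert_of t0 e al be (%ep. Ga (t0 + ep *\<^sub>R v) 0)
     - al * path_integral t0 (hfun e t0) (Ga t0) - be * path_integral t0 (%_. 1) (Ga t0) & D3 v =
    (hfun e t0 (pt (Ga t0 1)) * vert_of t0 e al be (%ep. Ga (t0 + ep *\<^sub>R v) 1) + phifun e t0 al be (pt (Ga t0 1)))
    - (hfun e t0 (pt (Ga t0 0)) * vert_of t0 e al be (%ep. Ga (t0 + ep *\<^sub>R v) 0) + phifun e t0 al be (pt (Ga t0 0)))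
     + al * t0 $ 5 / 12 * path_integral t0 (%_. 1) (Ga t0) + be * path_integral t0 (hfun e t0) (Ga t0))"

text \<open>Differentiation under the integral sign is allowed since \<open>ldiff\<close> and
  \<open>hfun_smooth\<close> make the integrands continuously differentiable. The derivative of the
  integrand is identified at each time by \<open>point_variation\<close>, and the total derivatives
  are integrated.\<close>

lemma path_variation:
 assumes f: "C1_family V Ga" and t0: "t0 \<in> V" and U: "!!s. s \<in> {0..1} ==> pt (Ga t0 s) \<in> U_frame e t0"
 shows "\<exists>D2 D3. path_rates e t0 Ga D2 D3"
proof -
 have V: "open V" "V <= TT" and cone: "!!t s. t \<in> V ==> s \<in> {0..1} ==> on_cone t (Ga t s)"
  and C1: "C1fun (V \<times> {0..1}) (%z. Ga (fst z) (snd z))" "C1fun (V \<times> {0..1}) (%z. velocity (Ga (fst z)) (snd z))"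
  using f by (auto simp: C1_family_def)
 have t0T: "t0 \<in> TT" using V t0 by blast
 obtain V' where V': "open V'" "t0 \<in> V'" "V' <= V" and U': "!!t s. t \<in> V' ==> s \<in> {0..1} ==> pt (Ga t s) \<in> U_frame e t"
  using ex_frame_near[OF f t0 U] by blast
 have sub: "V' \<times> {0..1::real} <= V \<times> {0..1}" using V'(3) by blast
 note C1' = C1fun_subset[OF C1(1) sub] C1fun_subset[OF C1(2) sub]
 define Gas where "Gas t s = velocity (Ga t) s" for t s
 have vel: "(Ga t hvd Gas t s) (at01 s)" if "t \<in> V" "s \<in> {0..1}" for t s
  using C1_family_velocity[OF f that] by (simp add: Gas_def)
 have pa: "path_at t {0..1} (Ga t) s (Gas t s)" if "t \<in> V" "s \<in> {0..1}" for t s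
  using C1_path_at[OF C1_family_path[OF f that(1)] that(2)] by (simp add: Gas_def)
 define l where "l t s = inv_diff t (Ga t s) (Gas t s)" for t s
 define h where "h t s = hfun e t (pt (Ga t s))" for t s
 define I2 where "I2 z = ldiff (fst z) (Ga (fst z) (snd z)) (velocity (Ga (fst z)) (snd z))" for z
 define Hs where "Hs z = (fst (frame_num e (fst z) (Ga (fst z) (snd z))) * cnj (fst (frame_den e (fst z) (Ga (fst z) (snd z)))) +
   snd (frame_num e (fst z) (Ga (fst z) (snd z))) * cnj (snd (frame_den e (fst z) (Ga (fst z) (snd z))))) / frame_norm e (fst z) (Ga (fst z) (snd z))" for z
 have C2: "C1fun (V' \<times> {0..1}) I2" unfolding I2_def by (rule C1fun_ldiff[OF C1']) (use cone V V' in auto)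
 have Q: "frame_norm e (fst z) (Ga (fst z) (snd z)) ~= 0" if "z \<in> V' \<times> {0..1}" for z
 proof -
  have z: "fst z \<in> V'" "fst z \<in> V" "snd z \<in> {0..1}" using that V'(3) by auto
  show ?thesis using frame_den_props(1)[OF cone[OF z(2,3)]] U'[OF z(1,3)] by (simp add: frame_norm_eq_0)
 qed
 have CH: "C1fun (V' \<times> {0..1}) Hs"
  unfolding Hs_def by (intro C1fun_divide C1fun_add C1fun_mult C1fun_cnj C1fun_frame[OF C1'(1)] Q)
 have C3: "C1fun (V' \<times> {0..1}) (%z. Hs z * I2 z)" by (rule C1fun_mult[OF CH C2])
 have Il: "I2 (t, s) = l t s" if "t \<in> V'" "s \<in> {0..1}" for t s
 proof -
  have t: "t \<in> V" "t \<in> TT" using that V' V by auto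
  show ?thesis using inv_diff_eq_ldiff[OF t(2) cone[OF t(1) that(2)] path_tangent[OF pa[OF t(1) that(2)]]]
   by (simp add: I2_def l_def Gas_def)
 qed
 have Ih: "Hs (t, s) = h t s" if "t \<in> V'" "s \<in> {0..1}" for t s
 proof -
  have t: "t \<in> V" using that V' by auto
  show ?thesis using hfun_smooth[OF cone[OF t that(2)] U'[OF that]] by (simp add: Hs_def h_def)
 qed
 have P2: "path_integral t (%_. 1) (Ga t) = integral {0..1} (%s. I2 (t, s))" if "t \<in> V'" for t
  unfolding path_integral_def by (rule integral_cong) (simp add: Il[OF that] l_def Gas_def)
 have P3: "path_integral t (hfun e t) (Ga t) = integral {0..1} (%s. Hs (t, s) * I2 (t, s))" if "t \<in> V'" for t
  unfolding path_integral_def by (rule integral_cong) (simp add: Il[OF that] Ih[OF that] l_def h_def Gas_def)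
 have one: "(1::real) \<in> {0<..1}" by simp
 obtain E2 where E2: "!!s. s \<in> {0..1} ==> ((%t. I2 (t, s)) has_derivative blinfun_apply (E2 s)) (at t0)"
  and I2': "((%t. integral {0..1} (%s. I2 (t, s))) has_derivative (%v. integral {0..1} (%s. E2 s v))) (at t0)"
  by (rule C1fun_leibniz[OF C2 V'(1,2) zero_less_one]) (rule that, assumption, use one in blast)
 obtain E3 where E3: "!!s. s \<in> {0..1} ==> ((%t. Hs (t, s) * I2 (t, s)) has_derivative blinfun_apply (E3 s)) (at t0)"
  and I3': "((%t. integral {0..1} (%s. Hs (t, s) * I2 (t, s))) has_derivative (%v. integral {0..1} (%s. E3 s v))) (at t0)"
  by (rule C1fun_leibniz[OF C3 V'(1,2) zero_less_one]) (rule that, assumption, use one in blast)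
 have pre: "path_integral t0 (%_. 1) (Ga t0) = integral {0..1} (l t0)" "path_integral t0 (hfun e t0) (Ga t0) = integral {0..1} (%s. h t0 s * l t0 s)"
  unfolding path_integral_def l_def h_def Gas_def by simp_all
 have intl: "l t0 integrable_on {0..1}"
  using path_integrable[OF t0T regular_on_const C1_family_path[OF f t0], of UNIV 1] unfolding l_def[abs_def] Gas_def by simp
 have inth: "(%s. h t0 s * l t0 s) integrable_on {0..1}"
  using path_integrable[OF t0T regular_hfun C1_family_path[OF f t0] U] unfolding l_def[abs_def] h_def Gas_def by simp
 note hl = integrable_integral[OF intl, folded pre] and hh = integrable_integral[OF inth, folded pre]
 show ?thesis unfolding path_rates_def
 proof (rule exI[of _ "%v. integral {0..1} (%s. E2 s v)"], rule exI[of _ "%v. integral {0..1} (%s. E3 s v)"], intro conjI, goal_cases)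
  case 1
  show ?case by (rule has_derivative_transform_within_open[OF I2' V'(1,2)]) (simp add: P2)
 next
  case 2
  show ?case by (rule has_derivative_transform_within_open[OF I3' V'(1,2)]) (simp add: P3)
 next
  case 3
  show ?case
  proof (intro allI impI, goal_cases)
  case lf: (1 v al be)
  obtain d d' where d: "!!s. s \<in> {0..1} ==> ((%ep::real. Ga (t0 + ep *\<^sub>R v) s) hvd d s) (at 0)"
   and d': "!!s. s \<in> {0..1} ==> ((%ep::real. Gas (t0 + ep *\<^sub>R v) s) hvd d' s) (at 0)"
   and dd': "!!s. s \<in> {0..1} ==> (d hvd d' s) (at01 s)"
   by (rule mixed_derivative[OF C1 _ V(1) t0, unfolded fst_conv snd_conv, folded Gas_def]) (erule (1) vel, rule that)
  have evV: "eventually (%ep::real. t0 + ep *\<^sub>R v \<in> V') (nhds 0)" by (rule eventually_line[OF V'(1,2)])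
  define b where "b s = vert_of t0 e al be (%ep. Ga (t0 + ep *\<^sub>R v) s)" for s
  have mp: "moving_path t0 v e al be Ga Gas d d' b"
  proof
   show "eventually (%ep. t0 + ep *\<^sub>R v \<in> TT &
    (\<forall>s\<in>{0..1}. path_at (t0 + ep *\<^sub>R v) {0..1} (Ga (t0 + ep *\<^sub>R v)) s (Gas (t0 + ep *\<^sub>R v) s))) (nhds 0)"
    using evV
   proof eventually_elim
    case (elim ep)
    then have "t0 + ep *\<^sub>R v \<in> V" using V' by blast
    then show ?case using pa V by blast
   qed
   show "vert t0 e al be (Ga t0 s) (d s) (b s)" if s: "s \<in> {0..1}" for s
   proof -
    have "eventually (%ep. on_cone (t0 + ep *\<^sub>R v) (Ga (t0 + ep *\<^sub>R v) s)) (nhds 0)"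
     using evV by eventually_elim (use cone s V' in blast)
    from vert_of[OF t0T lf d[OF s] this] show ?thesis by (simp add: b_def)
   qed
  qed (use t0T lf d d' dd' U in auto)
  have E: "((%ep. l (t0 + ep *\<^sub>R v) s) hvd E2 s v) (at 0)"
   "((%ep. h (t0 + ep *\<^sub>R v) s * l (t0 + ep *\<^sub>R v) s) hvd E3 s v) (at 0)" if s: "s \<in> {0..1}" for s
  proof -
   have ev1: "eventually (%ep. I2 (t0 + ep *\<^sub>R v, s) = l (t0 + ep *\<^sub>R v) s) (nhds 0)"
    using evV by (rule eventually_mono) (rule Il[OF _ s])
   have ev2: "eventually (%ep. Hs (t0 + ep *\<^sub>R v, s) * I2 (t0 + ep *\<^sub>R v, s) = h (t0 + ep *\<^sub>R v) s * l (t0 + ep *\<^sub>R v) s) (nhds 0)"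
    using evV by (rule eventually_mono) (simp only: Il[OF _ s] Ih[OF _ s])
   show "((%ep. l (t0 + ep *\<^sub>R v) s) hvd E2 s v) (at 0)"
    by (rule hvd_transform_nhds[OF has_derivative_along_line[OF E2[OF s]] ev1])
   show "((%ep. h (t0 + ep *\<^sub>R v) s * l (t0 + ep *\<^sub>R v) s) hvd E3 s v) (at 0)"
    by (rule hvd_transform_nhds[OF has_derivative_along_line[OF E3[OF s]] ev2])
  qed
  have V2: "(b hvd E2 s v + al * (h t0 s * l t0 s) + be * l t0 s) (at01 s) &
   ((%s. h t0 s * b s + phifun e t0 al be (pt (Ga t0 s))) hvd
     E3 s v - (al * t0 $ 5 / 12) * l t0 s - be * (h t0 s * l t0 s)) (at01 s)" if s: "s \<in> {0..1}" for s
  proof -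
   obtain b' b3' where b': "(b hvd b') (at01 s)"
    and L: "((%ep. l (t0 + ep *\<^sub>R v) s) hvd b' - al * h t0 s * l t0 s - be * l t0 s) (at 0)"
    and b3': "((%s. h t0 s * b s + phifun e t0 al be (pt (Ga t0 s))) hvd b3') (at01 s)"
    and L3: "((%ep. h (t0 + ep *\<^sub>R v) s * l (t0 + ep *\<^sub>R v) s) hvd
      b3' + (al * t0 $ 5 / 12 + be * h t0 s) * l t0 s) (at 0)"
    using moving_path.point_variation[OF mp s, folded l_def h_def] by blast
   have "E2 s v = b' - al * h t0 s * l t0 s - be * l t0 s" by (rule vector_derivative_unique_at[OF E(1)[OF s] L])
   then have 1: "b' = E2 s v + al * (h t0 s * l t0 s) + be * l t0 s" by (simp add: algebra_simps)
   have "E3 s v = b3' + (al * t0 $ 5 / 12 + be * h t0 s) * l t0 s" by (rule vector_derivative_unique_at[OF E(2)[OF s] L3])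
   then have 2: "b3' = E3 s v - (al * t0 $ 5 / 12) * l t0 s - be * (h t0 s * l t0 s)" by (simp add: algebra_simps)
   show ?thesis using b' b3' unfolding 1 2 by blast
  qed
  \<comment> \<open>The integrand is the derivative of b, so only the vertical velocities of the two
    ends remain.\<close>
  have F2: "((%s. E2 s v + al * (h t0 s * l t0 s) + be * l t0 s) has_integral b 1 - b 0) {0..1}"
   by (rule fundamental_theorem_of_calculus) (use V2 in auto)
  have F3: "((%s. E3 s v - (al * t0 $ 5 / 12) * l t0 s - be * (h t0 s * l t0 s)) has_integral
    (h t0 1 * b 1 + phifun e t0 al be (pt (Ga t0 1))) - (h t0 0 * b 0 + phifun e t0 al be (pt (Ga t0 0)))) {0..1}"
   by (rule fundamental_theorem_of_calculus) (use V2 in auto)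
  have "((%s. E2 s v) has_integral (b 1 - b 0) - al * path_integral t0 (hfun e t0) (Ga t0) - be * path_integral t0 (%_. 1) (Ga t0)) {0..1}"
   using has_integral_diff[OF has_integral_diff[OF F2 has_integral_mult_right[OF hh, of al]] has_integral_mult_right[OF hl, of be]]
   by simp
  moreover have "((%s. E3 s v) has_integral
    (h t0 1 * b 1 + phifun e t0 al be (pt (Ga t0 1))) - (h t0 0 * b 0 + phifun e t0 al be (pt (Ga t0 0)))
    + al * t0 $ 5 / 12 * path_integral t0 (%_. 1) (Ga t0) + be * path_integral t0 (hfun e t0) (Ga t0)) {0..1}"
   using has_integral_add[OF has_integral_add[OF F3 has_integral_mult_right[OF hl, of "al * t0 $ 5 / 12"]] has_integral_mult_right[OF hh, of be]]
   by simp
  ultimately show ?case unfolding b_def h_def by (blast intro: integral_unique)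
  qed
 qed
qed

section \<open>Variation of the boundary\<close>

lemma cycle_family_C1:
 assumes "cycle_family V c" "(n, Ga) \<in> set c"
 shows "C1_family V Ga" using assms unfolding cycle_family_def C1_family_def C1_on_eq case_prod_unfold by force

lemma cycle_family_open: "cycle_family V c ==> open V" "cycle_family V c ==> V <= TT" by (simp_all add: cycle_family_def)

lemma cycle_family_rel_chain:
 assumes c: "cycle_family V c" and t: "t \<in> V"
 shows "rel_chain t (at_param c t)"
proof -
 have "C1_path t ga" if "(n, ga) \<in> set (at_param c t)" for n ga
  using that C1_family_path[OF cycle_family_C1[OF c] t] by (auto simp: at_param_def)
 then show ?thesis using c t by (auto simp: rel_chain_def cycle_family_def)
qed

lemma boundary_sum_at_param:
 "boundary_sum F (at_param c t) = (\<Sum>(n, Ga)\<leftarrow>c. of_int n * (F (pt (Ga t 1)) - F (pt (Ga t 0))))"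
 by (simp add: boundary_sum_def at_param_def o_def case_prod_unfold)

lemma chain_integral_at_param:
 "chain_integral t g (at_param c t) = (\<Sum>(n, Ga)\<leftarrow>c. of_int n * path_integral t g (Ga t))"
 by (simp add: chain_integral_def at_param_def o_def case_prod_unfold)

text \<open>Equality of projective points as vanishing of p \<times> q; in this form being different
  is an open condition.\<close>

lemma cross_zero_iff_pt_eq:
 assumes "on_cone t p" "on_cone t q"
 shows "pt p = pt q \<longleftrightarrow> p $ 1 * q $ 3 = p $ 3 * q $ 1 & p $ 2 * q $ 3 = p $ 3 * q $ 2 & p $ 1 * q $ 2 = p $ 2 * q $ 1"
proof (cases "p $ 3 = 0 \<or> q $ 3 = 0")
 case True
 then show ?thesis using on_cone_None[OF assms(1)] on_cone_None[OF assms(2)] by (auto simp: pt_def)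
next
 case False
 then have "p $ 1 * q $ 2 = p $ 2 * q $ 1"
  if "p $ 1 * q $ 3 = p $ 3 * q $ 1" "p $ 2 * q $ 3 = p $ 3 * q $ 2"
 proof -
  have "p $ 3 * (p $ 1 * q $ 2) = p $ 1 * (p $ 2 * q $ 3)" unfolding that(2) by (simp add: mult_ac)
  also have "\<dots> = p $ 2 * (p $ 1 * q $ 3)" by (simp add: mult_ac)
  also have "\<dots> = p $ 3 * (p $ 2 * q $ 1)" unfolding that(1) by (simp add: mult_ac)
  finally show ?thesis using False by simp
 qed
 then show ?thesis using False by (auto simp: pt_def frac_eq_eq mult_ac)
qed

lemma eventually_pt_neq:
 assumes p: "isCont p t0" and q: "isCont q t0"
  and c: "eventually (%t. on_cone t (p t)) (nhds t0)" "eventually (%t. on_cone t (q t)) (nhds t0)"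
  and ne: "pt (p t0) ~= pt (q t0)"
 shows "eventually (%t. pt (p t) ~= pt (q t)) (nhds t0)"
proof -
 have lim: "((%t. p t $ i * q t $ j - p t $ k * q t $ l) ---> p t0 $ i * q t0 $ j - p t0 $ k * q t0 $ l) (nhds t0)" for i j k l
  using p q unfolding isCont_def by (auto intro!: tendsto_intros simp: tendsto_nhds_iff)
 have ev: "eventually (%t. p t $ i * q t $ j ~= p t $ k * q t $ l) (nhds t0)" if "p t0 $ i * q t0 $ j ~= p t0 $ k * q t0 $ l" for i j k l
  using tendsto_imp_eventually_ne[OF lim[of i j k l], of 0] that by simp
 have "\<not> (p t0 $ 1 * q t0 $ 3 = p t0 $ 3 * q t0 $ 1 & p t0 $ 2 * q t0 $ 3 = p t0 $ 3 * q t0 $ 2 & p t0 $ 1 * q t0 $ 2 = p t0 $ 2 * q t0 $ 1)"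
  using cross_zero_iff_pt_eq[OF eventually_nhds_x_imp_x[OF c(1)] eventually_nhds_x_imp_x[OF c(2)]] ne by blast
 then consider "p t0 $ 1 * q t0 $ 3 ~= p t0 $ 3 * q t0 $ 1" | "p t0 $ 2 * q t0 $ 3 ~= p t0 $ 3 * q t0 $ 2" | "p t0 $ 1 * q t0 $ 2 ~= p t0 $ 2 * q t0 $ 1"
  by blast
 then show ?thesis
 proof cases
  case 1
  show ?thesis using ev[OF 1] c by eventually_elim (simp add: cross_zero_iff_pt_eq)
 next
  case 2
  show ?thesis using ev[OF 2] c by eventually_elim (simp add: cross_zero_iff_pt_eq)
 next
  case 3
  show ?thesis using ev[OF 3] c by eventually_elim (simp add: cross_zero_iff_pt_eq)
 qed
qed

text \<open>A local coordinate at \<open>q\<close> whose derivative along a moving point is \<open>G q\<close> times the vertical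
 velocity up to a term depending on \<open>q\<close> only.\<close>

definition local_coord :: "param => (point => complex) => point => point => complex" where
 "local_coord t G q p = (case p of None => 0 | Some (x, y) =>
   (case q of None => - 2 * G q * (x / y)
   | Some (x0, y0) => G q * (if y0 ~= 0 then x / y0 else 2 * y / dcubic t x0)))"

definition coord_drift :: "param => complex => complex => complex => (point => complex) => point => complex" where
 "coord_drift t e al be G q = (case q of None => 0 | Some (x0, y0) =>
   G q * (al * (y0 / (2 * (x0 - e))) + (if y0 ~= 0 then xi0 t al be x0 / y0 else 2 * psi0 al be x0 y0 / dcubic t x0)))"

text \<open>The coordinates -2 x/y at O, x/y0 where y0 is non-zero and 2 y/f'(x0) at a branch point
  are normalised so that dx/y is their differential at q. The vertical velocity therefore enters
  with the factor G q, and the lift contributes the drift.\<close>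

lemma local_coord_derivative:
 fixes p :: "real => complex ^ 3"
 assumes t: "t0 \<in> TT" and p: "(p hvd d) (at 0)" and c: "eventually (%ep. on_cone (t0 + ep *\<^sub>R v) (p ep)) (nhds 0)"
  and b: "vert t0 e al be (p 0) d b"
 shows "((%ep. local_coord t0 G (pt (p 0)) (pt (p ep))) hvd
   coord_drift t0 e al be G (pt (p 0)) + G (pt (p 0)) * b) (at 0)"
proof -
 have c0: "on_cone t0 (p 0)" using eventually_nhds_x_imp_x[OF c] by simp
 note near = eventually_nonzero_nhds[OF hvd_vec_nth[OF p]]
 have quot: "((%ep. p ep $ i / p ep $ j) hvd (d $ i * p 0 $ j - p 0 $ i * d $ j) / (p 0 $ j)^2) (at 0)"
  if "p 0 $ j ~= 0" for i j by (intro hvd_quotient hvd_vec_nth p that)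
 show ?thesis
 proof (cases "p 0 $ 3 = 0")
  case True
  then have p2: "p 0 $ 2 ~= 0" and ptp: "pt (p 0) = None" using on_cone_None[OF c0 True] by (auto simp: pt_def)
  have "eventually (%ep. - 2 * G None * (p ep $ 1 / p ep $ 2) = local_coord t0 G (pt (p 0)) (pt (p ep))) (nhds 0)"
   using c near[OF p2]
  proof eventually_elim
   case (elim ep)
   show ?case
   proof (cases "p ep $ 3 = 0")
    case True
    then show ?thesis using on_cone_None[OF elim(1) True] unfolding ptp by (simp add: local_coord_def pt_def)
   next
    case False
    then show ?thesis using elim(2) unfolding ptp by (simp add: local_coord_def pt_def)
   qed
  qed
  note * = hvd_transform_nhds[OF hvd_mult_right[OF quot[OF p2]] this]
  define Q where "Q = (d $ 1 * p 0 $ 2 - p 0 $ 1 * d $ 2) / (p 0 $ 2)^2"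
  have "b = - 2 * Q" using b True by (simp only: vert_def if_True Q_def)
  then show ?thesis by (intro hvd_eq_rhs[OF *[folded Q_def]]) (simp add: ptp coord_drift_def)
 next
  case False
  define x0 y0 where "x0 = p 0 $ 1 / p 0 $ 3" and "y0 = p 0 $ 2 / p 0 $ 3"
  have ptp: "pt (p 0) = Some (x0, y0)" using False by (simp add: pt_def x0_def y0_def)
  define x' y' where "x' = (d $ 1 * p 0 $ 3 - p 0 $ 1 * d $ 3) / (p 0 $ 3)^2" and "y' = (d $ 2 * p 0 $ 3 - p 0 $ 2 * d $ 3) / (p 0 $ 3)^2"
  define B where "B = b + al * (y0 / (2 * (x0 - e)))"
  have xy: "x' = xi0 t0 al be x0 + B * y0" "2 * (y' - psi0 al be x0 y0) = B * dcubic t0 x0"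
   using b False by (simp_all add: vert_def B_def x0_def y0_def x'_def y'_def)
  have cc: "y0^2 = cubic t0 x0" using on_cone_affine[OF c0 False] by (simp add: x0_def y0_def)
  have pte: "pt (p ep) = Some (p ep $ 1 / p ep $ 3, p ep $ 2 / p ep $ 3)" if "p ep $ 3 ~= 0" for ep
   using that by (simp add: pt_def)
  show ?thesis
  proof (cases "y0 = 0")
   case True
   then have f: "dcubic t0 x0 ~= 0" using cc dcubic_nonzero[OF t] by simp
   have "eventually (%ep. G (Some (x0, y0)) * (2 / dcubic t0 x0) * (p ep $ 2 / p ep $ 3) = local_coord t0 G (pt (p 0)) (pt (p ep))) (nhds 0)"
    using near[OF False] by eventually_elim (simp add: ptp local_coord_def pte True mult_ac)
   note * = hvd_transform_nhds[OF hvd_mult_right[OF quot[OF False]] this, folded y'_def]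
   have eq: "2 / dcubic t0 x0 * y' = B + 2 * psi0 al be x0 y0 / dcubic t0 x0" using xy(2) f by (simp add: field_simps)
   have "G (Some (x0, y0)) * (2 / dcubic t0 x0) * y' = G (Some (x0, y0)) * (B + 2 * psi0 al be x0 y0 / dcubic t0 x0)"
    by (simp only: mult.assoc eq)
   also have "\<dots> = coord_drift t0 e al be G (pt (p 0)) + G (pt (p 0)) * b"
    using True unfolding ptp coord_drift_def B_def by (simp add: algebra_simps)
   finally show ?thesis by (rule hvd_eq_rhs[OF *])
  next
   case y0: False
   have "eventually (%ep. G (Some (x0, y0)) * (1 / y0) * (p ep $ 1 / p ep $ 3) = local_coord t0 G (pt (p 0)) (pt (p ep))) (nhds 0)"
    using near[OF False] by eventually_elim (simp add: ptp local_coord_def pte y0)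
   note * = hvd_transform_nhds[OF hvd_mult_right[OF quot[OF False]] this, folded x'_def]
   have eq: "1 / y0 * x' = B + xi0 t0 al be x0 / y0" using xy(1) y0 by (simp add: field_simps)
   have "G (Some (x0, y0)) * (1 / y0) * x' = G (Some (x0, y0)) * (B + xi0 t0 al be x0 / y0)" by (simp only: mult.assoc eq)
   also have "\<dots> = coord_drift t0 e al be G (pt (p 0)) + G (pt (p 0)) * b"
    using y0 unfolding ptp coord_drift_def B_def by (simp add: algebra_simps)
   finally show ?thesis by (rule hvd_eq_rhs[OF *])
  qed
 qed
qed

definition P_lift :: "param => complex ^ 3" where "P_lift t = vector [t $ 1, t $ 2, 1]"
definition O_lift :: "param => complex ^ 3" where "O_lift t = vector [0, 1, 0]"

lemma lift_cone: "on_cone t (P_lift t)" "on_cone t (O_lift t)"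
 and pt_lift: "pt (P_lift t) = Some (t $ 1, t $ 2)" "pt (O_lift t) = None"
 by (simp_all add: on_cone_def P_lift_def O_lift_def t3_def pt_def vec_eq_iff forall_3)

lemma P_lift_eq: "P_lift t = axis 1 (t $ 1) + axis 2 (t $ 2) + axis 3 1" by (auto simp: P_lift_def vec_eq_iff forall_3 axis_def)

lemma P_lift_derivative: "((%ep::real. P_lift (t0 + ep *\<^sub>R v)) hvd vector [v $ 1, v $ 2, 0]) (at 0)"
proof -
 have e: "vector [v $ 1, v $ 2, 0] = axis 1 (v $ 1) + axis 2 (v $ 2) + (0 :: complex ^ 3)"
  by (auto simp: vec_eq_iff forall_3 axis_def)
 show ?thesis unfolding P_lift_eq e by (intro hvd_add hvd_const
    bounded_linear.has_vector_derivative[OF bounded_linear_axis] line_param)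
qed

lemma isCont_lift: "isCont P_lift t" "isCont O_lift t"
proof -
 show "isCont P_lift t" unfolding P_lift_eq[abs_def] by (intro continuous_intros bounded_linear.isCont[OF bounded_linear_axis])
 show "isCont O_lift t" unfolding O_lift_def[abs_def] by (rule continuous_const)
qed

text \<open>P and O are included so that the moving ends can be compared with them on the same
  footing.\<close>

definition endpoints :: "(int \<times> (param => real => complex ^ 3)) list => (param => complex ^ 3) set" where
 "endpoints c = {P_lift, O_lift} \<union> (\<Union>(n, Ga)\<in>set c. {%t. Ga t 0, %t. Ga t 1})"

lemma endpoints_props:
 assumes c: "cycle_family V c" and t: "t0 \<in> V" and p: "p \<in> endpoints c"
 shows "isCont p t0" "t \<in> V ==> on_cone t (p t)" "\<exists>d. ((%ep::real. p (t0 + ep *\<^sub>R v)) hvd d) (at 0)"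
proof (atomize(full))
 consider "p = P_lift" | "p = O_lift" | n Ga s where "(n, Ga) \<in> set c" "s \<in> {0, 1::real}" "p = (%t. Ga t s)"
  using p unfolding endpoints_def by auto
 then show "isCont p t0 & (t \<in> V --> on_cone t (p t)) & (\<exists>d. ((%ep::real. p (t0 + ep *\<^sub>R v)) hvd d) (at 0))"
 proof cases
  case 1
  then show ?thesis using isCont_lift(1) lift_cone(1) P_lift_derivative by blast
 next
  case 2
  have "((%ep::real. O_lift (t0 + ep *\<^sub>R v)) hvd 0) (at 0)" unfolding O_lift_def by (rule hvd_const)
  then show ?thesis using isCont_lift(2) lift_cone(2) 2 by blast
 next
  case 3
  have f: "C1_family V Ga" by (rule cycle_family_C1[OF c 3(1)])
  have s: "s \<in> {0..1}" using 3(2) by auto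
  obtain D E where D: "!!t s. t \<in> V ==> s \<in> {0..1} ==> ((%t. Ga (fst (t, s)) (snd (t, s))) has_derivative blinfun_apply (D t s)) (at t)"
   by (rule C1fun_slice[of V 0 1 "%z. Ga (fst z) (snd z)"]) (use f in "auto simp: C1_family_def")
  have p': "(p has_derivative blinfun_apply (D t0 s)) (at t0)" using D[OF t s] 3(3) by simp
  have "t \<in> V --> on_cone t (p t)" using f s 3(3) by (auto simp: C1_family_def)
  then show ?thesis using has_derivative_continuous[OF p'] has_derivative_along_line[OF p'] by blast
 qed
qed

text \<open>A \<open>boundary_sum\<close> for functions of both the position of an end at
  \<open>t0\<close> and its current position; coordinates centred at the initial position are of
  this kind.\<close>

definition boundary_move :: "(int \<times> (param => real => complex ^ 3)) list => param => (point => point => complex) => param => complex" where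
 "boundary_move c t0 ps t = (\<Sum>(n, Ga)\<leftarrow>c. of_int n * (ps (pt (Ga t0 1)) (pt (Ga t 1)) - ps (pt (Ga t0 0)) (pt (Ga t 0))))"

text \<open>Single ends may lie anywhere; only the total boundary lies in Y. Distinct ends stay
  distinct for a while, so near \<open>t0\<close> the current position determines the initial one,
  and \<open>ps\<close> becomes a function of the current position to which the description of the
  boundary applies.\<close>

lemma boundary_identity:
 assumes c: "cycle_family V c" and t0: "t0 \<in> V"
 obtains m :: complex where
  "eventually (%t. \<forall>F. boundary_sum F (at_param c t) = m * (F (Some (t $ 1, t $ 2)) - F None)) (nhds t0)"
  "eventually (%t. \<forall>ps. boundary_move c t0 ps t =
    m * (ps (pt (P_lift t0)) (pt (P_lift t)) - ps (pt (O_lift t0)) (pt (O_lift t)))) (nhds t0)"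
proof -
 have V: "open V" using c by (rule cycle_family_open)
 have evV: "eventually (%t. t \<in> V) (nhds t0)" using V t0 by (rule eventually_nhds_in_open)
 have fin: "finite (endpoints c)" by (auto simp: endpoints_def)
 have dist: "eventually (%t. pt (p t) = pt (q t) --> pt (p t0) = pt (q t0)) (nhds t0)"
  if "p \<in> endpoints c" "q \<in> endpoints c" for p q
 proof (cases "pt (p t0) = pt (q t0)")
  case True
  then show ?thesis by simp
 next
  case False
  have ec: "eventually (%t. on_cone t (p t)) (nhds t0)" "eventually (%t. on_cone t (q t)) (nhds t0)"
   using evV endpoints_props(2)[OF c t0 that(1)] endpoints_props(2)[OF c t0 that(2)] by (auto elim!: eventually_mono)
  show ?thesis using eventually_pt_neq[OF endpoints_props(1)[OF c t0 that(1)] endpoints_props(1)[OF c t0 that(2)] ec False]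
   by (rule eventually_mono) blast
 qed
 have D: "eventually (%t. \<forall>p\<in>endpoints c. \<forall>q\<in>endpoints c. pt (p t) = pt (q t) --> pt (p t0) = pt (q t0)) (nhds t0)"
  by (intro eventually_ball_finite[OF fin] ballI dist)
 have ex: "\<exists>m. (\<forall>F. boundary_sum F (at_param c t) = m * (F (Some (t $ 1, t $ 2)) - F None))" if "t \<in> V" for t
 proof -
  have "singular_relcycle 1 (curve_top t) (YY t) (singular_chain_of (at_param c t))" using c that by (simp add: cycle_family_def)
  from relcycle_boundary[OF this] show ?thesis by blast
 qed
 define mm where "mm t = (SOME m. \<forall>F. boundary_sum F (at_param c t) = m * (F (Some (t $ 1, t $ 2)) - F None))" for t
 have mm: "boundary_sum F (at_param c t) = mm t * (F (Some (t $ 1, t $ 2)) - F None)" if "t \<in> V" for t F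
  using someI_ex[OF ex[OF that]] unfolding mm_def by blast
 have key: "boundary_move c t0 ps t = mm t * (ps (pt (P_lift t0)) (pt (P_lift t)) - ps (pt (O_lift t0)) (pt (O_lift t)))"
  if t: "t \<in> V" and Dt: "\<forall>p\<in>endpoints c. \<forall>q\<in>endpoints c. pt (p t) = pt (q t) --> pt (p t0) = pt (q t0)" for ps t
 proof -
  \<comment> \<open>Choose any end that is now at x and use its position at \<open>t0\<close>; by
    \<open>Dt\<close> the choice does not matter.\<close>
  define F where "F x = ps (pt ((SOME p. p \<in> endpoints c & pt (p t) = x) t0)) x" for x
  have F: "F (pt (p t)) = ps (pt (p t0)) (pt (p t))" if "p \<in> endpoints c" for p
  proof -
   have ex: "\<exists>q. q \<in> endpoints c & pt (q t) = pt (p t)" using that by blast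
   define q where "q = (SOME q. q \<in> endpoints c & pt (q t) = pt (p t))"
   have "q \<in> endpoints c & pt (q t) = pt (p t)" unfolding q_def by (rule someI_ex[OF ex])
   then have "pt (q t0) = pt (p t0)" using Dt that by blast
   then show ?thesis unfolding F_def q_def[symmetric] by simp
  qed
  have "boundary_move c t0 ps t = boundary_sum F (at_param c t)" unfolding boundary_move_def boundary_sum_at_param
  proof (rule arg_cong[where f = sum_list], rule map_cong[OF refl])
   fix x assume x: "x \<in> set c"
   obtain n Ga where [simp]: "x = (n, Ga)" by (cases x)
   have "(%t. Ga t 0) \<in> endpoints c" "(%t. Ga t 1) \<in> endpoints c" using x by (auto simp: endpoints_def)
   from F[OF this(1)] F[OF this(2)]
   show "(case x of (n, Ga) => of_int n * (ps (pt (Ga t0 1)) (pt (Ga t 1)) - ps (pt (Ga t0 0)) (pt (Ga t 0)))) =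
    (case x of (n, Ga) => of_int n * (F (pt (Ga t 1)) - F (pt (Ga t 0))))" by simp
  qed
  also have "\<dots> = mm t * (F (pt (P_lift t)) - F (pt (O_lift t)))" unfolding mm[OF t] pt_lift ..
  finally show ?thesis using F[of P_lift] F[of O_lift] by (simp add: endpoints_def)
 qed
 have D0: "\<forall>p\<in>endpoints c. \<forall>q\<in>endpoints c. pt (p t0) = pt (q t0) --> pt (p t0) = pt (q t0)" by blast
 have const: "mm t = mm t0"
  if t: "t \<in> V" and Dt: "\<forall>p\<in>endpoints c. \<forall>q\<in>endpoints c. pt (p t) = pt (q t) --> pt (p t0) = pt (q t0)" for t
 proof -
  \<comment> \<open>This \<open>ps\<close> ignores the current position and separates O from P at
    \<open>t0\<close>. The left side of \<open>key\<close> then does not depend on t, so neither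
    does the multiplicity.\<close>
  define ps :: "point => point => complex" where "ps q x = (if q = None then 0 else 1)" for q x
  have "boundary_move c t0 ps t = boundary_move c t0 ps t0" by (simp add: boundary_move_def ps_def)
  then show ?thesis unfolding key[OF t Dt] key[OF t0 D0] by (simp add: ps_def pt_lift)
 qed
 show thesis
 proof (rule that[of "mm t0"])
  show "eventually (%t. \<forall>F. boundary_sum F (at_param c t) = mm t0 * (F (Some (t $ 1, t $ 2)) - F None)) (nhds t0)"
   using evV D
  proof eventually_elim
   case (elim t)
   show ?case using mm[OF elim(1)] unfolding const[OF elim] by blast
  qed
  show "eventually (%t. \<forall>ps. boundary_move c t0 ps t =
    mm t0 * (ps (pt (P_lift t0)) (pt (P_lift t)) - ps (pt (O_lift t0)) (pt (O_lift t)))) (nhds t0)" using evV D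
  proof eventually_elim
   case (elim t)
   show ?case using key[OF elim] unfolding const[OF elim] by blast
  qed
 qed
qed

lemma hvd_sum_list:
 assumes "!!x. x \<in> set xs ==> (f x hvd f' x) F"
 shows "((%t. \<Sum>x\<leftarrow>xs. f x t) hvd (\<Sum>x\<leftarrow>xs. f' x)) F"
 using assms by (induction xs) (auto intro!: hvd_add)

lemma sum_list_diff_complex: "(\<Sum>x\<leftarrow>xs. f x + g x) - (\<Sum>x\<leftarrow>xs. f x) = (\<Sum>x\<leftarrow>xs. g x :: complex)"
 by (induction xs) simp_all

text \<open>\<open>boundary_identity\<close> differentiated for the local coordinates at the ends.
  The drift is a function of the position alone, so its sum is known from \<open>m1\<close> and
  cancels. O contributes nothing because the regular lift fixes it.\<close>

lemma boundary_variation: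
 assumes c: "cycle_family V c" and t0: "t0 \<in> V" and l: "lift_field t0 v al be"
  and m1: "!!F. boundary_sum F (at_param c t0) = m * (F (Some (t0 $ 1, t0 $ 2)) - F None)"
  and m: "eventually (%t. \<forall>ps. boundary_move c t0 ps t =
    m * (ps (pt (P_lift t0)) (pt (P_lift t)) - ps (pt (O_lift t0)) (pt (O_lift t)))) (nhds t0)"
 shows "(\<Sum>(n, Ga)\<leftarrow>c. of_int n * (G (pt (Ga t0 1)) * vert_of t0 e al be (%ep. Ga (t0 + ep *\<^sub>R v) 1)
    - G (pt (Ga t0 0)) * vert_of t0 e al be (%ep. Ga (t0 + ep *\<^sub>R v) 0))) =
   m * (G (Some (t0 $ 1, t0 $ 2)) * vert_of t0 e al be (%ep. P_lift (t0 + ep *\<^sub>R v)))"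
proof -
 have V: "open V" "V <= TT" using c by (rule cycle_family_open)+
 have t0T: "t0 \<in> TT" using V t0 by blast
 define T where "T = coord_drift t0 e al be G"
 define bb where "bb p = vert_of t0 e al be (%ep. p (t0 + ep *\<^sub>R v))" for p :: "param => complex ^ 3"
 define ps where "ps = local_coord t0 G"
 have der: "((%ep. ps (pt (p t0)) (pt (p (t0 + ep *\<^sub>R v)))) hvd T (pt (p t0)) + G (pt (p t0)) * bb p) (at 0)"
  if p: "p \<in> endpoints c" for p
 proof -
  obtain d where d: "((%ep::real. p (t0 + ep *\<^sub>R v)) hvd d) (at 0)" using endpoints_props(3)[OF c t0 p] by blast
  have ec: "eventually (%ep. on_cone (t0 + ep *\<^sub>R v) (p (t0 + ep *\<^sub>R v))) (nhds 0)"
   using eventually_line[OF V(1) t0] by (rule eventually_mono) (rule endpoints_props(2)[OF c t0 p])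
  have "vert t0 e al be (p (t0 + 0 *\<^sub>R v)) d (bb p)" unfolding bb_def by (rule vert_of[OF t0T l d ec])
  from local_coord_derivative[OF t0T d ec this, of G] show ?thesis by (simp add: T_def ps_def)
 qed
 define f where "f x ep = of_int (fst x) * (ps (pt (snd x t0 1)) (pt (snd x (t0 + ep *\<^sub>R v) 1)) - ps (pt (snd x t0 0)) (pt (snd x (t0 + ep *\<^sub>R v) 0)))"
  for x :: "int \<times> (param => real => complex ^ 3)" and ep :: real
 define f1 where "f1 x = of_int (fst x) * (T (pt (snd x t0 1)) - T (pt (snd x t0 0)))" for x :: "int \<times> (param => real => complex ^ 3)"
 define f2 where "f2 x = of_int (fst x) * (G (pt (snd x t0 1)) * bb (%t. snd x t 1) - G (pt (snd x t0 0)) * bb (%t. snd x t 0))"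
  for x :: "int \<times> (param => real => complex ^ 3)"
 have f': "(f x hvd f1 x + f2 x) (at 0)" if x: "x \<in> set c" for x
 proof -
  have e: "(%t. snd x t 0) \<in> endpoints c" "(%t. snd x t 1) \<in> endpoints c"
   using x by (auto simp: endpoints_def case_prod_unfold)
  show ?thesis unfolding f_def by (rule hvd_eq_rhs[OF hvd_mult_right[OF hvd_diff[OF der[OF e(2)] der[OF e(1)]]]])
    (simp add: f1_def f2_def algebra_simps)
 qed
 have lhs: "((%ep. \<Sum>x\<leftarrow>c. f x ep) hvd (\<Sum>x\<leftarrow>c. f1 x + f2 x)) (at 0)" by (rule hvd_sum_list) (rule f')
 have PO: "P_lift \<in> endpoints c" "O_lift \<in> endpoints c" by (auto simp: endpoints_def)
 have rhs: "((%ep. m * (ps (pt (P_lift t0)) (pt (P_lift (t0 + ep *\<^sub>R v))) - ps (pt (O_lift t0)) (pt (O_lift (t0 + ep *\<^sub>R v)))))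
   hvd m * ((T (pt (P_lift t0)) + G (pt (P_lift t0)) * bb P_lift) - (T (pt (O_lift t0)) + G (pt (O_lift t0)) * bb O_lift))) (at 0)"
  by (intro hvd_mult_right hvd_diff der PO)
 have "eventually (%ep::real. (\<Sum>x\<leftarrow>c. f x ep) =
   m * (ps (pt (P_lift t0)) (pt (P_lift (t0 + ep *\<^sub>R v))) - ps (pt (O_lift t0)) (pt (O_lift (t0 + ep *\<^sub>R v))))) (nhds 0)"
 proof -
  have "filterlim (%ep::real. t0 + ep *\<^sub>R v) (nhds t0) (nhds 0)" unfolding filterlim_iff eventually_nhds[of _ t0]
   using eventually_line by (blast intro: eventually_mono)
  from eventually_compose_filterlim[OF m this] show ?thesis
   by (rule eventually_mono) (simp add: f_def boundary_move_def case_prod_unfold)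
 qed
 then have ev: "eventually (%ep::real. (\<Sum>x\<leftarrow>c. f x ep) =
   m * (ps (pt (P_lift t0)) (pt (P_lift (t0 + ep *\<^sub>R v))) - ps (pt (O_lift t0)) (pt (O_lift (t0 + ep *\<^sub>R v))))) (at 0)"
  "(\<Sum>x\<leftarrow>c. f x 0) = m * (ps (pt (P_lift t0)) (pt (P_lift (t0 + 0 *\<^sub>R v))) - ps (pt (O_lift t0)) (pt (O_lift (t0 + 0 *\<^sub>R v))))"
  by (auto simp: eventually_nhds_conv_at)
 have "((%ep. m * (ps (pt (P_lift t0)) (pt (P_lift (t0 + ep *\<^sub>R v))) - ps (pt (O_lift t0)) (pt (O_lift (t0 + ep *\<^sub>R v)))))
   hvd (\<Sum>x\<leftarrow>c. f1 x + f2 x)) (at 0)" using lhs unfolding hvd_def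
  by (rule has_derivative_transform_eventually[OF _ ev(1)]) (use ev(2) in simp_all)
 then have "(\<Sum>x\<leftarrow>c. f1 x + f2 x) =
   m * ((T (pt (P_lift t0)) + G (pt (P_lift t0)) * bb P_lift) - (T (pt (O_lift t0)) + G (pt (O_lift t0)) * bb O_lift))"
  by (rule vector_derivative_unique_at[OF _ rhs])
 moreover have "(\<Sum>x\<leftarrow>c. f1 x) = m * (T (Some (t0 $ 1, t0 $ 2)) - T None)"
  using m1[of T] unfolding boundary_sum_at_param by (simp add: f1_def case_prod_unfold)
 moreover have "bb O_lift = 0"
 proof -
  have "((%ep::real. O_lift (t0 + ep *\<^sub>R v)) hvd 0) (at 0)" unfolding O_lift_def by (rule hvd_const)
  from vert_of[OF t0T l this, of e] have "vert t0 e al be (O_lift t0) 0 (bb O_lift)" using lift_cone(2) by (simp add: bb_def)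
  then show ?thesis by (simp add: vert_def O_lift_def)
 qed
 ultimately have eq: "(\<Sum>x\<leftarrow>c. f1 x + f2 x) = m * ((T (Some (t0 $ 1, t0 $ 2)) + G (Some (t0 $ 1, t0 $ 2)) * bb P_lift) - T None)"
  "(\<Sum>x\<leftarrow>c. f1 x) = m * (T (Some (t0 $ 1, t0 $ 2)) - T None)" by (simp_all add: pt_lift)
 have "(\<Sum>x\<leftarrow>c. f2 x) = (\<Sum>x\<leftarrow>c. f1 x + f2 x) - (\<Sum>x\<leftarrow>c. f1 x)" by (simp only: sum_list_diff_complex)
 also have "\<dots> = m * (G (Some (t0 $ 1, t0 $ 2)) * bb P_lift)" unfolding eq by (simp add: algebra_simps)
 finally have "(\<Sum>x\<leftarrow>c. f2 x) = m * (G (Some (t0 $ 1, t0 $ 2)) * bb P_lift)" .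
 then show ?thesis by (simp add: f2_def bb_def case_prod_unfold)
qed

section \<open>The Gauss-Manin system of the periods\<close>

text \<open>Cramer's rule for the two equations of \<open>lift_field\<close>, whose determinant is
  -4/3 times \<open>Disc\<close>; likewise in \<open>beta_of\<close>.\<close>

definition alpha_of :: "param => param => complex" where
 "alpha_of t v = - (3 / 4) * ((6 * t3 t * v $ 5 - 4 * t $ 5 * dt3 t v) / Disc t)"

definition beta_of :: "param => param => complex" where
 "beta_of t v = - (3 / 4) * ((1 / 3 * (t $ 5)^2 * v $ 5 - 6 * t3 t * dt3 t v) / Disc t)"

text \<open>The coefficients come from the Bezout identity for the cubic and its derivative.\<close>

definition mu_of :: "param => param => complex" where
 "mu_of t v = ((18 * t $ 5 * t $ 1 - 27 * t3 t) * t $ 2 * (v $ 1 - xi0 t (alpha_of t v) (beta_of t v) (t $ 1))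
   + (- 6 * t $ 5 * (t $ 1)^2 + 9 * t3 t * t $ 1 + (t $ 5)^2) * (2 * (v $ 2 - psi0 (alpha_of t v) (beta_of t v) (t $ 1) (t $ 2)))) / Disc t"

lemma bezout_cubic:
 "(18 * t $ 5 * x - 27 * t3 t) * cubic t x + (- 6 * t $ 5 * x^2 + 9 * t3 t * x + (t $ 5)^2) * dcubic t x = Disc t"
 by (simp add: cubic_def dcubic_def Disc_def algebra_simps pow_eqs)

lemma lift_field_of:
 assumes "t \<in> TT"
 shows "lift_field t v (alpha_of t v) (beta_of t v)"
proof -
 have D: "Disc t ~= 0" using assms by (simp add: TT_def)
 have "Disc t * (- 6 * t3 t * alpha_of t v + 4 * t $ 5 * beta_of t v) = Disc t * v $ 5"
  "Disc t * (- ((t $ 5)^2 / 3) * alpha_of t v + 6 * t3 t * beta_of t v) = Disc t * dt3 t v"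
 proof -
  have a: "Disc t * alpha_of t v = - (3 / 4) * (6 * t3 t * v $ 5 - 4 * t $ 5 * dt3 t v)"
   and b: "Disc t * beta_of t v = - (3 / 4) * (1 / 3 * (t $ 5)^2 * v $ 5 - 6 * t3 t * dt3 t v)"
   using D by (simp_all add: alpha_of_def beta_of_def)
  have "Disc t * (- 6 * t3 t * alpha_of t v + 4 * t $ 5 * beta_of t v) = - 6 * t3 t * (Disc t * alpha_of t v) + 4 * t $ 5 * (Disc t * beta_of t v)"
   by (simp add: algebra_simps)
  also have "\<dots> = Disc t * v $ 5" unfolding a b by (simp add: Disc_def field_simps pow_eqs)
  finally show "Disc t * (- 6 * t3 t * alpha_of t v + 4 * t $ 5 * beta_of t v) = Disc t * v $ 5" .
  have "Disc t * (- ((t $ 5)^2 / 3) * alpha_of t v + 6 * t3 t * beta_of t v) = - ((t $ 5)^2 / 3) * (Disc t * alpha_of t v) + 6 * t3 t * (Disc t * beta_of t v)"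
   by (simp add: algebra_simps)
  also have "\<dots> = Disc t * dt3 t v" unfolding a b by (simp add: Disc_def field_simps pow_eqs)
  finally show "Disc t * (- ((t $ 5)^2 / 3) * alpha_of t v + 6 * t3 t * beta_of t v) = Disc t * dt3 t v" .
 qed
 then show ?thesis using D by (simp add: lift_field_def)
qed

lemma lift_field_unique:
 assumes t: "t \<in> TT" and l: "lift_field t v al be"
 shows "alpha_of t v = al" "beta_of t v = be"
proof -
 have D: "Disc t ~= 0" using t by (simp add: TT_def)
 have v: "v $ 5 = - 6 * t3 t * al + 4 * t $ 5 * be" "dt3 t v = - ((t $ 5)^2 / 3) * al + 6 * t3 t * be"
  using l by (simp_all add: lift_field_def)
 have "6 * t3 t * v $ 5 - 4 * t $ 5 * dt3 t v = - (4 / 3) * Disc t * al"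
  "1 / 3 * (t $ 5)^2 * v $ 5 - 6 * t3 t * dt3 t v = - (4 / 3) * Disc t * be"
  unfolding v by (simp_all add: Disc_def field_simps pow_eqs)
 then show "alpha_of t v = al" "beta_of t v = be" using D by (simp_all add: alpha_of_def beta_of_def)
qed

text \<open>Neither b nor f'(a) may be divided by, since each can vanish. The two equations are
  compatible, b q = f'(a) p, so the Bezout combination solves both with \<open>Disc\<close> as
  denominator.\<close>

lemma mu_of:
 assumes t: "t \<in> TT"
 shows "v $ 1 = xi0 t (alpha_of t v) (beta_of t v) (t $ 1) + t $ 2 * mu_of t v"
  and "2 * (v $ 2 - psi0 (alpha_of t v) (beta_of t v) (t $ 1) (t $ 2)) = dcubic t (t $ 1) * mu_of t v"
proof -
 have D: "Disc t ~= 0" using t by (simp add: TT_def)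
 define a b where "a = t $ 1" and "b = t $ 2"
 define p where "p = v $ 1 - xi0 t (alpha_of t v) (beta_of t v) a"
 define q where "q = 2 * (v $ 2 - psi0 (alpha_of t v) (beta_of t v) a b)"
 define A B where "A = 18 * t $ 5 * a - 27 * t3 t" and "B = - 6 * t $ 5 * a^2 + 9 * t3 t * a + (t $ 5)^2"
 have cc: "b^2 = cubic t a" using point_on_curve[of t] by (simp add: a_def b_def)
 have bz: "A * b^2 + B * dcubic t a = Disc t" unfolding A_def B_def cc by (rule bezout_cubic)
 have e1: "2 * b * v $ 2 = dcubic t a * v $ 1 - v $ 5 * a - dt3 t v" by (simp add: dt3_def dcubic_def a_def b_def algebra_simps)
 note e2 = lift_tangent[OF lift_field_of[OF t, of v] cc]
 have "b * q = 2 * b * v $ 2 - 2 * b * psi0 (alpha_of t v) (beta_of t v) a b" by (simp add: q_def algebra_simps)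
 then have bq: "b * q = dcubic t a * p" unfolding e1 e2 by (simp add: p_def algebra_simps)
 have mu: "mu_of t v = (A * b * p + B * q) / Disc t" by (simp add: mu_of_def A_def B_def p_def q_def a_def b_def)
 have "b * (A * b * p + B * q) = A * b^2 * p + B * (b * q)" by (simp add: algebra_simps power2_eq_square)
 also have "\<dots> = (A * b^2 + B * dcubic t a) * p" unfolding bq by (simp add: algebra_simps)
 finally have "b * mu_of t v = p" unfolding mu bz using D by simp
 then show "v $ 1 = xi0 t (alpha_of t v) (beta_of t v) (t $ 1) + t $ 2 * mu_of t v" by (simp add: p_def a_def b_def algebra_simps)
 have "dcubic t a * (A * b * p + B * q) = A * b * (dcubic t a * p) + B * dcubic t a * q" by (simp add: algebra_simps)
 also have "\<dots> = (A * b^2 + B * dcubic t a) * q" unfolding bq[symmetric] by (simp add: algebra_simps power2_eq_square)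
 finally have "dcubic t a * mu_of t v = q" unfolding mu bz using D by simp
 then show "2 * (v $ 2 - psi0 (alpha_of t v) (beta_of t v) (t $ 1) (t $ 2)) = dcubic t (t $ 1) * mu_of t v"
  by (simp add: q_def a_def b_def)
qed

lemma mu_unique:
 assumes t: "t \<in> TT" and v: "v $ 1 = xi0 t (alpha_of t v) (beta_of t v) (t $ 1) + t $ 2 * my"
  "2 * (v $ 2 - psi0 (alpha_of t v) (beta_of t v) (t $ 1) (t $ 2)) = dcubic t (t $ 1) * my"
 shows "mu_of t v = my"
proof -
 have "t $ 2 * mu_of t v = t $ 2 * my" using trans[OF mu_of(1)[OF t, of v, symmetric] v(1)] by (rule add_left_imp_eq)
 moreover have "dcubic t (t $ 1) * mu_of t v = dcubic t (t $ 1) * my" by (rule trans[OF mu_of(2)[OF t, of v, symmetric] v(2)])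
 moreover have "t $ 2 ~= 0 \<or> dcubic t (t $ 1) ~= 0" using point_on_curve[of t] dcubic_nonzero[OF t] by fastforce
 ultimately show ?thesis by auto
qed

text \<open>Row \<open>i\<close> gives \<open>\<nabla>\<^sub>v \<alpha>\<^sub>i\<close> in the frame.\<close>

definition conn :: "param => param => complex ^ 3 ^ 3" where
 "conn t v = (let al = alpha_of t v; be = beta_of t v; my = mu_of t v in
   vector [vector [0, 0, 0],
       vector [al * t $ 3 - my, al * t $ 4 - be, - al],
       vector [v $ 3 - be * t $ 3 - (t $ 1 + t $ 4) * my + 1 / 2 * al * t $ 2 + al * t $ 3 * t $ 4,
           v $ 4 + 1 / 12 * al * t $ 5 + al * (t $ 4)^2 - 2 * be * t $ 4, be - al * t $ 4]])"

lemma conn_entries: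
 "conn t v $ 1 $ j = 0"
 "conn t v $ 2 $ 1 = alpha_of t v * t $ 3 - mu_of t v" "conn t v $ 2 $ 2 = alpha_of t v * t $ 4 - beta_of t v"
 "conn t v $ 2 $ 3 = - alpha_of t v"
 "conn t v $ 3 $ 1 = v $ 3 - beta_of t v * t $ 3 - (t $ 1 + t $ 4) * mu_of t v + 1 / 2 * alpha_of t v * t $ 2 + alpha_of t v * t $ 3 * t $ 4"
 "conn t v $ 3 $ 2 = v $ 4 + 1 / 12 * alpha_of t v * t $ 5 + alpha_of t v * (t $ 4)^2 - 2 * beta_of t v * t $ 4"
 "conn t v $ 3 $ 3 = beta_of t v - alpha_of t v * t $ 4" using exhaust_3[of j] by (auto simp: conn_def Let_def)

text \<open>The vertical velocity of P relative to the polynomial lift is \<open>my\<close>; the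
  subtracted term is the correction that makes the lift regular at O. Uniqueness holds as b and
  f'(a) do not vanish together.\<close>

lemma vert_P:
 assumes t: "t0 \<in> TT" and l: "lift_field t0 v al be"
  and my: "v $ 1 = xi0 t0 al be (t0 $ 1) + t0 $ 2 * my" "2 * (v $ 2 - psi0 al be (t0 $ 1) (t0 $ 2)) = dcubic t0 (t0 $ 1) * my"
 shows "vert_of t0 e al be (%ep. P_lift (t0 + ep *\<^sub>R v)) = my - al * (t0 $ 2 / (2 * (t0 $ 1 - e)))"
proof -
 define b where "b = vert_of t0 e al be (%ep. P_lift (t0 + ep *\<^sub>R v)) + al * (t0 $ 2 / (2 * (t0 $ 1 - e))) - my"
 have "vert t0 e al be (P_lift t0) (vector [v $ 1, v $ 2, 0]) (vert_of t0 e al be (%ep. P_lift (t0 + ep *\<^sub>R v)))"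
  using vert_of[OF t l P_lift_derivative[of t0 v], of e] lift_cone(1) by simp
 then have "v $ 1 = xi0 t0 al be (t0 $ 1) + (b + my) * t0 $ 2"
  "2 * (v $ 2 - psi0 al be (t0 $ 1) (t0 $ 2)) = (b + my) * dcubic t0 (t0 $ 1)"
  unfolding vert_def by (simp_all add: P_lift_def b_def)
 then have "b * t0 $ 2 = 0" "b * dcubic t0 (t0 $ 1) = 0" using my by (simp_all add: algebra_simps)
 moreover have "t0 $ 2 ~= 0 \<or> dcubic t0 (t0 $ 1) ~= 0" using point_on_curve[of t0] dcubic_nonzero[OF t] by fastforce
 ultimately have "b = 0" by auto
 then show ?thesis by (simp add: b_def algebra_simps)
qed

text \<open>The contribution of P to the derivative of the third period. The last bracket is the
  derivative of b/(2(a-e)), coming from \<open>kap\<close>; with it all dependence on e cancels, in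
  accordance with \<open>rep_independent\<close>.\<close>

lemma P_identity:
 fixes t :: param
 defines "a \<equiv> t $ 1" and "b \<equiv> t $ 2"
 assumes e: "t $ 1 ~= e" and v1: "v1 = xi0 t al be a + b * my" and v2: "2 * (v2 - psi0 al be a b) = dcubic t a * my"
 defines "i \<equiv> 1 / (t $ 1 - e)"
 shows "hfun e t (Some (t $ 1, t $ 2)) * (my - al * (b * i / 2)) + phifun e t al be (Some (t $ 1, t $ 2)) - be * b * i / 2
   + (v2 * i / 2 - b * v1 * i^2 / 2) = a * my - al * b / 2"
proof -
 define d where "d = a - e"
 have ad: "a = e + d" and d0: "d ~= 0" using e by (simp_all add: d_def a_def)
 have i: "i = 1 / d" by (simp add: i_def d_def a_def)
 define N K where "N = 2 * e * a^2 + (2 * e^2 - t $ 5 / 2) * a - (e * t $ 5 / 2 + t3 t)"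
  and "K = (2 * e^2 + t $ 5 / 6) * a + (2 * e^3 - 7 / 6 * e * t $ 5 - t3 t)"
 define h where "h = hfun e t (Some (a, b))"
 have h1: "h = N * i^2 / 2" unfolding h_def hfun_def N_def i d_def by (simp add: power_divide)
 have cc: "b^2 = cubic t a" using point_on_curve[of t] by (simp add: a_def b_def)
 have h2: "h + dcubic t a * i / 4 - b^2 * i^2 / 2 = a"
  using hfun_eq[OF cc, of e] e unfolding h_def i d_def by (simp add: a_def power_divide)
 have ph: "phifun e t al be (Some (a, b)) = b * (al * K * i^3 / 4 + be * e * i^2)"
  unfolding phifun_def K_def i d_def by (simp add: power_divide mult_ac)
 have v2': "v2 = psi0 al be a b + dcubic t a * my / 2" using v2 by (simp add: field_simps)
 have KN: "K - N = d * (- 2 * e * (a + e) + 2 * t $ 5 / 3)" unfolding K_def N_def ad by (simp add: field_simps eval_nat_numeral)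
 have A: "(K - N) * i^3 / 4 - 3 * a * i / 2 + (2 * a^2 - t $ 5 / 3) * i^2 / 2 = - 1 / 2"
  unfolding KN i using d0 by (simp add: divide_simps) (simp add: ad algebra_simps eval_nat_numeral)
 have B: "e * i^2 + i - a * i^2 = 0"
  unfolding i ad using d0 by (simp add: divide_simps) (simp add: algebra_simps eval_nat_numeral)
 have "h * (my - al * (b * i / 2)) + phifun e t al be (Some (a, b)) - be * b * i / 2 + (v2 * i / 2 - b * v1 * i^2 / 2)
  = (h + dcubic t a * i / 4 - b^2 * i^2 / 2) * my
   + al * b * (K * i^3 / 4 - h * i / 2 - 3 * a * i / 2 + (2 * a^2 - t $ 5 / 3) * i^2 / 2)
   + be * b * (e * i^2 + i - a * i^2)" unfolding ph v1 v2' xi0_def psi0_def by (simp add: field_simps eval_nat_numeral)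
 also have "K * i^3 / 4 - h * i / 2 - 3 * a * i / 2 + (2 * a^2 - t $ 5 / 3) * i^2 / 2 =
   (K - N) * i^3 / 4 - 3 * a * i / 2 + (2 * a^2 - t $ 5 / 3) * i^2 / 2" unfolding h1 by (simp add: field_simps eval_nat_numeral)
 also have "(h + dcubic t a * i / 4 - b^2 * i^2 / 2) * my + al * b * ((K - N) * i^3 / 4 - 3 * a * i / 2 + (2 * a^2 - t $ 5 / 3) * i^2 / 2)
   + be * b * (e * i^2 + i - a * i^2) = a * my - al * b / 2" unfolding h2 A B by simp
 finally show ?thesis unfolding h_def a_def b_def .
qed

section \<open>Periods of the frame and their derivatives\<close>

lemma has_derivative_sum_list:
 assumes "!!x. x \<in> set xs ==> (f x has_derivative f' x) F"
 shows "((%t. \<Sum>x\<leftarrow>xs. f x t) has_derivative (%v. \<Sum>x\<leftarrow>xs. f' x v)) F"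
 using assms by (induction xs) (auto intro!: has_derivative_add)

text \<open>The first frame form is the differential of a function that is 0 at P and 1 at O, whence
  the period -m.\<close>

lemma period_cls:
 assumes t: "t \<in> TT" and e: "t $ 1 ~= e" and c: "rel_chain t c"
  and U: "!!n ga s. (n, ga) \<in> set c ==> s \<in> {0..1} ==> pt (ga s) \<in> U_frame e t"
  and m: "!!F. boundary_sum F c = m * (F (Some (t $ 1, t $ 2)) - F None)"
 shows "period t c (cls t z) = z $ 1 * (- m) + z $ 2 * chain_integral t (%_. 1) c +
   z $ 3 * (- m * kap e t + t $ 4 * chain_integral t (%_. 1) c + chain_integral t (hfun e t) c)"
proof -
 have C1: "!!n ga. (n, ga) \<in> set c ==> C1_path t ga" using c by (auto simp: rel_chain_def)
 obtain F where F: "!!p. p \<in> U_frame e t ==> F p = ffun e t p"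
  "!!T ga s v. path_at t T ga s v ==> pt (ga s) \<in> U_frame e t ==>
    ((%s. F (pt (ga s))) hvd gfun e t (pt (ga s)) * inv_diff t (ga s) v) (at s within T)"
  using path_primitive[OF t _ order_refl U_frame_subset regular_gfun regular_ffun is_differential_ffun, of e thesis]
   affine_open_U_frame[of t e] by (auto simp: affine_open_def)
 have "chain_integral t (gfun e t) c = boundary_sum F c"
  by (rule chain_integral_exact[where U = "U_frame e t"]; blast intro: F(2) C1 U)
 also have "\<dots> = - m" using m[of F] F(1)[of "Some (t $ 1, t $ 2)"] F(1)[of None] e point_on_curve[of t]
  by (simp add: Some_in_U_frame None_in_U_frame ffun_def)
 finally have G: "chain_integral t (gfun e t) c = - m" .
 have r1: "regular_on (U_frame e t) (%p. z $ 3 * hfun e t p + (z $ 2 + z $ 3 * t $ 4) * 1)"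
  by (intro regular_on_add regular_on_cmult regular_hfun regular_on_const)
 have "period t c (cls t z) = chain_integral t (rep e t z) c"
  unfolding cls_eq[OF t not_sym[OF e]] by (rule period_dR_class[OF t c forms_rep[OF t not_sym[OF e]]]) (blast intro: U)
 also have "rep e t z = (%p. (z $ 1 + z $ 3 * kap e t) * gfun e t p + 1 * (z $ 3 * hfun e t p + (z $ 2 + z $ 3 * t $ 4) * 1))"
  by (auto simp: rep_def fun_eq_iff algebra_simps)
 also have "chain_integral t \<dots> c = (z $ 1 + z $ 3 * kap e t) * chain_integral t (gfun e t) c +
   1 * chain_integral t (%p. z $ 3 * hfun e t p + (z $ 2 + z $ 3 * t $ 4) * 1) c"
  by (rule chain_integral_lincomb[OF t regular_gfun r1]; blast intro: C1 U)
 also have "chain_integral t (%p. z $ 3 * hfun e t p + (z $ 2 + z $ 3 * t $ 4) * 1) c =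
   z $ 3 * chain_integral t (hfun e t) c + (z $ 2 + z $ 3 * t $ 4) * chain_integral t (%_. 1) c"
  by (rule chain_integral_lincomb[OF t regular_hfun regular_on_const]; blast intro: C1 U)
 finally show ?thesis unfolding G by (simp add: algebra_simps)
qed

lemma list_sum_lincomb:
 "(\<Sum>(n, Ga)\<leftarrow>c. of_int n * (A Ga + k * B Ga + k' * C Ga)) =
   (\<Sum>(n, Ga)\<leftarrow>c. of_int n * A Ga) + k * (\<Sum>(n, Ga)\<leftarrow>c. of_int n * B Ga) + k' * (\<Sum>(n, Ga)\<leftarrow>c. of_int n * C Ga :: complex)"
 by (induction c) (auto simp: algebra_simps)

lemma kap_derivative:
 fixes t0 :: param
 assumes "t0 $ 1 ~= e"
 defines "i \<equiv> 1 / (t0 $ 1 - e)"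
 shows "(kap e has_derivative (%v. v $ 3 - (v $ 2 * i / 2 - t0 $ 2 * v $ 1 * i^2 / 2))) (at t0)"
proof -
 define d where "d = t0 $ 1 - e"
 have d: "d ~= 0" using assms(1) by (simp add: d_def)
 have "((%t. t $ 3 - t $ 2 / (2 * (t $ 1 - e))) has_derivative
   (%v. v $ 3 - (- (t0 $ 2) * (inverse (2 * (t0 $ 1 - e)) * (2 * (v $ 1 - 0)) * inverse (2 * (t0 $ 1 - e))) + v $ 2 / (2 * (t0 $ 1 - e))))) (at t0)"
  by (intro has_derivative_diff has_derivative_divide has_derivative_mult_right has_derivative_const has_derivative_vec_nth
    has_derivative_ident) (use assms in simp)
 moreover have "v $ 3 - (- (t0 $ 2) * (inverse (2 * d) * (2 * (v $ 1 - 0)) * inverse (2 * d)) + v $ 2 / (2 * d))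
   = v $ 3 - (v $ 2 * i / 2 - t0 $ 2 * v $ 1 * i^2 / 2)" for v :: param
  using d unfolding i_def d_def[symmetric] by (simp add: field_simps power2_eq_square)
 ultimately show ?thesis unfolding kap_def[abs_def] d_def by (simp only:)
qed

text \<open>\<open>pi1\<close> is -m and hence locally constant, which is the zero first row of
  \<open>conn\<close>. The pole is chosen for the cycle at \<open>t0\<close> and stays off the
  cycles at nearby parameters.\<close>

lemma period_variation:
 assumes c: "cycle_family V c" and t0: "t0 \<in> V"
 obtains pi1 pi2 pi3 D2 D3 where
  "eventually (%t. t \<in> V & (\<forall>z. period t (at_param c t) (cls t z) = z $ 1 * pi1 + z $ 2 * pi2 t + z $ 3 * pi3 t)) (nhds t0)"
  "(pi2 has_derivative D2) (at t0)" "(pi3 has_derivative D3) (at t0)"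
  "!!v. D2 v = conn t0 v $ 2 $ 1 * pi1 + conn t0 v $ 2 $ 2 * pi2 t0 + conn t0 v $ 2 $ 3 * pi3 t0"
  "!!v. D3 v = conn t0 v $ 3 $ 1 * pi1 + conn t0 v $ 3 $ 2 * pi2 t0 + conn t0 v $ 3 $ 3 * pi3 t0"
proof -
 have V: "open V" "V <= TT" using c by (rule cycle_family_open)+
 have t0T: "t0 \<in> TT" using V t0 by blast
 have C1p: "C1_path t0 ga" if "ga \<in> (%x. snd x t0) ` set c" for ga
  using that C1_family_path[OF cycle_family_C1[OF c] t0] by auto
 obtain e where e: "e ~= t0 $ 1" and "!!ga s. ga \<in> (%x. snd x t0) ` set c ==> s \<in> {0..1} ==> pt (ga s) \<in> U_frame e t0"
  using ex_frame_avoiding[OF finite_imageI[OF finite_set] C1p] by blast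
 then have U: "pt (Ga t0 s) \<in> U_frame e t0" if "(n, Ga) \<in> set c" "s \<in> {0..1}" for n Ga s using that by force
 obtain m where m: "eventually (%t. \<forall>F. boundary_sum F (at_param c t) = m * (F (Some (t $ 1, t $ 2)) - F None)) (nhds t0)"
  and m': "eventually (%t. \<forall>ps. boundary_move c t0 ps t =
    m * (ps (pt (P_lift t0)) (pt (P_lift t)) - ps (pt (O_lift t0)) (pt (O_lift t)))) (nhds t0)"
  by (rule boundary_identity[OF c t0])
 have m0: "!!F. boundary_sum F (at_param c t0) = m * (F (Some (t0 $ 1, t0 $ 2)) - F None)"
  using eventually_nhds_x_imp_x[OF m] by blast
 have evU: "eventually (%t. \<forall>x\<in>set c. \<forall>s\<in>{0..1}. pt (snd x t s) \<in> U_frame e t) (nhds t0)"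
 proof (rule eventually_ball_finite[OF finite_set], rule ballI)
  fix x assume x: "x \<in> set c"
  obtain n Ga where [simp]: "x = (n, Ga)" by (cases x)
  have x': "(n, Ga) \<in> set c" using x by simp
  have "\<exists>V'. open V' & t0 \<in> V' & V' <= V & (\<forall>t\<in>V'. \<forall>s\<in>{0..1}. pt (Ga t s) \<in> U_frame e t)"
   by (rule ex_frame_near[OF cycle_family_C1[OF c x'] t0 U[OF x']])
  then show "eventually (%t. \<forall>s\<in>{0..1}. pt (snd x t s) \<in> U_frame e t) (nhds t0)" unfolding eventually_nhds by auto
 qed
 have eve: "eventually (%t. t \<in> V \<inter> {t. t $ 1 ~= e}) (nhds t0)"
 proof (rule eventually_nhds_in_open)
  have "open {t::param. t $ 1 ~= e}" by (intro open_Collect_neq continuous_intros)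
  then show "open (V \<inter> {t. t $ 1 ~= e})" using V(1) by (rule open_Int[rotated])
 qed (use t0 e in auto)
 define P2 where "P2 t = chain_integral t (%_. 1) (at_param c t)" for t
 define Ph where "Ph t = chain_integral t (hfun e t) (at_param c t)" for t
 define pi3 where "pi3 t = - m * kap e t + t $ 4 * P2 t + Ph t" for t
 have per: "eventually (%t. t \<in> V & (\<forall>z. period t (at_param c t) (cls t z) = z $ 1 * (- m) + z $ 2 * P2 t + z $ 3 * pi3 t)) (nhds t0)"
  using m evU eve
 proof eventually_elim
  case (elim t)
  have t: "t \<in> TT" "t \<in> V" "t $ 1 ~= e" using elim(3) V by auto
  have "period t (at_param c t) (cls t z) = z $ 1 * (- m) + z $ 2 * P2 t + z $ 3 * pi3 t" for z unfolding P2_def pi3_def Ph_def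
  proof (rule period_cls[OF t(1,3) cycle_family_rel_chain[OF c t(2)]])
   show "pt (ga s) \<in> U_frame e t" if "(n, ga) \<in> set (at_param c t)" "s \<in> {0..1}" for n ga s
    using that elim(2) by (force simp: at_param_def)
   show "!!F. boundary_sum F (at_param c t) = m * (F (Some (t $ 1, t $ 2)) - F None)" using elim(1) by blast
  qed
  then show ?case using t by blast
 qed
 have "\<exists>D. path_rates e t0 (snd x) (fst D) (snd D)" if "x \<in> set c" for x
 proof -
  obtain n Ga where x: "x = (n, Ga)" by (cases x)
  with that have "(n, Ga) \<in> set c" by simp
  from path_variation[OF cycle_family_C1[OF c this] t0 U[OF this]] show ?thesis unfolding x by auto
 qed
 then obtain D where D: "!!x. x \<in> set c ==> path_rates e t0 (snd x) (fst (D x)) (snd (D x))" by metis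
 define D2 where "D2 v = (\<Sum>x\<leftarrow>c. of_int (fst x) * fst (D x) v)" for v
 define Dh where "Dh v = (\<Sum>x\<leftarrow>c. of_int (fst x) * snd (D x) v)" for v
 have P2': "(P2 has_derivative D2) (at t0)" unfolding P2_def chain_integral_at_param D2_def case_prod_unfold
  by (rule has_derivative_sum_list) (use D in "auto simp: path_rates_def intro!: has_derivative_mult_right")
 have Ph': "(Ph has_derivative Dh) (at t0)" unfolding Ph_def chain_integral_at_param Dh_def case_prod_unfold
  by (rule has_derivative_sum_list) (use D in "auto simp: path_rates_def intro!: has_derivative_mult_right")
 define i where "i = 1 / (t0 $ 1 - e)"
 define D3 where "D3 v = - m * (v $ 3 - (v $ 2 * i / 2 - t0 $ 2 * v $ 1 * i^2 / 2)) + (t0 $ 4 * D2 v + v $ 4 * P2 t0) + Dh v" for v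
 have p3': "(pi3 has_derivative D3) (at t0)" unfolding pi3_def[abs_def] D3_def[abs_def] i_def
  by (intro has_derivative_add has_derivative_mult_right has_derivative_mult kap_derivative P2' Ph' not_sym[OF e]
    has_derivative_vec_nth has_derivative_ident)
 show thesis
 proof (rule that[OF per P2' p3'])
  fix v
  define al be my where "al = alpha_of t0 v" and "be = beta_of t0 v" and "my = mu_of t0 v"
  note l = lift_field_of[OF t0T, of v, folded al_def be_def] and my = mu_of[OF t0T, of v, folded al_def be_def my_def]
  note conn = conn_entries[of t0 v, folded al_def be_def my_def]
  define bb where "bb Ga s = vert_of t0 e al be (%ep. Ga (t0 + ep *\<^sub>R v) s)" for Ga :: "param => real => complex ^ 3" and s :: real
  have bP: "vert_of t0 e al be (%ep. P_lift (t0 + ep *\<^sub>R v)) = my - al * (t0 $ 2 * i / 2)"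
   unfolding vert_P[OF t0T l my] i_def by simp
  \<comment> \<open>In total the ends contribute as m times P alone would.\<close>
  note bv = boundary_variation[OF c t0 l m0 m', of _ e, folded bb_def, unfolded bP]
  have "D2 v = (\<Sum>(n, Ga)\<leftarrow>c. of_int n * ((1 * bb Ga 1 - 1 * bb Ga 0) + (- al) * path_integral t0 (hfun e t0) (Ga t0)
    + (- be) * path_integral t0 (%_. 1) (Ga t0)))" unfolding D2_def case_prod_unfold
   by (rule arg_cong[where f = sum_list], rule map_cong[OF refl]) (use D l in "simp add: path_rates_def bb_def")
  also have "\<dots> = m * (my - al * (t0 $ 2 * i / 2)) + (- al) * Ph t0 + (- be) * P2 t0"
   unfolding list_sum_lincomb bv[of "%_. 1"] Ph_def P2_def chain_integral_at_param by simp
  finally have D2v: "D2 v = m * (my - al * (t0 $ 2 * i / 2)) - al * Ph t0 - be * P2 t0" by simp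
  have "Dh v = (\<Sum>(n, Ga)\<leftarrow>c. of_int n * (((hfun e t0 (pt (Ga t0 1)) * bb Ga 1 - hfun e t0 (pt (Ga t0 0)) * bb Ga 0)
    + 1 * (phifun e t0 al be (pt (Ga t0 1)) - phifun e t0 al be (pt (Ga t0 0))) + 1 * (al * t0 $ 5 / 12 * path_integral t0 (%_. 1) (Ga t0)
    + be * path_integral t0 (hfun e t0) (Ga t0)))))" unfolding Dh_def case_prod_unfold
   by (rule arg_cong[where f = sum_list], rule map_cong[OF refl]) (use D l in "simp add: path_rates_def bb_def")
  also have "\<dots> = m * (hfun e t0 (Some (t0 $ 1, t0 $ 2)) * (my - al * (t0 $ 2 * i / 2))) + boundary_sum (phifun e t0 al be) (at_param c t0)
    + (\<Sum>(n, Ga)\<leftarrow>c. of_int n * (0 + (al * t0 $ 5 / 12) * path_integral t0 (%_. 1) (Ga t0) + be * path_integral t0 (hfun e t0) (Ga t0)))"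
   unfolding list_sum_lincomb[where A = "%Ga. hfun e t0 (pt (Ga t0 1)) * bb Ga 1 - hfun e t0 (pt (Ga t0 0)) * bb Ga 0"]
    bv[of "hfun e t0"] boundary_sum_at_param by simp
  also have "\<dots> = m * (hfun e t0 (Some (t0 $ 1, t0 $ 2)) * (my - al * (t0 $ 2 * i / 2)) + phifun e t0 al be (Some (t0 $ 1, t0 $ 2)))
    + al * t0 $ 5 / 12 * P2 t0 + be * Ph t0"
   unfolding list_sum_lincomb m0 Ph_def P2_def chain_integral_at_param by (simp add: phifun_def algebra_simps case_prod_unfold)
  finally have Dhv: "Dh v = m * (hfun e t0 (Some (t0 $ 1, t0 $ 2)) * (my - al * (t0 $ 2 * i / 2)) + phifun e t0 al be (Some (t0 $ 1, t0 $ 2)))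
    + al * t0 $ 5 / 12 * P2 t0 + be * Ph t0" .
  have id: "hfun e t0 (Some (t0 $ 1, t0 $ 2)) * (my - al * (t0 $ 2 * i / 2)) + phifun e t0 al be (Some (t0 $ 1, t0 $ 2))
    = t0 $ 1 * my - al * t0 $ 2 / 2 + be * t0 $ 2 * i / 2 - (v $ 2 * i / 2 - t0 $ 2 * v $ 1 * i^2 / 2)"
   using P_identity[OF not_sym[OF e] my] unfolding i_def[symmetric] by (simp add: algebra_simps)
  have kap: "kap e t0 = t0 $ 3 - t0 $ 2 * i / 2" by (simp add: kap_def i_def)
  \<comment> \<open>The integral of h dx/y is traded for the third period, so that the derivatives
    close up in the frame.\<close>
  have Ph0: "Ph t0 = pi3 t0 + m * (t0 $ 3 - t0 $ 2 * i / 2) - t0 $ 4 * P2 t0" by (simp add: pi3_def kap)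
  show "D2 v = conn t0 v $ 2 $ 1 * (- m) + conn t0 v $ 2 $ 2 * P2 t0 + conn t0 v $ 2 $ 3 * pi3 t0"
   unfolding D2v Ph0 conn by (simp add: algebra_simps)
  show "D3 v = conn t0 v $ 3 $ 1 * (- m) + conn t0 v $ 3 $ 2 * P2 t0 + conn t0 v $ 3 $ 3 * pi3 t0"
   unfolding D3_def D2v Dhv id Ph0 conn by (simp add: algebra_simps power2_eq_square)
 qed
qed

section \<open>Construction of cycle families\<close>

lemma hvd_vector3:
 assumes "(x hvd x') F" "(y hvd y') F" "(z hvd z') F"
 shows "((%s. vector [x s, y s, z s] :: complex ^ 3) hvd vector [x', y', z']) F"
proof -
 have v: "vector [p, q, r] = axis 1 p + axis 2 q + (axis 3 r :: complex ^ 3)" for p q r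
  by (auto simp: vec_eq_iff forall_3 axis_def)
 show ?thesis unfolding v by (intro hvd_add bounded_linear.has_vector_derivative[OF bounded_linear_axis] assms)
qed

text \<open>Neighbourhoods of O are complements of compact sets in the affine curve. Close to O the
  lift satisfies |Y| > R |Z|, which puts the affine point outside the ball of radius R.\<close>

lemma path_continuous_map:
 fixes ga :: "real => complex ^ 3"
 assumes g: "continuous_on {0..1} ga" and c: "!!s. s \<in> {0..1} ==> on_cone t (ga s)"
 shows "continuous_map (top_of_set {0..1}) (curve_top t) (%s. pt (ga s))"
proof (rule continuous_map_atin[THEN iffD2], intro ballI)
 fix s assume "s \<in> topspace (top_of_set {0..1::real})"
 then have s: "s \<in> {0..1}" by simp
 have lim: "((%s. ga s $ k) ---> ga s $ k) (at01 s)" for k using g s by (auto simp: continuous_on_def intro: tendsto_vec_nth)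
 have at: "atin (top_of_set {0..1}) s = at s within {0..1}"
  unfolding atin_subtopology_within[OF s] filter_eq_iff eventually_atin_within eventually_at_topological by auto
 have near: "eventually (%s'. s' \<in> {0..1}) (at01 s)" by (auto simp: eventually_at_filter)
 have memb: "pt (ga s') \<in> insert None (Some ` affine_curve t)" if "s' \<in> {0..1}" for s'
  using pt_in_XX[OF c[OF that]] by (simp add: XX_def)
 show "limitin (curve_top t) (%s. pt (ga s)) (pt (ga s)) (atin (top_of_set {0..1}) s)" unfolding at limitin_def
 proof (intro conjI allI impI)
  show "pt (ga s) \<in> topspace (curve_top t)" using memb[OF s] by (simp add: curve_top_def)
  fix U assume "openin (curve_top t) U & pt (ga s) \<in> U"
  then have U: "openin (Alexandroff_compactification (top_of_set (affine_curve t))) U" "pt (ga s) \<in> U"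
   by (auto simp: curve_top_def)
  show "eventually (%s'. pt (ga s') \<in> U) (at01 s)"
  proof (cases "ga s $ 3 = 0")
   case True
   then have N: "pt (ga s) = None" and y: "ga s $ 2 ~= 0" using on_cone_None[OF c[OF s] True] by (auto simp: pt_def)
   obtain C where C: "compact C" "U = insert None (Some ` (affine_curve t - C))"
    using U N unfolding openin_Alexandroff_compactification by (auto simp: compactin_subtopology)
   obtain R where R: "!!q. q \<in> C ==> norm q \<le> R" "R > 0" using compact_imp_bounded[OF C(1)] unfolding bounded_pos by blast
   have "((%s. norm (ga s $ 2) - R * norm (ga s $ 3)) ---> norm (ga s $ 2) - R * norm (ga s $ 3)) (at01 s)"
    by (intro tendsto_intros lim)
   then have "eventually (%s'. norm (ga s' $ 2) - R * norm (ga s' $ 3) > 0) (at01 s)" by (rule order_tendstoD) (simp add: True y)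
   then show ?thesis using near
   proof eventually_elim
    case (elim s')
    show ?case
    proof (cases "ga s' $ 3 = 0")
     case True
     then show ?thesis unfolding C(2) by (simp add: pt_def)
    next
     case False
     have "norm (ga s' $ 2 / ga s' $ 3) > R" using elim(1) False by (simp add: norm_divide field_simps)
     moreover have "norm (ga s' $ 2 / ga s' $ 3) \<le> norm (ga s' $ 1 / ga s' $ 3, ga s' $ 2 / ga s' $ 3)"
      by (simp add: norm_Pair real_le_rsqrt)
     ultimately have "(ga s' $ 1 / ga s' $ 3, ga s' $ 2 / ga s' $ 3) \<notin> C" using R(1) by force
     then show ?thesis using memb[OF elim(2)] False unfolding C(2) by (auto simp: pt_def)
    qed
   qed
  next
   case False
   define q where "q s = (ga s $ 1 / ga s $ 3, ga s $ 2 / ga s $ 3)" for s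
   have qp: "pt (ga s') = Some (q s')" if "ga s' $ 3 ~= 0" for s' using that by (simp add: pt_def q_def)
   have ql: "(q ---> q s) (at01 s)" unfolding q_def by (intro tendsto_intros lim False)
   have "openin (top_of_set (affine_curve t)) {x \<in> topspace (top_of_set (affine_curve t)). Some x \<in> U}"
    by (rule openin_continuous_map_preimage[OF continuous_map_Some U(1)])
   then obtain W where W: "open W" "{x \<in> affine_curve t. Some x \<in> U} = affine_curve t \<inter> W"
    unfolding openin_open by auto
   have "q s \<in> affine_curve t" using memb[OF s] qp[OF False] by auto
   then have "q s \<in> W" using W(2) U(2) qp[OF False] by auto
   from topological_tendstoD[OF ql W(1) this] tendsto_imp_eventually_ne[OF lim False] near
   show ?thesis
   proof eventually_elim
    case (elim s')
    have "q s' \<in> affine_curve t" using memb[OF elim(3)] qp[OF elim(2)] by auto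
    then show ?case using elim(1) W(2) qp[OF elim(2)] by auto
   qed
  qed
 qed
qed

text \<open>For a loop the two faces coincide as singular simplices, since the 0-simplex is a single
  point; otherwise both faces lie in Y.\<close>

lemma relcycle_path:
 fixes ga :: "real => complex ^ 3"
 assumes g: "continuous_on {0..1} ga" and c: "!!s. s \<in> {0..1} ==> on_cone t (ga s)"
  and ends: "pt (ga 0) = pt (ga 1) \<or> {pt (ga 0), pt (ga 1)} <= YY t"
 shows "singular_relcycle 1 (curve_top t) (YY t) (singular_chain_of [(1, ga)])"
proof -
 define sg where "sg = restrict (%z. pt (ga (z 1))) (standard_simplex 1)"
 have ch: "singular_chain_of [(1, ga)] = frag_of sg" by (simp add: singular_chain_of_def sg_def)
 have "continuous_map (subtopology (powertop_real UNIV) (standard_simplex 1)) (top_of_set {0..1}) (%z. z 1)"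
  by (rule continuous_map_into_subtopology)
   (auto intro!: continuous_map_from_subtopology continuous_map_product_projection simp: standard_simplex_def)
 from continuous_map_compose[OF this path_continuous_map[OF g c]]
 have "continuous_map (subtopology (powertop_real UNIV) (standard_simplex 1)) (curve_top t) sg"
  by (rule continuous_map_eq) (auto simp: sg_def)
 then have s1: "singular_simplex 1 (curve_top t) sg" by (simp add: singular_simplex_def sg_def)
 have f0: "singular_simplex 0 (curve_top t) (singular_face 1 k sg)" if "k \<le> 1" for k
  using singular_simplex_singular_face[OF s1 order_refl that] by simp
 have face: "singular_face 1 k sg vertex = pt (ga (simplical_face k vertex 1))" if "k \<le> 1" for k
  using vertex_simplex simplical_face_in_standard_simplex[of 1 k vertex] that by (simp add: singular_face_def sg_def)
 have fv: "singular_face 1 0 sg vertex = pt (ga 1)" "singular_face 1 1 sg vertex = pt (ga 0)"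
  by (simp_all only: face order_refl zero_le) (simp_all add: simplical_face_def vertex_def)
 have sx: "standard_simplex 0 = {vertex}" unfolding standard_simplex_0 by (auto simp: vertex_def fun_eq_iff)
 have bd: "chain_boundary 1 (frag_of sg) = frag_of (singular_face 1 0 sg) - frag_of (singular_face 1 1 sg)"
  by (simp add: chain_boundary_of)
 have "singular_chain 0 (subtopology (curve_top t) (YY t)) (chain_boundary 1 (frag_of sg))" using ends
 proof
  assume "pt (ga 0) = pt (ga 1)"
  then have "singular_face 1 0 sg vertex = singular_face 1 1 sg vertex" by (simp only: fv)
  moreover have "singular_face 1 k sg \<in> extensional (standard_simplex 0)" if "k \<le> 1" for k
   using f0[OF that] by (simp add: singular_simplex_def)
  ultimately have "singular_face 1 0 sg = singular_face 1 1 sg"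
   by (intro extensionalityI[of _ "standard_simplex 0"]) (auto simp: sx)
  then show ?thesis unfolding bd by simp
 next
  assume Y: "{pt (ga 0), pt (ga 1)} <= YY t"
  have "singular_simplex 0 (subtopology (curve_top t) (YY t)) (singular_face 1 k sg)" if "k = 0 \<or> k = 1" for k
   using that f0[of k] fv Y by (auto simp: singular_simplex_subtopology sx)
  then show ?thesis unfolding bd by (intro singular_chain_diff) (simp_all add: singular_chain_of)
 qed
 then show ?thesis using s1 unfolding ch by (simp add: singular_relcycle singular_chain_of)
qed

lemma cycle_family_single:
 assumes f: "C1_family V Ga" and ends: "!!t. t \<in> V ==> pt (Ga t 0) = pt (Ga t 1) \<or> {pt (Ga t 0), pt (Ga t 1)} <= YY t"
 shows "cycle_family V [(1, Ga)]"
proof -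
 have "singular_relcycle 1 (curve_top t) (YY t) (singular_chain_of [(1, Ga t)])" if t: "t \<in> V" for t
  by (rule relcycle_path[OF C1_path_continuous[OF C1_family_path[OF f t]] _ ends[OF t]])
   (use f t in "auto simp: C1_family_def")
 then show ?thesis using f unfolding cycle_family_def C1_family_def C1_on_eq by (simp add: at_param_def case_prod_unfold)
qed

text \<open>X and Z are prescribed, and Y is the root of F that follows the approximate root B. By
  compactness F/B^2 stays in the right half-plane for t near \<open>t0\<close>, where the principal
  root is holomorphic and no sign can jump.\<close>

lemma sqrt_cycle_family:
 fixes X Z B F Xs Zs Fs :: "param \<times> real => complex"
 assumes V0: "open V0" "t0 \<in> V0" "V0 <= TT"
  and C: "C1fun (V0 \<times> {0..1}) X" "C1fun (V0 \<times> {0..1}) Z" "C1fun (V0 \<times> {0..1}) B" "C1fun (V0 \<times> {0..1}) F"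
   "C1fun (V0 \<times> {0..1}) Xs" "C1fun (V0 \<times> {0..1}) Zs" "C1fun (V0 \<times> {0..1}) Fs"
  and hX: "!!t s. t \<in> V0 ==> s \<in> {0..1} ==> ((%s. X (t, s)) hvd Xs (t, s)) (at01 s)"
  and hZ: "!!t s. t \<in> V0 ==> s \<in> {0..1} ==> ((%s. Z (t, s)) hvd Zs (t, s)) (at01 s)"
  and hF: "!!t s. t \<in> V0 ==> s \<in> {0..1} ==> ((%s. F (t, s)) hvd Fs (t, s)) (at01 s)"
  and B0: "!!s. s \<in> {0..1} ==> B (t0, s) ~= 0 & Re (F (t0, s) / B (t0, s)^2) > 0"
  and cone: "!!t s y. t \<in> V0 ==> s \<in> {0..1} ==> y^2 = F (t, s) ==> y ~= 0 ==> on_cone t (vector [X (t, s), y, Z (t, s)])"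
 defines "Ga \<equiv> %t s. vector [X (t, s), B (t, s) * csqrt (F (t, s) / B (t, s)^2), Z (t, s)] :: complex ^ 3"
 assumes ends: "!!t. t \<in> V0 ==> B (t, 0) ~= 0 ==> B (t, 1) ~= 0 ==>
   pt (Ga t 0) = pt (Ga t 1) \<or> {pt (Ga t 0), pt (Ga t 1)} <= YY t"
 shows "\<exists>V. open V & t0 \<in> V & V <= V0 & cycle_family V [(1, Ga)]"
proof -
 obtain V1 where V1: "open V1" "t0 \<in> V1" "V1 <= V0" "\<forall>t\<in>V1. \<forall>s\<in>{0..1}. B (t, s) \<in> - {0}"
  using tube_open[OF C1fun_continuous[OF C(3)] _ V0(1,2), of "- {0}"] B0 by auto
 have s1: "V1 \<times> {0..1::real} <= V0 \<times> {0..1}" using V1(3) by blast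
 have CQ: "C1fun (V1 \<times> {0..1}) (%z. F z / B z ^ 2)"
  using V1(4) by (intro C1fun_divide C1fun_power C1fun_subset[OF C(4) s1] C1fun_subset[OF C(3) s1]) auto
 have oR: "open {z. Re z > 0}" by (rule open_halfspace_Re_gt)
 obtain V where V: "open V" "t0 \<in> V" "V <= V1" "\<forall>t\<in>V. \<forall>s\<in>{0..1}. F (t, s) / B (t, s) ^ 2 \<in> {z. Re z > 0}"
  using tube_open[OF C1fun_continuous[OF CQ] oR V1(1,2)] B0 by auto
 have s2: "V \<times> {0..1::real} <= V1 \<times> {0..1}" using V(3) by blast
 have s3: "V \<times> {0..1::real} <= V0 \<times> {0..1}" using s1 s2 by blast
 define Y where "Y z = B z * csqrt (F z / B z ^ 2)" for z
 have hc: "csqrt holomorphic_on {z. Re z > 0}"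
  by (rule holomorphic_on_subset[OF holomorphic_on_csqrt]) (auto dest: Re_pos_not_nonpos)
 have CY: "C1fun (V \<times> {0..1}) Y" unfolding Y_def
  by (intro C1fun_mult C1fun_subset[OF C(3) s3] C1fun_holomorphic[OF C1fun_subset[OF CQ s2] oR hc]) (use V(4) in auto)
 have Y: "Y (t, s) ^ 2 = F (t, s) & Y (t, s) ~= 0" if "t \<in> V" "s \<in> {0..1}" for t s
 proof -
  have b: "B (t, s) ~= 0" using V1(4) V(3) that by auto
  have "Re (F (t, s) / B (t, s) ^ 2) > 0" using V(4) that by auto
  then have "F (t, s) / B (t, s)^2 ~= 0" by force
  then show ?thesis using b by (simp add: Y_def power_mult_distrib)
 qed
 define Ys where "Ys z = Fs z / (2 * Y z)" for z
 have CYs: "C1fun (V \<times> {0..1}) Ys"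
  unfolding Ys_def using Y by (intro C1fun_divide C1fun_mult C1fun_const C1fun_subset[OF C(7) s3] CY) auto
 have hY: "((%s. Y (t, s)) hvd Ys (t, s)) (at01 s)" if t: "t \<in> V" and s: "s \<in> {0..1}" for t s
 proof -
  obtain D E where E: "!!t s. t \<in> V ==> s \<in> {0..1} ==> ((%s. Y (t, s)) hvd E t s) (at s within {0..1::real})"
   by (rule C1fun_slice[OF CY V(1) zero_less_one]) auto
  have t': "t \<in> V0" using t V(3) V1(3) by blast
  have "((%s. Y (t, s) * Y (t, s)) hvd Y (t, s) * E t s + E t s * Y (t, s)) (at01 s)" by (rule hvd_mult[OF E[OF t s] E[OF t s]])
  then have "((%s. F (t, s)) hvd Y (t, s) * E t s + E t s * Y (t, s)) (at01 s)" unfolding hvd_def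
   by (rule has_derivative_transform[rotated 2]) (use s Y[OF t] in "auto simp: power2_eq_square")
  then have "Y (t, s) * E t s + E t s * Y (t, s) = Fs (t, s)"
   by (rule vector_derivative_unique_within[OF unit_interval_nontrivial[OF s] _ hF[OF t' s]])
  then have "E t s = Ys (t, s)" using Y[OF t s] by (simp add: Ys_def field_simps)
  then show ?thesis using E[OF t s] by simp
 qed
 have Ga: "Ga t s = vector [X (t, s), Y (t, s), Z (t, s)]" for t s by (simp add: Ga_def Y_def)
 have vel: "velocity (Ga t) s = vector [Xs (t, s), Ys (t, s), Zs (t, s)]" if t: "t \<in> V" and s: "s \<in> {0..1}" for t s
 proof -
  have t': "t \<in> V0" using t V(3) V1(3) by blast
  show ?thesis unfolding Ga by (rule vector_derivative_within[OF unit_interval_nontrivial[OF s]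
     hvd_vector3[OF hX[OF t' s] hY[OF t s] hZ[OF t' s]]])
 qed
 have C1v: "C1fun (V \<times> {0..1}) (%z. vector [x z, y z, w z] :: complex ^ 3)"
  if "C1fun (V \<times> {0..1}) x" "C1fun (V \<times> {0..1}) y" "C1fun (V \<times> {0..1}) w" for x y w
 proof (rule C1fun_vec3)
  fix i :: 3
  show "C1fun (V \<times> {0..1}) (%z. (vector [x z, y z, w z] :: complex ^ 3) $ i)" using exhaust_3[of i] that by auto
 qed
 have "C1_family V Ga" unfolding C1_family_def
 proof (intro conjI ballI)
  show "open V" "V <= TT" using V V1 V0 by auto
  show "on_cone t (Ga t s)" if "t \<in> V" "s \<in> {0..1}" for t s unfolding Ga by (rule cone) (use that Y[OF that] V V1 in auto)
  show "C1fun (V \<times> {0..1}) (%z. Ga (fst z) (snd z))"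
   unfolding Ga prod.collapse by (intro C1v CY C1fun_subset[OF C(1) s3] C1fun_subset[OF C(2) s3])
  have "C1fun (V \<times> {0..1}) (%z. vector [Xs z, Ys z, Zs z] :: complex ^ 3)"
   by (intro C1v CYs C1fun_subset[OF C(5) s3] C1fun_subset[OF C(6) s3])
  then obtain f' where f': "continuous_on (V \<times> {0..1}) f'"
   "!!z. z \<in> V \<times> {0..1} ==> ((%z. vector [Xs z, Ys z, Zs z] :: complex ^ 3) has_derivative blinfun_apply (f' z)) (at z within V \<times> {0..1})"
   by (rule C1funE) (rule that)
  have eq: "velocity (Ga (fst z)) (snd z) = vector [Xs z, Ys z, Zs z]" if "z \<in> V \<times> {0..1}" for z
   using vel[of "fst z" "snd z"] that by (auto simp: mem_Times_iff)
  have "((%z. velocity (Ga (fst z)) (snd z)) has_derivative blinfun_apply (f' z)) (at z within V \<times> {0..1})"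
   if "z \<in> V \<times> {0..1}" for z by (rule has_derivative_transform[OF that _ f'(2)[OF that]]) (rule eq)
  then show "C1fun (V \<times> {0..1}) (%z. velocity (Ga (fst z)) (snd z))" using f'(1) unfolding C1fun_def by blast
 qed
 then have "cycle_family V [(1, Ga)]"
 proof (rule cycle_family_single)
  fix t assume t: "t \<in> V"
  then have "t \<in> V0" "B (t, 0) ~= 0" "B (t, 1) ~= 0" using V V1 by auto
  then show "pt (Ga t 0) = pt (Ga t 1) \<or> {pt (Ga t 0), pt (Ga t 1)} <= YY t" by (rule ends)
 qed
 then show ?thesis using V V1(3) by blast
qed

section \<open>Cycles with independent periods\<close>

text \<open>At the parameter with curve \<open>y\<^sup>2 = 4 x\<^sup>3 - 4 x\<close> the loop \<open>x = 1/2 - w/8 - 1/(2 w)\<close>, \<open>\<bar>w\<bar> = 1\<close>, runs around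
 the roots \<open>0\<close> and \<open>1\<close>, since \<open>4 x (x - 1) = (w/4 - 1/w)\<^sup>2\<close>. The automorphism \<open>(x, y) \<mapsto> (- x, \<i> y)\<close>
 yields the second loop.\<close>

definition lw :: "real => complex" where "lw s = exp (2 * of_real pi * \<i> * of_real s)"
definition lw' :: "real => complex" where "lw' s = exp (- (2 * of_real pi * \<i> * of_real s))"
definition lx :: "real => complex" where "lx s = 1 / 2 - lw s / 8 - lw' s / 2"
definition lxd :: "real => complex" where "lxd s = - (of_real pi * \<i>) * (lw s / 4 - lw' s)"
text \<open>The factor of y that \<open>lx_square\<close> leaves over, as 4x^3 - 4x = 4x(x-1)(x+1).
  The principal root is continuous along the loop because 1 + x stays in the right
  half-plane.\<close>

definition lc :: "real => complex" where "lc s = csqrt (1 + lx s)"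

lemma lw_inverse: "lw s * lw' s = 1" by (simp add: lw_def lw'_def exp_minus_inverse)

lemma lw_cnj: "lw' s = cnj (lw s)" by (simp add: lw_def lw'_def exp_cnj)

lemma lw_circle: "(Re (lw s))^2 + (Im (lw s))^2 = 1"
proof -
 have "norm (lw s) = 1" by (simp add: lw_def norm_exp_eq_Re)
 then show ?thesis by (simp add: cmod_def)
qed

lemma lw_ends: "lw 0 = 1" "lw 1 = 1" "lw' 0 = 1" "lw' 1 = 1"
proof -
 have "exp (2 * complex_of_real pi * \<i>) = 1" using exp_two_pi_i by (simp add: mult_ac)
 then show "lw 0 = 1" "lw 1 = 1" "lw' 0 = 1" "lw' 1 = 1" by (simp_all add: lw_def lw'_def exp_minus)
qed

lemma lw_derivative:
 "(lw hvd 2 * of_real pi * \<i> * lw s) (at s within S)"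
 "(lw' hvd - (2 * of_real pi * \<i> * lw' s)) (at s within S)"
proof -
 have "((%z. exp (2 * of_real pi * \<i> * z)) has_field_derivative 2 * of_real pi * \<i> * exp (2 * of_real pi * \<i> * of_real s)) (at (of_real s))"
  by (auto intro!: derivative_eq_intros)
 from has_vector_derivative_real_field[OF this] show "(lw hvd 2 * of_real pi * \<i> * lw s) (at s within S)"
  by (simp add: lw_def[abs_def])
 have "((%z. exp (- (2 * of_real pi * \<i> * z))) has_field_derivative - (2 * of_real pi * \<i> * exp (- (2 * of_real pi * \<i> * of_real s)))) (at (of_real s))"
  by (auto intro!: derivative_eq_intros)
 from has_vector_derivative_real_field[OF this] show "(lw' hvd - (2 * of_real pi * \<i> * lw' s)) (at s within S)"
  by (simp add: lw'_def[abs_def])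
qed

lemma lx_derivative: "(lx hvd lxd s) (at s within S)" unfolding lx_def by (rule hvd_eq_rhs[OF hvd_diff[OF hvd_diff[OF hvd_const
    hvd_divide[OF lw_derivative(1)]] hvd_divide[OF lw_derivative(2)]]])
  (simp add: lxd_def field_simps)

lemma lx_square: "4 * lx s * (lx s - 1) = (lw s / 4 - lw' s)^2"
proof -
 have "4 * lx s * (lx s - 1) = (lw s / 4 - lw' s)^2 + (lw s * lw' s - 1)" by (simp add: lx_def field_simps power2_eq_square)
 then show ?thesis by (simp add: lw_inverse)
qed

text \<open>The loop is an ellipse with foci 0 and 1, on which the distance to a focus is affine in
  the position along the axis, hence in Re w.\<close>

lemma lx_parts: "Re (lx s) = (4 - 5 * Re (lw s)) / 8" "cmod (lx s) = (5 - 4 * Re (lw s)) / 8"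
proof -
 define k m where "k = Re (lw s)" and "m = Im (lw s)"
 have km: "m^2 = 1 - k^2" using lw_circle[of s] by (simp add: k_def m_def)
 then have "k^2 \<le> 1" by (metis diff_ge_0_iff_ge zero_le_power2)
 then have k: "- 1 \<le> k" "k \<le> 1" by (auto simp: abs_square_le_1)
 have R: "Re (lx s) = (4 - 5 * k) / 8" and I: "Im (lx s) = 3 * m / 8" by (simp_all add: lx_def lw_cnj k_def m_def field_simps)
 show "Re (lx s) = (4 - 5 * Re (lw s)) / 8" using R by (simp add: k_def)
 have "(cmod (lx s))^2 = ((5 - 4 * k) / 8)^2" unfolding cmod_power2 R I using km by (simp add: field_simps power2_eq_square)
 then show "cmod (lx s) = (5 - 4 * Re (lw s)) / 8" using k unfolding k_def[symmetric] by (subst (asm) power2_eq_iff_nonneg) auto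
qed

lemma lw_range: "- 1 \<le> Re (lw s)" "Re (lw s) \<le> 1"
proof -
 have "(Re (lw s))^2 \<le> 1" using lw_circle[of s] by (metis le_add_same_cancel1 zero_le_power2)
 then show "- 1 \<le> Re (lw s)" "Re (lw s) \<le> 1" by (auto simp: abs_square_le_1)
qed

lemma lc_props: "Re (1 + lx s) > 0" "lc s ^ 2 = 1 + lx s" "lc s ~= 0" "lx s ~= 0" "lw s / 4 - lw' s ~= 0"
proof -
 show R: "Re (1 + lx s) > 0" using lw_range[of s] by (simp add: lx_parts field_simps)
 show "lc s ^ 2 = 1 + lx s" by (simp add: lc_def)
 have "1 + lx s ~= 0" using R by force
 then show "lc s ~= 0" by (simp only: lc_def csqrt_eq_0 not_False_eq_True)
 have "cmod (lx s) > 0" using lw_range[of s] by (simp add: lx_parts)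
 then show "lx s ~= 0" by auto
 show "lw s / 4 - lw' s ~= 0"
 proof
  assume "lw s / 4 - lw' s = 0"
  then have "lw s * (lw s / 4) = 1" using lw_inverse[of s] by simp
  then have "cmod (lw s * (lw s / 4)) = 1" by simp
  moreover have "cmod (lw s) = 1" by (simp add: lw_def norm_exp_eq_Re)
  ultimately show False by (simp add: norm_mult norm_divide)
 qed
qed

text \<open>For c^2 = 1 + x one has 1/c - 1 = -x/(c(1+c)), and the real part of the denominator is
  Re c + Re (c^2), which is at least 7/8 + q.\<close>

lemma lc_estimate:
 "cmod (1 / lc s - 1) \<le> cmod (lx s) * 8 / (19 - 5 * Re (lw s))"
proof -
 define q where "q = (12 - 5 * Re (lw s)) / 8"
 have q: "Re (1 + lx s) = q" by (simp add: lx_parts q_def field_simps)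
 have q0: "q \<ge> 7 / 8" using lw_range[of s] by (simp add: q_def)
 have "Re (lc s ^ 2) = q" unfolding lc_props(2) by (rule q)
 then have "(Re (lc s))^2 - (Im (lc s))^2 = q" by (simp only: Re_power2)
 then have "(Re (lc s))^2 \<ge> q" using zero_le_power2[of "Im (lc s)"] by linarith
 \<comment> \<open>Since (7/8)^2 < 7/8 \<le> q.\<close>
 then have "(7 / 8)^2 \<le> (Re (lc s))^2" using q0 by (simp add: power2_eq_square)
 moreover have "Re (lc s) \<ge> 0" unfolding lc_def by (rule Re_csqrt)
 ultimately have R: "Re (lc s) \<ge> 7 / 8" by (rule power2_le_imp_le)
 have "Re (lc s * (1 + lc s)) = Re (lc s) + q" using lc_props(2)[of s] q by (simp add: distrib_left power2_eq_square)
 then have N: "cmod (lc s * (1 + lc s)) \<ge> 7 / 8 + q" using complex_Re_le_cmod[of "lc s * (1 + lc s)"] R by linarith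
 then have nz: "lc s * (1 + lc s) ~= 0" using q0 by auto
 have "(1 / lc s - 1) * (lc s * (1 + lc s)) = 1 - lc s ^ 2" using lc_props(3)[of s] by (simp add: field_simps power2_eq_square)
 then have "(1 / lc s - 1) * (lc s * (1 + lc s)) = - lx s" by (simp add: lc_props(2))
 then have "1 / lc s - 1 = - lx s / (lc s * (1 + lc s))" by (rule nonzero_eq_divide_eq[OF nz, THEN iffD2])
 then have "cmod (1 / lc s - 1) = cmod (lx s) / cmod (lc s * (1 + lc s))" by (simp only: norm_divide norm_minus_cancel)
 also have "\<dots> \<le> cmod (lx s) / (7 / 8 + q)" using N q0 by (intro divide_left_mono mult_pos_pos) auto
 also have "7 / 8 + q = (19 - 5 * Re (lw s)) / 8" by (simp add: q_def field_simps)
 finally show ?thesis by simp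
qed

lemma continuous_on_lc: "continuous_on S lw" "continuous_on S lw'" "continuous_on S lx" "continuous_on S lc"
proof -
 show 1: "continuous_on S lw" "continuous_on S lw'" unfolding lw_def lw'_def by (intro continuous_intros)+
 show 2: "continuous_on S lx" unfolding lx_def by (intro continuous_intros 1) auto
 show "continuous_on S lc" unfolding continuous_on_def lc_def
  by (intro ballI tendsto_csqrt) (use 2 lc_props(1) in "auto simp: continuous_on_def intro!: tendsto_intros")
qed

text \<open>With \<open>lc\<close> replaced by 1 the integrals are 1 and 1/2. The integrands change
  by at most 1/2 and 9/20, too little to reach 0.\<close>

lemma integrals_nonzero:
 "integral {0..1} (%s. 1 / lc s) ~= 0" "integral {0..1} (%s. lx s / lc s) ~= 0"
proof -
 have c: "continuous_on {0..1} (%s. 1 / lc s)" "continuous_on {0..1} (%s. lx s / lc s)"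
  by (intro continuous_intros continuous_on_lc ballI lc_props(3))+
 have i: "((%s. 1 / lc s) has_integral integral {0..1} (%s. 1 / lc s)) {0..1}"
  "((%s. lx s / lc s) has_integral integral {0..1} (%s. lx s / lc s)) {0..1}"
  using integrable_integral[OF integrable_continuous_interval[OF c(1)]] integrable_integral[OF integrable_continuous_interval[OF c(2)]] by auto
 have k: "Re (lw s) * Re (lw s) \<le> 1" for s using lw_circle[of s] by (metis le_add_same_cancel1 power2_eq_square zero_le_power2)
 have b1: "cmod (1 / lc s - 1) \<le> 1 / 2" for s
 proof -
  have "cmod (1 / lc s - 1) \<le> (5 - 4 * Re (lw s)) / (19 - 5 * Re (lw s))"
   using lc_estimate[of s] unfolding lx_parts by (simp only: times_divide_eq_left nonzero_mult_div_cancel_right zero_neq_numeral[symmetric] not_False_eq_True)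
  also have "\<dots> \<le> 1 / 2" using lw_range[of s] by (simp add: divide_simps)
  finally show ?thesis .
 qed
 have b2: "cmod (lx s / lc s - lx s) \<le> 9 / 20" for s
 proof -
  have "lx s / lc s - lx s = lx s * (1 / lc s - 1)" by (simp add: algebra_simps)
  then have "cmod (lx s / lc s - lx s) = cmod (lx s) * cmod (1 / lc s - 1)" by (simp add: norm_mult)
  also have "\<dots> \<le> cmod (lx s) * (cmod (lx s) * 8 / (19 - 5 * Re (lw s)))" by (intro mult_left_mono lc_estimate) simp
  also have "\<dots> = (5 - 4 * Re (lw s)) * (5 - 4 * Re (lw s)) / (8 * (19 - 5 * Re (lw s)))"
  proof -
   have "a / 8 * (a / 8 * 8 / b) = a * a / (8 * b)" for a b :: real by simp
   then show ?thesis unfolding lx_parts .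
  qed
  also have "\<dots> \<le> 9 / 20"
  proof -
   have "20 * ((5 - 4 * Re (lw s)) * (5 - 4 * Re (lw s))) \<le> 9 * (8 * (19 - 5 * Re (lw s)))"
    using k[of s] lw_range[of s] by (simp add: algebra_simps)
   then show ?thesis using lw_range[of s] by (simp add: divide_simps)
  qed
  finally show ?thesis .
 qed
 show "integral {0..1} (%s. 1 / lc s) ~= 0"
 proof
  assume z: "integral {0..1} (%s. 1 / lc s) = 0"
  have "((%s. 1 / lc s - 1) has_integral 0 - 1) {0..1}"
   using has_integral_diff[OF i(1)[unfolded z] has_integral_const_real[of "1::complex" 0 1]] by simp
  from has_integral_bound_real[OF _ finite.emptyI this, of "1 / 2"] b1 show False by simp
 qed
 have x: "(lx has_integral 1 / 2) {0..1}"
 proof -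
  \<comment> \<open>Termwise primitive: w and 1/w integrate to 0 over a period, leaving the constant
    term 1/2.\<close>
  define G where "G s = of_real s / 2 - lw s / (16 * of_real pi * \<i>) + lw' s / (4 * of_real pi * \<i>)" for s
  have "(lx has_integral G 1 - G 0) {0..1}"
  proof (rule fundamental_theorem_of_calculus)
   fix s :: real
   have "((%s. complex_of_real s) hvd 1) (at01 s)" using has_vector_derivative_of_real[OF DERIV_ident] by simp
   from hvd_add[OF hvd_diff[OF hvd_divide[OF this, of 2]
     hvd_divide[OF lw_derivative(1), of "16 * of_real pi * \<i>"]]
     hvd_divide[OF lw_derivative(2), of "4 * of_real pi * \<i>"]]
   show "(G hvd lx s) (at01 s)" unfolding G_def by (rule hvd_eq_rhs) (simp add: lx_def field_simps)
  qed simp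
  then show ?thesis by (simp add: G_def lw_ends)
 qed
 show "integral {0..1} (%s. lx s / lc s) ~= 0"
 proof
  assume z: "integral {0..1} (%s. lx s / lc s) = 0"
  have "((%s. lx s / lc s - lx s) has_integral 0 - 1 / 2) {0..1}" using has_integral_diff[OF i(2)[unfolded z] x] .
  from has_integral_bound_real[OF _ finite.emptyI this, of "9 / 20"] b2 show False by (simp add: norm_divide)
 qed
qed

text \<open>The curve y^2 = 4x^3 - 4x with P = (2, 2 sqrt 6). Since t_3 = 0, it has the automorphism
  used for the second loop; as 2 lies to the right of the roots -1, 0 and 1, the real curve leads
  from P to O without a branch point.\<close>

definition base_pt :: param where "base_pt = vector [2, of_real (2 * sqrt 6), 0, 0, 4]"

lemma base_pt: "base_pt $ 1 = 2" "base_pt $ 2 ^ 2 = 24" "base_pt $ 4 = 0" "base_pt $ 5 = 4" "t3 base_pt = 0" "base_pt \<in> TT" "base_pt $ 2 ~= 0"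
proof -
 have "(of_real (2 * sqrt 6))^2 = complex_of_real ((2 * sqrt 6)^2)" by (rule of_real_power[symmetric])
 also have "(2 * sqrt 6)^2 = (24::real)" by (simp add: power_mult_distrib)
 finally show b: "base_pt $ 2 ^ 2 = 24" by (simp add: base_pt_def)
 show "base_pt $ 1 = 2" "base_pt $ 4 = 0" "base_pt $ 5 = 4" by (simp_all add: base_pt_def)
 then show "t3 base_pt = 0" using b by (simp add: t3_def)
 then show "base_pt \<in> TT" by (simp add: TT_def Disc_def base_pt_def)
 show "base_pt $ 2 ~= 0" using b by auto
qed

lemma C1fun_loop: "C1fun S (%z. lw (snd z))" "C1fun S (%z. lw' (snd z))" "C1fun S (%z. lx (snd z))" "C1fun S (%z. lxd (snd z))"
 "C1fun S (%z. lc (snd z))"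
proof -
 have h: "(%z. exp (2 * of_real pi * \<i> * z)) holomorphic_on UNIV" "(%z. exp (- (2 * of_real pi * \<i> * z))) holomorphic_on UNIV"
  by (intro holomorphic_intros)+
 show 1: "C1fun S (%z. lw (snd z))" "C1fun S (%z. lw' (snd z))"
  unfolding lw_def lw'_def by (rule C1fun_holomorphic[OF C1fun_snd open_UNIV h(1)] C1fun_holomorphic[OF C1fun_snd open_UNIV h(2)], simp)+
 have d: "C1fun S (%z. f z / k)" if "C1fun S f" "k ~= 0" for f :: "param \<times> real => complex" and k
  using that by (intro C1fun_divide C1fun_const) auto
 show 2: "C1fun S (%z. lx (snd z))" unfolding lx_def by (intro C1fun_diff C1fun_const d 1) auto
 show "C1fun S (%z. lxd (snd z))" unfolding lxd_def by (intro C1fun_diff C1fun_const C1fun_mult d 1) auto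
 have hc: "csqrt holomorphic_on {z. Re z > 0}"
  by (rule holomorphic_on_subset[OF holomorphic_on_csqrt]) (auto dest: Re_pos_not_nonpos)
 show "C1fun S (%z. lc (snd z))" unfolding lc_def
  by (rule C1fun_holomorphic[OF C1fun_add[OF C1fun_const 2] open_halfspace_Re_gt hc]) (use lc_props(1) in simp)
qed

lemma C1fun_cubic: "C1fun S f ==> C1fun S (%z. cubic (fst z) (f z))" "C1fun S f ==> C1fun S (%z. dcubic (fst z) (f z))"
 unfolding cubic_def dcubic_def by (intro C1fun_intros; assumption)+

lemma cubic_derivative_path:
 assumes "(x hvd x') (at s within S)"
 shows "((%s. cubic t (x s)) hvd dcubic t (x s) * x') (at s within S)"
 using field_vector_diff_chain_within[OF assms has_field_derivative_at_within[OF DERIV_cubic]] by (simp add: o_def mult.commute)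

text \<open>\<open>rh\<close> = \<open>ka\<close> = 1 gives the loop itself, \<open>rh\<close> = -1
  and \<open>ka\<close> = \<i> its image under the automorphism. The x-coordinate stays fixed as t
  moves; at the base parameter F = B^2, so the root there is 1.\<close>

lemma loop_family:
 assumes r: "rh^2 = 1" "ka^2 = rh"
 shows "\<exists>V Ga. open V & base_pt \<in> V & V <= TT & cycle_family V [(1, Ga)] &
   (\<forall>s. Ga base_pt s = vector [rh * lx s, ka * (lw s / 4 - lw' s) * lc s, 1])"
proof -
 have k0: "ka ~= 0" using r by auto
 define X where "X z = rh * lx (snd z)" for z :: "param \<times> real"
 define B where "B z = ka * (lw (snd z) / 4 - lw' (snd z)) * lc (snd z)" for z :: "param \<times> real"
 define F where "F z = cubic (fst z) (X z)" for z :: "param \<times> real"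
 define Ga where "Ga t s = (vector [X (t, s), B (t, s) * csqrt (F (t, s) / B (t, s)^2), 1] :: complex ^ 3)" for t s
 have B0: "B z ~= 0" for z using lc_props(3,5)[of "snd z"] k0 by (simp add: B_def)
 have FB: "F (base_pt, s) = B (base_pt, s)^2" for s
 proof -
  have "F (base_pt, s) = rh * (rh^2 * (4 * lx s ^ 3) - 4 * lx s)"
   by (simp add: F_def X_def cubic_def base_pt algebra_simps pow_eqs)
  also have "\<dots> = rh * ((4 * lx s * (lx s - 1)) * (1 + lx s))" unfolding r by (simp add: algebra_simps power3_eq_cube)
  also have "\<dots> = B (base_pt, s)^2" unfolding lx_square B_def by (simp add: power_mult_distrib r lc_props(2))
  finally show ?thesis .
 qed
 have CX: "C1fun (TT \<times> {0..1}) X" unfolding X_def by (intro C1fun_mult C1fun_const C1fun_loop)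
 have Cw: "C1fun (TT \<times> {0..1}) (%z. lw (snd z) / 4)" by (intro C1fun_divide C1fun_const C1fun_loop) simp
 have "\<exists>V. open V & base_pt \<in> V & V <= TT & cycle_family V [(1, Ga)]" unfolding Ga_def
 proof (rule sqrt_cycle_family[where Z = "%_. 1" and Zs = "%_. 0" and Xs = "%z. rh * lxd (snd z)"
    and Fs = "%z. dcubic (fst z) (X z) * (rh * lxd (snd z))"])
  show "open TT" by (rule open_TT)
  show "base_pt \<in> TT" by (rule base_pt)
  show "C1fun (TT \<times> {0..1}) B" unfolding B_def by (intro C1fun_mult C1fun_diff C1fun_const C1fun_loop Cw)
  show "C1fun (TT \<times> {0..1}) F" unfolding F_def by (rule C1fun_cubic[OF CX])
  show Cd: "C1fun (TT \<times> {0..1}) (%z. rh * lxd (snd z))" by (intro C1fun_mult C1fun_const C1fun_loop)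
  show "C1fun (TT \<times> {0..1}) (%z. dcubic (fst z) (X z) * (rh * lxd (snd z)))" by (rule C1fun_mult[OF C1fun_cubic(2)[OF CX] Cd])
  show x': "((%s. X (t, s)) hvd rh * lxd (snd (t, s))) (at01 s)" for t s
   unfolding X_def snd_conv by (intro hvd_mult_right lx_derivative)
  show "((%s. F (t, s)) hvd dcubic (fst (t, s)) (X (t, s)) * (rh * lxd (snd (t, s)))) (at01 s)" for t s
   using cubic_derivative_path[OF x'[of t s], of t] by (simp add: F_def)
  show "B (base_pt, s) ~= 0 & Re (F (base_pt, s) / B (base_pt, s)^2) > 0" for s using B0[of "(base_pt, s)"] by (simp add: FB)
  show "on_cone t (vector [X (t, s), y, 1])" if "y^2 = F (t, s)" for t s y
   using that by (simp add: on_cone_def F_def cubic_def vec_eq_iff forall_3)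
  have "X (t, 0) = X (t, 1)" "B (t, 0) = B (t, 1)" for t by (simp_all add: X_def B_def lx_def lc_def lw_ends)
  then show "pt (vector [X (t, 0), B (t, 0) * csqrt (F (t, 0) / B (t, 0)^2), 1]) =
    pt (vector [X (t, 1), B (t, 1) * csqrt (F (t, 1) / B (t, 1)^2), 1]) \<or>
   {pt (vector [X (t, 0), B (t, 0) * csqrt (F (t, 0) / B (t, 0)^2), 1]),
    pt (vector [X (t, 1), B (t, 1) * csqrt (F (t, 1) / B (t, 1)^2), 1])} <= YY t" for t by (simp add: F_def)
 qed (auto intro: CX C1fun_const)
 moreover have "Ga base_pt s = vector [rh * lx s, ka * (lw s / 4 - lw' s) * lc s, 1]" for s
  using B0[of "(base_pt, s)"] by (simp add: Ga_def FB) (simp add: X_def B_def)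
 ultimately show ?thesis by blast
qed

text \<open>With the pole e = 0, off the loop, h dx/y differs from x dx/y by d(y/(2x)), which
  integrates to 0. Along the loop dx/y is -(ka pi i/lc) ds, because the factor w/4 - 1/w of y also
  divides the derivative of x.\<close>

lemma loop_period:
 assumes r: "rh^2 = 1" "ka^2 = rh" and c: "rel_chain base_pt [(1, ga)]"
  and g: "!!s. ga s = vector [rh * lx s, ka * (lw s / 4 - lw' s) * lc s, 1]"
 shows "period base_pt [(1, ga)] (cls base_pt z) =
   z $ 2 * (- (ka * of_real pi * \<i>) * integral {0..1} (%s. 1 / lc s))
   + z $ 3 * (- (rh * ka * of_real pi * \<i>) * integral {0..1} (%s. lx s / lc s))"
proof -
 have k0: "ka ~= 0" "rh ~= 0" using r by auto
 have C: "C1_path base_pt ga" using c by (simp add: rel_chain_def)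
 define x y where "x s = rh * lx s" and "y s = ka * (lw s / 4 - lw' s) * lc s" for s
 have gx: "ga s $ 1 = x s" "ga s $ 2 = y s" "ga s $ 3 = 1" for s by (simp_all add: g x_def y_def)
 have x0: "x s ~= 0" for s using lc_props(4)[of s] k0 by (simp add: x_def)
 have y0: "y s ~= 0" for s using lc_props(3,5)[of s] k0 by (simp add: y_def)
 have ptg: "pt (ga s) = Some (x s, y s)" for s by (simp add: pt_def gx)
 have cc: "y s ^ 2 = cubic base_pt (x s)" if "s \<in> {0..1}" for s
  using on_cone_affine[of base_pt "ga s"] C that by (simp add: C1_path_def gx)
 have U: "pt (ga s) \<in> U_frame 0 base_pt" if "s \<in> {0..1}" for s unfolding ptg Some_in_U_frame using cc[OF that] x0 by simp
 define v where "v s = velocity ga s" for s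
 have v: "(ga hvd v s) (at01 s)" if "s \<in> {0..1}" for s using C that by (simp add: C1_path_def v_def)
 have x': "(x hvd rh * lxd s) (at s within S)" for s S unfolding x_def by (intro hvd_mult_right lx_derivative)
 have v1: "v s $ 1 = rh * lxd s" if s: "s \<in> {0..1}" for s
  by (rule vector_derivative_unique_within[OF unit_interval_nontrivial[OF s] hvd_vec_nth[OF v[OF s], of 1, unfolded gx] x'])
 have v3: "v s $ 3 = 0" if s: "s \<in> {0..1}" for s
  by (rule vector_derivative_unique_within[OF unit_interval_nontrivial[OF s] hvd_vec_nth[OF v[OF s], of 3, unfolded gx] hvd_const])
 define l where "l s = inv_diff base_pt (ga s) (v s)" for s
 have p: "path_at base_pt {0..1} ga s (v s)" if "s \<in> {0..1}" for s using C1_path_at[OF C that] by (simp add: v_def)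
 have l1: "l s * y s = rh * lxd s" "l s * dcubic base_pt (x s) = 2 * v s $ 2" if s: "s \<in> {0..1}" for s
  using inv_diff_affine_eqs[OF base_pt(6) p[OF s]] by (simp_all add: gx l_def v1[OF s] v3[OF s])
 have l: "l s = - (ka * of_real pi * \<i>) * (1 / lc s)" if s: "s \<in> {0..1}" for s
 proof -
  have "(- (ka * of_real pi * \<i>) * (1 / lc s)) * y s = ka^2 * lxd s"
   using lc_props(3)[of s] by (simp add: y_def lxd_def power2_eq_square)
  then have "(- (ka * of_real pi * \<i>) * (1 / lc s)) * y s = l s * y s" using l1(1)[OF s] r by simp
  then show ?thesis by (simp only: mult_right_cancel[OF y0])
 qed
 define h where "h s = hfun 0 base_pt (pt (ga s))" for s
 define sg where "sg s = y s / (2 * x s)" for s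
 have sig: "(sg hvd l s * (x s - h s)) (at01 s)" if s: "s \<in> {0..1}" for s
 proof -
  have y': "(y hvd v s $ 2) (at01 s)" using hvd_vec_nth[OF v[OF s], of 2] by (simp add: gx)
  have "((%s. 2 * x s) hvd 2 * (rh * lxd s)) (at01 s)" by (intro hvd_mult_right x')
  from hvd_quotient[OF y' this] x0
  have "(sg hvd (v s $ 2 * (2 * x s) - y s * (2 * (l s * y s))) / (2 * x s)^2) (at01 s)" unfolding sg_def l1(1)[OF s] by simp
  moreover have "(v s $ 2 * (2 * x s) - y s * (2 * (l s * y s))) / (2 * x s)^2 = l s * (x s - h s)"
  proof -
   have eq: "x s - h s = dcubic base_pt (x s) / (4 * x s) - y s ^ 2 / (2 * x s ^ 2)"
    unfolding h_def ptg hfun_eq[OF cc[OF s] x0] by simp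
   then have "l s * (x s - h s) = (l s * dcubic base_pt (x s)) / (4 * x s) - l s * y s ^ 2 / (2 * x s ^ 2)"
    by (simp only: eq right_diff_distrib times_divide_eq_right)
   also have "\<dots> = (v s $ 2 * (2 * x s) - y s * (2 * (l s * y s))) / (2 * x s)^2"
    unfolding l1(2)[OF s] using x0[of s] by (simp add: field_simps power2_eq_square)
   finally show ?thesis by simp
  qed
  ultimately show ?thesis by simp
 qed
 have "sg 0 = sg 1" by (simp add: sg_def x_def y_def lx_def lc_def lw_ends)
 then have s0: "((%s. l s * (x s - h s)) has_integral 0) {0..1}"
  using fundamental_theorem_of_calculus[of 0 1 sg "%s. l s * (x s - h s)"] sig by simp
 have I0: "(l has_integral - (ka * of_real pi * \<i>) * integral {0..1} (%s. 1 / lc s)) {0..1}"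
 proof (rule has_integral_eq)
  show "((%s. - (ka * of_real pi * \<i>) * (1 / lc s)) has_integral - (ka * of_real pi * \<i>) * integral {0..1} (%s. 1 / lc s)) {0..1}"
   by (intro has_integral_mult_right integrable_integral integrable_continuous_interval continuous_intros continuous_on_lc ballI lc_props(3))
 qed (simp add: l)
 have I1: "((%s. l s * x s) has_integral - (rh * ka * of_real pi * \<i>) * integral {0..1} (%s. lx s / lc s)) {0..1}"
 proof (rule has_integral_eq)
  show "((%s. - (rh * ka * of_real pi * \<i>) * (lx s / lc s)) has_integral - (rh * ka * of_real pi * \<i>) * integral {0..1} (%s. lx s / lc s)) {0..1}"
   by (intro has_integral_mult_right integrable_integral integrable_continuous_interval continuous_intros continuous_on_lc ballI lc_props(3))
 qed (simp add: l x_def)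
 have I2: "((%s. h s * l s) has_integral - (rh * ka * of_real pi * \<i>) * integral {0..1} (%s. lx s / lc s)) {0..1}"
  using has_integral_diff[OF I1 s0] by (rule has_integral_eq_rhs[OF has_integral_eq[rotated]]) (simp_all add: algebra_simps)
 have P: "path_integral base_pt (%_. 1) ga = - (ka * of_real pi * \<i>) * integral {0..1} (%s. 1 / lc s)"
  "path_integral base_pt (hfun 0 base_pt) ga = - (rh * ka * of_real pi * \<i>) * integral {0..1} (%s. lx s / lc s)"
  using integral_unique[OF I0] integral_unique[OF I2] unfolding path_integral_def l_def h_def v_def by simp_all
 have "ga 0 = ga 1" by (simp add: g lx_def lc_def lw_ends)
 then have m: "!!F. boundary_sum F [(1, ga)] = 0 * (F (Some (base_pt $ 1, base_pt $ 2)) - F None)" by (simp add: boundary_sum_def)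
 have e: "base_pt $ 1 ~= 0" by (simp add: base_pt)
 have "period base_pt [(1, ga)] (cls base_pt z) = z $ 1 * (- 0) + z $ 2 * chain_integral base_pt (%_. 1) [(1, ga)] +
   z $ 3 * (- 0 * kap 0 base_pt + base_pt $ 4 * chain_integral base_pt (%_. 1) [(1, ga)] + chain_integral base_pt (hfun 0 base_pt) [(1, ga)])"
  by (rule period_cls[OF base_pt(6) e c _ m]) (use U in auto)
 then show ?thesis by (simp add: chain_integral_def P base_pt)
qed

text \<open>The path x = a/s^2 starts at O for s = 0 and ends at P. With X = a s and Z = s^3 the
  square of the remaining coordinate is s^6 f(a/s^2), a polynomial in s, so nothing is singular at
  O.\<close>

lemma OP_family:
 "\<exists>V Ga. open V & base_pt \<in> V & V <= TT & cycle_family V [(1, Ga)] &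
   pt (Ga base_pt 0) = None & pt (Ga base_pt 1) = Some (base_pt $ 1, base_pt $ 2)"
proof -
 define X where "X z = fst z $ 1 * of_real (snd z)" for z :: "param \<times> real"
 define Z where "Z z = complex_of_real (snd z) ^ 3" for z :: "param \<times> real"
 define B where "B z = fst z $ 2" for z :: "param \<times> real"
 define F where "F z = 4 * (fst z $ 1)^3 - fst z $ 5 * fst z $ 1 * of_real (snd z) ^ 4 - t3 (fst z) * of_real (snd z) ^ 6"
  for z :: "param \<times> real"
 define Ga where "Ga t s = (vector [X (t, s), B (t, s) * csqrt (F (t, s) / B (t, s)^2), Z (t, s)] :: complex ^ 3)" for t s
 have ends: "pt (Ga t 0) = None" "B (t, 1) ~= 0 ==> pt (Ga t 1) = Some (t $ 1, t $ 2)" for t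
 proof -
  show "pt (Ga t 0) = None" by (simp add: Ga_def pt_def Z_def)
  assume b: "B (t, 1) ~= 0"
  have "F (t, 1) = B (t, 1)^2" by (simp add: F_def B_def t3_def)
  then show "pt (Ga t 1) = Some (t $ 1, t $ 2)" using b by (simp add: Ga_def pt_def) (simp add: X_def Z_def B_def)
 qed
 have pw: "((%s. complex_of_real s ^ n) hvd of_nat n * of_real s ^ (n - 1)) (at s within S)" for n s S
  by (rule has_vector_derivative_real_field) (auto intro!: derivative_eq_intros)
 have "\<exists>V. open V & base_pt \<in> V & V <= TT & cycle_family V [(1, Ga)]" unfolding Ga_def
 proof (rule sqrt_cycle_family[where Zs = "%z. of_nat 3 * complex_of_real (snd z) ^ (3 - 1)" and Xs = "%z. fst z $ 1"
    and Fs = "%z. 0 - fst z $ 5 * fst z $ 1 * (of_nat 4 * complex_of_real (snd z) ^ (4 - 1)) - t3 (fst z) * (of_nat 6 * complex_of_real (snd z) ^ (6 - 1))"])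
  show "open TT" by (rule open_TT)
  show "base_pt \<in> TT" by (rule base_pt)
  show "C1fun (TT \<times> {0..1}) X" "C1fun (TT \<times> {0..1}) Z" "C1fun (TT \<times> {0..1}) B" "C1fun (TT \<times> {0..1}) F"
   "C1fun (TT \<times> {0..1}) (%z. fst z $ 1)" "C1fun (TT \<times> {0..1}) (%z. of_nat 3 * complex_of_real (snd z) ^ (3 - 1))"
   "C1fun (TT \<times> {0..1}) (%z. 0 - fst z $ 5 * fst z $ 1 * (of_nat 4 * complex_of_real (snd z) ^ (4 - 1)) - t3 (fst z) * (of_nat 6 * complex_of_real (snd z) ^ (6 - 1)))"
   unfolding X_def Z_def B_def F_def by (intro C1fun_intros)+
  show "((%s. X (t, s)) hvd fst (t, s) $ 1) (at01 s)" for t s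
   using hvd_mult_right[OF pw[of 1 s "{0..1}"], of "t $ 1"] by (simp add: X_def)
  show "((%s. Z (t, s)) hvd of_nat 3 * of_real (snd (t, s)) ^ (3 - 1)) (at01 s)" for t s unfolding Z_def snd_conv by (rule pw)
  show "((%s. F (t, s)) hvd 0 - fst (t, s) $ 5 * fst (t, s) $ 1 * (of_nat 4 * of_real (snd (t, s)) ^ (4 - 1))
    - t3 (fst (t, s)) * (of_nat 6 * of_real (snd (t, s)) ^ (6 - 1))) (at01 s)" for t s unfolding F_def fst_conv snd_conv
   by (intro hvd_diff hvd_const hvd_mult_right pw)
  show "B (base_pt, s) ~= 0 & Re (F (base_pt, s) / B (base_pt, s)^2) > 0" if s: "s \<in> {0..1}" for s
  proof -
   \<comment> \<open>Here a = 2, t_2 = 4 and t_3 = 0; the quotient is at least 1 on the unit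
     interval.\<close>
   have "F (base_pt, s) / B (base_pt, s)^2 = of_real ((32 - 8 * s ^ 4) / 24)" by (simp add: F_def B_def base_pt)
   moreover have "s ^ 4 \<le> 1" using s by (intro power_le_one) auto
   ultimately show ?thesis by (simp add: B_def base_pt)
  qed
  show "on_cone t (vector [X (t, s), y, Z (t, s)])" if "y^2 = F (t, s)" "y ~= 0" for t s y
   using that by (simp add: on_cone_def vec_eq_iff forall_3) (simp add: F_def X_def Z_def algebra_simps eval_nat_numeral)
  show "pt (vector [X (t, 0), B (t, 0) * csqrt (F (t, 0) / B (t, 0)^2), Z (t, 0)]) =
    pt (vector [X (t, 1), B (t, 1) * csqrt (F (t, 1) / B (t, 1)^2), Z (t, 1)]) \<or>
   {pt (vector [X (t, 0), B (t, 0) * csqrt (F (t, 0) / B (t, 0)^2), Z (t, 0)]),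
    pt (vector [X (t, 1), B (t, 1) * csqrt (F (t, 1) / B (t, 1)^2), Z (t, 1)])} <= YY t" if "B (t, 1) ~= 0" for t
   using ends[of t] that unfolding Ga_def YY_def by simp
 qed auto
 then show ?thesis using ends[of base_pt] by (auto simp: B_def base_pt)
qed

lemma cycle_family_subset: "cycle_family V c ==> open V' ==> V' <= V ==> cycle_family V' c"
 unfolding cycle_family_def C1_on_eq case_prod_unfold by (meson C1fun_subset Sigma_mono order_refl subset_iff)

text \<open>The loops have no boundary, so the first coordinate does not enter. Continuity of the
  other two periods will carry independence to nearby parameters.\<close>

lemma loop_periods:
 assumes r: "rh^2 = 1" "ka^2 = rh"
 obtains c p2 p3 where "eventually (%t. \<forall>z. period t (at_param c t) (cls t z) = z $ 2 * p2 t + z $ 3 * p3 t) (nhds base_pt)"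
  "isCont p2 base_pt" "isCont p3 base_pt"
  "p2 base_pt = - (ka * of_real pi * \<i>) * integral {0..1} (%s. 1 / lc s)"
  "p3 base_pt = - (rh * ka * of_real pi * \<i>) * integral {0..1} (%s. lx s / lc s)"
  "\<exists>V. open V & base_pt \<in> V & cycle_family V c"
proof -
 obtain V Ga where V: "open V" "base_pt \<in> V" and c: "cycle_family V [(1, Ga)]"
  and G: "!!s. Ga base_pt s = vector [rh * lx s, ka * (lw s / 4 - lw' s) * lc s, 1]" using loop_family[OF r] by blast
 obtain pi1 pi2 pi3 D2 D3 where
  ev: "eventually (%t. t \<in> V & (\<forall>z. period t (at_param [(1, Ga)] t) (cls t z) = z $ 1 * pi1 + z $ 2 * pi2 t + z $ 3 * pi3 t)) (nhds base_pt)"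
  and d: "(pi2 has_derivative D2) (at base_pt)" "(pi3 has_derivative D3) (at base_pt)"
  by (rule period_variation[OF c V(2)]) (rule that, assumption+)
 have "rel_chain base_pt [(1, Ga base_pt)]" using cycle_family_rel_chain[OF c V(2)] by (simp add: at_param_def)
 note per = loop_period[OF r this G]
 have eq: "z $ 1 * pi1 + z $ 2 * pi2 base_pt + z $ 3 * pi3 base_pt =
   z $ 2 * (- (ka * of_real pi * \<i>) * integral {0..1} (%s. 1 / lc s))
   + z $ 3 * (- (rh * ka * of_real pi * \<i>) * integral {0..1} (%s. lx s / lc s))" for z :: "complex ^ 3"
 proof -
  have "period base_pt [(1, Ga base_pt)] (cls base_pt z) = z $ 1 * pi1 + z $ 2 * pi2 base_pt + z $ 3 * pi3 base_pt"
   using eventually_nhds_x_imp_x[OF ev] by (simp add: at_param_def)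
  then show ?thesis using per[of z] by simp
 qed
 have p1: "pi1 = 0" using eq[of "axis 1 1"] by (simp add: axis_def)
 show thesis
 proof (rule that[of "[(1, Ga)]" pi2 pi3])
  show "eventually (%t. \<forall>z. period t (at_param [(1, Ga)] t) (cls t z) = z $ 2 * pi2 t + z $ 3 * pi3 t) (nhds base_pt)"
   using ev unfolding p1 by (rule eventually_mono) simp
  show "isCont pi2 base_pt" "isCont pi3 base_pt" using d by (auto dest: has_derivative_continuous)
  show "pi2 base_pt = - (ka * of_real pi * \<i>) * integral {0..1} (%s. 1 / lc s)" using eq[of "axis 2 1"] by (simp add: axis_def)
  show "pi3 base_pt = - (rh * ka * of_real pi * \<i>) * integral {0..1} (%s. lx s / lc s)"
   using eq[of "axis 3 1"] by (simp add: axis_def)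
  show "\<exists>V. open V & base_pt \<in> V & cycle_family V [(1, Ga)]" using V c by blast
 qed
qed

lemma OP_periods:
 obtains c pi2 pi3 where
  "eventually (%t. \<forall>z. period t (at_param c t) (cls t z) = - (z $ 1) + z $ 2 * pi2 t + z $ 3 * pi3 t) (nhds base_pt)"
  "\<exists>V. open V & base_pt \<in> V & cycle_family V c"
proof -
 obtain V Ga where V: "open V" "base_pt \<in> V" and c: "cycle_family V [(1, Ga)]"
  and G: "pt (Ga base_pt 0) = None" "pt (Ga base_pt 1) = Some (base_pt $ 1, base_pt $ 2)" using OP_family by blast
 obtain pi1 pi2 pi3 D2 D3 where
  ev: "eventually (%t. t \<in> V & (\<forall>z. period t (at_param [(1, Ga)] t) (cls t z) = z $ 1 * pi1 + z $ 2 * pi2 t + z $ 3 * pi3 t)) (nhds base_pt)"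
  and d: "(pi2 has_derivative D2) (at base_pt)" "(pi3 has_derivative D3) (at base_pt)"
  by (rule period_variation[OF c V(2)]) (rule that, assumption+)
 have rc: "rel_chain base_pt [(1, Ga base_pt)]" using cycle_family_rel_chain[OF c V(2)] by (simp add: at_param_def)
 obtain e where e: "e ~= base_pt $ 1" and "!!ga s. ga \<in> {Ga base_pt} ==> s \<in> {0..1} ==> pt (ga s) \<in> U_frame e base_pt"
  using ex_frame_avoiding[of "{Ga base_pt}" base_pt "base_pt $ 1" thesis] rc by (auto simp: rel_chain_def)
 then have U: "pt (ga s) \<in> U_frame e base_pt" if "(n, ga) \<in> set [(1::int, Ga base_pt)]" "s \<in> {0..1}" for n ga s
  using that by simp
 have m: "boundary_sum F [(1, Ga base_pt)] = 1 * (F (Some (base_pt $ 1, base_pt $ 2)) - F None)" for F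
  by (simp add: boundary_sum_def G)
 have "period base_pt [(1, Ga base_pt)] (cls base_pt (axis 1 1)) = - 1"
  by (subst period_cls[where m = 1 and e = e, OF base_pt(6) not_sym[OF e] rc]; (blast intro: U | simp add: m axis_def))
 moreover have "period base_pt [(1, Ga base_pt)] (cls base_pt (axis 1 1)) = pi1"
  using eventually_nhds_x_imp_x[OF ev] by (simp add: at_param_def axis_def)
 ultimately have p1: "pi1 = - 1" by simp
 show thesis
 proof (rule that[of "[(1, Ga)]" pi2 pi3])
  show "eventually (%t. \<forall>z. period t (at_param [(1, Ga)] t) (cls t z) = - (z $ 1) + z $ 2 * pi2 t + z $ 3 * pi3 t) (nhds base_pt)"
   using ev unfolding p1 by (rule eventually_mono) simp
  show "\<exists>V. open V & base_pt \<in> V & cycle_family V [(1, Ga)]" using V c by blast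
 qed
qed

text \<open>The automorphism multiplies the periods of dx/y and x dx/y by \<i> and -\<i>, so the
  determinant of the two loops at the base parameter is 2 pi^2 \<i> \<open>J0\<close>
  \<open>J1\<close>, which is non-zero. The path from O to P then detects the first
  coordinate.\<close>

lemma nondegenerate_cycles:
 "\<exists>V cs. open V & V ~= {} & V <= TT & (\<forall>c\<in>cs. cycle_family V c) &
   (\<forall>t\<in>V. \<forall>z. (\<forall>c\<in>cs. period t (at_param c t) (cls t z) = 0) --> z = 0)"
proof -
 define J0 J1 where "J0 = integral {0..1} (%s. 1 / lc s)" and "J1 = integral {0..1} (%s. lx s / lc s)"
 have J: "J0 ~= 0" "J1 ~= 0" using integrals_nonzero by (simp_all add: J0_def J1_def)
 obtain cA a2 a3 where A: "eventually (%t. \<forall>z. period t (at_param cA t) (cls t z) = z $ 2 * a2 t + z $ 3 * a3 t) (nhds base_pt)"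
  "isCont a2 base_pt" "isCont a3 base_pt" "a2 base_pt = - (1 * of_real pi * \<i>) * J0" "a3 base_pt = - (1 * 1 * of_real pi * \<i>) * J1"
  "\<exists>V. open V & base_pt \<in> V & cycle_family V cA"
  by (rule loop_periods[of 1 1, folded J0_def J1_def]) (simp, simp, rule that)
 obtain cB b2 b3 where B: "eventually (%t. \<forall>z. period t (at_param cB t) (cls t z) = z $ 2 * b2 t + z $ 3 * b3 t) (nhds base_pt)"
  "isCont b2 base_pt" "isCont b3 base_pt" "b2 base_pt = - (\<i> * of_real pi * \<i>) * J0" "b3 base_pt = - (- 1 * \<i> * of_real pi * \<i>) * J1"
  "\<exists>V. open V & base_pt \<in> V & cycle_family V cB"
  by (rule loop_periods[of "- 1" \<i>, folded J0_def J1_def]) (simp, simp, rule that)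
 obtain cC d2 d3 where C: "eventually (%t. \<forall>z. period t (at_param cC t) (cls t z) = - (z $ 1) + z $ 2 * d2 t + z $ 3 * d3 t) (nhds base_pt)"
  "\<exists>V. open V & base_pt \<in> V & cycle_family V cC" by (rule OP_periods)
 define D where "D t = a2 t * b3 t - b2 t * a3 t" for t
 have "D base_pt = 2 * (of_real pi)^2 * \<i> * (J0 * J1) * (- (\<i> * \<i>))"
  unfolding D_def A(4,5) B(4,5) by (simp add: algebra_simps power2_eq_square)
 then have "D base_pt ~= 0" using J by simp
 moreover have "isCont D base_pt" unfolding D_def by (intro continuous_intros A B)
 ultimately have D: "eventually (%t. D t ~= 0) (nhds base_pt)"
  using tendsto_imp_eventually_ne[of D "D base_pt" "nhds base_pt" 0] by (simp add: isCont_def tendsto_nhds_iff)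
 obtain VA VB VC where W: "open VA" "base_pt \<in> VA" "cycle_family VA cA" "open VB" "base_pt \<in> VB" "cycle_family VB cB"
  "open VC" "base_pt \<in> VC" "cycle_family VC cC" using A(6) B(6) C(2) by blast
 have "eventually (%t. t \<in> VA \<inter> VB \<inter> VC) (nhds base_pt)" using W by (intro eventually_nhds_in_open) auto
 with A(1) B(1) C(1) D
 have "eventually (%t. t \<in> VA \<inter> VB \<inter> VC & (\<forall>z. (\<forall>c\<in>{cA, cB, cC}. period t (at_param c t) (cls t z) = 0) --> z = 0)) (nhds base_pt)"
 proof eventually_elim
  case (elim t)
  have "z = 0" if z: "\<forall>c\<in>{cA, cB, cC}. period t (at_param c t) (cls t z) = 0" for z
  proof -
   have e: "z $ 2 * a2 t + z $ 3 * a3 t = 0" "z $ 2 * b2 t + z $ 3 * b3 t = 0" "- (z $ 1) + z $ 2 * d2 t + z $ 3 * d3 t = 0"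
    using z elim(1-3) by auto
   have "z $ 2 * D t = (z $ 2 * a2 t + z $ 3 * a3 t) * b3 t - (z $ 2 * b2 t + z $ 3 * b3 t) * a3 t"
    "z $ 3 * D t = a2 t * (z $ 2 * b2 t + z $ 3 * b3 t) - b2 t * (z $ 2 * a2 t + z $ 3 * a3 t)"
    by (simp_all add: D_def algebra_simps)
   then have "z $ 2 = 0" "z $ 3 = 0" unfolding e using elim(4) by simp_all
   moreover from this have "z $ 1 = 0" using e(3) by simp
   ultimately show ?thesis by (simp add: vec_eq_iff forall_3)
  qed
  then show ?case using elim(5) by blast
 qed
 then obtain V where V: "open V" "base_pt \<in> V"
  "!!t. t \<in> V ==> t \<in> VA \<inter> VB \<inter> VC & (\<forall>z. (\<forall>c\<in>{cA, cB, cC}. period t (at_param c t) (cls t z) = 0) --> z = 0)"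
  unfolding eventually_nhds by blast
 have sub: "V <= VA" "V <= VB" "V <= VC" using V(3) by auto
 have "\<forall>c\<in>{cA, cB, cC}. cycle_family V c"
  using cycle_family_subset[OF W(3) V(1) sub(1)] cycle_family_subset[OF W(6) V(1) sub(2)] cycle_family_subset[OF W(9) V(1) sub(3)] by simp
 moreover have "V <= TT" using sub(1) cycle_family_open(2)[OF W(3)] by blast
 moreover have "\<forall>t\<in>V. \<forall>z. (\<forall>c\<in>{cA, cB, cC}. period t (at_param c t) (cls t z) = 0) --> z = 0" using V(3) by blast
 ultimately show ?thesis using V(1,2) by (intro exI[of _ V] exI[of _ "{cA, cB, cC}"]) blast
qed

section \<open>The Gauss-Manin connection\<close>

text \<open>Row 2 of the matrix yields al, be and mu, row 3 then yields v $ 3 and v $ 4, and the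
  equations of the lift recover the remaining components.\<close>

lemma conn_inject:
 assumes t: "t \<in> TT" and eq: "conn t v = conn t w"
 shows "v = w"
proof -
 have e: "conn t v $ i $ j = conn t w $ i $ j" for i j using eq by simp
 have a: "alpha_of t v = alpha_of t w" using e[of 2 3] by (simp add: conn_entries)
 have b: "beta_of t v = beta_of t w" using e[of 2 2] a by (simp add: conn_entries)
 have m: "mu_of t v = mu_of t w" using e[of 2 1] a by (simp add: conn_entries)
 have "v $ 3 = w $ 3" using e[of 3 1] by (simp add: conn_entries a b m)
 moreover have "v $ 4 = w $ 4" using e[of 3 2] by (simp add: conn_entries a b m)
 moreover have "v $ 1 = w $ 1" using mu_of(1)[OF t, of v] mu_of(1)[OF t, of w] by (simp add: a b m)
 moreover have "v $ 2 = w $ 2" using trans[OF mu_of(2)[OF t, of v, unfolded a b m] mu_of(2)[OF t, of w, symmetric]] by simp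
 moreover have "v $ 5 = w $ 5" using lift_field_of[OF t, of v] lift_field_of[OF t, of w] by (simp add: lift_field_def a b)
 ultimately show ?thesis by (simp add: vec_eq_iff forall_5)
qed

text \<open>Sums over the directions pass through every operation, so linearity in v of an explicit
  formula is proved by rewriting.\<close>

lemma sum_rules:
 fixes v :: param and f g :: "5 => complex"
 shows "(\<Sum>k\<in>UNIV. v $ k * (c * f k)) = c * (\<Sum>k\<in>UNIV. v $ k * f k)"
  "(\<Sum>k\<in>UNIV. v $ k * (f k / c)) = (\<Sum>k\<in>UNIV. v $ k * f k) / c"
  "(\<Sum>k\<in>UNIV. v $ k * (f k + g k)) = (\<Sum>k\<in>UNIV. v $ k * f k) + (\<Sum>k\<in>UNIV. v $ k * g k)"
  "(\<Sum>k\<in>UNIV. v $ k * (f k - g k)) = (\<Sum>k\<in>UNIV. v $ k * f k) - (\<Sum>k\<in>UNIV. v $ k * g k)"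
  "(\<Sum>k\<in>UNIV. v $ k * (f k * c)) = (\<Sum>k\<in>UNIV. v $ k * f k) * c"
  "(\<Sum>k\<in>UNIV. v $ k * (- f k)) = - (\<Sum>k\<in>UNIV. v $ k * f k)" "(\<Sum>k\<in>UNIV. v $ k * 0) = (0::complex)"
  "(\<Sum>k\<in>UNIV. v $ k * (axis k 1 :: param) $ j) = v $ j"
 by (simp_all add: sum_distrib_left sum_distrib_right sum_divide_distrib sum_negf sum_subtractf sum.distrib algebra_simps
   axis_def if_distrib sum.delta cong: if_cong)

lemma param_linear_of:
 "alpha_of t v = (\<Sum>k\<in>UNIV. v $ k * alpha_of t (axis k 1))" "beta_of t v = (\<Sum>k\<in>UNIV. v $ k * beta_of t (axis k 1))"
 "mu_of t v = (\<Sum>k\<in>UNIV. v $ k * mu_of t (axis k 1))"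
proof -
 have d: "dt3 t v = (\<Sum>k\<in>UNIV. v $ k * dt3 t (axis k 1))" by (simp add: sum_5 dt3_def axis_def)
 show a: "alpha_of t v = (\<Sum>k\<in>UNIV. v $ k * alpha_of t (axis k 1))" unfolding alpha_of_def sum_rules d[symmetric] ..
 show b: "beta_of t v = (\<Sum>k\<in>UNIV. v $ k * beta_of t (axis k 1))" unfolding beta_of_def sum_rules d[symmetric] ..
 have psi: "psi0 al be x y = (- 3 * x * y) * al + (3 * y) * be" for al be x y by (simp add: psi0_def mult_ac)
 have xi: "xi0 t al be x = (- 2 * x^2 + t $ 5 / 3) * al + (2 * x) * be" for al be x by (simp add: xi0_def mult_ac)
 show "mu_of t v = (\<Sum>k\<in>UNIV. v $ k * mu_of t (axis k 1))"
  unfolding mu_of_def xi psi sum_rules a[symmetric] b[symmetric] ..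
qed

lemma conn_linear: "conn t v $ i $ j = (\<Sum>k\<in>UNIV. v $ k * conn t (axis k 1) $ i $ j)"
proof -
 note rules = conn_entries sum_rules param_linear_of[of t v, symmetric]
 have "conn t v $ 1 $ j = (\<Sum>k\<in>UNIV. v $ k * conn t (axis k 1) $ 1 $ j)" for j unfolding rules ..
 moreover have "conn t v $ 2 $ 1 = (\<Sum>k\<in>UNIV. v $ k * conn t (axis k 1) $ 2 $ 1)"
  "conn t v $ 2 $ 2 = (\<Sum>k\<in>UNIV. v $ k * conn t (axis k 1) $ 2 $ 2)"
  "conn t v $ 2 $ 3 = (\<Sum>k\<in>UNIV. v $ k * conn t (axis k 1) $ 2 $ 3)"
  "conn t v $ 3 $ 1 = (\<Sum>k\<in>UNIV. v $ k * conn t (axis k 1) $ 3 $ 1)"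
  "conn t v $ 3 $ 2 = (\<Sum>k\<in>UNIV. v $ k * conn t (axis k 1) $ 3 $ 2)"
  "conn t v $ 3 $ 3 = (\<Sum>k\<in>UNIV. v $ k * conn t (axis k 1) $ 3 $ 3)" unfolding rules by (rule refl)+
 ultimately show ?thesis using exhaust_3[of i] exhaust_3[of j] by auto
qed

lemma reg_dt3: "reg (%t. dt3 t v)" unfolding dt3_def by (intro reg_intros)

lemma reg_of: "reg (%t. alpha_of t v)" "reg (%t. beta_of t v)" "reg (%t. mu_of t v)"
proof -
 show 1: "reg (%t. alpha_of t v)" "reg (%t. beta_of t v)" unfolding alpha_of_def beta_of_def by (intro reg_intros reg_dt3)+
 show "reg (%t. mu_of t v)" unfolding mu_of_def xi0_def psi0_def by (intro reg_intros 1)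
qed

lemma reg_conn: "reg (%t. conn t v $ i $ j)"
proof -
 have "reg (%t. conn t v $ 1 $ j)" for j unfolding conn_entries by (rule reg_const)
 moreover have "reg (%t. conn t v $ 2 $ 1)" "reg (%t. conn t v $ 2 $ 2)" "reg (%t. conn t v $ 2 $ 3)"
  "reg (%t. conn t v $ 3 $ 1)" "reg (%t. conn t v $ 3 $ 2)" "reg (%t. conn t v $ 3 $ 3)"
  unfolding conn_entries by (intro reg_intros reg_of)+
 ultimately show ?thesis using exhaust_3[of i] exhaust_3[of j] by auto
qed

section \<open>Sections in coordinates\<close>

definition sec :: "(3 => param => complex) => param => dR_class" where
 "sec f = (\<lambda>t\<in>TT. cls t (\<chi> i. f i t))"

lemma sections_eq: "sections = {sec f | f. \<forall>i. f i \<in> regT}"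
proof -
 have "(\<lambda>t\<in>TT. \<Oplus>\<^bsub>H1dR t\<^esub> i\<in>UNIV. f i t \<odot>\<^bsub>H1dR t\<^esub> frame i t) = sec f" for f
  unfolding sec_def by (rule restrict_cong_simple) (rule finsum_frame)
 then show ?thesis unfolding sections_def by auto
qed

lemma sec_cong: "(!!i t. t \<in> TT ==> f i t = g i t) ==> sec f = sec g" unfolding sec_def by (rule restrict_cong_simple) simp

lemma sec_in_sections:
 assumes "!!i. reg (f i)"
 shows "sec f \<in> sections"
proof -
 have "sec f = sec (%i. \<lambda>t\<in>TT. f i t)" by (rule sec_cong) simp
 then show ?thesis using assms unfolding sections_eq reg_def by blast
qed

lemma period_linear:
 assumes c: "cycle_family V c" and t: "t \<in> V"
 shows "period t (at_param c t) (cls t (z - z')) = period t (at_param c t) (cls t z) - period t (at_param c t) (cls t z')"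
proof -
 obtain pi1 pi2 pi3 D2 D3 where
  ev: "eventually (%t. t \<in> V & (\<forall>z. period t (at_param c t) (cls t z) = z $ 1 * pi1 + z $ 2 * pi2 t + z $ 3 * pi3 t)) (nhds t)"
  by (rule period_variation[OF c t]) (rule that, assumption+)
 then show ?thesis using eventually_nhds_x_imp_x[OF ev] by (simp add: algebra_simps)
qed

lemma sec_determined:
 assumes r: "!!i. reg (f i)" "!!i. reg (g i)" and t: "t \<in> TT"
  and p: "!!V c t. cycle_family V c ==> t \<in> V ==> period t (at_param c t) (sec f t) = period t (at_param c t) (sec g t)"
 shows "f i t = g i t"
proof -
 obtain V cs where V: "open V" "V ~= {}" "V <= TT" "!!c. c \<in> cs ==> cycle_family V c"
  and nd: "!!t z. t \<in> V ==> \<forall>c\<in>cs. period t (at_param c t) (cls t z) = 0 ==> z = 0"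
  using nondegenerate_cycles by blast
 obtain t0 where t0: "t0 \<in> V" using V(2) by blast
 have "reg (%t. f i t - g i t)" by (intro reg_diff r)
 then have d: "(\<lambda>t\<in>TT. f i t - g i t) \<in> regT" by (simp add: reg_def)
 have "(\<lambda>t\<in>TT. f i t - g i t) t = 0"
 proof (rule regT_identity[OF d V(1,3) t0 _ t])
  fix s assume s: "s \<in> V"
  have sT: "s \<in> TT" using s V(3) by blast
  have "(\<chi> i. f i s) - (\<chi> i. g i s) = (0 :: complex ^ 3)"
  proof (rule nd[OF s], rule ballI)
   fix c assume c: "c \<in> cs"
   show "period s (at_param c s) (cls s ((\<chi> i. f i s) - (\<chi> i. g i s))) = 0"
    using p[OF V(4)[OF c] s] sT unfolding period_linear[OF V(4)[OF c] s] by (simp add: sec_def)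
  qed
  then have "((\<chi> i. f i s) - (\<chi> i. g i s) :: complex ^ 3) $ i = 0" by simp
  then show "(\<lambda>t\<in>TT. f i t - g i t) s = 0" using sT by simp
 qed
 then show ?thesis using t by simp
qed

lemma sec_eqD:
 assumes "!!i. reg (f i)" "!!i. reg (g i)" "sec f = sec g" "t \<in> TT"
 shows "f i t = g i t" by (rule sec_determined) (use assms in auto)

lemma sec_inject:
 assumes f: "!!i. f i \<in> regT" and g: "!!i. g i \<in> regT" and eq: "sec f = sec g"
 shows "f = g"
proof
 fix i
 show "f i = g i" by (rule extensionalityI[OF regT_extensional[OF f] regT_extensional[OF g]])
   (rule sec_eqD[OF reg_regT[OF f] reg_regT[OF g] eq])
qed

text \<open>Recovers the coordinates of a section from its values; the choice is unique by
  \<open>sec_inject\<close>.\<close>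

definition coef :: "(param => dR_class) => 3 => param => complex" where
 "coef s = (SOME f. (\<forall>i. f i \<in> regT) & s = sec f)"

lemma coef_sec: "(!!i. f i \<in> regT) ==> coef (sec f) = f" unfolding coef_def by (rule some_equality) (auto intro: sec_inject)

text \<open>The operator d plus connection matrix in the frame: the j-th coordinate of the
  derivative is df_j plus the sum of f_i times the (i, j) entry, taken in the k-th coordinate
  direction.\<close>

definition gmc :: connection where
 "gmc = (\<lambda>s\<in>sections. %k. sec (%j t. partialT k (coef s j) t + (\<Sum>i\<in>UNIV. coef s i t * conn t (axis k 1) $ i $ j)))"

lemma gmc_sec:
 assumes "!!i. f i \<in> regT"
 shows "gmc (sec f) k = sec (%j t. partialT k (f j) t + (\<Sum>i\<in>UNIV. f i t * conn t (axis k 1) $ i $ j))"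
proof -
 have "sec f \<in> sections" using assms unfolding sections_eq by blast
 then show ?thesis by (simp add: gmc_def coef_sec[OF assms])
qed

lemma reg_gmc:
 assumes f: "!!i. f i \<in> regT"
 shows "reg (%t. partialT k (f j) t + (\<Sum>i\<in>UNIV. f i t * conn t (axis k 1) $ i $ j))"
 by (intro reg_add reg_sum reg_mult reg_conn reg_regT f partialT_regT(1))

lemma partialT_add:
 assumes f: "f \<in> regT" and g: "g \<in> regT" and t: "t \<in> TT"
 shows "partialT k (\<lambda>t\<in>TT. f t + g t) t = partialT k f t + partialT k g t"
proof (rule partialT_eq[OF _ t])
 have "((%t. f t + g t) has_derivative (%v. (\<Sum>k\<in>UNIV. v $ k * partialT k f t) + (\<Sum>k\<in>UNIV. v $ k * partialT k g t))) (at t)"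
  by (intro has_derivative_add partialT_regT(2) f g t)
 then show "((\<lambda>t\<in>TT. f t + g t) has_derivative (%v. \<Sum>k\<in>UNIV. v $ k * (partialT k f t + partialT k g t))) (at t)"
  by (simp add: has_derivative_restrict_TT[OF t] distrib_left sum.distrib)
qed

lemma partialT_mult:
 assumes f: "f \<in> regT" and g: "g \<in> regT" and t: "t \<in> TT"
 shows "partialT k (\<lambda>t\<in>TT. f t * g t) t = partialT k f t * g t + f t * partialT k g t"
proof (rule partialT_eq[OF _ t])
 have "((%t. f t * g t) has_derivative (%v. f t * (\<Sum>k\<in>UNIV. v $ k * partialT k g t) + (\<Sum>k\<in>UNIV. v $ k * partialT k f t) * g t)) (at t)"
  by (intro has_derivative_mult partialT_regT(2) f g t)
 then show "((\<lambda>t\<in>TT. f t * g t) has_derivative (%v. \<Sum>k\<in>UNIV. v $ k * (partialT k f t * g t + f t * partialT k g t))) (at t)"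
  by (simp add: has_derivative_restrict_TT[OF t] distrib_left sum.distrib sum_distrib_left sum_distrib_right mult_ac add_ac)
qed

lemma is_connection_gmc: "is_connection gmc" unfolding is_connection_def
proof (intro conjI ballI allI)
 show "gmc \<in> extensional sections" by (simp add: gmc_def)
next
 fix s k assume "s \<in> sections"
 then obtain f where f: "!!i. f i \<in> regT" "s = sec f" unfolding sections_eq by blast
 show "gmc s k \<in> sections" unfolding f(2) gmc_sec[OF f(1)] by (rule sec_in_sections) (rule reg_gmc[OF f(1)])
next
 fix s s' k t assume "s \<in> sections" "s' \<in> sections" and t: "t \<in> TT"
 then obtain f g where f: "!!i. f i \<in> regT" "s = sec f" and g: "!!i. g i \<in> regT" "s' = sec g"
  unfolding sections_eq by blast
 define h where "h i = (\<lambda>t\<in>TT. f i t + g i t)" for i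
 have h: "h i \<in> regT" for i unfolding h_def by (rule regT.add[OF f(1) g(1)])
 have "(\<lambda>t\<in>TT. s t \<oplus>\<^bsub>H1dR t\<^esub> s' t) = sec h" unfolding sec_def f(2) g(2)
  by (rule restrict_cong_simple) (simp add: cls_add h_def vec_eq_iff plus_vec_def)
 then have "gmc (\<lambda>t\<in>TT. s t \<oplus>\<^bsub>H1dR t\<^esub> s' t) k t = sec (%j t. partialT k (h j) t + (\<Sum>i\<in>UNIV. h i t * conn t (axis k 1) $ i $ j)) t"
  by (simp only: gmc_sec[OF h])
 also have "\<dots> = gmc s k t \<oplus>\<^bsub>H1dR t\<^esub> gmc s' k t" unfolding f(2) g(2) gmc_sec[OF f(1)] gmc_sec[OF g(1)]
  using t by (simp add: sec_def cls_add plus_vec_def h_def partialT_add[OF f(1) g(1) t] distrib_right sum.distrib add_ac)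
 finally show "gmc (\<lambda>t\<in>TT. s t \<oplus>\<^bsub>H1dR t\<^esub> s' t) k t = gmc s k t \<oplus>\<^bsub>H1dR t\<^esub> gmc s' k t" .
next
 fix f s k t assume f: "f \<in> regT" and "s \<in> sections" and t: "t \<in> TT"
 then obtain g where g: "!!i. g i \<in> regT" "s = sec g" unfolding sections_eq by blast
 define h where "h i = (\<lambda>t\<in>TT. f t * g i t)" for i
 have h: "h i \<in> regT" for i unfolding h_def by (rule regT.mult[OF f g(1)])
 have "(\<lambda>t\<in>TT. f t \<odot>\<^bsub>H1dR t\<^esub> s t) = sec h" unfolding sec_def g(2)
  by (rule restrict_cong_simple) (simp add: cls_smult h_def vec_eq_iff vector_scalar_mult_def)
 then have "gmc (\<lambda>t\<in>TT. f t \<odot>\<^bsub>H1dR t\<^esub> s t) k t = sec (%j t. partialT k (h j) t + (\<Sum>i\<in>UNIV. h i t * conn t (axis k 1) $ i $ j)) t"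
  by (simp only: gmc_sec[OF h])
 also have "\<dots> = partialT k f t \<odot>\<^bsub>H1dR t\<^esub> s t \<oplus>\<^bsub>H1dR t\<^esub> f t \<odot>\<^bsub>H1dR t\<^esub> gmc s k t"
  unfolding g(2) gmc_sec[OF g(1)]
  using t by (simp add: sec_def cls_add cls_smult plus_vec_def vector_scalar_mult_def h_def partialT_mult[OF f g(1) t]
    distrib_left sum_distrib_left mult.assoc add.assoc)
 finally show "gmc (\<lambda>t\<in>TT. f t \<odot>\<^bsub>H1dR t\<^esub> s t) k t = partialT k f t \<odot>\<^bsub>H1dR t\<^esub> s t \<oplus>\<^bsub>H1dR t\<^esub> f t \<odot>\<^bsub>H1dR t\<^esub> gmc s k t" .
qed

text \<open>Product rule for the sum of f_i times the i-th period; linearity of \<open>conn\<close>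
  in v then regroups the terms by coordinate directions.\<close>

lemma gmc_period_derivative:
 assumes f: "!!i. f i \<in> regT" and c: "cycle_family V c" and t0: "t0 \<in> V"
 shows "((%t. period t (at_param c t) (sec f t)) has_derivative
   (%v. \<Sum>k\<in>UNIV. v $ k * period t0 (at_param c t0) (gmc (sec f) k t0))) (at t0)"
proof -
 have t0T: "t0 \<in> TT" using cycle_family_open(2)[OF c] t0 by blast
 obtain pi1 pi2 pi3 D2 D3 where
  ev: "eventually (%t. t \<in> V & (\<forall>z. period t (at_param c t) (cls t z) = z $ 1 * pi1 + z $ 2 * pi2 t + z $ 3 * pi3 t)) (nhds t0)"
  and d: "(pi2 has_derivative D2) (at t0)" "(pi3 has_derivative D3) (at t0)"
  and D2: "!!v. D2 v = conn t0 v $ 2 $ 1 * pi1 + conn t0 v $ 2 $ 2 * pi2 t0 + conn t0 v $ 2 $ 3 * pi3 t0"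
  and D3: "!!v. D3 v = conn t0 v $ 3 $ 1 * pi1 + conn t0 v $ 3 $ 2 * pi2 t0 + conn t0 v $ 3 $ 3 * pi3 t0"
  by (rule period_variation[OF c t0]) (rule that, assumption+)
 have per: "period t0 (at_param c t0) (cls t0 z) = z $ 1 * pi1 + z $ 2 * pi2 t0 + z $ 3 * pi3 t0" for z
  using eventually_nhds_x_imp_x[OF ev] by blast
 define df where "df i v = (\<Sum>k\<in>UNIV. v $ k * partialT k (f i) t0)" for i v
 have df: "(f i has_derivative df i) (at t0)" for i unfolding df_def by (rule partialT_regT(2)[OF f t0T])
 have "((%t. f 1 t * pi1 + f 2 t * pi2 t + f 3 t * pi3 t) has_derivative
   (%v. (f 1 t0 * 0 + df 1 v * pi1) + (f 2 t0 * D2 v + df 2 v * pi2 t0) + (f 3 t0 * D3 v + df 3 v * pi3 t0))) (at t0)"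
  by (intro has_derivative_add has_derivative_mult df d has_derivative_const)
 moreover have "(f 1 t0 * 0 + df 1 v * pi1) + (f 2 t0 * D2 v + df 2 v * pi2 t0) + (f 3 t0 * D3 v + df 3 v * pi3 t0) =
   (\<Sum>k\<in>UNIV. v $ k * period t0 (at_param c t0) (gmc (sec f) k t0))" for v
 proof -
  have "(\<Sum>k\<in>UNIV. v $ k * period t0 (at_param c t0) (gmc (sec f) k t0)) =
   (\<Sum>k\<in>UNIV. v $ k * ((partialT k (f 1) t0 + (\<Sum>i\<in>UNIV. f i t0 * conn t0 (axis k 1) $ i $ 1)) * pi1
    + (partialT k (f 2) t0 + (\<Sum>i\<in>UNIV. f i t0 * conn t0 (axis k 1) $ i $ 2)) * pi2 t0
    + (partialT k (f 3) t0 + (\<Sum>i\<in>UNIV. f i t0 * conn t0 (axis k 1) $ i $ 3)) * pi3 t0))"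
   unfolding gmc_sec[OF f] using t0T by (simp add: sec_def per)
  also have "\<dots> = (df 1 v + (\<Sum>i\<in>UNIV. f i t0 * conn t0 v $ i $ 1)) * pi1
    + (df 2 v + (\<Sum>i\<in>UNIV. f i t0 * conn t0 v $ i $ 2)) * pi2 t0
    + (df 3 v + (\<Sum>i\<in>UNIV. f i t0 * conn t0 v $ i $ 3)) * pi3 t0"
  proof -
   have e: "df j v + (\<Sum>i\<in>UNIV. f i t0 * conn t0 v $ i $ j) =
     (\<Sum>k\<in>UNIV. v $ k * (partialT k (f j) t0 + (\<Sum>i\<in>UNIV. f i t0 * conn t0 (axis k 1) $ i $ j)))" for j
   proof -
    have "(\<Sum>i\<in>UNIV. f i t0 * conn t0 v $ i $ j) = (\<Sum>i\<in>UNIV. \<Sum>k\<in>UNIV. v $ k * (f i t0 * conn t0 (axis k 1) $ i $ j))"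
     by (subst conn_linear) (simp add: sum_distrib_left mult_ac)
    also have "\<dots> = (\<Sum>k\<in>UNIV. v $ k * (\<Sum>i\<in>UNIV. f i t0 * conn t0 (axis k 1) $ i $ j))"
     by (subst sum.swap) (simp add: sum_distrib_left)
    finally show ?thesis by (simp add: df_def distrib_left sum.distrib)
   qed
   have "(\<Sum>k\<in>UNIV. v $ k * (X k * p + Y k * q + Z k * r)) =
     (\<Sum>k\<in>UNIV. v $ k * X k) * p + (\<Sum>k\<in>UNIV. v $ k * Y k) * q + (\<Sum>k\<in>UNIV. v $ k * Z k) * r"
    for X Y Z :: "5 => complex" and p q r by (simp add: sum_distrib_right distrib_left sum.distrib mult.assoc)
   then show ?thesis unfolding e .
  qed
  also have "\<dots> = (f 1 t0 * 0 + df 1 v * pi1) + (f 2 t0 * D2 v + df 2 v * pi2 t0) + (f 3 t0 * D3 v + df 3 v * pi3 t0)"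
   unfolding D2 D3 by (simp add: sum_3 conn_entries(1) algebra_simps)
  finally show ?thesis by simp
 qed
 ultimately have H: "((%t. f 1 t * pi1 + f 2 t * pi2 t + f 3 t * pi3 t) has_derivative
   (%v. \<Sum>k\<in>UNIV. v $ k * period t0 (at_param c t0) (gmc (sec f) k t0))) (at t0)" by simp
 have ev': "eventually (%t. f 1 t * pi1 + f 2 t * pi2 t + f 3 t * pi3 t = period t (at_param c t) (sec f t)) (nhds t0)" using ev
 proof eventually_elim
  case (elim t)
  then have "t \<in> TT" using cycle_family_open(2)[OF c] by blast
  then show ?case using elim by (simp add: sec_def)
 qed
 show ?thesis by (rule has_derivative_transform_eventually[OF H])
   (use ev' eventually_nhds_x_imp_x[OF ev'] in "auto simp: eventually_at_filter elim: eventually_mono")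
qed

text \<open>For uniqueness, equal derivatives of all periods are evaluated on unit vectors, which
  separates the directions; sections with equal periods agree by
  \<open>sec_determined\<close>.\<close>

lemma gauss_manin_eq: "gauss_manin = gmc" unfolding gauss_manin_def
proof (rule the_equality)
 show "is_gauss_manin gmc" unfolding is_gauss_manin_def
 proof (intro conjI is_connection_gmc ballI allI impI)
  fix s V c t assume "s \<in> sections" and c: "cycle_family V c" and t: "t \<in> V"
  then obtain f where f: "!!i. f i \<in> regT" "s = sec f" unfolding sections_eq by blast
  show "((%t'. period t' (at_param c t') (s t')) has_derivative
    (%v. \<Sum>k\<in>UNIV. v $ k * period t (at_param c t) (gmc s k t))) (at t)"
   unfolding f(2) by (rule gmc_period_derivative[OF f(1) c t])
 qed
next
 fix D assume D: "is_gauss_manin D"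
 have Dext: "D \<in> extensional sections" and Dsec: "!!s k. s \<in> sections ==> D s k \<in> sections"
  and Dp: "!!s V c t. s \<in> sections ==> cycle_family V c ==> t \<in> V ==>
   ((%t'. period t' (at_param c t') (s t')) has_derivative (%v. \<Sum>k\<in>UNIV. v $ k * period t (at_param c t) (D s k t))) (at t)"
  using D by (auto simp: is_gauss_manin_def is_connection_def)
 show "D = gmc"
 proof (rule extensionalityI[OF Dext])
  show "gmc \<in> extensional sections" by (simp add: gmc_def)
  fix s assume s: "s \<in> sections"
  then obtain f where f: "!!i. f i \<in> regT" "s = sec f" unfolding sections_eq by blast
  show "D s = gmc s"
  proof
   fix k
   obtain g where g: "!!i. g i \<in> regT" "D s k = sec g" using Dsec[OF s, of k] unfolding sections_eq by blast
   define h where "h j t = partialT k (f j) t + (\<Sum>i\<in>UNIV. f i t * conn t (axis k 1) $ i $ j)" for j t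
   have h: "gmc s k = sec h" unfolding f(2) gmc_sec[OF f(1)] h_def ..
   have eq: "period t (at_param c t) (sec g t) = period t (at_param c t) (sec h t)" if c: "cycle_family V c" and t: "t \<in> V" for V c t
   proof -
    have "(%v. \<Sum>k\<in>UNIV. v $ k * period t (at_param c t) (D s k t)) = (%v. \<Sum>k\<in>UNIV. v $ k * period t (at_param c t) (gmc s k t))"
     by (rule has_derivative_unique[OF Dp[OF s c t]])
      (unfold f(2), rule gmc_period_derivative[OF f(1) c t])
    then have "(\<Sum>l\<in>UNIV. (axis k 1 :: param) $ l * period t (at_param c t) (D s l t)) =
      (\<Sum>l\<in>UNIV. (axis k 1 :: param) $ l * period t (at_param c t) (gmc s l t))" by (rule fun_cong)
    then have "period t (at_param c t) (D s k t) = period t (at_param c t) (gmc s k t)"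
     using exhaust_5[of k] by (auto simp: sum_5 axis_def)
    then show ?thesis by (simp only: g(2) h)
   qed
   have "g i t = h i t" if t: "t \<in> TT" for i t
   proof (rule sec_determined[OF _ _ t])
    show "reg (g i)" for i by (rule reg_regT[OF g(1)])
    show "reg (h i)" for i unfolding h_def by (rule reg_gmc[OF f(1)])
   qed (rule eq)
   then show "D s k = gmc s k" unfolding g(2) h by (intro sec_cong) blast
  qed
 qed
qed

text \<open>The frame has constant coordinates, so the partial derivatives vanish and a row of the
  matrix remains.\<close>

lemma nabla_frame: "nabla R (frame i) = sec (%j t. conn t (R t) $ i $ j)"
proof -
 define f where "f j = (\<lambda>t\<in>TT. (axis i 1 :: complex ^ 3) $ j)" for j
 have f: "f j \<in> regT" for j unfolding f_def by (rule regT.const)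
 have fr: "frame i = sec f"
 proof (rule extensionalityI[of _ TT])
  show "frame i \<in> extensional TT" by (simp add: frame_def)
  show "sec f \<in> extensional TT" by (simp add: sec_def)
  show "frame i t = sec f t" if t: "t \<in> TT" for t
  proof -
   have "(\<chi> j. f j t) = axis i 1" using t by (simp add: f_def vec_eq_iff)
   then show ?thesis using frame_eq_cls[OF t] t by (simp add: sec_def)
  qed
 qed
 have p0: "partialT k (f j) t = 0" if t: "t \<in> TT" for k j t
 proof -
  have "((%t. (axis i 1 :: complex ^ 3) $ j) has_derivative (%v. \<Sum>k\<in>UNIV. v $ k * 0)) (at t)" by simp
  from partialT_eq[OF has_derivative_restrict_TT[OF t, THEN iffD2, OF this] t] show ?thesis unfolding f_def .
 qed
 have g: "gauss_manin (frame i) k t = cls t (conn t (axis k 1) $ i)" if t: "t \<in> TT" for k t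
 proof -
  have "(\<Sum>l\<in>UNIV. f l t * conn t (axis k 1) $ l $ j) = conn t (axis k 1) $ i $ j" for j
   using exhaust_3[of i] t by (auto simp: sum_3 f_def axis_def)
  then show ?thesis unfolding gauss_manin_eq fr gmc_sec[OF f] using t by (simp add: sec_def p0 vec_eq_iff)
 qed
 show ?thesis unfolding nabla_def sec_def
 proof (rule restrict_cong_simple)
  fix t assume t: "t \<in> TT"
  have "(\<Oplus>\<^bsub>H1dR t\<^esub> k\<in>UNIV. R t $ k \<odot>\<^bsub>H1dR t\<^esub> gauss_manin (frame i) k t) = cls t (\<Sum>k\<in>UNIV. R t $ k *s (conn t (axis k 1) $ i))"
   unfolding g[OF t] by (rule finsum_smult_cls[OF t])
  also have "(\<Sum>k\<in>UNIV. R t $ k *s (conn t (axis k 1) $ i)) = (\<chi> j. conn t (R t) $ i $ j)"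
   unfolding conn_linear[of t "R t"] by (simp add: vec_eq_iff)
  finally show "(\<Oplus>\<^bsub>H1dR t\<^esub> k\<in>UNIV. R t $ k \<odot>\<^bsub>H1dR t\<^esub> gauss_manin (frame i) k t) = cls t (\<chi> j. conn t (R t) $ i $ j)" .
 qed
qed

section \<open>From sections to connection matrices\<close>

lemma mat_sections_frame: "mat_sections M frame i = sec (%j t. M $ i $ j)"
 unfolding mat_sections_def sec_def by (rule restrict_cong_simple) (rule finsum_frame)

text \<open>Regular coordinates in the frame are unique, so an equation between sections is an
  equation between matrices at every parameter.\<close>

lemma nabla_frame_iff:
 assumes R: "R \<in> vector_fields"
 shows "(\<forall>i. nabla R (frame i) = mat_sections M frame i) \<longleftrightarrow> (\<forall>t\<in>TT. conn t (R t) = M)"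
proof
 assume l: "\<forall>i. nabla R (frame i) = mat_sections M frame i"
 show "\<forall>t\<in>TT. conn t (R t) = M"
 proof
  fix t assume t: "t \<in> TT"
  have rR: "reg (%t. R t $ k)" for k using R by (simp add: vector_fields_def reg_def)
  have "conn t (R t) $ i $ j = M $ i $ j" for i j
  proof (rule sec_eqD[OF _ _ _ t, where f = "%j t. conn t (R t) $ i $ j" and g = "%j t. M $ i $ j"])
   show "reg (%t. conn t (R t) $ i $ j)" for j by (subst conn_linear) (intro reg_sum reg_mult rR reg_conn)
   show "sec (%j t. conn t (R t) $ i $ j) = sec (%j t. M $ i $ j)" using l unfolding nabla_frame mat_sections_frame by blast
  qed (rule reg_const)
  then show "conn t (R t) = M" by (simp add: vec_eq_iff)
 qed
next
 assume "\<forall>t\<in>TT. conn t (R t) = M"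
 then show "\<forall>i. nabla R (frame i) = mat_sections M frame i"
  unfolding nabla_frame mat_sections_frame by (auto intro: sec_cong)
qed

text \<open>Guessed values of al, be and mu are verified in their defining equations, which avoids
  expanding the quotients by \<open>Disc\<close>.\<close>

lemma conn_eqI:
 assumes t: "t \<in> TT" and l: "lift_field t v al be"
  and my: "v $ 1 = xi0 t al be (t $ 1) + t $ 2 * my" "2 * (v $ 2 - psi0 al be (t $ 1) (t $ 2)) = dcubic t (t $ 1) * my"
  and M: "M $ 1 = 0" "M $ 2 $ 1 = al * t $ 3 - my" "M $ 2 $ 2 = al * t $ 4 - be" "M $ 2 $ 3 = - al"
   "M $ 3 $ 1 = v $ 3 - be * t $ 3 - (t $ 1 + t $ 4) * my + 1 / 2 * al * t $ 2 + al * t $ 3 * t $ 4"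
   "M $ 3 $ 2 = v $ 4 + 1 / 12 * al * t $ 5 + al * (t $ 4)^2 - 2 * be * t $ 4" "M $ 3 $ 3 = be - al * t $ 4"
 shows "conn t v = M"
proof -
 note ab = lift_field_unique[OF t l]
 have m: "mu_of t v = my" by (rule mu_unique[OF t]) (simp_all only: ab my)
 show ?thesis by (simp add: vec_eq_iff forall_3 conn_entries ab m M)
qed

lemma reg_cong: "reg f ==> (!!t. t \<in> TT ==> g t = f t) ==> reg g" unfolding reg_def by (metis restrict_cong_simple)

lemma R_tau_props: "R_tau \<in> vector_fields" "t \<in> TT ==> conn t (R_tau t) = M_tau"
proof -
 have v: "R_tau t $ 1 = -2 * (t $ 1)^2 + 2 * t $ 1 * t $ 4 + t $ 2 * t $ 3 + t $ 5 / 3"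
  "R_tau t $ 2 = 6 * (t $ 1)^2 * t $ 3 - t $ 3 * t $ 5 / 2 - 3 * t $ 1 * t $ 2 + 3 * t $ 2 * t $ 4"
  "R_tau t $ 3 = t $ 1 * t $ 3 + t $ 3 * t $ 4 - t $ 2 / 2"
  "R_tau t $ 4 = (t $ 4)^2 - t $ 5 / 12" "R_tau t $ 5 = 4 * t $ 4 * t $ 5 - 6 * t3 t" if "t \<in> TT" for t
  using that by (simp_all add: R_tau_def Let_def)
 have "reg (%t. R_tau t $ k)" for k
 proof -
  have "reg (%t. R_tau t $ 1)" "reg (%t. R_tau t $ 2)" "reg (%t. R_tau t $ 3)" "reg (%t. R_tau t $ 4)" "reg (%t. R_tau t $ 5)"
   by (rule v[THEN reg_cong[rotated]]; (assumption | intro reg_intros))+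
  then show ?thesis using exhaust_5[of k] by auto
 qed
 then show "R_tau \<in> vector_fields" by (auto simp: vector_fields_def reg_def R_tau_def)
 assume t: "t \<in> TT"
 show "conn t (R_tau t) = M_tau"
 \<comment> \<open>Row 2 of \<open>M_tau\<close> leaves no choice but al = 1, be = t_1 and mu = c;
   the zero row 3 then dictates the components along c and t_1.\<close>
 proof (rule conn_eqI[OF t, where al = 1 and be = "t $ 4" and my = "t $ 3"])
  show "lift_field t (R_tau t) 1 (t $ 4)" unfolding lift_field_def dt3_def v[OF t] by (simp add: t3_def field_simps pow_eqs)
 qed (simp_all add: v[OF t] xi0_def psi0_def dcubic_def M_tau_def vec_eq_iff forall_3 field_simps power2_eq_square)
qed

lemma R_z_props: "R_z \<in> vector_fields" "t \<in> TT ==> conn t (R_z t) = M_z"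
proof -
 have v: "R_z t $ 1 = t $ 2" "R_z t $ 2 = 6 * (t $ 1)^2 - t $ 5 / 2" "R_z t $ 3 = t $ 1 + t $ 4" "R_z t $ 4 = 0" "R_z t $ 5 = 0"
  if "t \<in> TT" for t using that by (simp_all add: R_z_def Let_def)
 have "reg (%t. R_z t $ k)" for k
 proof -
  have "reg (%t. R_z t $ 1)" "reg (%t. R_z t $ 2)" "reg (%t. R_z t $ 3)" "reg (%t. R_z t $ 4)" "reg (%t. R_z t $ 5)"
   by (rule v[THEN reg_cong[rotated]]; (assumption | intro reg_intros))+
  then show ?thesis using exhaust_5[of k] by auto
 qed
 then show "R_z \<in> vector_fields" by (auto simp: vector_fields_def reg_def R_z_def)
 assume t: "t \<in> TT"
 show "conn t (R_z t) = M_z"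
 \<comment> \<open>Row 2 of \<open>M_z\<close> requires al = be = 0 and mu = 1: the curve is fixed,
   and P moves with velocity 1 as measured by dx/y.\<close>
 proof (rule conn_eqI[OF t, where al = 0 and be = 0 and my = 1])
  show "lift_field t (R_z t) 0 0" unfolding lift_field_def dt3_def v[OF t] by (simp add: field_simps)
 qed (simp_all add: v[OF t] xi0_def psi0_def dcubic_def M_z_def vec_eq_iff forall_3 field_simps)
qed

lemma vector_field_unique:
 assumes "R \<in> vector_fields" "R' \<in> vector_fields" "\<forall>t\<in>TT. conn t (R t) = M" "\<forall>t\<in>TT. conn t (R' t) = M"
 shows "R = R'"
proof (rule extensionalityI[of _ TT])
 show "R \<in> extensional TT" "R' \<in> extensional TT" using assms by (auto simp: vector_fields_def)
 show "R t = R' t" if "t \<in> TT" for t by (rule conn_inject[OF that]) (use assms that in simp)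
qed

theorem theorem1p3:
 shows "(\<exists>!R. R \<in> vector_fields \<and> (\<forall>i. nabla R (frame i) = mat_sections M_tau frame i)) \<and>
     (R_tau \<in> vector_fields \<and> (\<forall>i. nabla R_tau (frame i) = mat_sections M_tau frame i)) \<and>
     (\<exists>!R. R \<in> vector_fields \<and> (\<forall>i. nabla R (frame i) = mat_sections M_z frame i)) \<and>
     (R_z \<in> vector_fields \<and> (\<forall>i. nabla R_z (frame i) = mat_sections M_z frame i))"
proof -
 have *: "(\<exists>!R. R \<in> vector_fields & (\<forall>i. nabla R (frame i) = mat_sections M frame i)) &
   (R0 \<in> vector_fields & (\<forall>i. nabla R0 (frame i) = mat_sections M frame i))"
  if R0: "R0 \<in> vector_fields" "\<forall>t\<in>TT. conn t (R0 t) = M" for R0 M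
 proof -
  have n: "\<forall>i. nabla R0 (frame i) = mat_sections M frame i" using R0 nabla_frame_iff by blast
  have "R = R0" if "R \<in> vector_fields" "\<forall>i. nabla R (frame i) = mat_sections M frame i" for R
   using vector_field_unique[OF that(1) R0(1) _ R0(2)] that nabla_frame_iff by blast
  then show ?thesis using n R0(1) by blast
 qed
 show ?thesis using *[of R_tau M_tau] *[of R_z M_z] R_tau_props R_z_props by blast
qed

end
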